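(* Let $A,B,C$ be vector spaces over an algebraically closed field $K$ of characteristic zero, of dimensions $a,b,c\ge 3$. Inside $\mathbb P(A^*\otimes B^*\otimes C^* )$ one has the equalities of sets $$\sigma_3(\mathbb P A^*\times\mathbb P B^*\times\mathbb P C^* )=Comm^3_A\cap Sub_{3,3,3}=Comm^3_B\cap Sub_{3,3,3}=Comm^3_C\cap Sub_{3,3,3}.$$ That is, $\sigma_3(\mathbb P^{a-1}\times\mathbb P^{b-1}\times\mathbb P^{c-1})$ is the common zero set of the (multiplicity one) module $S_{2,1,1}A\otimes S_{2,1,1}B\otimes S_{2,1,1}C\subset S^4(A\otimes B\otimes C)$ and of the modules in $S^4(A\otimes B\otimes C)$ containing a fourth exterior power, i.e. $\Lambda^4A\otimes\Lambda^4(B\otimes C)$, $\Lambda^4B\otimes\Lambda^4(A\otimes C)$ and $\Lambda^4C\otimes\Lambda^4(A\otimes B)$. In particular, $\sigma_3(\mathbb P^{a-1}\times\mathbb P^{b-1}\times\mathbb P^{c-1})$ is cut out set-theoretically by equations of degree four.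
   Context: $\mathbb P A^*\times\mathbb P B^*\times\mathbb P C^*\subset\mathbb P(A^*\otimes B^*\otimes C^* )$ is the Segre variety of decomposable tensors, and $\sigma_r(X)$ is the Zariski closure of the union of all linear spans of $r$ points of $X$. Elements of $S^d(A\otimes B\otimes C)$ are viewed as degree $d$ homogeneous polynomials on $A^*\otimes B^*\otimes C^*$; $S_\pi V$ is the irreducible $GL(V)$-module of the partition $\pi$. $Sub_{b_1,b_2,b_3}\subset\mathbb P(A^*\otimes B^*\otimes C^* )$ is the set of $[T]$ such that there are subspaces $A'\subseteq A^*$, $B'\subseteq B^*$, $C'\subseteq C^*$ of dimensions $b_1,b_2,b_3$ with $T\in A'\otimes B'\otimes C'$. For $T\in A^*\otimes B^*\otimes C^*$ and $\alpha\in A$, $T_\alpha\in B^*\otimes C^*$ is the contraction and $T_\alpha^{\wedge k}\in\Lambda^kB^*\otimes\Lambda^kC^*$ its $k$-th exterior power (if $T_\alpha=\sum_i x_i\otimes y_i$, then $T_\alpha^{\wedge k}=\sum_{i_1<\dots<i_k}(x_{i_1}\wedge\cdots\wedge x_{i_k})\otimes(y_{i_1}\wedge\cdots\wedge y_{i_k})$). For $\alpha,\alpha_1,\alpha_2\in A$, let $\psi^{1,r-1}_{\alpha,\alpha_1,\alpha_2}(T)\in\Lambda^rB^*\otimes B^*\otimes C^*\otimes\Lambda^rC^*$ be obtained from $T_{\alpha_1}\otimes T_\alpha^{\wedge(r-1)}\otimes T_{\alpha_2}$ by wedging the $B^*$-part of $T_{\alpha_1}$ with the $B^*$-part of $T_\alpha^{\wedge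 (r-1)}$ (in this order), and the $C^*$-part of $T_\alpha^{\wedge (r-1)}$ with the $C^*$-part of $T_{\alpha_2}$ (in this order), keeping the $B^*$-part of $T_{\alpha_2}$ and the $C^*$-part of $T_{\alpha_1}$. Then $Comm^r_A$ is the set of $[T]$ such that $\psi^{1,r-1}_{\alpha,\alpha_1,\alpha_2}(T)=\psi^{1,r-1}_{\alpha,\alpha_2,\alpha_1}(T)$ for all $\alpha,\alpha_1,\alpha_2\in A$. $Comm^r_B$ and $Comm^r_C$ are defined in the same way with the role of $A$ played by $B$, respectively $C$. *)

theory Defs
  imports "HOL-Analysis.Analysis" "HOL-Library.Poly_Mapping" "HOL-Library.Numeral_Type"
    "HOL-Computational_Algebra.Polynomial"
begin

text \<open>
  A vector space of dimension \<open>n\<close> over the field \<open>'k\<close> is rendered as \<open>'k ^ 'n\<close> with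
  \<open>CARD('n) = n\<close>; its dual is identified with \<open>'k ^ 'n\<close> through the dual basis, and the
  tensor product of \<open>'k ^ 'm\<close> and \<open>'k ^ 'n\<close> is \<open>'k ^ ('m \<times> 'n)\<close>.  So
  \<open>A\<^sup>* \<otimes> B\<^sup>* \<otimes> C\<^sup>*\<close> and \<open>A \<otimes> B \<otimes> C\<close> both are \<open>'k ^ ('a \<times> 'b \<times> 'c)\<close>.
\<close>

definition tensor2 :: "'k::times ^ 'x \<Rightarrow> 'k ^ 'y \<Rightarrow> 'k ^ ('x::finite \<times> 'y::finite)" where
  "tensor2 x y = (\<chi> p. case p of (i, j) \<Rightarrow> x $ i * y $ j)"

definition tensor3 :: "'k::times ^ 'x \<Rightarrow> 'k ^ 'y \<Rightarrow> 'k ^ 'z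
    \<Rightarrow> 'k ^ ('x::finite \<times> 'y::finite \<times> 'z::finite)" where
  "tensor3 x y z = (\<chi> p. case p of (i, j, k) \<Rightarrow> x $ i * y $ j * z $ k)"


section \<open>Polynomials\<close>

text \<open>
  The variable \<open>v\<close> is the \<open>v\<close>-th basis vector of \<open>V = 'k ^ 'v\<close>, i.e. the \<open>v\<close>-th coordinate
  function on \<open>V\<^sup>*\<close>; the homogeneous polynomials of degree \<open>d\<close> form \<open>S\<^sup>d V\<close>.
\<close>

type_synonym ('v, 'k) mpoly = "('v \<Rightarrow>\<^sub>0 nat) \<Rightarrow>\<^sub>0 'k"

definition pconst :: "'k::zero \<Rightarrow> ('v, 'k) mpoly" where
  "pconst c = Poly_Mapping.single 0 c"

definition pvar :: "'v \<Rightarrow> ('v, 'k::zero_neq_one) mpoly" where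
  "pvar v = Poly_Mapping.single (Poly_Mapping.single v 1) 1"

definition pscale :: "'k::comm_ring_1 \<Rightarrow> ('v, 'k) mpoly \<Rightarrow> ('v, 'k) mpoly" where
  "pscale c p = pconst c * p"

definition homogeneous :: "nat \<Rightarrow> ('v::finite, 'k::zero) mpoly \<Rightarrow> bool" where
  "homogeneous d p \<longleftrightarrow> (\<forall>m \<in> Poly_Mapping.keys p. (\<Sum>v\<in>UNIV. Poly_Mapping.lookup m v) = d)"

definition peval :: "('v::finite, 'k::comm_ring_1) mpoly \<Rightarrow> 'k ^ 'v \<Rightarrow> 'k" where
  "peval p x = (\<Sum>m \<in> Poly_Mapping.keys p.
     Poly_Mapping.lookup p m * (\<Prod>v\<in>UNIV. (x $ v) ^ Poly_Mapping.lookup m v))"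

text \<open>The algebra endomorphism of \<open>Sym V\<close> induced by the linear map \<open>M\<close> on \<open>V\<close>.\<close>

definition psubst :: "'k::comm_ring_1 ^ 'v ^ 'v \<Rightarrow> ('v::finite, 'k) mpoly \<Rightarrow> ('v, 'k) mpoly" where
  "psubst M p = (\<Sum>m \<in> Poly_Mapping.keys p.
     pconst (Poly_Mapping.lookup p m) *
     (\<Prod>v\<in>UNIV. (\<Sum>w\<in>UNIV. pscale (M $ w $ v) (pvar w)) ^ Poly_Mapping.lookup m v))"

interpretation mpoly: vector_space "pscale :: 'k::field \<Rightarrow> ('v, 'k) mpoly \<Rightarrow> ('v, 'k) mpoly"
  by unfold_locales
    (simp_all add: pscale_def pconst_def algebra_simps single_add mult_single
      flip: mult.assoc)


section \<open>Projective space and secant varieties\<close>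

text \<open>The point \<open>[v]\<close> is the line spanned by \<open>v\<close>.\<close>

definition pt :: "'k::field ^ 'n \<Rightarrow> ('k ^ 'n) set" where
  "pt v = vec.span {v}"

definition proj_space :: "('k::field ^ 'n) set set" where
  "proj_space = {pt v |v. v \<noteq> 0}"

definition zero_locus :: "('n::finite, 'k::field) mpoly set \<Rightarrow> ('k ^ 'n) set set" where
  "zero_locus F = {L \<in> proj_space. \<forall>f \<in> F. \<forall>v \<in> L. peval f v = 0}"

definition zariski_closed :: "('k::field ^ 'n::finite) set set \<Rightarrow> bool" where
  "zariski_closed Z \<longleftrightarrow> (\<exists>F. (\<forall>f \<in> F. \<exists>d. homogeneous d f) \<and> Z = zero_locus F)"

definition zariski_closure :: "('k::field ^ 'n::finite) set set \<Rightarrow> ('k ^ 'n) set set" where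
  "zariski_closure Y = \<Inter> {Z. zariski_closed Z \<and> Y \<subseteq> Z}"

definition secant_variety ::
    "nat \<Rightarrow> ('k::field ^ 'n::finite) set set \<Rightarrow> ('k ^ 'n) set set" where
  "secant_variety r X = zariski_closure
     {L \<in> proj_space. \<exists>x :: nat \<Rightarrow> ('k ^ 'n) set.
        (\<forall>i<r. x i \<in> X) \<and> L \<subseteq> vec.span (\<Union>i<r. x i)}"

definition segre :: "('k::field ^ ('a::finite \<times> 'b::finite \<times> 'c::finite)) set set" where
  "segre = {pt (tensor3 x y z) |x y z. x \<noteq> 0 \<and> y \<noteq> 0 \<and> z \<noteq> 0}"

definition Sub :: "nat \<Rightarrow> nat \<Rightarrow> nat
    \<Rightarrow> ('k::field ^ ('a::finite \<times> 'b::finite \<times> 'c::finite)) set set" where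
  "Sub b1 b2 b3 = {pt T |T. T \<noteq> 0 \<and> (\<exists>A' B' C'.
     vec.subspace A' \<and> vec.subspace B' \<and> vec.subspace C' \<and>
     vec.dim A' = b1 \<and> vec.dim B' = b2 \<and> vec.dim C' = b3 \<and>
     T \<in> vec.span {tensor3 x y z |x y z. x \<in> A' \<and> y \<in> B' \<and> z \<in> C'})}"


section \<open>Exterior powers and the commutation conditions\<close>

text \<open>
  Elements of \<open>\<Lambda>\<^sup>k('k ^ 'b)\<close> are alternating tensors, given by their coordinates as functions of
  a multi-index \<open>J :: nat \<Rightarrow> 'b\<close> of which only \<open>J 0, \<dots>, J (k - 1)\<close> matter;
  \<open>x\<^sub>0 \<and> \<dots> \<and> x\<^sub>k\<^sub>-\<^sub>1\<close> is the signed sum over all permutations \<open>\<sigma>\<close> of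
  \<open>x\<^bsub>\<sigma> 0\<^esub> \<otimes> \<dots> \<otimes> x\<^bsub>\<sigma> (k-1)\<^esub>\<close>.
\<close>

definition wedge :: "nat \<Rightarrow> (nat \<Rightarrow> 'k::comm_ring_1 ^ 'b) \<Rightarrow> (nat \<Rightarrow> 'b) \<Rightarrow> 'k" where
  "wedge k x J = (\<Sum>\<sigma> | \<sigma> permutes {..<k}. of_int (sign \<sigma>) * (\<Prod>s<k. x (\<sigma> s) $ J s))"

text \<open>The value at the multi-indices \<open>J\<close>, \<open>L\<close> of the sum over all \<open>i\<^sub>1 < \<dots> < i\<^sub>k\<close> in \<open>{..<n}\<close>.\<close>

definition wedge_sum :: "nat \<Rightarrow> nat \<Rightarrow> (nat \<Rightarrow> 'k::comm_ring_1 ^ 'b) \<Rightarrow> (nat \<Rightarrow> 'k ^ 'c)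
    \<Rightarrow> (nat \<Rightarrow> 'b) \<Rightarrow> (nat \<Rightarrow> 'c) \<Rightarrow> 'k" where
  "wedge_sum k n x y J L = (\<Sum>I | I \<subseteq> {..<n} \<and> card I = k.
     wedge k (\<lambda>s. x (sorted_list_of_set I ! s)) J *
     wedge k (\<lambda>s. y (sorted_list_of_set I ! s)) L)"

text \<open>
  The \<open>k\<close>-th exterior power of an element of \<open>B\<^sup>* \<otimes> C\<^sup>*\<close>, through any decomposition of it;
  \<open>ext_power_decomposition\<close> below shows that this is well defined in characteristic zero.
\<close>

definition ext_power :: "nat \<Rightarrow> 'k::comm_ring_1 ^ ('b::finite \<times> 'c::finite)
    \<Rightarrow> (nat \<Rightarrow> 'b) \<Rightarrow> (nat \<Rightarrow> 'c) \<Rightarrow> 'k" where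
  "ext_power k M = (THE W. \<forall>n x y.
     M = (\<Sum>i<n. tensor2 (x i) (y i)) \<longrightarrow> W = wedge_sum k n x y)"

lemma wedge_permute:
  assumes "\<pi> permutes {..<k}"
  shows "wedge k (\<lambda>s. x (\<pi> s)) J = of_int (sign \<pi>) * wedge k x J"
proof -
  have fin: "finite {..<k}" by simp
  have pp: "permutation \<pi>" using assms permutation_permutes fin by blast
  have "of_int (sign \<pi>) * wedge k x J
      = (\<Sum>\<sigma> | \<sigma> permutes {..<k}. of_int (sign \<pi>) * (of_int (sign \<sigma>) * (\<Prod>s<k. x (\<sigma> s) $ J s)))"
    by (simp add: wedge_def sum_distrib_left)
  also have "\<dots> = (\<Sum>\<sigma> | \<sigma> permutes {..<k}.
      of_int (sign \<pi>) * (of_int (sign (\<pi> \<circ> \<sigma>)) * (\<Prod>s<k. x ((\<pi> \<circ> \<sigma>) s) $ J s)))"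
    by (rule setum_permutations_compose_left[OF assms])
  also have "\<dots> = wedge k (\<lambda>s. x (\<pi> s)) J"
    unfolding wedge_def
  proof (rule sum.cong[OF refl])
    fix \<sigma> assume "\<sigma> \<in> {\<sigma>. \<sigma> permutes {..<k}}"
    then have ps: "permutation \<sigma>" using permutation_permutes fin by blast
    have "sign \<pi> * sign (\<pi> \<circ> \<sigma>) = sign \<sigma>"
      by (simp add: sign_compose[OF pp ps] flip: mult.assoc)
    then have "(of_int (sign \<pi>) * of_int (sign (\<pi> \<circ> \<sigma>)) :: 'a) = of_int (sign \<sigma>)"
      by (metis of_int_mult)
    then show "of_int (sign \<pi>) * (of_int (sign (\<pi> \<circ> \<sigma>)) * (\<Prod>s<k. x ((\<pi> \<circ> \<sigma>) s) $ J s))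
        = of_int (sign \<sigma>) * (\<Prod>s<k. x (\<pi> (\<sigma> s)) $ J s)"
      by (simp flip: mult.assoc)
  qed
  finally show ?thesis by simp
qed

lemma wedge_cong: "(\<And>s. s < k \<Longrightarrow> x s = y s) \<Longrightarrow> wedge k x J = wedge k y J"
  unfolding wedge_def
  by (intro sum.cong refl arg_cong2[where f = "(*)"] prod.cong)
     (metis lessThan_iff mem_Collect_eq permutes_in_image)

lemma wedge_repeated:
  fixes x :: "nat \<Rightarrow> 'k::field_char_0 ^ 'b"
  assumes "i < k" "j < k" "i \<noteq> j" "x i = x j"
  shows "wedge k x J = 0"
proof -
  let ?t = "Transposition.transpose i j"
  have "?t permutes {..<k}" using assms by (simp add: permutes_swap_id)
  then have "wedge k (\<lambda>s. x (?t s)) J = of_int (sign ?t) * wedge k x J" by (rule wedge_permute)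
  moreover have "(\<lambda>s. x (?t s)) = x" using assms by (auto simp: Transposition.transpose_def fun_eq_iff)
  ultimately show ?thesis using assms by (simp add: sign_swap_id)
qed

text \<open>The Cauchy--Binet formula.\<close>

lemma wedge_sum_minor:
  fixes x :: "nat \<Rightarrow> 'k::field_char_0 ^ 'b::finite" and y :: "nat \<Rightarrow> 'k ^ 'c::finite"
  assumes M: "M = (\<Sum>i<n. tensor2 (x i) (y i))"
  shows "wedge_sum k n x y J L
    = (\<Sum>\<rho> | \<rho> permutes {..<k}. of_int (sign \<rho>) * (\<Prod>s<k. M $ (J s, L (\<rho> s))))"
proof -
  let ?P = "{\<rho>. \<rho> permutes {..<k}}"
  let ?F = "{..<k} \<rightarrow>\<^sub>E {..<n}"
  let ?e = "\<lambda>I. (!) (sorted_list_of_set I)"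
  let ?S = "{I. I \<subseteq> {..<n} \<and> card I = k}"
  let ?G = "\<lambda>f. (\<Prod>s<k. x (f s) $ J s) * wedge k (\<lambda>s. y (f s)) L"
  have finP: "finite ?P" by (simp add: finite_permutations)
  have finF: "finite ?F" by (simp add: finite_PiE)
  have finS: "finite ?S" by (rule finite_subset[of _ "Pow {..<n}"]) auto
  have wy: "wedge k (\<lambda>s. y (f s)) L
      = (\<Sum>\<rho>\<in>?P. of_int (sign \<rho>) * (\<Prod>s<k. y (f s) $ L (\<rho> s)))" for f
  proof -
    have "wedge k (\<lambda>s. y (f s)) L
        = (\<Sum>\<rho>\<in>?P. of_int (sign (inv \<rho>)) * (\<Prod>s<k. y (f (inv \<rho> s)) $ L s))"
      unfolding wedge_def by (rule sum_permutations_inverse)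
    also have "\<dots> = (\<Sum>\<rho>\<in>?P. of_int (sign \<rho>) * (\<Prod>s<k. y (f s) $ L (\<rho> s)))"
    proof (rule sum.cong[OF refl])
      fix \<rho> assume "\<rho> \<in> ?P"
      then have r: "\<rho> permutes {..<k}" by simp
      have "sign (inv \<rho>) = sign \<rho>"
        using r permutation_permutes sign_inverse by blast
      moreover have "(\<Prod>s<k. y (f (inv \<rho> s)) $ L s) = (\<Prod>s<k. y (f s) $ L (\<rho> s))"
        using prod.permute[OF r, of "\<lambda>s. y (f (inv \<rho> s)) $ L s"] permutes_inverses(2)[OF r]
        by (simp add: o_def)
      ultimately show "of_int (sign (inv \<rho>)) * (\<Prod>s<k. y (f (inv \<rho> s)) $ L s)
          = of_int (sign \<rho>) * (\<Prod>s<k. y (f s) $ L (\<rho> s))" by simp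
    qed
    finally show ?thesis .
  qed
  have "(\<Sum>\<rho>\<in>?P. of_int (sign \<rho>) * (\<Prod>s<k. M $ (J s, L (\<rho> s))))
      = (\<Sum>\<rho>\<in>?P. \<Sum>f\<in>?F. of_int (sign \<rho>) *
           ((\<Prod>s<k. x (f s) $ J s) * (\<Prod>s<k. y (f s) $ L (\<rho> s))))"
    by (simp add: M tensor2_def prod_sum_PiE sum_distrib_left prod.distrib)
  also have "\<dots> = (\<Sum>f\<in>?F. ?G f)"
    by (subst sum.swap) (simp add: wy sum_distrib_left mult.left_commute)
  also have "\<dots> = (\<Sum>f\<in>{f\<in>?F. inj_on f {..<k}}. ?G f)"
  proof (rule sum.mono_neutral_right)
    show "\<forall>f \<in> ?F - {f \<in> ?F. inj_on f {..<k}}. ?G f = 0"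
    proof
      fix f assume "f \<in> ?F - {f \<in> ?F. inj_on f {..<k}}"
      then obtain i j where "i < k" "j < k" "i \<noteq> j" "f i = f j"
        by (auto simp: inj_on_def)
      then have "wedge k (\<lambda>s. y (f s)) L = 0" by (intro wedge_repeated[of i k j]) auto
      then show "?G f = 0" by simp
    qed
  qed (use finF in auto)
  also have "\<dots> = (\<Sum>(I, \<sigma>)\<in>?S \<times> ?P. ?G (\<lambda>s. ?e I (\<sigma> s)))"
  proof -
    let ?h = "\<lambda>(I, \<sigma>). restrict (\<lambda>s. ?e I (\<sigma> s)) {..<k}"
    have bij: "bij_betw (?e I) {..<k} I" if "I \<in> ?S" for I
    proof -
      have "finite I" using that finite_subset by blast
      then show ?thesis
        using that bij_betw_nth[of "sorted_list_of_set I" "{..<k}" I] by simp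
    qed
    have bij_h: "bij_betw ?h (?S \<times> ?P) {f \<in> ?F. inj_on f {..<k}}"
      unfolding bij_betw_def
    proof
      have im: "?h (I, \<sigma>) ` {..<k} = I" and inj: "inj_on (?h (I, \<sigma>)) {..<k}"
        if "I \<in> ?S" "\<sigma> \<in> ?P" for I \<sigma>
      proof -
        have "bij_betw \<sigma> {..<k} {..<k}" using that permutes_imp_bij by blast
        then have "bij_betw (?e I \<circ> \<sigma>) {..<k} I" using bij[OF that(1)] bij_betw_trans by blast
        then have "bij_betw (?h (I, \<sigma>)) {..<k} I"
          by (rule bij_betw_cong[THEN iffD1, rotated]) simp
        then show "?h (I, \<sigma>) ` {..<k} = I" "inj_on (?h (I, \<sigma>)) {..<k}"
          by (auto simp: bij_betw_def)
      qed
      show "inj_on ?h (?S \<times> ?P)"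
      proof (rule inj_onI)
        fix z z' assume zz: "z \<in> ?S \<times> ?P" "z' \<in> ?S \<times> ?P" and e: "?h z = ?h z'"
        obtain I \<sigma> I' \<sigma>' where z: "z = (I, \<sigma>)" "z' = (I', \<sigma>')" by (cases z, cases z') blast
        have I: "I \<in> ?S" "I' \<in> ?S" and p: "\<sigma> permutes {..<k}" "\<sigma>' permutes {..<k}"
          using zz z by auto
        have e': "?h (I, \<sigma>) = ?h (I', \<sigma>')" using e z by metis
        have "I = ?h (I, \<sigma>) ` {..<k}" using im[of I \<sigma>] I p by simp
        also have "\<dots> = ?h (I', \<sigma>') ` {..<k}" by (simp only: e')
        also have "\<dots> = I'" using im[of I' \<sigma>'] I p by simp
        finally have II: "I = I'" .
        have "\<sigma> s = \<sigma>' s" for s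
        proof (cases "s < k")
          case True
          have "?e I (\<sigma> s) = ?e I (\<sigma>' s)"
            using fun_cong[OF e', of s] True II by simp
          moreover have "\<sigma> s \<in> {..<k}" "\<sigma>' s \<in> {..<k}"
            using True permutes_in_image[OF p(1), of s] permutes_in_image[OF p(2), of s] by simp_all
          ultimately show ?thesis
            using bij[OF I(1)] unfolding bij_betw_def inj_on_def by blast
        next
          case False
          then show ?thesis using p by (simp add: permutes_def)
        qed
        then show "z = z'" using II z by auto
      qed
      show "?h ` (?S \<times> ?P) = {f \<in> ?F. inj_on f {..<k}}"
      proof
        show "?h ` (?S \<times> ?P) \<subseteq> {f \<in> ?F. inj_on f {..<k}}"
        proof
          fix f assume "f \<in> ?h ` (?S \<times> ?P)"
          then obtain I \<sigma> where f: "f = ?h (I, \<sigma>)" "I \<in> ?S" "\<sigma> \<in> ?P" by blast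
          have "f \<in> extensional {..<k}" using f(1) by simp
          moreover have "f ` {..<k} \<subseteq> {..<n}" using im[OF f(2,3)] f by blast
          ultimately show "f \<in> {f \<in> ?F. inj_on f {..<k}}"
            using inj[OF f(2,3)] f(1) by (auto simp: PiE_def)
        qed
        show "{f \<in> ?F. inj_on f {..<k}} \<subseteq> ?h ` (?S \<times> ?P)"
        proof
          fix f assume "f \<in> {f \<in> ?F. inj_on f {..<k}}"
          then have f: "f \<in> ?F" "inj_on f {..<k}" by auto
          define I where "I = f ` {..<k}"
          have I: "I \<in> ?S" using f by (auto simp: I_def card_image)
          define g where "g = the_inv_into {..<k} (?e I)"
          define \<sigma> where "\<sigma> = (\<lambda>s. if s < k then g (f s) else s)"
          have bg: "bij_betw g I {..<k}" unfolding g_def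
            by (rule bij_betw_the_inv_into[OF bij[OF I]])
          have bf: "bij_betw f {..<k} I" using f I_def by (simp add: bij_betw_def)
          have "bij_betw (g \<circ> f) {..<k} {..<k}" using bf bg bij_betw_trans by blast
          then have "bij_betw \<sigma> {..<k} {..<k}"
            by (rule bij_betw_cong[THEN iffD1, rotated]) (simp add: \<sigma>_def)
          then have s: "\<sigma> permutes {..<k}"
            by (rule bij_imp_permutes) (simp add: \<sigma>_def)
          have "f = ?h (I, \<sigma>)"
          proof
            fix s
            show "f s = ?h (I, \<sigma>) s"
            proof (cases "s < k")
              case True
              then have "f s \<in> I" by (simp add: I_def)
              then show ?thesis using True f_the_inv_into_f_bij_betw[OF bij[OF I], of "f s"]
                by (simp add: \<sigma>_def g_def)
            next
              case False
              then show ?thesis using f(1) by (auto simp: PiE_def extensional_def)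
            qed
          qed
          then show "f \<in> ?h ` (?S \<times> ?P)" using I s by blast
        qed
      qed
    qed
    have "(\<Sum>z\<in>?S \<times> ?P. ?G (?h z)) = (\<Sum>(I, \<sigma>)\<in>?S \<times> ?P. ?G (\<lambda>s. ?e I (\<sigma> s)))"
    proof (rule sum.cong[OF refl])
      fix z assume "z \<in> ?S \<times> ?P"
      obtain I \<sigma> where z: "z = (I, \<sigma>)" by (cases z)
      have "wedge k (\<lambda>s. y (?h z s)) L = wedge k (\<lambda>s. y (?e I (\<sigma> s))) L"
        by (rule wedge_cong) (simp add: z)
      then show "?G (?h z) = (case z of (I, \<sigma>) \<Rightarrow> ?G (\<lambda>s. ?e I (\<sigma> s)))"
        by (simp add: z)
    qed
    then show ?thesis by (rule trans[OF sum.reindex_bij_betw[OF bij_h, of ?G, symmetric]])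
  qed
  also have "\<dots> = (\<Sum>I\<in>?S. \<Sum>\<sigma>\<in>?P. ?G (\<lambda>s. ?e I (\<sigma> s)))"
    by (simp add: sum.cartesian_product)
  also have "\<dots> = wedge_sum k n x y J L"
    unfolding wedge_sum_def
  proof (rule sum.cong[OF refl])
    fix I
    have "(\<Sum>\<sigma>\<in>?P. ?G (\<lambda>s. ?e I (\<sigma> s)))
       = (\<Sum>\<sigma>\<in>?P. (of_int (sign \<sigma>) * (\<Prod>s<k. x (?e I (\<sigma> s)) $ J s)) * wedge k (\<lambda>s. y (?e I s)) L)"
    proof (rule sum.cong[OF refl])
      fix \<sigma> assume "\<sigma> \<in> ?P"
      then have "wedge k (\<lambda>s. y (?e I (\<sigma> s))) L = of_int (sign \<sigma>) * wedge k (\<lambda>s. y (?e I s)) L"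
        by (intro wedge_permute[where x = "\<lambda>s. y (?e I s)"]) simp
      then show "?G (\<lambda>s. ?e I (\<sigma> s))
          = of_int (sign \<sigma>) * (\<Prod>s<k. x (?e I (\<sigma> s)) $ J s) * wedge k (\<lambda>s. y (?e I s)) L"
        by (simp only: mult_ac)
    qed
    also have "\<dots> = wedge k (\<lambda>s. x (?e I s)) J * wedge k (\<lambda>s. y (?e I s)) L"
      by (simp add: wedge_def[of k "\<lambda>s. x (?e I s)"] sum_distrib_right)
    finally show "(\<Sum>\<sigma>\<in>?P. ?G (\<lambda>s. ?e I (\<sigma> s)))
       = wedge k (\<lambda>s. x (?e I s)) J * wedge k (\<lambda>s. y (?e I s)) L" .
  qed
  finally show ?thesis by simp
qed

lemma ex_decomposition:
  fixes M :: "'k::comm_ring_1 ^ ('b::finite \<times> 'c::finite)"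
  shows "\<exists>(n::nat) x y. M = (\<Sum>i<n. tensor2 (x i) (y i))"
proof -
  obtain b :: "nat \<Rightarrow> 'b" where b: "bij_betw b {..<CARD('b)} UNIV"
    using ex_bij_betw_nat_finite[of "UNIV :: 'b set"] by (auto simp: atLeast0LessThan)
  let ?x = "\<lambda>i. axis (b i) (1::'k)" and ?y = "\<lambda>i. \<chi> k. M $ (b i, k)"
  have "M $ (j, k) = (\<Sum>i<CARD('b). tensor2 (?x i) (?y i)) $ (j, k)" for j k
  proof -
    have "(\<Sum>i<CARD('b). tensor2 (?x i) (?y i)) $ (j, k)
        = (\<Sum>i<CARD('b). axis (b i) 1 $ j * M $ (b i, k))"
      by (simp add: tensor2_def)
    also have "\<dots> = (\<Sum>l\<in>UNIV. axis l 1 $ j * M $ (l, k))"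
      by (rule sum.reindex_bij_betw[OF b])
    also have "\<dots> = (\<Sum>l\<in>UNIV. if l = j then M $ (l, k) else 0)"
      by (intro sum.cong) (auto simp: axis_def)
    finally show ?thesis by simp
  qed
  then have "M = (\<Sum>i<CARD('b). tensor2 (?x i) (?y i))"
    unfolding vec_eq_iff split_paired_All by blast
  then have "\<exists>y. M = (\<Sum>i<CARD('b). tensor2 (?x i) (y i))" by (rule exI[where x = ?y])
  then have "\<exists>x y. M = (\<Sum>i<CARD('b). tensor2 (x i) (y i))" by (rule exI[where x = ?x])
  then show ?thesis by (rule exI)
qed

lemma ext_power_decomposition:
  fixes x :: "nat \<Rightarrow> 'k::field_char_0 ^ 'b::finite" and y :: "nat \<Rightarrow> 'k ^ 'c::finite"
  assumes "M = (\<Sum>i<n. tensor2 (x i) (y i))"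
  shows "ext_power k M = wedge_sum k n x y"
proof -
  have "wedge_sum k n x y = wedge_sum k n' x' y'"
    if "M = (\<Sum>i<n'. tensor2 (x' i) (y' i))"
    for n' and x' :: "nat \<Rightarrow> 'k ^ 'b" and y' :: "nat \<Rightarrow> 'k ^ 'c"
    using wedge_sum_minor[OF assms] wedge_sum_minor[OF that] by (intro ext) simp
  then show ?thesis unfolding ext_power_def by (intro the_equality) (use assms in blast)+
qed

lemma ext_power_minor:
  fixes M :: "'k::field_char_0 ^ ('b::finite \<times> 'c::finite)"
  shows "ext_power k M J L
    = (\<Sum>\<rho> | \<rho> permutes {..<k}. of_int (sign \<rho>) * (\<Prod>s<k. M $ (J s, L (\<rho> s))))"
proof -
  obtain n :: nat and x y where d: "M = (\<Sum>i<n. tensor2 (x i) (y i))"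
    using ex_decomposition[of M] by blast
  show ?thesis unfolding ext_power_decomposition[OF d] by (rule wedge_sum_minor[OF d])
qed

definition omit :: "nat \<Rightarrow> (nat \<Rightarrow> 'i) \<Rightarrow> nat \<Rightarrow> 'i" where
  "omit s J = (\<lambda>i. if i < s then J i else J (Suc i))"

text \<open>
  \<open>x \<and> \<omega>\<close> and \<open>\<omega> \<and> x\<close> for a vector \<open>x\<close> and \<open>\<omega> \<in> \<Lambda>\<^sup>k\<close>.  With the above convention for \<open>wedge\<close>
  these are the expansions of a determinant along its first, respectively last, row.
\<close>

definition wedge_left :: "nat \<Rightarrow> ('b \<Rightarrow> 'k::comm_ring_1) \<Rightarrow> ((nat \<Rightarrow> 'b) \<Rightarrow> 'k)
    \<Rightarrow> (nat \<Rightarrow> 'b) \<Rightarrow> 'k" where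
  "wedge_left k x \<omega> J = (\<Sum>s\<le>k. (-1) ^ s * x (J s) * \<omega> (omit s J))"

definition wedge_right :: "nat \<Rightarrow> ((nat \<Rightarrow> 'b) \<Rightarrow> 'k::comm_ring_1) \<Rightarrow> ('b \<Rightarrow> 'k)
    \<Rightarrow> (nat \<Rightarrow> 'b) \<Rightarrow> 'k" where
  "wedge_right k \<omega> x J = (\<Sum>s\<le>k. (-1) ^ (k - s) * \<omega> (omit s J) * x (J s))"

definition contract :: "'k::comm_ring_1 ^ ('a::finite \<times> 'b::finite \<times> 'c::finite) \<Rightarrow> 'k ^ 'a
    \<Rightarrow> 'k ^ ('b \<times> 'c)" where
  "contract T \<alpha> = (\<chi> p. case p of (j, k) \<Rightarrow> \<Sum>i\<in>UNIV. \<alpha> $ i * T $ (i, j, k))"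

text \<open>
  The coordinates of \<open>\<psi>\<^bsup>1,r-1\<^esup>\<^bsub>\<alpha>,\<alpha>1,\<alpha>2\<^esub>(T)\<close>: \<open>J\<close> and \<open>L\<close> belong to the factors \<open>\<Lambda>\<^sup>rB\<^sup>*\<close> and
  \<open>\<Lambda>\<^sup>rC\<^sup>*\<close>, the index \<open>j\<close> to the \<open>B\<^sup>*\<close>-part of the contraction with \<open>\<alpha>2\<close>, and \<open>k\<close> to the
  \<open>C\<^sup>*\<close>-part of the contraction with \<open>\<alpha>1\<close>.
\<close>

definition psi :: "nat \<Rightarrow> 'k::comm_ring_1 ^ 'a \<Rightarrow> 'k ^ 'a \<Rightarrow> 'k ^ 'a
    \<Rightarrow> 'k ^ ('a::finite \<times> 'b::finite \<times> 'c::finite)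
    \<Rightarrow> (nat \<Rightarrow> 'b) \<Rightarrow> 'b \<Rightarrow> 'c \<Rightarrow> (nat \<Rightarrow> 'c) \<Rightarrow> 'k" where
  "psi r \<alpha> \<alpha>1 \<alpha>2 T = (\<lambda>J j k L.
     wedge_left (r - 1) (\<lambda>j'. contract T \<alpha>1 $ (j', k))
       (\<lambda>J'. wedge_right (r - 1) (ext_power (r - 1) (contract T \<alpha>) J')
               (\<lambda>k'. contract T \<alpha>2 $ (j, k')) L) J)"

definition commuting :: "nat \<Rightarrow> 'k::comm_ring_1 ^ ('a::finite \<times> 'b::finite \<times> 'c::finite) \<Rightarrow> bool" where
  "commuting r T \<longleftrightarrow> (\<forall>\<alpha> \<alpha>1 \<alpha>2. psi r \<alpha> \<alpha>1 \<alpha>2 T = psi r \<alpha> \<alpha>2 \<alpha>1 T)"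

definition Comm_A :: "nat \<Rightarrow> ('k::field ^ ('a::finite \<times> 'b::finite \<times> 'c::finite)) set set" where
  "Comm_A r = {pt T |T. T \<noteq> 0 \<and> commuting r T}"

definition Comm_B :: "nat \<Rightarrow> ('k::field ^ ('a::finite \<times> 'b::finite \<times> 'c::finite)) set set" where
  "Comm_B r = {pt T |T. T \<noteq> 0 \<and> commuting r (\<chi> p. case p of (j, i, k) \<Rightarrow> T $ (i, j, k))}"

definition Comm_C :: "nat \<Rightarrow> ('k::field ^ ('a::finite \<times> 'b::finite \<times> 'c::finite)) set set" where
  "Comm_C r = {pt T |T. T \<noteq> 0 \<and> commuting r (\<chi> p. case p of (k, i, j) \<Rightarrow> T $ (i, j, k))}"


section \<open>Modules of equations\<close>

text \<open>
  \<open>V\<^bsup>\<otimes>d\<^esup>\<close> is \<open>'k ^ ('d \<Rightarrow> 'n)\<close> with \<open>CARD('d) = d\<close>.  A Young tableau is given by the map sending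
  an entry in \<open>'d\<close> to the box (row, column) containing it.  For a tableau of shape \<open>\<pi>\<close> the image
  of its Young symmetrizer is the module \<open>S\<^sub>\<pi>V\<close>.
\<close>

definition row_group :: "('d \<Rightarrow> nat \<times> nat) \<Rightarrow> ('d \<Rightarrow> 'd) set" where
  "row_group t = {\<sigma>. \<sigma> permutes UNIV \<and> (\<forall>s. fst (t (\<sigma> s)) = fst (t s))}"

definition col_group :: "('d \<Rightarrow> nat \<times> nat) \<Rightarrow> ('d \<Rightarrow> 'd) set" where
  "col_group t = {\<tau>. \<tau> permutes UNIV \<and> (\<forall>s. snd (t (\<tau> s)) = snd (t s))}"

definition young_symmetrizer :: "('d \<Rightarrow> nat \<times> nat) \<Rightarrow> 'k::comm_ring_1 ^ ('d::finite \<Rightarrow> 'n::finite)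
    \<Rightarrow> 'k ^ ('d \<Rightarrow> 'n)" where
  "young_symmetrizer t f = (\<chi> I. \<Sum>\<sigma>\<in>row_group t. \<Sum>\<tau>\<in>col_group t.
     of_int (sign \<tau>) * f $ (I \<circ> \<tau> \<circ> \<sigma>))"

definition schur_module :: "('d \<Rightarrow> nat \<times> nat) \<Rightarrow> ('k::comm_ring_1 ^ ('d::finite \<Rightarrow> 'n::finite)) set" where
  "schur_module t = range (young_symmetrizer t)"

definition tableau211 :: "4 \<Rightarrow> nat \<times> nat" where
  "tableau211 s = (if s = 0 then (0, 0) else if s = 1 then (0, 1) else if s = 2 then (1, 0) else (2, 0))"

definition tensor_power :: "'k::comm_ring_1 ^ 'n ^ 'n \<Rightarrow> 'k ^ ('d::finite \<Rightarrow> 'n::finite) ^ ('d \<Rightarrow> 'n)" where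
  "tensor_power g = (\<chi> I I'. \<Prod>s\<in>UNIV. g $ I s $ I' s)"

definition kron3 :: "'k::comm_ring_1 ^ 'x ^ 'x \<Rightarrow> 'k ^ 'y ^ 'y \<Rightarrow> 'k ^ 'z ^ 'z
    \<Rightarrow> 'k ^ ('x::finite \<times> 'y::finite \<times> 'z::finite) ^ ('x \<times> 'y \<times> 'z)" where
  "kron3 g h l = (\<chi> p q. case (p, q) of ((i, j, k), (i', j', k')) \<Rightarrow>
     g $ i $ i' * h $ j $ j' * l $ k $ k')"

text \<open>\<open>S\<^bsub>211\<^esub>A \<otimes> S\<^bsub>211\<^esub>B \<otimes> S\<^bsub>211\<^esub>C\<close> inside \<open>A\<^bsup>\<otimes>4\<^esup> \<otimes> B\<^bsup>\<otimes>4\<^esup> \<otimes> C\<^bsup>\<otimes>4\<^esup>\<close>.\<close>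

definition schur211_tensor ::
    "('k::field ^ ((4 \<Rightarrow> 'a::finite) \<times> (4 \<Rightarrow> 'b::finite) \<times> (4 \<Rightarrow> 'c::finite))) set" where
  "schur211_tensor = vec.span {tensor3 f g h |f g h. f \<in> schur_module tableau211 \<and>
     g \<in> schur_module tableau211 \<and> h \<in> schur_module tableau211}"

text \<open>
  \<open>M\<close> is a \<open>GL(A) \<times> GL(B) \<times> GL(C)\<close>-submodule of \<open>S\<^sup>4(A \<otimes> B \<otimes> C)\<close> isomorphic to
  \<open>S\<^bsub>211\<^esub>A \<otimes> S\<^bsub>211\<^esub>B \<otimes> S\<^bsub>211\<^esub>C\<close>.  The isomorphism is the restriction of a linear map \<open>\<phi>\<close> defined
  on all of \<open>A\<^bsup>\<otimes>4\<^esup> \<otimes> B\<^bsup>\<otimes>4\<^esup> \<otimes> C\<^bsup>\<otimes>4\<^esup>\<close>, which is no restriction over a field.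
\<close>

definition schur211_submodule ::
    "('a::finite \<times> 'b::finite \<times> 'c::finite, 'k::field) mpoly set \<Rightarrow> bool" where
  "schur211_submodule M \<longleftrightarrow>
     mpoly.subspace M \<and>
     (\<forall>f \<in> M. homogeneous 4 f) \<and>
     (\<forall>(g :: 'k ^ 'a ^ 'a) (h :: 'k ^ 'b ^ 'b) (l :: 'k ^ 'c ^ 'c).
        invertible g \<longrightarrow> invertible h \<longrightarrow> invertible l \<longrightarrow>
        (\<forall>f \<in> M. psubst (kron3 g h l) f \<in> M)) \<and>
     (\<exists>\<phi>. Vector_Spaces.linear (*s) pscale \<phi> \<and> bij_betw \<phi> schur211_tensor M \<and>
        (\<forall>(g :: 'k ^ 'a ^ 'a) (h :: 'k ^ 'b ^ 'b) (l :: 'k ^ 'c ^ 'c).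
           invertible g \<longrightarrow> invertible h \<longrightarrow> invertible l \<longrightarrow>
           (\<forall>u \<in> schur211_tensor.
              \<phi> (kron3 (tensor_power g) (tensor_power h) (tensor_power l) *v u)
              = psubst (kron3 g h l) (\<phi> u))))"

text \<open>
  \<open>\<Lambda>\<^sup>4E \<otimes> \<Lambda>\<^sup>4F\<close> inside \<open>S\<^sup>4(E \<otimes> F)\<close>: the image of the equivariant embedding
  sending \<open>(e\<^sub>1 \<and> \<dots> \<and> e\<^sub>4) \<otimes> (f\<^sub>1 \<and> \<dots> \<and> f\<^sub>4)\<close> to the determinant of the matrix of the
  linear forms \<open>e\<^sub>s \<otimes> f\<^sub>t\<close>.  The map \<open>\<iota>\<close> names the variable that is the tensor product of two
  basis vectors.
\<close>

definition ext4_module :: "('x::finite \<Rightarrow> 'y::finite \<Rightarrow> 'v) \<Rightarrow> ('v, 'k::field) mpoly set" where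
  "ext4_module \<iota> = mpoly.span
     {det ((\<chi> s t. \<Sum>i\<in>UNIV. \<Sum>j\<in>UNIV. pscale (e s $ i * f t $ j) (pvar (\<iota> i j)))
         :: ('v, 'k) mpoly ^ 4 ^ 4)
      |(e :: 4 \<Rightarrow> 'k ^ 'x) (f :: 4 \<Rightarrow> 'k ^ 'y). True}"

definition ext4_A :: "('a::finite \<times> 'b::finite \<times> 'c::finite, 'k::field) mpoly set" where
  "ext4_A = ext4_module (\<lambda>i (j, k). (i, j, k))"

definition ext4_B :: "('a::finite \<times> 'b::finite \<times> 'c::finite, 'k::field) mpoly set" where
  "ext4_B = ext4_module (\<lambda>j (i, k). (i, j, k))"

definition ext4_C :: "('a::finite \<times> 'b::finite \<times> 'c::finite, 'k::field) mpoly set" where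
  "ext4_C = ext4_module (\<lambda>k (i, j). (i, j, k))"

end

theory Submission
  imports Defs
begin

text \<open>
  A tensor lies over the secant variety exactly if every homogeneous polynomial that vanishes on
  all sums of three decomposable tensors vanishes at it (\<open>sec3\<close>, lemma
  \<open>secant_variety_segre\<close>). All the conditions in question are vanishing conditions
  on quartic polynomials, so one inclusion only has to be checked on sums of three decomposable
  tensors. There the matrices of contractions factor as \<open>W D V\<close> with
  \<open>D\<close> diagonal, and diagonal matrices commute; the three flattenings have rank at
  most three; and the elements of the module vanish because two of four positions must carry the
  same one of the three summands.

  For the converse, a tensor in \<open>Sub 3 3 3\<close> is, up to linear maps of the factors, a
  net of three by three matrices. The commutation condition becomes the condition of Strassen:
  \<open>X adj(Y) Z = Z adj(Y) X\<close> for all \<open>X\<close>, \<open>Y\<close>,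
  \<open>Z\<close> in the net. The heart of the matter is \<open>border_strassen\<close>: such a
  net is a limit of nets of rank at most three. If the net contains an invertible matrix, it may
  be taken to be the identity, and then the other two matrices commute. Following Motzkin and
  Taussky, a commuting pair \<open>M\<close>, \<open>N\<close> is approached by pairs
  \<open>M'\<close>, \<open>N\<close> where \<open>M'\<close> has a cyclic vector;
  \<open>N\<close> is then a polynomial in \<open>M'\<close>, and moving the roots of the
  companion matrix of \<open>M'\<close> apart makes the pair simultaneously diagonalizable
  (\<open>border_commuting\<close>). If every matrix in the net is singular, then either all
  three slices have rank at most one, or the slices have a common left or right kernel, in which
  case the three factors are permuted so that one slice vanishes and a generic pair of slices
  can be used, or the net has a normal form that is an explicit limit
  (\<open>border_double_tangent\<close>).

  The module is found and shown to be unique by regarding a quartic form as a symmetric tensor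
  of degree four. Antisymmetry in the first column of the hook is a symmetry among three of the
  four positions; if the remaining position is chosen differently in the three factors,
  symmetrizing over all four positions is injective on the tensor product of the three Schur
  modules (\<open>hook_map_eq_0\<close>), and this gives one copy. For uniqueness, the image of
  a highest weight vector is described by a tensor with six indices in \<open>{0, 1, 2,
  3}\<close> that is invariant under all permutations of positions, and the space of these
  tensors is at most one dimensional (\<open>invariant_eq_0\<close>); this is the Kronecker
  coefficient of three copies of the partition (2,1,1). Finally, suitable elements of the copy
  evaluate at a tensor to nonzero multiples of the entries of \<open>X adj(Y) Z - Z adj(Y)
  X\<close> (\<open>hook_form_commutator\<close>), which links the module to the condition of
  Strassen.
\<close>

section \<open>Polynomial functions\<close>

lemma peval_superset:
  assumes "finite A" "Poly_Mapping.keys p \<subseteq> A"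
  shows "peval p x = (\<Sum>m\<in>A. Poly_Mapping.lookup p m * (\<Prod>v\<in>UNIV. (x $ v) ^ Poly_Mapping.lookup m v))"
  unfolding peval_def
  by (rule sum.mono_neutral_left[OF assms]) (auto simp: in_keys_iff)

lemma peval_0 [simp]: "peval 0 x = 0"
  by (simp add: peval_def)

lemma peval_add [simp]: "peval (p + q) x = peval p x + peval q x"
proof -
  let ?A = "Poly_Mapping.keys p \<union> Poly_Mapping.keys q"
  have "finite ?A" "Poly_Mapping.keys (p + q) \<subseteq> ?A" using Poly_Mapping.keys_add[of p q] by simp_all
  then show ?thesis
    by (simp add: peval_superset[of ?A] lookup_add distrib_right sum.distrib)
qed

lemma peval_single:
  "peval (Poly_Mapping.single m c) x = c * (\<Prod>v\<in>UNIV. (x $ v) ^ Poly_Mapping.lookup m v)"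
  by (subst peval_superset[of "{m}"]) auto

lemma peval_sum [simp]: "peval (\<Sum>i\<in>I. f i) x = (\<Sum>i\<in>I. peval (f i) x)"
  by (induction I rule: infinite_finite_induct) auto

lemma mpoly_eq_sum_singles:
  "p = (\<Sum>m\<in>Poly_Mapping.keys p. Poly_Mapping.single m (Poly_Mapping.lookup p m))"
proof (rule poly_mapping_eqI)
  fix k
  have "Poly_Mapping.lookup (\<Sum>m\<in>Poly_Mapping.keys p. Poly_Mapping.single m (Poly_Mapping.lookup p m)) k
      = (\<Sum>m\<in>Poly_Mapping.keys p. if m = k then Poly_Mapping.lookup p m else 0)"
    unfolding lookup_sum by (intro sum.cong refl) (simp add: lookup_single when_def)
  then show "Poly_Mapping.lookup p k
      = Poly_Mapping.lookup (\<Sum>m\<in>Poly_Mapping.keys p. Poly_Mapping.single m (Poly_Mapping.lookup p m)) k"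
    by (simp add: in_keys_iff)
qed

lemma peval_mult [simp]: "peval (p * q) x = peval p x * peval q x"
proof -
  have single: "peval (Poly_Mapping.single m c * Poly_Mapping.single n d) x
      = peval (Poly_Mapping.single m c) x * peval (Poly_Mapping.single n d) x" for m n c d
    by (simp add: mult_single peval_single lookup_add power_add prod.distrib mult_ac)
  have "peval (p * q) x = peval ((\<Sum>m\<in>Poly_Mapping.keys p. Poly_Mapping.single m (Poly_Mapping.lookup p m))
      * (\<Sum>m\<in>Poly_Mapping.keys q. Poly_Mapping.single m (Poly_Mapping.lookup q m))) x"
    by (simp flip: mpoly_eq_sum_singles)
  also have "\<dots> = peval (\<Sum>m\<in>Poly_Mapping.keys p. Poly_Mapping.single m (Poly_Mapping.lookup p m)) x
      * peval (\<Sum>m\<in>Poly_Mapping.keys q. Poly_Mapping.single m (Poly_Mapping.lookup q m)) x"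
    unfolding peval_sum sum_product by (simp add: single)
  finally show ?thesis by (simp flip: mpoly_eq_sum_singles)
qed

lemma peval_pconst [simp]: "peval (pconst c) x = c"
  by (simp add: pconst_def peval_single)

lemma peval_1 [simp]: "peval 1 x = 1"
  using peval_pconst[of 1 x] by (simp add: pconst_def)

lemma peval_uminus [simp]: "peval (- p) x = - peval p x"
  using peval_add[of p "- p" x] by (simp add: eq_neg_iff_add_eq_0 add.commute)

lemma peval_of_nat [simp]: "peval (of_nat n) x = of_nat n"
  by (induction n) auto

lemma peval_of_int [simp]: "peval (of_int n) x = of_int n"
  by (cases n rule: int_cases2) simp_all

lemma peval_prod [simp]: "peval (\<Prod>i\<in>I. f i) x = (\<Prod>i\<in>I. peval (f i) x)"
  by (induction I rule: infinite_finite_induct) auto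

lemma peval_pvar [simp]: "peval (pvar v) x = x $ v"
proof -
  have "(\<Prod>w\<in>UNIV. (x $ w) ^ Poly_Mapping.lookup (Poly_Mapping.single v 1) w)
      = (\<Prod>w\<in>UNIV. if w = v then x $ w else 1)"
    by (intro prod.cong) (auto simp: lookup_single when_def)
  then show ?thesis by (simp add: pvar_def peval_single)
qed

lemma peval_pscale [simp]: "peval (pscale c p) x = c * peval p x"
  by (simp add: pscale_def)

lemma homogeneous_0: "homogeneous d 0"
  by (simp add: homogeneous_def)

lemma homogeneous_add: "homogeneous d p \<Longrightarrow> homogeneous d q \<Longrightarrow> homogeneous d (p + q)"
  unfolding homogeneous_def using Poly_Mapping.keys_add[of p q] by blast

lemma homogeneous_sum: "(\<And>i. i \<in> I \<Longrightarrow> homogeneous d (f i)) \<Longrightarrow> homogeneous d (\<Sum>i\<in>I. f i)"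
  by (induction I rule: infinite_finite_induct) (auto intro: homogeneous_0 homogeneous_add)

lemma homogeneous_mult: "homogeneous d p \<Longrightarrow> homogeneous e q \<Longrightarrow> homogeneous (d + e) (p * q)"
  unfolding homogeneous_def using keys_mult[of p q] by (fastforce simp: lookup_add sum.distrib)

lemma homogeneous_pconst: "homogeneous 0 (pconst c)"
  by (simp add: homogeneous_def pconst_def)

lemma homogeneous_pvar: "homogeneous 1 (pvar v)"
  by (simp add: homogeneous_def pvar_def lookup_single when_def)

lemma homogeneous_pscale: "homogeneous d p \<Longrightarrow> homogeneous d (pscale c p)"
  unfolding pscale_def using homogeneous_mult[OF homogeneous_pconst, of d p c] by simp

lemma homogeneous_prod:
  "(\<And>i. i \<in> I \<Longrightarrow> homogeneous (d i) (f i)) \<Longrightarrow> finite I \<Longrightarrow> homogeneous (\<Sum>i\<in>I. d i) (\<Prod>i\<in>I. f i)"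
proof (induction I rule: infinite_finite_induct)
  case empty
  then show ?case using homogeneous_pconst[of 1] by (simp add: pconst_def flip: single_one)
qed (auto intro: homogeneous_mult)

lemma peval_scale:
  assumes "homogeneous d p"
  shows "peval p (c *s x) = c ^ d * peval p x"
proof -
  have "(\<Prod>v\<in>UNIV. ((c *s x) $ v) ^ Poly_Mapping.lookup m v)
      = c ^ d * (\<Prod>v\<in>UNIV. (x $ v) ^ Poly_Mapping.lookup m v)"
    if "m \<in> Poly_Mapping.keys p" for m
    using assms that by (auto simp: homogeneous_def power_mult_distrib prod.distrib power_sum)
  then show ?thesis by (simp add: peval_def sum_distrib_left mult.left_commute)
qed

text \<open>
  Homogeneous polynomial functions. Closure properties of functions are more convenient than
  those of formal polynomials, because the equations below are given by determinants and matrix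
  products.
\<close>

definition hpf :: "nat \<Rightarrow> ('k::comm_ring_1 ^ 'v::finite \<Rightarrow> 'k) \<Rightarrow> bool" where
  "hpf d f \<longleftrightarrow> (\<exists>p. homogeneous d p \<and> (\<forall>x. peval p x = f x))"

lemma hpf_peval: "homogeneous d p \<Longrightarrow> hpf d (peval p)"
  unfolding hpf_def by blast

lemma hpf_0: "hpf d (\<lambda>x. 0)"
  unfolding hpf_def by (rule exI[of _ 0]) (simp add: homogeneous_0)

lemma hpf_add: "hpf d f \<Longrightarrow> hpf d g \<Longrightarrow> hpf d (\<lambda>x. f x + g x)"
  unfolding hpf_def using homogeneous_add peval_add by metis

lemma hpf_mult: "hpf d f \<Longrightarrow> hpf e g \<Longrightarrow> hpf (d + e) (\<lambda>x. f x * g x)"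
  unfolding hpf_def using homogeneous_mult peval_mult by metis

lemma hpf_const: "hpf 0 (\<lambda>x. c)"
  unfolding hpf_def using homogeneous_pconst peval_pconst by metis

lemma hpf_coord: "hpf 1 (\<lambda>x. x $ v)"
  unfolding hpf_def using homogeneous_pvar peval_pvar by metis

lemma hpf_coord_Suc: "hpf (Suc 0) (\<lambda>x. x $ v)"
  using hpf_coord by simp

lemma hpf_scale: "hpf d f \<Longrightarrow> hpf d (\<lambda>x. c * f x)"
  using hpf_mult[OF hpf_const, of d f c] by simp

lemma hpf_uminus: "hpf d f \<Longrightarrow> hpf d (\<lambda>x. - f x)"
  using hpf_scale[of d f "-1"] by simp

lemma hpf_diff: "hpf d f \<Longrightarrow> hpf d g \<Longrightarrow> hpf d (\<lambda>x. f x - g x)"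
  using hpf_add[OF _ hpf_uminus, of d f g] by simp

lemma hpf_sum: "(\<And>i. i \<in> I \<Longrightarrow> hpf d (f i)) \<Longrightarrow> hpf d (\<lambda>x. \<Sum>i\<in>I. f i x)"
  by (induction I rule: infinite_finite_induct) (auto intro: hpf_0 hpf_add)

lemma hpf_prod:
  "finite I \<Longrightarrow> (\<And>i. i \<in> I \<Longrightarrow> hpf (d i) (f i)) \<Longrightarrow> hpf (\<Sum>i\<in>I. d i) (\<lambda>x. \<Prod>i\<in>I. f i x)"
proof (induction I rule: finite_induct)
  case empty
  then show ?case using hpf_const[of 1] by simp
qed (auto intro: hpf_mult)

lemma hpf_power: "hpf d f \<Longrightarrow> hpf (n * d) (\<lambda>x. f x ^ n)"
  using hpf_const[of 1] by (induction n) (auto intro: hpf_mult)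

text \<open>
  Substituting linear forms preserves the degree; this lets equations be pulled back along
  linear maps of the ambient spaces.
\<close>

lemma hpf_compose:
  fixes f :: "'k::comm_ring_1 ^ 'v::finite \<Rightarrow> 'k" and L :: "'k ^ 'w::finite \<Rightarrow> 'k ^ 'v"
  assumes "hpf d f" and L: "\<And>v. hpf 1 (\<lambda>x. L x $ v)"
  shows "hpf d (\<lambda>x. f (L x))"
proof -
  obtain p where p: "homogeneous d p" "\<And>x. peval p x = f x" using assms(1) hpf_def by metis
  have "hpf d (\<lambda>x. \<Prod>v\<in>UNIV. (L x $ v) ^ Poly_Mapping.lookup m v)"
    if "m \<in> Poly_Mapping.keys p" for m
  proof -
    have "hpf (\<Sum>v\<in>UNIV. Poly_Mapping.lookup m v) (\<lambda>x. \<Prod>v\<in>UNIV. (L x $ v) ^ Poly_Mapping.lookup m v)"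
      using hpf_power[OF L] by (intro hpf_prod) auto
    then show ?thesis using p(1) that by (simp add: homogeneous_def)
  qed
  then have "hpf d (\<lambda>x. peval p (L x))"
    unfolding peval_def by (intro hpf_sum hpf_scale)
  then show ?thesis by (simp add: p(2))
qed

definition polyfun :: "('k::comm_ring_1 \<Rightarrow> 'k) \<Rightarrow> bool" where
  "polyfun f \<longleftrightarrow> (\<exists>p. \<forall>t. f t = poly p t)"

lemma polyfun_const [intro, simp]: "polyfun (\<lambda>t. c)"
  unfolding polyfun_def by (rule exI[of _ "[:c:]"]) simp

lemma polyfun_id [intro, simp]: "polyfun (\<lambda>t. t)"
  unfolding polyfun_def by (rule exI[of _ "[:0, 1:]"]) simp

lemma polyfun_add [intro]: "polyfun f \<Longrightarrow> polyfun g \<Longrightarrow> polyfun (\<lambda>t. f t + g t)"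
  unfolding polyfun_def by (metis poly_add)

lemma polyfun_mult [intro]: "polyfun f \<Longrightarrow> polyfun g \<Longrightarrow> polyfun (\<lambda>t. f t * g t)"
  unfolding polyfun_def by (metis poly_mult)

lemma polyfun_uminus [intro]: "polyfun f \<Longrightarrow> polyfun (\<lambda>t. - f t)"
  unfolding polyfun_def by (metis poly_minus)

lemma polyfun_diff [intro]: "polyfun f \<Longrightarrow> polyfun g \<Longrightarrow> polyfun (\<lambda>t. f t - g t)"
  unfolding polyfun_def by (metis poly_diff)

lemma polyfun_power [intro]: "polyfun f \<Longrightarrow> polyfun (\<lambda>t. f t ^ n)"
  unfolding polyfun_def by (metis poly_power)

lemma polyfun_sum [intro]: "(\<And>i. i \<in> I \<Longrightarrow> polyfun (f i)) \<Longrightarrow> polyfun (\<lambda>t. \<Sum>i\<in>I. f i t)"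
  by (induction I rule: infinite_finite_induct) auto

lemma polyfun_prod [intro]: "(\<And>i. i \<in> I \<Longrightarrow> polyfun (f i)) \<Longrightarrow> polyfun (\<lambda>t. \<Prod>i\<in>I. f i t)"
  by (induction I rule: infinite_finite_induct) auto

lemma polyfun_if [intro]: "polyfun f \<Longrightarrow> polyfun g \<Longrightarrow> polyfun (\<lambda>t. if P then f t else g t)"
  by (cases P) simp_all

text \<open>
  A polynomial that vanishes outside a finite set is zero, as the field is infinite. All limit
  arguments below use this in place of a topology.
\<close>

lemma polyfun_eq_0:
  fixes f :: "'k::field_char_0 \<Rightarrow> 'k"
  assumes "polyfun f" "finite {t. f t \<noteq> 0}"
  shows "f s = 0"
proof -
  obtain p where p: "\<And>t. f t = poly p t" using assms(1) polyfun_def by blast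
  have "p = 0"
  proof (rule ccontr)
    assume "p \<noteq> 0"
    then have "finite {t. f t = 0}" by (simp add: p poly_roots_finite)
    then have "finite ({t. f t = 0} \<union> {t. f t \<noteq> 0})" using assms(2) by blast
    moreover have "{t. f t = 0} \<union> {t. f t \<noteq> 0} = UNIV" by blast
    ultimately show False using infinite_UNIV_char_0 by metis
  qed
  then show ?thesis by (simp add: p)
qed

lemma polyfun_finite_zeros:
  fixes f :: "'k::field_char_0 \<Rightarrow> 'k"
  assumes "polyfun f" "f s \<noteq> 0"
  shows "finite {t. f t = 0}"
proof -
  obtain p where p: "\<And>t. f t = poly p t" using assms(1) polyfun_def by blast
  then have "p \<noteq> 0" using assms(2) by auto
  then show ?thesis by (simp add: p poly_roots_finite)
qed

section \<open>The affine cone over the third secant variety\<close>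

definition rank_le3 :: "'k::comm_ring_1 ^ ('a::finite \<times> 'b::finite \<times> 'c::finite) \<Rightarrow> bool" where
  "rank_le3 T \<longleftrightarrow> (\<exists>(x :: 3 \<Rightarrow> _) y z. T = (\<Sum>i\<in>UNIV. tensor3 (x i) (y i) (z i)))"

text \<open>
  The affine cone over the third secant variety: the zeros of the homogeneous polynomials that
  vanish on all sums of three decomposable tensors.
\<close>

definition sec3 :: "'k::comm_ring_1 ^ ('a::finite \<times> 'b::finite \<times> 'c::finite) \<Rightarrow> bool" where
  "sec3 T \<longleftrightarrow> (\<forall>d f. hpf d f \<longrightarrow> (\<forall>X. rank_le3 X \<longrightarrow> f X = 0) \<longrightarrow> f T = 0)"

lemma rank_le3_imp_sec3: "rank_le3 T \<Longrightarrow> sec3 T"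
  by (simp add: sec3_def)

lemma sec3_hpf: "sec3 T \<Longrightarrow> hpf d f \<Longrightarrow> (\<And>X. rank_le3 X \<Longrightarrow> f X = 0) \<Longrightarrow> f T = 0"
  unfolding sec3_def by blast

lemma tensor3_0_left [simp]: "tensor3 (0 :: 'k::comm_ring_1 ^ 'a::finite) y z = 0"
  by (simp add: tensor3_def vec_eq_iff)

lemma sec3_map:
  fixes L :: "'k::comm_ring_1 ^ ('a::finite \<times> 'b::finite \<times> 'c::finite)
      \<Rightarrow> 'k ^ ('x::finite \<times> 'y::finite \<times> 'z::finite)"
  assumes "sec3 T" "\<And>v. hpf 1 (\<lambda>x. L x $ v)" "\<And>X. rank_le3 X \<Longrightarrow> rank_le3 (L X)"
  shows "sec3 (L T)"
  unfolding sec3_def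
proof (intro allI impI)
  fix d and f :: "'k ^ ('x \<times> 'y \<times> 'z) \<Rightarrow> 'k"
  assume f: "hpf d f" "\<forall>X. rank_le3 X \<longrightarrow> f X = 0"
  show "f (L T) = 0"
    by (rule sec3_hpf[OF assms(1) hpf_compose[OF f(1) assms(2)]]) (use f(2) assms(3) in blast)
qed

lemma hpf_polyfun:
  assumes "hpf d f" "\<And>v. polyfun (\<lambda>t. T t $ v)"
  shows "polyfun (\<lambda>t. f (T t))"
proof -
  obtain p where "\<And>x. f x = peval p x" using assms(1) unfolding hpf_def by metis
  then show ?thesis unfolding peval_def
    by (auto intro!: polyfun_sum polyfun_mult polyfun_prod polyfun_power assms(2))
qed

text \<open>
  A polynomial curve that is in the cone for all but finitely many parameters stays in it, as
  each equation restricts to a polynomial in the parameter.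
\<close>

lemma sec3_curve:
  fixes T :: "'k::field_char_0 \<Rightarrow> 'k ^ ('a::finite \<times> 'b::finite \<times> 'c::finite)"
  assumes "\<And>v. polyfun (\<lambda>t. T t $ v)" "finite {t. \<not> sec3 (T t)}"
  shows "sec3 (T s)"
  unfolding sec3_def
proof (intro allI impI)
  fix d and f :: "'k ^ ('a \<times> 'b \<times> 'c) \<Rightarrow> 'k"
  assume f: "hpf d f" "\<forall>X. rank_le3 X \<longrightarrow> f X = 0"
  have "{t. f (T t) \<noteq> 0} \<subseteq> {t. \<not> sec3 (T t)}" using f unfolding sec3_def by blast
  then have "finite {t. f (T t) \<noteq> 0}" using assms(2) finite_subset by blast
  then show "f (T s) = 0" by (rule polyfun_eq_0[OF hpf_polyfun[OF f(1) assms(1)]])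
qed

lemma pt_eq: "pt v = range (\<lambda>c. c *s v)"
  by (auto simp: pt_def vec.span_singleton)

lemma pt_self: "v \<in> pt v"
  unfolding pt_def by (simp add: vec.span_base)

lemma pt_eqD: "pt v = pt w \<Longrightarrow> v \<noteq> 0 \<Longrightarrow> \<exists>c. c \<noteq> 0 \<and> v = c *s w"
  using pt_self[of v] by (auto simp: pt_eq)

lemma sum_UNIV_3: "(\<Sum>i\<in>(UNIV :: 3 set). f i) = f 0 + f 1 + f 2"
proof -
  have "(3 :: 3) = 0" by simp
  then show ?thesis by (simp only: sum_3 add_ac)
qed

lemma zero_locus_pt:
  assumes "\<And>f. f \<in> F \<Longrightarrow> \<exists>d. homogeneous d f" "v \<noteq> 0"
  shows "pt v \<in> zero_locus F \<longleftrightarrow> (\<forall>f\<in>F. peval f v = 0)"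
proof
  assume "pt v \<in> zero_locus F"
  then show "\<forall>f\<in>F. peval f v = 0" using pt_self by (auto simp: zero_locus_def)
next
  assume v: "\<forall>f\<in>F. peval f v = 0"
  have "peval f w = 0" if f: "f \<in> F" and w: "w \<in> pt v" for f w
  proof -
    obtain c where "w = c *s v" using w by (auto simp: pt_eq)
    moreover obtain d where "homogeneous d f" using assms(1)[OF f] by blast
    ultimately show ?thesis using v f by (simp add: peval_scale)
  qed
  then show "pt v \<in> zero_locus F" using assms(2) by (auto simp: zero_locus_def proj_space_def)
qed

text \<open>
  For homogeneous polynomials one representative of each point decides.
\<close>

lemma zero_locus_eq:
  assumes "\<And>f. f \<in> F \<Longrightarrow> \<exists>d. homogeneous d f"
  shows "zero_locus F = {pt v |v. v \<noteq> 0 \<and> (\<forall>f\<in>F. peval f v = 0)}"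
proof -
  have "L \<in> zero_locus F \<longleftrightarrow> (\<exists>v. L = pt v \<and> v \<noteq> 0 \<and> (\<forall>f\<in>F. peval f v = 0))" for L
  proof
    assume L: "L \<in> zero_locus F"
    then obtain v where v: "v \<noteq> 0" "L = pt v" by (auto simp: zero_locus_def proj_space_def)
    then show "\<exists>v. L = pt v \<and> v \<noteq> 0 \<and> (\<forall>f\<in>F. peval f v = 0)"
      using zero_locus_pt[of F, OF assms v(1)] L by blast
  next
    assume "\<exists>v. L = pt v \<and> v \<noteq> 0 \<and> (\<forall>f\<in>F. peval f v = 0)"
    then obtain v where v: "v \<noteq> 0" "L = pt v" "\<forall>f\<in>F. peval f v = 0" by blast
    then show "L \<in> zero_locus F" using zero_locus_pt[of F, OF assms v(1)] by blast
  qed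
  then show ?thesis by (intro set_eqI) (simp only: mem_Collect_eq)
qed

text \<open>
  A sum of three decomposable tensors may have zero summands, but the definition of the secant
  variety asks for three honest points of the Segre variety; any point can stand in for a zero
  summand.
\<close>

lemma segre_span_iff_rank_le3:
  fixes T :: "'k::field ^ ('a::finite \<times> 'b::finite \<times> 'c::finite)"
  assumes "T \<noteq> 0"
  shows "(\<exists>x :: nat \<Rightarrow> _. (\<forall>i<3. x i \<in> segre) \<and> pt T \<subseteq> vec.span (\<Union>i<3. x i)) \<longleftrightarrow> rank_le3 T"
    (is "?L \<longleftrightarrow> _")
proof
  assume ?L
  then obtain x :: "nat \<Rightarrow> ('k ^ ('a \<times> 'b \<times> 'c)) set" where
    x: "\<And>i. i < 3 \<Longrightarrow> x i \<in> segre" and T: "pt T \<subseteq> vec.span (\<Union>i<3. x i)" by blast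
  have "\<exists>a b c. x i = pt (tensor3 a b c)" if "i < 3" for i using x[OF that] by (auto simp: segre_def)
  then obtain a b c where abc: "\<And>i. i < 3 \<Longrightarrow> x i = pt (tensor3 (a i) (b i) (c i))" by metis
  let ?t = "\<lambda>i. tensor3 (a i) (b i) (c i)"
  have "(\<Union>i<3. x i) \<subseteq> vec.span {?t 0, ?t 1, ?t 2}"
  proof
    fix y assume "y \<in> (\<Union>i<3. x i)"
    then obtain i where i: "i < 3" "y \<in> x i" by blast
    then have "y \<in> vec.span {?t i}" using abc by (simp add: pt_def)
    moreover have "?t i \<in> {?t 0, ?t 1, ?t 2}"
      using i(1) by (auto simp: less_Suc_eq numeral_3_eq_3 numeral_2_eq_2)
    ultimately show "y \<in> vec.span {?t 0, ?t 1, ?t 2}"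
      by (meson empty_subsetI insert_subset subset_iff vec.span_mono)
  qed
  then have "vec.span (\<Union>i<3. x i) \<subseteq> vec.span {?t 0, ?t 1, ?t 2}"
    by (simp add: vec.span_minimal)
  then have "T \<in> vec.span {?t 0, ?t 1, ?t 2}" using T pt_self by blast
  then obtain p q r where "T = p *s ?t 0 + q *s ?t 1 + r *s ?t 2"
    by (auto simp: vec.span_insert vec.span_singleton algebra_simps)
  then have "T = (\<Sum>i\<in>(UNIV :: 3 set). tensor3 ((if i = 0 then p else if i = 1 then q else r) *s
      (if i = 0 then a 0 else if i = 1 then a 1 else a 2))
      (if i = 0 then b 0 else if i = 1 then b 1 else b 2)
      (if i = 0 then c 0 else if i = 1 then c 1 else c 2))"
    by (simp add: sum_UNIV_3 tensor3_def vec_eq_iff mult.assoc)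
  then show "rank_le3 T" unfolding rank_le3_def by (intro exI)
next
  assume "rank_le3 T"
  then obtain x y z where T: "T = (\<Sum>i\<in>(UNIV :: 3 set). tensor3 (x i) (y i) (z i))"
    unfolding rank_le3_def by blast
  define o1 :: "'k ^ 'a" where "o1 = 1"
  define o2 :: "'k ^ 'b" where "o2 = 1"
  define o3 :: "'k ^ 'c" where "o3 = 1"
  have nz: "o1 \<noteq> 0" "o2 \<noteq> 0" "o3 \<noteq> 0" by (simp_all add: o1_def o2_def o3_def)
  define w where "w i = (if x i \<noteq> 0 \<and> y i \<noteq> 0 \<and> z i \<noteq> 0 then pt (tensor3 (x i) (y i) (z i))
    else pt (tensor3 o1 o2 o3))" for i
  have seg: "w i \<in> segre" for i using nz unfolding w_def segre_def by auto
  have mem: "tensor3 (x i) (y i) (z i) \<in> vec.span (w i)" for i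
  proof (cases "x i \<noteq> 0 \<and> y i \<noteq> 0 \<and> z i \<noteq> 0")
    case True then show ?thesis by (simp add: w_def pt_self vec.span_base)
  next
    case False
    then have "tensor3 (x i) (y i) (z i) = 0" by (auto simp: tensor3_def vec_eq_iff)
    then show ?thesis by (simp add: vec.span_zero)
  qed
  let ?v = "\<lambda>n::nat. w (of_nat n)"
  have sub: "w i \<subseteq> (\<Union>n<3. ?v n)" for i
  proof -
    have "i = of_nat 0 \<or> i = of_nat 1 \<or> i = of_nat 2" using exhaust_3[of i] by auto
    then obtain n where "n < 3" "i = of_nat n" 
      using that[of 0] that[of 1] that[of 2] by fastforce
    then show ?thesis by blast
  qed
  have "T \<in> vec.span (\<Union>n<3. ?v n)"
    unfolding T by (intro vec.span_sum subsetD[OF vec.span_mono[OF sub] mem])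
  then have "pt T \<subseteq> vec.span (\<Union>n<3. ?v n)"
    by (auto simp: pt_eq vec.span_scale)
  then show ?L using seg by (intro exI[of _ ?v]) auto
qed

lemma secant_variety_segre:
  "secant_variety 3 (segre :: ('k::field ^ ('a::finite \<times> 'b::finite \<times> 'c::finite)) set set)
    = {pt T |T. T \<noteq> 0 \<and> sec3 T}"
proof -
  let ?Y = "{L \<in> proj_space. \<exists>x :: nat \<Rightarrow> ('k ^ ('a \<times> 'b \<times> 'c)) set.
        (\<forall>i<3. x i \<in> segre) \<and> L \<subseteq> vec.span (\<Union>i<3. x i)}"
  have Y: "?Y = {pt T |T. T \<noteq> 0 \<and> rank_le3 T}"
    using segre_span_iff_rank_le3 unfolding proj_space_def by blast
  let ?F = "{f :: ('a \<times> 'b \<times> 'c, 'k) mpoly. (\<exists>d. homogeneous d f) \<and> (\<forall>X. rank_le3 X \<longrightarrow> peval f X = 0)}"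
  have sub: "zariski_closure ?Y \<subseteq> {pt T |T. T \<noteq> 0 \<and> sec3 T}"
  proof
    fix L assume L: "L \<in> zariski_closure ?Y"
    have "zariski_closed (zero_locus ?F)" unfolding zariski_closed_def
      by (intro exI[of _ ?F]) simp
    moreover have "?Y \<subseteq> zero_locus ?F" unfolding Y by (subst zero_locus_eq) auto
    ultimately have "L \<in> zero_locus ?F" using L unfolding zariski_closure_def by blast
    then obtain T where T: "T \<noteq> 0" "L = pt T" "\<And>f. f \<in> ?F \<Longrightarrow> peval f T = 0"
      by (subst (asm) zero_locus_eq) auto
    have "sec3 T" unfolding sec3_def hpf_def
    proof (intro allI impI, elim exE conjE)
      fix d f and p :: "('a \<times> 'b \<times> 'c, 'k) mpoly"
      assume p: "homogeneous d p" "\<forall>x. peval p x = f x" and f: "\<forall>X. rank_le3 X \<longrightarrow> f X = 0"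
      then have "p \<in> ?F" by auto
      then show "f T = 0" using T(3)[of p] p(2) by simp
    qed
    then show "L \<in> {pt T |T. T \<noteq> 0 \<and> sec3 T}" using T(1,2) by (intro CollectI exI[of _ T]) simp
  qed
  have "pt T \<in> Z" if T: "T \<noteq> 0" "sec3 T" and Z: "zariski_closed Z" "?Y \<subseteq> Z" for T Z
  proof -
    obtain F where F: "\<And>f. f \<in> F \<Longrightarrow> \<exists>d. homogeneous d f" "Z = zero_locus F"
      using Z(1) unfolding zariski_closed_def by blast
    have "peval f T = 0" if f: "f \<in> F" for f
    proof -
      obtain d where d: "homogeneous d f" using F(1)[OF f] by blast
      have nz: "peval f X = 0" if "rank_le3 X" "X \<noteq> 0" for X
      proof -
        have "pt X \<in> {pt T |T. T \<noteq> 0 \<and> rank_le3 T}"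
          unfolding mem_Collect_eq using that by (intro exI[of _ X]) simp
        then have "pt X \<in> zero_locus F" using subsetD[OF Z(2)[unfolded Y]] F(2) by simp
        then show ?thesis using zero_locus_pt[OF F(1) that(2)] f by blast
      qed
      obtain X :: "'k ^ ('a \<times> 'b \<times> 'c)" where X: "rank_le3 X" "X \<noteq> 0"
      proof
        show "tensor3 1 1 1 \<noteq> (0 :: 'k ^ ('a \<times> 'b \<times> 'c))" by (simp add: tensor3_def vec_eq_iff)
        show "rank_le3 (tensor3 1 1 1 :: 'k ^ ('a \<times> 'b \<times> 'c))"
          unfolding rank_le3_def
          by (rule exI[of _ "\<lambda>i. if i = 0 then 1 else 0"], rule exI[of _ "\<lambda>i. 1"],
              rule exI[of _ "\<lambda>i. 1"]) (simp add: sum_UNIV_3)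
      qed
      (* The polynomial f may be constant, so that its value at 0 has to be found from a nonzero
         tensor. *)
      have "peval f (0 *s X) = 0" using peval_scale[OF d, of 0 X] nz[OF X] by simp
      then have "peval f X' = 0" if "rank_le3 X'" for X'
        using nz[OF that] by (cases "X' = 0") auto
      then show ?thesis using sec3_hpf[OF T(2) hpf_peval[OF d]] by blast
    qed
    then show ?thesis using zero_locus_pt[OF F(1) T(1)] F(2) by blast
  qed
  then have "{pt T |T. T \<noteq> 0 \<and> sec3 T} \<subseteq> zariski_closure ?Y"
    unfolding zariski_closure_def by (intro subsetI InterI) (elim CollectE exE conjE, simp)
  then show ?thesis using sub unfolding secant_variety_def by (rule subset_antisym[rotated])
qed

section \<open>Linear maps and permutations of the factors\<close>

text \<open>
  The tensor product of three linear maps. The shapes of the matrices are arbitrary, so this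
  also restricts tensors to three dimensional subspaces and extends them again.
\<close>

definition tmap :: "'k::comm_ring_1 ^ 'a ^ 'x \<Rightarrow> 'k ^ 'b ^ 'y \<Rightarrow> 'k ^ 'c ^ 'z
    \<Rightarrow> 'k ^ ('a::finite \<times> 'b::finite \<times> 'c::finite) \<Rightarrow> 'k ^ ('x::finite \<times> 'y::finite \<times> 'z::finite)" where
  "tmap g h l T = (\<chi> p. case p of (i, j, k) \<Rightarrow>
     \<Sum>i'\<in>UNIV. \<Sum>j'\<in>UNIV. \<Sum>k'\<in>UNIV. g $ i $ i' * h $ j $ j' * l $ k $ k' * T $ (i', j', k'))"

lemma tmap_tensor3:
  fixes g :: "'k::comm_ring_1 ^ 'a::finite ^ 'x::finite" and h :: "'k ^ 'b::finite ^ 'y::finite"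
    and l :: "'k ^ 'c::finite ^ 'z::finite"
  shows "tmap g h l (tensor3 x y z) = tensor3 (g *v x) (h *v y) (l *v z)"
proof -
  have sum3: "(\<Sum>i\<in>UNIV. \<Sum>j\<in>UNIV. \<Sum>k\<in>UNIV. a i * b j * c k * (d i * e j * f k))
      = (\<Sum>i\<in>UNIV. a i * d i) * (\<Sum>j\<in>UNIV. b j * e j) * (\<Sum>k\<in>UNIV. c k * f k)"
    for a d :: "'a \<Rightarrow> 'k" and b e :: "'b \<Rightarrow> 'k" and c f :: "'c \<Rightarrow> 'k"
  proof -
    have "(\<Sum>i\<in>UNIV. a i * d i) * (\<Sum>j\<in>UNIV. b j * e j) * (\<Sum>k\<in>UNIV. c k * f k)
        = (\<Sum>i\<in>UNIV. a i * d i * (\<Sum>j\<in>UNIV. b j * e j * (\<Sum>k\<in>UNIV. c k * f k)))"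
      by (simp add: sum_distrib_right mult.assoc)
    also have "\<dots> = (\<Sum>i\<in>UNIV. \<Sum>j\<in>UNIV. \<Sum>k\<in>UNIV. a i * d i * (b j * e j * (c k * f k)))"
      by (simp add: sum_distrib_left)
    finally show ?thesis by (simp add: mult_ac)
  qed
  show ?thesis
    by (auto simp: tmap_def tensor3_def matrix_vector_mult_def vec_eq_iff sum3)
qed

lemma tmap_add: "tmap g h l (S + T) = tmap g h l S + tmap g h l T"
  by (auto simp: tmap_def vec_eq_iff distrib_left sum.distrib)

lemma tmap_0: "tmap g h l 0 = 0"
  by (auto simp: tmap_def vec_eq_iff)

lemma tmap_sum: "tmap g h l (\<Sum>i\<in>I. f i) = (\<Sum>i\<in>I. tmap g h l (f i))"
  by (induction I rule: infinite_finite_induct) (auto simp: tmap_add tmap_0)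

lemma rank_le3_tmap: "rank_le3 T \<Longrightarrow> rank_le3 (tmap g h l T)"
  unfolding rank_le3_def
  by (elim exE, hypsubst, unfold tmap_sum tmap_tensor3)
     (intro exI, rule refl)

lemma hpf_tmap: "hpf 1 (\<lambda>T. tmap g h l T $ v)"
  by (cases v) (auto simp: tmap_def intro!: hpf_sum hpf_scale hpf_coord_Suc)

lemma sec3_tmap: "sec3 T \<Longrightarrow> sec3 (tmap g h l T)"
  by (rule sec3_map[OF _ hpf_tmap rank_le3_tmap])

lemma sum_mat_1: "(\<Sum>j\<in>UNIV. (mat 1 :: 'k::comm_ring_1 ^ 'n ^ 'n) $ i $ j * f j) = f (i :: 'n::finite)"
proof -
  have "(\<Sum>j\<in>UNIV. (mat 1 :: 'k ^ 'n ^ 'n) $ i $ j * f j) = (\<Sum>j\<in>UNIV. if i = j then f j else 0)"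
    by (intro sum.cong) (auto simp: mat_def)
  then show ?thesis by simp
qed

text \<open>
  Together with its analogues for the other two factors below, this isolates what happens in one
  factor.
\<close>

lemma tmap_slices:
  "tmap g (mat 1) (mat 1) T $ (i, j, k) = (\<Sum>i'\<in>UNIV. g $ i $ i' * T $ (i', j, k))"
proof -
  have "(\<Sum>j'\<in>UNIV. \<Sum>k'\<in>UNIV. g $ i $ i' * mat 1 $ j $ j' * mat 1 $ k $ k' * T $ (i', j', k'))
      = (\<Sum>j'\<in>UNIV. mat 1 $ j $ j' * (\<Sum>k'\<in>UNIV. mat 1 $ k $ k' * (g $ i $ i' * T $ (i', j', k'))))"
    for i'
    by (simp add: sum_distrib_left mult_ac)
  then show ?thesis by (simp add: tmap_def sum_mat_1)
qed

definition swap12 :: "'k ^ ('a::finite \<times> 'b::finite \<times> 'c::finite) \<Rightarrow> 'k ^ ('b \<times> 'a \<times> 'c)" where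
  "swap12 T = (\<chi> p. case p of (j, i, k) \<Rightarrow> T $ (i, j, k))"

definition cycle3 :: "'k ^ ('a::finite \<times> 'b::finite \<times> 'c::finite) \<Rightarrow> 'k ^ ('c \<times> 'a \<times> 'b)" where
  "cycle3 T = (\<chi> p. case p of (k, i, j) \<Rightarrow> T $ (i, j, k))"

lemma swap12_swap12 [simp]: "swap12 (swap12 T) = T"
  by (auto simp: swap12_def vec_eq_iff)

lemma cycle3_cycle3 [simp]: "cycle3 (cycle3 (cycle3 T)) = T"
  by (auto simp: cycle3_def vec_eq_iff)

lemma rank_le3_swap12: "rank_le3 T \<Longrightarrow> rank_le3 (swap12 T)"
proof -
  assume "rank_le3 T"
  then obtain x y z where "T = (\<Sum>i\<in>(UNIV :: 3 set). tensor3 (x i) (y i) (z i))"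
    unfolding rank_le3_def by blast
  then have "swap12 T = (\<Sum>i\<in>(UNIV :: 3 set). tensor3 (y i) (x i) (z i))"
    by (auto simp: swap12_def tensor3_def vec_eq_iff mult_ac)
  then show ?thesis unfolding rank_le3_def by blast
qed

lemma rank_le3_cycle3: "rank_le3 T \<Longrightarrow> rank_le3 (cycle3 T)"
proof -
  assume "rank_le3 T"
  then obtain x y z where "T = (\<Sum>i\<in>(UNIV :: 3 set). tensor3 (x i) (y i) (z i))"
    unfolding rank_le3_def by blast
  then have "cycle3 T = (\<Sum>i\<in>(UNIV :: 3 set). tensor3 (z i) (x i) (y i))"
    by (auto simp: cycle3_def tensor3_def vec_eq_iff mult_ac)
  then show ?thesis unfolding rank_le3_def by blast
qed

lemma sec3_swap12 [simp]: "sec3 (swap12 T) \<longleftrightarrow> sec3 T"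
proof -
  have 1: "sec3 (swap12 T)" if "sec3 T" for T :: "'a ^ ('x::finite \<times> 'y::finite \<times> 'z::finite)"
    by (rule sec3_map[OF that _ rank_le3_swap12]) (auto simp: swap12_def hpf_coord_Suc split: prod.splits)
  then show ?thesis using 1[of "swap12 T"] 1[of T] by auto
qed

lemma sec3_cycle3 [simp]: "sec3 (cycle3 T) \<longleftrightarrow> sec3 T"
proof -
  have 1: "sec3 (cycle3 T)" if "sec3 T" for T :: "'a ^ ('x::finite \<times> 'y::finite \<times> 'z::finite)"
    by (rule sec3_map[OF that _ rank_le3_cycle3]) (auto simp: cycle3_def hpf_coord_Suc split: prod.splits)
  then show ?thesis using 1[of "cycle3 (cycle3 T)"] 1[of "cycle3 T"] 1[of T] by auto
qed

section \<open>Three by three matrices\<close>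

lemma all_3: "(\<forall>i::3. P i) \<longleftrightarrow> P 0 \<and> P 1 \<and> P 2"
proof -
  have "(3 :: 3) = 0" by simp
  then show ?thesis by (metis forall_3)
qed

text \<open>
  Matrices with explicit entries turn matrix identities into polynomial identities that the
  simplifier can check.
\<close>

definition m33 :: "'k \<Rightarrow> 'k \<Rightarrow> 'k \<Rightarrow> 'k \<Rightarrow> 'k \<Rightarrow> 'k \<Rightarrow> 'k \<Rightarrow> 'k \<Rightarrow> 'k \<Rightarrow> 'k ^ 3 ^ 3" where
  "m33 a b c d e f g h i = (\<chi> r s.
     if r = 0 then (if s = 0 then a else if s = 1 then b else c)
     else if r = 1 then (if s = 0 then d else if s = 1 then e else f)
     else (if s = 0 then g else if s = 1 then h else i))"

definition v3 :: "'k \<Rightarrow> 'k \<Rightarrow> 'k \<Rightarrow> 'k ^ 3" where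
  "v3 a b c = (\<chi> s. if s = 0 then a else if s = 1 then b else c)"

lemma m33_nth [simp]:
  "m33 a b c d e f g h i $ 0 $ 0 = a" "m33 a b c d e f g h i $ 0 $ 1 = b"
  "m33 a b c d e f g h i $ 0 $ 2 = c" "m33 a b c d e f g h i $ 1 $ 0 = d"
  "m33 a b c d e f g h i $ 1 $ 1 = e" "m33 a b c d e f g h i $ 1 $ 2 = f"
  "m33 a b c d e f g h i $ 2 $ 0 = g" "m33 a b c d e f g h i $ 2 $ 1 = h"
  "m33 a b c d e f g h i $ 2 $ 2 = i"
  by (simp_all add: m33_def)

lemma v3_nth [simp]: "v3 a b c $ 0 = a" "v3 a b c $ 1 = b" "v3 a b c $ 2 = c"
  by (simp_all add: v3_def)

lemma m33_cases: obtains a b c d e f g h i where "A = m33 a b c d e f g h i"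
proof
  show "A = m33 (A$0$0) (A$0$1) (A$0$2) (A$1$0) (A$1$1) (A$1$2) (A$2$0) (A$2$1) (A$2$2)"
    by (simp add: vec_eq_iff all_3)
qed

lemma v3_cases: obtains a b c where "x = v3 a b c"
proof
  show "x = v3 (x$0) (x$1) (x$2)" by (simp add: vec_eq_iff all_3)
qed

lemma m33_eq_iff: "m33 a b c d e f g h i = m33 a' b' c' d' e' f' g' h' i' \<longleftrightarrow>
  a = a' \<and> b = b' \<and> c = c' \<and> d = d' \<and> e = e' \<and> f = f' \<and> g = g' \<and> h = h' \<and> i = i'"
  by (auto simp: vec_eq_iff all_3)

lemma v3_eq_iff: "v3 a b c = v3 a' b' c' \<longleftrightarrow> a = a' \<and> b = b' \<and> c = c'"
  by (auto simp: vec_eq_iff all_3)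

lemma m33_mult: "m33 a b c d e f g h i ** m33 a' b' c' d' e' f' g' h' i' =
  m33 (a*a' + b*d' + c*g') (a*b' + b*e' + c*h') (a*c' + b*f' + c*i')
      (d*a' + e*d' + f*g') (d*b' + e*e' + f*h') (d*c' + e*f' + f*i')
      (g*a' + h*d' + i*g') (g*b' + h*e' + i*h') (g*c' + h*f' + i*i')"
  by (simp add: vec_eq_iff all_3 matrix_matrix_mult_def sum_UNIV_3)

lemma m33_vec: "m33 a b c d e f g h i *v v3 x y z = v3 (a*x + b*y + c*z) (d*x + e*y + f*z) (g*x + h*y + i*z)"
  by (simp add: vec_eq_iff all_3 matrix_vector_mult_def sum_UNIV_3)

lemma m33_add: "m33 a b c d e f g h i + m33 a' b' c' d' e' f' g' h' i' =
  m33 (a+a') (b+b') (c+c') (d+d') (e+e') (f+f') (g+g') (h+h') (i+i')"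
  by (simp add: vec_eq_iff all_3)

lemma m33_mat: "(mat k :: 'k::zero ^ 3 ^ 3) = m33 k 0 0 0 k 0 0 0 k"
  by (simp add: vec_eq_iff all_3 mat_def)

lemma m33_zero: "(0 :: 'k::zero ^ 3 ^ 3) = m33 0 0 0 0 0 0 0 0 0"
  by (simp add: vec_eq_iff all_3)

lemma m33_transpose: "transpose (m33 a b c d e f g h i) = m33 a d g b e h c f i"
  by (simp add: vec_eq_iff all_3 transpose_def)

lemma m33_det: "det (m33 a b c d e f g h i :: 'k::comm_ring_1 ^ 3 ^ 3)
  = a*(e*i - f*h) - b*(d*i - f*g) + c*(d*h - e*g)"
proof -
  have "(3 :: 3) = 0" by simp
  then show ?thesis unfolding det_3 by (simp only: m33_nth) (simp add: algebra_simps)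
qed

text \<open>
  The adjugate, in the cyclic form of the cofactors that needs no signs.
\<close>

definition adj3 :: "'k::comm_ring_1 ^ 3 ^ 3 \<Rightarrow> 'k ^ 3 ^ 3" where
  "adj3 X = (\<chi> s r. X $ (r+1) $ (s+1) * X $ (r+2) $ (s+2) - X $ (r+1) $ (s+2) * X $ (r+2) $ (s+1))"

lemma m33_adj3: "adj3 (m33 a b c d e f g h i) = m33 (e*i - f*h) (c*h - b*i) (b*f - c*e)
    (f*g - d*i) (a*i - c*g) (c*d - a*f) (d*h - e*g) (b*g - a*h) (a*e - b*d)"
proof -
  have 3: "(3 :: 3) = 0" and 4: "(4 :: 3) = 1" by simp_all
  show ?thesis by (simp add: 3 4 vec_eq_iff all_3 adj3_def algebra_simps)
qed

lemma adj3_left: "adj3 X ** X = mat (det X)"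
  by (rule m33_cases[of X]) (simp add: m33_adj3 m33_mult m33_mat m33_det m33_eq_iff algebra_simps)

lemma adj3_right: "X ** adj3 X = mat (det X)"
  by (rule m33_cases[of X]) (simp add: m33_adj3 m33_mult m33_mat m33_det m33_eq_iff algebra_simps)

lemma adj3_mult: "adj3 (X ** Y) = adj3 Y ** adj3 X"
  by (rule m33_cases[of X], rule m33_cases[of Y])
     (simp add: m33_adj3 m33_mult m33_eq_iff algebra_simps)

lemma mat_mult_comm: "mat k ** X = X ** mat k" for X :: "'k::comm_ring_1 ^ 3 ^ 3"
  by (rule m33_cases[of X]) (simp add: m33_mult m33_mat m33_eq_iff algebra_simps)

lemma matrix_mult_add_left: "(A + B) ** C = A ** C + B ** (C :: 'k::semiring_1 ^ 'n ^ 'm::finite)"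
  by (simp add: vec_eq_iff matrix_matrix_mult_def distrib_right sum.distrib)

lemma adj3_mat: "adj3 (mat k) = mat (k * k)"
  by (simp add: m33_mat m33_adj3 m33_eq_iff)

lemma invertible_m33:
  fixes P :: "'k::field ^ 3 ^ 3"
  assumes "det P \<noteq> 0"
  obtains Q where "P ** Q = mat 1" "Q ** P = mat 1"
proof -
  have "invertible P" using assms by (simp add: invertible_det_nz)
  then show ?thesis using that unfolding invertible_def by blast
qed

lemma det_nz_of_inverse: "P ** Q = mat 1 \<Longrightarrow> det (P :: 'k::field ^ 'n::finite ^ 'n) \<noteq> 0"
  by (metis det_I det_mul mult_zero_left zero_neq_one)

definition cube3 :: "'k ^ 3 ^ 3 \<Rightarrow> 'k ^ 3 ^ 3 \<Rightarrow> 'k ^ 3 ^ 3 \<Rightarrow> 'k ^ (3 \<times> 3 \<times> 3)" where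
  "cube3 X0 X1 X2 = (\<chi> p. case p of (i, j, k) \<Rightarrow>
     (if i = 0 then X0 else if i = 1 then X1 else X2) $ j $ k)"

lemma cube3_nth [simp]:
  "cube3 X0 X1 X2 $ (0, j, k) = X0 $ j $ k" "cube3 X0 X1 X2 $ (1, j, k) = X1 $ j $ k"
  "cube3 X0 X1 X2 $ (2, j, k) = X2 $ j $ k"
  by (simp_all add: cube3_def)

lemma cube3_eq_iff: "T = cube3 X0 X1 X2 \<longleftrightarrow> (\<forall>j k. T $ (0, j, k) = X0 $ j $ k \<and>
    T $ (1, j, k) = X1 $ j $ k \<and> T $ (2, j, k) = X2 $ j $ k)"
  by (auto simp: vec_eq_iff all_3)

text \<open>
  The net spanned by three matrices is a limit of nets of rank at most three.
\<close>

definition border :: "'k::comm_ring_1 ^ 3 ^ 3 \<Rightarrow> 'k ^ 3 ^ 3 \<Rightarrow> 'k ^ 3 ^ 3 \<Rightarrow> bool" where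
  "border X0 X1 X2 \<longleftrightarrow> sec3 (cube3 X0 X1 X2)"

text \<open>
  Multiplication from both sides acts on the second and third factor of the tensor.
\<close>

lemma border_mult:
  assumes "border X0 X1 X2"
  shows "border (P ** X0 ** Q) (P ** X1 ** Q) (P ** X2 ** Q)"
proof -
  have "tmap (mat 1) P (transpose Q) (cube3 X0 X1 X2)
      = cube3 (P ** X0 ** Q) (P ** X1 ** Q) (P ** X2 ** Q)"
  proof -
    have 1: "(\<Sum>i'\<in>UNIV. \<Sum>j'\<in>UNIV. \<Sum>k'\<in>UNIV. (mat 1 :: 'a ^ 3 ^ 3) $ i $ i' * P $ j $ j' *
        transpose Q $ k $ k' * cube3 X0 X1 X2 $ (i', j', k'))
      = (\<Sum>j'\<in>UNIV. \<Sum>k'\<in>UNIV. P $ j $ j' * cube3 X0 X1 X2 $ (i, j', k') * Q $ k' $ k)" for i j k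
      using sum_mat_1[of i "\<lambda>i'. \<Sum>j'\<in>UNIV. \<Sum>k'\<in>UNIV. P $ j $ j' *
        transpose Q $ k $ k' * cube3 X0 X1 X2 $ (i', j', k')"]
      by (simp add: sum_distrib_left mult_ac transpose_def)
    have 2: "(P ** X ** Q) $ j $ k = (\<Sum>j'\<in>UNIV. \<Sum>k'\<in>UNIV. P $ j $ j' * X $ j' $ k' * Q $ k' $ k)"
      for X :: "'a ^ 3 ^ 3" and j k
      unfolding matrix_matrix_mult_def by (simp add: sum_distrib_right) (rule sum.swap)
    show ?thesis unfolding cube3_eq_iff by (simp add: tmap_def 1 2)
  qed
  then show ?thesis using sec3_tmap[OF assms[unfolded border_def]] unfolding border_def by metis
qed

lemma border_conj:
  assumes "border (P ** X0 ** Q) (P ** X1 ** Q) (P ** X2 ** Q)" "P' ** P = mat 1" "Q ** Q' = mat 1"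
  shows "border X0 X1 X2"
proof -
  have "P' ** (P ** X ** Q) ** Q' = X" for X :: "'a ^ 3 ^ 3"
  proof -
    have "P' ** (P ** X ** Q) ** Q' = (P' ** P) ** X ** (Q ** Q')" by (simp add: matrix_mul_assoc)
    then show ?thesis using assms by simp
  qed
  then show ?thesis using border_mult[OF assms(1), of P' Q'] by simp
qed

definition smul :: "'k::comm_ring_1 \<Rightarrow> 'k ^ 3 ^ 3 \<Rightarrow> 'k ^ 3 ^ 3" where
  "smul c X = (\<chi> i j. c * X $ i $ j)"

lemma smul_nth [simp]: "smul c X $ i $ j = c * X $ i $ j"
  by (simp add: smul_def)

lemma m33_smul: "smul k (m33 a b c d e f g h i) = m33 (k*a) (k*b) (k*c) (k*d) (k*e) (k*f) (k*g) (k*h) (k*i)"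
  by (simp add: vec_eq_iff all_3)

text \<open>
  The general element of the net spanned by three matrices.
\<close>

definition lc3 :: "'k::comm_ring_1 ^ 3 ^ 3 \<Rightarrow> 'k ^ 3 ^ 3 \<Rightarrow> 'k ^ 3 ^ 3 \<Rightarrow> 'k ^ 3 \<Rightarrow> 'k ^ 3 ^ 3" where
  "lc3 X0 X1 X2 a = smul (a$0) X0 + smul (a$1) X1 + smul (a$2) X2"

lemma lc3_v3: "lc3 X0 X1 X2 (v3 a b c) = smul a X0 + smul b X1 + smul c X2"
  by (simp add: lc3_def)

lemma lc3_units [simp]: "lc3 X0 X1 X2 (v3 1 0 0) = X0" "lc3 X0 X1 X2 (v3 0 1 0) = X1"
    "lc3 X0 X1 X2 (v3 0 0 1) = X2"
  by (simp_all add: lc3_def vec_eq_iff)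

text \<open>
  Replacing the slices by linear combinations acts on the first factor of the tensor.
\<close>

lemma border_lc:
  assumes "border X0 X1 X2"
  shows "border (lc3 X0 X1 X2 a) (lc3 X0 X1 X2 b) (lc3 X0 X1 X2 c)"
proof -
  let ?g = "m33 (a$0) (a$1) (a$2) (b$0) (b$1) (b$2) (c$0) (c$1) (c$2)"
  have "tmap ?g (mat 1) (mat 1) (cube3 X0 X1 X2)
      = cube3 (lc3 X0 X1 X2 a) (lc3 X0 X1 X2 b) (lc3 X0 X1 X2 c)"
    unfolding cube3_eq_iff by (simp add: tmap_slices sum_UNIV_3 lc3_def)
  then show ?thesis using sec3_tmap[OF assms[unfolded border_def]] unfolding border_def by metis
qed

lemma border_swap01: "border X0 X1 X2 \<Longrightarrow> border X1 X0 X2"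
  using border_lc[of X0 X1 X2 "v3 0 1 0" "v3 1 0 0" "v3 0 0 1"] by simp

lemma border_swap12: "border X0 X1 X2 \<Longrightarrow> border X0 X2 X1"
  using border_lc[of X0 X1 X2 "v3 1 0 0" "v3 0 0 1" "v3 0 1 0"] by simp

lemma border_curve:
  fixes X0 X1 X2 :: "'k::field_char_0 \<Rightarrow> 'k ^ 3 ^ 3"
  assumes "\<And>j k. polyfun (\<lambda>t. X0 t $ j $ k)" "\<And>j k. polyfun (\<lambda>t. X1 t $ j $ k)"
    "\<And>j k. polyfun (\<lambda>t. X2 t $ j $ k)" "finite {t. \<not> border (X0 t) (X1 t) (X2 t)}"
  shows "border (X0 s) (X1 s) (X2 s)"
  unfolding border_def
proof (rule sec3_curve[where T = "\<lambda>t. cube3 (X0 t) (X1 t) (X2 t)"])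
  show "polyfun (\<lambda>t. cube3 (X0 t) (X1 t) (X2 t) $ v)" for v
  proof (cases v)
    case (fields i j k)
    then show ?thesis
      using assms(1-3) by (cases "i = 0"; cases "i = 1"; simp add: cube3_def)
  qed
  show "finite {t. \<not> sec3 (cube3 (X0 t) (X1 t) (X2 t))}"
    using assms(4) by (simp add: border_def)
qed

lemma polyfun_m33:
  assumes "polyfun a" "polyfun b" "polyfun c" "polyfun d" "polyfun e" "polyfun f" "polyfun g" "polyfun h" "polyfun i"
  shows "polyfun (\<lambda>t. m33 (a t) (b t) (c t) (d t) (e t) (f t) (g t) (h t) (i t) $ r $ s)"
  using assms by (simp add: m33_def polyfun_if)

text \<open>
  Three slices that are diagonal in common bases give a sum of three decomposable tensors, one
  for each diagonal position.
\<close>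

lemma border_diagonal:
  fixes W V :: "'k::comm_ring_1 ^ 3 ^ 3"
  shows "border (W ** m33 a0 0 0 0 a1 0 0 0 a2 ** V) (W ** m33 b0 0 0 0 b1 0 0 0 b2 ** V)
    (W ** m33 c0 0 0 0 c1 0 0 0 c2 ** V)"
proof (rule border_mult, unfold border_def, rule rank_le3_imp_sec3)
  let ?x = "\<lambda>i::3. if i = 0 then v3 a0 b0 c0 else if i = 1 then v3 a1 b1 c1 else v3 a2 b2 c2"
  have "cube3 (m33 a0 0 0 0 a1 0 0 0 a2) (m33 b0 0 0 0 b1 0 0 0 b2) (m33 c0 0 0 0 c1 0 0 0 c2)
     = (\<Sum>i\<in>UNIV. tensor3 (?x i) (axis i 1) (axis i 1))"
    by (simp add: vec_eq_iff all_3 sum_UNIV_3 tensor3_def axis_def)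
  then show "rank_le3 (cube3 (m33 a0 0 0 0 a1 0 0 0 a2) (m33 b0 0 0 0 b1 0 0 0 b2)
     (m33 c0 0 0 0 c1 0 0 0 c2))" unfolding rank_le3_def by (intro exI)
qed

text \<open>
  Two roots suffice: split off one root, then a second one from the quadratic quotient; the
  third is read off.
\<close>

lemma cubic_splits:
  fixes c0 c1 c2 :: "'k::alg_closed_field"
  obtains l0 l1 l2 where "c2 = l0 + l1 + l2" "c1 = - (l0*l1 + l0*l2 + l1*l2)" "c0 = l0*l1*l2"
proof -
  have root: "\<exists>x. poly p x = 0" if "degree p > 0" for p :: "'k poly"
    using alg_closed_imp_poly_has_root[OF that] .
  obtain l0 where l0: "poly [:- c0, - c1, - c2, 1:] l0 = 0" using root[of "[:- c0, - c1, - c2, 1:]"] by auto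
  define q1 where "q1 = l0 - c2"
  define q0 where "q0 = l0 * q1 - c1"
  obtain l1 where l1: "poly [:q0, q1, 1:] l1 = 0" using root[of "[:q0, q1, 1:]"] by auto
  show ?thesis
  proof
    show "c2 = l0 + l1 + (- q1 - l1)" by (simp add: q1_def)
    have e1: "q0 = - l1 * (q1 + l1)" using l1 by (simp add: algebra_simps eq_neg_iff_add_eq_0)
    have c1: "c1 = l0 * q1 - q0" by (simp add: q0_def)
    show "c1 = - (l0*l1 + l0*(- q1 - l1) + l1*(- q1 - l1))"
      unfolding c1 e1 by (simp add: algebra_simps)
    have "c0 = l0 * q0" using l0 by (simp add: q0_def q1_def algebra_simps)
    also have "\<dots> = l0 * l1 * (- q1 - l1)" unfolding e1 by (simp add: algebra_simps)
    finally show "c0 = l0 * l1 * (- q1 - l1)" .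
  qed
qed

section \<open>Pairs of commuting three by three matrices\<close>

text \<open>
  Parametrized by the roots of its characteristic polynomial, so that they can be moved.
\<close>

definition companion :: "'k::comm_ring_1 \<Rightarrow> 'k \<Rightarrow> 'k \<Rightarrow> 'k ^ 3 ^ 3" where
  "companion l0 l1 l2 = m33 0 0 (l0*l1*l2) 1 0 (- (l0*l1 + l0*l2 + l1*l2)) 0 1 (l0 + l1 + l2)"

definition quadratic_in :: "'k::comm_ring_1 \<Rightarrow> 'k \<Rightarrow> 'k \<Rightarrow> 'k ^ 3 ^ 3 \<Rightarrow> 'k ^ 3 ^ 3" where
  "quadratic_in p0 p1 p2 M = mat p0 + smul p1 M + smul p2 (M ** M)"

text \<open>
  With distinct roots the Vandermonde matrix diagonalizes the companion matrix and every
  polynomial in it.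
\<close>

lemma border_companion_distinct:
  fixes l0 l1 l2 :: "'k::field"
  assumes "l0 \<noteq> l1" "l0 \<noteq> l2" "l1 \<noteq> l2"
  shows "border (mat 1) (companion l0 l1 l2) (quadratic_in p0 p1 p2 (companion l0 l1 l2))"
proof -
  define V where "V = m33 1 l0 (l0*l0) 1 l1 (l1*l1) 1 l2 (l2*l2)"
  let ?d = "\<lambda>f. m33 (f l0) 0 0 0 (f l1) 0 0 0 (f l2)"
  have "det V = (l1 - l0) * (l2 - l0) * (l2 - l1)" unfolding V_def m33_det by (simp add: algebra_simps)
  then have "det V \<noteq> 0" using assms by simp
  then obtain W where W: "V ** W = mat 1" "W ** V = mat 1" by (rule invertible_m33)
  have 1: "X = W ** D ** V" if "V ** X = D ** V" for X D
  proof -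
    have "W ** (V ** X) = X" by (simp add: matrix_mul_assoc W)
    then show ?thesis using that by (simp add: matrix_mul_assoc)
  qed
  have c0: "mat 1 = W ** ?d (\<lambda>l. 1) ** V" by (rule 1) (simp add: V_def m33_mat m33_mult m33_eq_iff)
  have c1: "companion l0 l1 l2 = W ** ?d (\<lambda>l. l) ** V"
    by (rule 1) (simp add: V_def companion_def m33_mult m33_eq_iff algebra_simps)
  have c2: "quadratic_in p0 p1 p2 (companion l0 l1 l2) = W ** ?d (\<lambda>l. p0 + p1 * l + p2 * (l * l)) ** V"
    by (rule 1) (simp add: V_def companion_def quadratic_in_def m33_mat m33_smul m33_add m33_mult
        m33_eq_iff algebra_simps)
  show ?thesis unfolding c2 unfolding c0 unfolding c1 by (rule border_diagonal)
qed

text \<open>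
  Repeated roots are moved apart along a line.
\<close>

lemma border_companion:
  fixes l0 l1 l2 :: "'k::field_char_0"
  shows "border (mat 1) (companion l0 l1 l2) (quadratic_in p0 p1 p2 (companion l0 l1 l2))"
proof -
  (* Different speeds, so that any two roots collide only finitely often. *)
  let ?C = "\<lambda>t. companion l0 (l1 + t) (l2 + 2 * t)"
  have "border (mat 1) (?C 0) (quadratic_in p0 p1 p2 (?C 0))"
  proof (rule border_curve[where ?X0.0 = "\<lambda>t. mat 1" and ?X1.0 = ?C
        and ?X2.0 = "\<lambda>t. quadratic_in p0 p1 p2 (?C t)"])
    show "polyfun (\<lambda>t. mat 1 $ j $ k)" for j k by simp
    show "polyfun (\<lambda>t. ?C t $ j $ k)" for j k
      unfolding companion_def by (intro polyfun_m33) (auto intro!: polyfun_add polyfun_mult polyfun_uminus polyfun_diff)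
    show "polyfun (\<lambda>t. quadratic_in p0 p1 p2 (?C t) $ j $ k)" for j k
      unfolding companion_def quadratic_in_def m33_mat m33_smul m33_add m33_mult
      by (intro polyfun_m33) (auto intro!: polyfun_add polyfun_mult polyfun_uminus polyfun_diff)
    have "{t. \<not> border (mat 1) (?C t) (quadratic_in p0 p1 p2 (?C t))}
       \<subseteq> {l0 - l1, (l0 - l2) / 2, l1 - l2}"
    proof (rule subsetI, rule ccontr)
      fix t assume t: "t \<in> {t. \<not> border (mat 1) (?C t) (quadratic_in p0 p1 p2 (?C t))}"
        "t \<notin> {l0 - l1, (l0 - l2) / 2, l1 - l2}"
      then have "l0 \<noteq> l1 + t" "l0 \<noteq> l2 + 2 * t" "l1 + t \<noteq> l2 + 2 * t" by (auto simp: algebra_simps)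
      then show False using t(1) border_companion_distinct by blast
    qed
    then show "finite {t. \<not> border (mat 1) (?C t) (quadratic_in p0 p1 p2 (?C t))}"
      by (rule finite_subset) simp
  qed
  then show ?thesis by simp
qed

text \<open>
  The matrix with columns \<open>v\<close>, \<open>M v\<close>, \<open>M (M v)\<close>; it is
  invertible exactly if \<open>v\<close> is a cyclic vector of \<open>M\<close>.
\<close>

definition krylov :: "'k::comm_ring_1 ^ 3 ^ 3 \<Rightarrow> 'k ^ 3 \<Rightarrow> 'k ^ 3 ^ 3" where
  "krylov M v = (\<chi> i j. if j = 0 then v $ i else if j = 1 then (M *v v) $ i else (M *v (M *v v)) $ i)"

lemma krylov_column:
  "krylov M v *v v3 1 0 0 = v" "krylov M v *v v3 0 1 0 = M *v v" "krylov M v *v v3 0 0 1 = M *v (M *v v)"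
  by (simp_all add: vec_eq_iff matrix_vector_mult_def sum_UNIV_3 krylov_def)

lemma m33_krylov: "krylov M (v3 x y z) = (case (M *v v3 x y z, M *v (M *v v3 x y z)) of
   (a, b) \<Rightarrow> m33 x (a$0) (b$0) y (a$1) (b$1) z (a$2) (b$2))"
  by (simp add: krylov_def vec_eq_iff all_3)

lemma krylov_conj:
  assumes "Q ** P = mat 1"
  shows "krylov (P ** M ** Q) (P *v v) = P ** krylov M v"
proof -
  have 1: "(P ** M ** Q) *v (P *v w) = P *v (M *v w)" for w
  proof -
    have "(P ** M ** Q) *v (P *v w) = P *v (M *v ((Q ** P) *v w))"
      by (simp add: matrix_vector_mul_assoc matrix_mul_assoc)
    then show ?thesis using assms by simp
  qed
  have 2: "(P ** krylov M v) $ i $ j = (if j = 0 then (P *v v) $ i else if j = 1 then (P *v (M *v v)) $ i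
     else (P *v (M *v (M *v v))) $ i)" for i j
    by (simp add: krylov_def matrix_matrix_mult_def matrix_vector_mult_def)
  show ?thesis by (simp add: vec_eq_iff 2) (simp add: krylov_def 1)
qed

lemma m33_vec_units: "m33 a b c d e f g h i *v v3 1 0 0 = v3 a d g"
  "m33 a b c d e f g h i *v v3 0 1 0 = v3 b e h" "m33 a b c d e f g h i *v v3 0 0 1 = v3 c f i"
  by (simp_all add: m33_vec)

text \<open>
  In the basis given by a cyclic vector, \<open>M\<close> is a companion matrix. A matrix that
  commutes with it is determined by its first column, hence is a polynomial of degree at most
  two in \<open>M\<close>.
\<close>

lemma border_cyclic:
  fixes M N :: "'k::{alg_closed_field, field_char_0} ^ 3 ^ 3"
  assumes comm: "M ** N = N ** M" and cyc: "det (krylov M v) \<noteq> 0"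
  shows "border (mat 1) M N"
proof -
  let ?P = "krylov M v"
  obtain Q where Q: "?P ** Q = mat 1" "Q ** ?P = mat 1" by (rule invertible_m33[OF cyc])
  define M' where "M' = Q ** M ** ?P"
  define N' where "N' = Q ** N ** ?P"
  have col: "M' *v w = Q *v (M *v (?P *v w))" for w
    by (simp add: M'_def matrix_vector_mul_assoc matrix_mul_assoc)
  have Qv: "Q *v (?P *v w) = w" for w by (simp add: matrix_vector_mul_assoc Q)
  have e: "M' *v v3 1 0 0 = v3 0 1 0" "M' *v v3 0 1 0 = v3 0 0 1"
    using Qv[of "v3 0 1 0"] Qv[of "v3 0 0 1"] by (simp_all add: col krylov_column)
  have comm': "M' ** N' = N' ** M'"
  proof -
    have "M' ** N' = Q ** M ** (?P ** Q) ** N ** ?P" "N' ** M' = Q ** N ** (?P ** Q) ** M ** ?P"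
      by (simp_all add: M'_def N'_def matrix_mul_assoc)
    then have "M' ** N' = Q ** (M ** N) ** ?P" "N' ** M' = Q ** (N ** M) ** ?P"
      by (simp_all add: Q matrix_mul_assoc)
    then show ?thesis using comm by simp
  qed
  obtain a b c d e' f g h i where M: "M' = m33 a b c d e' f g h i" by (rule m33_cases)
  have M: "M' = m33 0 0 c 1 0 f 0 1 i" using e by (simp add: M m33_vec_units v3_eq_iff)
  obtain l0 l1 l2 where l: "i = l0 + l1 + l2" "f = - (l0*l1 + l0*l2 + l1*l2)" "c = l0*l1*l2"
    by (rule cubic_splits)
  obtain p0 n01 n02 p1 n11 n12 p2 n21 n22 where N: "N' = m33 p0 n01 n02 p1 n11 n12 p2 n21 n22"
    by (rule m33_cases)
  have n: "n01 = c * p2" "n02 = c * n21" "n11 = p0 + f * p2" "n12 = n01 + f * n21"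
      "n21 = p1 + i * p2" "n22 = n11 + i * n21"
    using comm' unfolding M N m33_mult m33_eq_iff by simp_all
  have N2: "N' = quadratic_in p0 p1 p2 M'"
    unfolding M N quadratic_in_def m33_mat m33_mult m33_smul m33_add m33_eq_iff
    by (simp add: n algebra_simps)
  have "M' = companion l0 l1 l2" by (simp add: M l companion_def)
  then have "border (mat 1) M' N'" using border_companion[of l0 l1 l2] N2 by simp
  then have "border (Q ** mat 1 ** ?P) (Q ** M ** ?P) (Q ** N ** ?P)" by (simp add: Q M'_def N'_def)
  then show ?thesis by (rule border_conj[OF _ Q(1) Q(1)])
qed

text \<open>
  Subtract an eigenvalue and move the eigenvector to the first basis vector.
\<close>

definition cyclic_commutant :: "'k::comm_ring_1 ^ 3 ^ 3 \<Rightarrow> bool" where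
  "cyclic_commutant N \<longleftrightarrow> (\<exists>R v. R ** N = N ** R \<and> det (krylov R v) \<noteq> 0)"

lemma cyclic_commutant_conj:
  fixes N :: "'k::field ^ 3 ^ 3"
  assumes "cyclic_commutant (Q ** N ** P)" "P ** Q = mat 1" "Q ** P = mat 1"
  shows "cyclic_commutant N"
proof -
  obtain R v where R: "R ** (Q ** N ** P) = (Q ** N ** P) ** R" and v: "det (krylov R v) \<noteq> 0"
    using assms(1) unfolding cyclic_commutant_def by blast
  have "P ** (R ** (Q ** N ** P)) ** Q = P ** R ** Q ** N ** (P ** Q)" by (simp add: matrix_mul_assoc)
  moreover have "P ** ((Q ** N ** P) ** R) ** Q = (P ** Q) ** N ** (P ** R ** Q)" by (simp add: matrix_mul_assoc)
  ultimately have "(P ** R ** Q) ** N = N ** (P ** R ** Q)" using R assms(2) by simp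
  moreover have "det (krylov (P ** R ** Q) (P *v v)) \<noteq> 0"
    using v det_nz_of_inverse[OF assms(2)] by (simp add: krylov_conj[OF assms(3)] det_mul)
  ultimately show ?thesis unfolding cyclic_commutant_def by blast
qed

lemma cyclic_commutant_shift:
  fixes N :: "'k::field ^ 3 ^ 3"
  assumes "cyclic_commutant (N + mat c)"
  shows "cyclic_commutant N"
proof -
  obtain R v where R: "R ** (N + mat c) = (N + mat c) ** R" and v: "det (krylov R v) \<noteq> 0"
    using assms unfolding cyclic_commutant_def by blast
  have "R ** N = N ** R" using R mat_mult_comm[of c R] by (simp add: matrix_add_ldistrib matrix_mult_add_left)
  then show ?thesis using v unfolding cyclic_commutant_def by blast
qed

lemmas m33_simps = m33_mult m33_vec m33_vec_units m33_add m33_mat m33_smul m33_transpose m33_det m33_adj3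
  m33_eq_iff v3_eq_iff m33_krylov

lemma cyclic_commutant_witness:
  "R ** N = N ** R \<Longrightarrow> det (krylov R v) \<noteq> 0 \<Longrightarrow> cyclic_commutant N"
  unfolding cyclic_commutant_def by blast

text \<open>
  If the first entry is nonzero, the matrix is diagonalizable and commutes with a matrix that
  has distinct eigenvalues. Otherwise it is zero or a nonzero multiple of the square of a
  nilpotent matrix with a cyclic vector.
\<close>

lemma cyclic_commutant_row:
  fixes m p q :: "'k::field_char_0"
  shows "cyclic_commutant (m33 m p q 0 0 0 0 0 0)"
proof -
  consider "m \<noteq> 0" | "m = 0" "p \<noteq> 0" | "m = 0" "p = 0" "q \<noteq> 0" | "m = 0" "p = 0" "q = 0" by blast
  then show ?thesis
  proof cases
    case 1
    show ?thesis
      by (rule cyclic_commutant_witness[of "m33 0 p (2*q) 0 (-m) 0 0 0 (-2*m)" _ "v3 (1 + p + q) (-m) (-m)"])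
        (use 1 in \<open>simp_all add: m33_simps algebra_simps\<close>)
  next
    case 2
    show ?thesis
      by (rule cyclic_commutant_witness[of "m33 0 0 1 0 (-p*q) (-q*q) 0 (p*p) (p*q)" _ "v3 0 1 0"])
        (use 2 in \<open>simp_all add: m33_simps algebra_simps\<close>)
  next
    case 3
    show ?thesis
      by (rule cyclic_commutant_witness[of "m33 0 1 0 0 0 (q*q) 0 0 0" _ "v3 0 0 1"])
        (use 3 in \<open>simp_all add: m33_simps algebra_simps\<close>)
  next
    case 4
    show ?thesis
      by (rule cyclic_commutant_witness[of "m33 0 1 0 0 0 1 0 0 0" _ "v3 0 0 1"])
        (use 4 in \<open>simp_all add: m33_simps algebra_simps\<close>)
  qed
qed

lemma basis_with_first:
  fixes w :: "'k::field ^ 3"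
  assumes "w \<noteq> 0"
  obtains P where "P *v v3 1 0 0 = w" "det P \<noteq> 0"
proof -
  obtain a b c where w: "w = v3 a b c" by (rule v3_cases)
  have "(0::'k^3) = v3 0 0 0" by (simp add: vec_eq_iff all_3)
  then consider "a \<noteq> 0" | "b \<noteq> 0" | "c \<noteq> 0" using assms by (auto simp: w v3_eq_iff)
  then show ?thesis
  proof cases
    case 1 show ?thesis by (rule that[of "m33 a 0 0 b 1 0 c 0 1"]) (use 1 in \<open>simp_all add: w m33_simps\<close>)
  next
    case 2 show ?thesis by (rule that[of "m33 a 1 0 b 0 0 c 0 1"]) (use 2 in \<open>simp_all add: w m33_simps\<close>)
  next
    case 3 show ?thesis by (rule that[of "m33 a 1 0 b 0 1 c 0 0"]) (use 3 in \<open>simp_all add: w m33_simps\<close>)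
  qed
qed

text \<open>
  A matrix of rank one has only one nonzero row in a basis that starts with a vector spanning
  its image.
\<close>

lemma cyclic_commutant_rank1:
  fixes x y :: "'k::field_char_0 ^ 3"
  shows "cyclic_commutant (\<chi> i j. x $ i * y $ j)"
proof (cases "x = 0")
  case True
  then have "(\<chi> i j. x $ i * y $ j) = m33 0 0 0 0 0 0 0 0 0" by (simp add: vec_eq_iff all_3)
  then show ?thesis using cyclic_commutant_row[of 0 0 0] by simp
next
  case False
  then obtain P where P: "P *v v3 1 0 0 = x" "det P \<noteq> 0" by (rule basis_with_first)
  obtain Q where Q: "P ** Q = mat 1" "Q ** P = mat 1" by (rule invertible_m33[OF P(2)])
  obtain y0 y1 y2 where y: "y = v3 y0 y1 y2" by (rule v3_cases)
  obtain a b c d e f g h i where Pm: "P = m33 a b c d e f g h i" by (rule m33_cases)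
  have x: "x = v3 a d g" using P(1) by (simp add: Pm m33_simps)
  have N: "(\<chi> i j. x $ i * y $ j) = P ** m33 y0 y1 y2 0 0 0 0 0 0"
    by (simp add: x y Pm m33_mult vec_eq_iff all_3)
  have "Q ** (\<chi> i j. x $ i * y $ j) ** P = (Q ** P) ** (m33 y0 y1 y2 0 0 0 0 0 0 ** P)"
    unfolding N by (simp add: matrix_mul_assoc)
  also have "\<dots> = m33 (y0*a + y1*d + y2*g) (y0*b + y1*e + y2*h) (y0*c + y1*f + y2*i) 0 0 0 0 0 0"
    unfolding Q by (simp add: Pm m33_mult)
  finally have "cyclic_commutant (Q ** (\<chi> i j. x $ i * y $ j) ** P)" using cyclic_commutant_row by simp
  then show ?thesis by (rule cyclic_commutant_conj[OF _ Q])
qed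

text \<open>
  Both have finitely many zeros, and the field is infinite.
\<close>

lemma ex_nonzero_both:
  fixes f g :: "'k::field_char_0 \<Rightarrow> 'k"
  assumes "polyfun f" "polyfun g" "f s \<noteq> 0" "g s' \<noteq> 0"
  obtains t where "f t \<noteq> 0" "g t \<noteq> 0"
proof -
  have "finite ({t. f t = 0} \<union> {t. g t = 0})"
    using polyfun_finite_zeros[OF assms(1,3)] polyfun_finite_zeros[OF assms(2,4)] by simp
  then obtain t where "t \<notin> {t. f t = 0} \<union> {t. g t = 0}"
    using ex_new_if_finite[OF infinite_UNIV_char_0] by blast
  then show ?thesis using that by blast
qed

text \<open>
  The first basis vector is in the kernel. Some vector \<open>(x, 1, t)\<close> is cyclic for
  the matrix itself, unless the lower right block is scalar or the matrix has rank at most one.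
\<close>

lemma cyclic_commutant_kernel:
  fixes p q a b c d :: "'k::field_char_0"
  shows "cyclic_commutant (m33 0 p q 0 a b 0 c d)"
proof -
  let ?N = "m33 0 p q 0 a b 0 c d"
  define Q where "Q = (\<lambda>t. c + (d - a) * t - b * t * t)"
  define L where "L = (\<lambda>t. (p * d - q * c) + (q * a - p * b) * t)"
  have polyQ: "polyfun Q" unfolding Q_def by (intro polyfun_diff polyfun_add polyfun_mult) auto
  have polyL: "polyfun L" unfolding L_def by (intro polyfun_diff polyfun_add polyfun_mult) auto
  have kry: "det (krylov ?N (v3 x 1 t)) = Q t * (x * (a * d - b * c) - L t)" for x t
    unfolding Q_def L_def by (simp add: m33_simps algebra_simps)
  show ?thesis
  proof (cases "\<forall>t. Q t = 0")
    case True
    have "Q 0 = 0" "Q 1 = 0" "Q (-1) = 0" using True by blast+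
    then have c: "c = 0" and "d - a - b = 0" "a - d - b = 0" by (simp_all add: Q_def)
    then have "2 * b = 0" "d = a + b" by (simp_all add: algebra_simps)
    then have b: "b = 0" and d: "d = a" by auto
    have "?N + mat (- a) = m33 (- a) p q 0 0 0 0 0 0" by (simp add: b c d m33_simps)
    then show ?thesis using cyclic_commutant_shift[of ?N "- a"] cyclic_commutant_row by metis
  next
    case False
    then obtain s where s: "Q s \<noteq> 0" by blast
    show ?thesis
    proof (cases "a * d - b * c \<noteq> 0")
      case True
      have "\<exists>x. x * (a * d - b * c) - L s \<noteq> 0"
      proof (cases "L s = 0")
        case False then show ?thesis by (intro exI[of _ 0]) simp
      next
        case L: True then show ?thesis using True by (intro exI[of _ 1]) simp
      qed
      then obtain x where "x * (a * d - b * c) - L s \<noteq> 0" by blast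
      then have "det (krylov ?N (v3 x 1 s)) \<noteq> 0" using s by (simp add: kry)
      then show ?thesis by (rule cyclic_commutant_witness[OF refl])
    next
      case det0: False
      show ?thesis
      proof (cases "\<exists>s'. L s' \<noteq> 0")
        case True
        then obtain s' where "L s' \<noteq> 0" by blast
        then obtain t where "Q t \<noteq> 0" "L t \<noteq> 0" by (rule ex_nonzero_both[OF polyQ polyL s])
        then have "det (krylov ?N (v3 0 1 t)) \<noteq> 0" by (simp add: kry)
        then show ?thesis by (rule cyclic_commutant_witness[OF refl])
      next
        case False
        then have "L 0 = 0" "L 1 = 0" by blast+
        then have L: "p * d = q * c" "q * a = p * b" by (simp_all add: L_def)
        have ad: "a * d = b * c" using det0 by simp
        have outer: "cyclic_commutant ?N" if "?N = (\<chi> i j. v3 x0 x1 x2 $ i * v3 y0 y1 y2 $ j)"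
          for x0 x1 x2 y0 y1 y2 using cyclic_commutant_rank1[of "v3 x0 x1 x2" "v3 y0 y1 y2"] that by simp
        consider "a \<noteq> 0" | "b \<noteq> 0" | "c \<noteq> 0" | "d \<noteq> 0" | "a = 0" "b = 0" "c = 0" "d = 0" by blast
        then show ?thesis
        proof cases
          case 1 show ?thesis
            by (rule outer[of "p/a" 1 "c/a" 0 a b]) (use 1 L ad in \<open>simp add: vec_eq_iff all_3 field_simps\<close>)
        next
          case 2 show ?thesis
            by (rule outer[of "q/b" 1 "d/b" 0 a b]) (use 2 L ad in \<open>simp add: vec_eq_iff all_3 field_simps\<close>)
        next
          case 3 show ?thesis
            by (rule outer[of "p/c" "a/c" 1 0 c d]) (use 3 L ad in \<open>simp add: vec_eq_iff all_3 field_simps\<close>)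
        next
          case 4 show ?thesis
            by (rule outer[of "q/d" "b/d" 1 0 c d]) (use 4 L ad in \<open>simp add: vec_eq_iff all_3 field_simps\<close>)
        next
          case 5 then show ?thesis using cyclic_commutant_row[of 0 p q] by simp
        qed
      qed
    qed
  qed
qed

text \<open>
  The characteristic polynomial has a root.
\<close>

lemma ex_eigenvector:
  fixes N :: "'k::alg_closed_field ^ 3 ^ 3"
  obtains l w where "w \<noteq> 0" "N *v w = l *s w"
proof -
  obtain a b c d e f g h i where N: "N = m33 a b c d e f g h i" by (rule m33_cases)
  let ?p = "[: - det N, (a*e - b*d) + (a*i - c*g) + (e*i - f*h), - (a + e + i), 1 :]"
  have "\<exists>l. poly ?p l = 0" by (rule alg_closed_imp_poly_has_root) simp
  then obtain l where l: "poly ?p l = 0" by blast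
  have "det (N + mat (- l)) = - poly ?p l"
    unfolding N by (simp add: m33_simps algebra_simps)
  then have "det (N + mat (- l)) = 0" using l by simp
  then have "\<not> invertible (N + mat (- l))" by (simp add: invertible_det_nz)
  then obtain w where w: "w \<noteq> 0" "(N + mat (- l)) *v w = 0"
    unfolding invertible_left_inverse matrix_left_invertible_ker by blast
  obtain x y z where wv: "w = v3 x y z" by (rule v3_cases)
  have "N *v w = l *s w"
    using w(2) unfolding N wv m33_mat m33_add m33_vec
    by (simp add: vec_eq_iff all_3 algebra_simps eq_neg_iff_add_eq_0)
  then show ?thesis using that w(1) by blast
qed

theorem cyclic_commutant:
  fixes N :: "'k::{alg_closed_field, field_char_0} ^ 3 ^ 3"
  shows "cyclic_commutant N"
proof -
  obtain l w where w: "w \<noteq> 0" "N *v w = l *s w" by (rule ex_eigenvector)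
  obtain P where P: "P *v v3 1 0 0 = w" "det P \<noteq> 0" by (rule basis_with_first[OF w(1)])
  obtain Q where Q: "P ** Q = mat 1" "Q ** P = mat 1" by (rule invertible_m33[OF P(2)])
  have "(Q ** N ** P) *v v3 1 0 0 = Q *v (l *s w)"
    by (simp add: P(1) w(2) flip: matrix_vector_mul_assoc)
  also have "\<dots> = l *s ((Q ** P) *v v3 1 0 0)"
    by (simp add: vector_scalar_commute P(1) flip: matrix_vector_mul_assoc)
  finally have e: "(Q ** N ** P) *v v3 1 0 0 = l *s v3 1 0 0" by (simp add: Q)
  obtain a b c d e f g h i where m: "Q ** N ** P = m33 a b c d e f g h i" by (rule m33_cases)
  have "a = l" "d = 0" "g = 0" using e unfolding m m33_vec_units by (simp_all add: vec_eq_iff all_3)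
  then have "Q ** N ** P + mat (- l) = m33 0 b c 0 (e - l) f 0 h (i - l)" by (simp add: m m33_simps)
  then have "cyclic_commutant (Q ** N ** P + mat (- l))" by (simp add: cyclic_commutant_kernel)
  then have "cyclic_commutant (Q ** N ** P)" by (rule cyclic_commutant_shift)
  then show ?thesis by (rule cyclic_commutant_conj[OF _ Q])
qed

lemma polyfun_det:
  assumes "\<And>i j. polyfun (\<lambda>t. M t $ i $ j)"
  shows "polyfun (\<lambda>t. det (M t :: 'k::comm_ring_1 ^ 'n::finite ^ 'n))"
  unfolding det_def using assms by (auto intro!: polyfun_sum polyfun_mult polyfun_prod)

text \<open>
  The argument of Motzkin and Taussky: \<open>N\<close> commutes with some \<open>R\<close> that
  has a cyclic vector, so it commutes with all matrices on the line from \<open>M\<close> to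
  \<open>R\<close>, and almost all of these have that vector as a cyclic vector.
\<close>

theorem border_commuting:
  fixes M N :: "'k::{alg_closed_field, field_char_0} ^ 3 ^ 3"
  assumes comm: "M ** N = N ** M"
  shows "border (mat 1) M N"
proof -
  obtain R v where R: "R ** N = N ** R" and v: "det (krylov R v) \<noteq> 0"
    using cyclic_commutant[of N] unfolding cyclic_commutant_def by blast
  let ?M = "\<lambda>t. smul (1 - t) M + smul t R"
  have comm': "?M t ** N = N ** ?M t" for t
  proof -
    have "smul c X ** N = smul c (X ** N)" "N ** smul c X = smul c (N ** X)" for c X
      by (simp_all add: vec_eq_iff matrix_matrix_mult_def sum_distrib_left mult_ac)
    then show ?thesis by (simp add: matrix_add_ldistrib matrix_mult_add_left comm R)
  qed
  let ?f = "\<lambda>t. det (krylov (?M t) v)"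
  have entry: "polyfun (\<lambda>t. ?M t $ i $ j)" for i j by (auto intro!: polyfun_add polyfun_mult polyfun_diff)
  have vec: "polyfun (\<lambda>t. (?M t *v w t) $ i)" if "\<And>j. polyfun (\<lambda>t. w t $ j)" for w i
    unfolding matrix_vector_mult_def using that entry by (auto intro!: polyfun_sum polyfun_mult)
  have "polyfun (\<lambda>t. krylov (?M t) v $ i $ j)" for i j
    unfolding krylov_def using vec[of "\<lambda>t. v" i] vec[of "\<lambda>t. ?M t *v v" i] vec[of "\<lambda>t. v"]
    by (simp add: polyfun_if del: vector_add_component smul_nth)
  then have "polyfun ?f" by (rule polyfun_det)
  moreover have "?M 1 = R" by (simp add: vec_eq_iff)
  then have "?f 1 \<noteq> 0" using v by simp
  ultimately have fin: "finite {t. ?f t = 0}" by (rule polyfun_finite_zeros)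
  have "border (mat 1) (?M 0) N"
  proof (rule border_curve[where ?X0.0 = "\<lambda>t. mat 1" and ?X1.0 = ?M and ?X2.0 = "\<lambda>t. N"])
    show "finite {t. \<not> border (mat 1) (?M t) N}"
      by (rule finite_subset[OF _ fin]) (use border_cyclic[OF comm'] in blast)
  qed (auto simp del: vector_add_component smul_nth intro: entry)
  moreover have "?M 0 = M" by (simp add: vec_eq_iff)
  ultimately show ?thesis by simp
qed

section \<open>Nets of three by three matrices\<close>

text \<open>
  The first matrix is moved to an invertible one, which may be taken to be the identity; the
  second one commutes with zero.
\<close>

lemma border_pencil:
  fixes X0 X1 :: "'k::{alg_closed_field, field_char_0} ^ 3 ^ 3"
  shows "border X0 X1 0"
proof -
  have inv: "border X X1 0" if X: "det X \<noteq> 0" for X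
  proof -
    obtain W where W: "X ** W = mat 1" "W ** X = mat 1" by (rule invertible_m33[OF X])
    have "border (mat 1) (W ** X1) 0" by (rule border_commuting) (simp add: vec_eq_iff matrix_matrix_mult_def)
    moreover have "W ** 0 ** mat 1 = (0 :: 'k ^ 3 ^ 3)" by (simp add: vec_eq_iff matrix_matrix_mult_def)
    ultimately have "border (W ** X ** mat 1) (W ** X1 ** mat 1) (W ** 0 ** mat 1)" by (simp add: W)
    then show ?thesis by (rule border_conj[OF _ W(1)]) simp
  qed
  let ?X = "\<lambda>t. smul (1 - t) X0 + mat t"
  have entry: "polyfun (\<lambda>t. ?X t $ i $ j)" for i j
  proof -
    have "(mat t :: 'k ^ 3 ^ 3) $ i $ j = (if i = j then t else 0)" for t by (simp add: mat_def)
    then show ?thesis by (auto intro!: polyfun_add polyfun_mult polyfun_diff)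
  qed
  have "?X 1 = mat 1" by (simp add: vec_eq_iff)
  then have "det (?X 1) \<noteq> 0" by simp
  with polyfun_det[OF entry] have fin: "finite {t. det (?X t) = 0}" by (rule polyfun_finite_zeros)
  have "border (?X 0) X1 0"
  proof (rule border_curve[where ?X0.0 = ?X and ?X1.0 = "\<lambda>t. X1" and ?X2.0 = "\<lambda>t. 0"])
    show "finite {t. \<not> border (?X t) X1 0}"
      by (rule finite_subset[OF _ fin]) (use inv in blast)
  qed (simp_all add: entry del: vector_add_component smul_nth)
  moreover have "?X 0 = X0" by (simp add: vec_eq_iff mat_def)
  ultimately show ?thesis by simp
qed

lemma sec3_two_slices:
  fixes T :: "'k::{alg_closed_field, field_char_0} ^ (3 \<times> 3 \<times> 3)"
  assumes "\<And>j k. T $ (0, j, k) = 0"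
  shows "sec3 T"
proof -
  let ?S = "\<lambda>i. \<chi> j k. T $ (i, j, k)"
  have "T = cube3 0 (?S 1) (?S 2)" unfolding cube3_eq_iff using assms by simp
  moreover have "border 0 (?S 1) (?S 2)"
    using border_pencil[of "?S 1" "?S 2"] border_swap01 border_swap12 by blast
  ultimately show ?thesis unfolding border_def by simp
qed

text \<open>
  In a basis that starts with the common kernel vector the first column of each slice is zero.
  After a cyclic permutation of the factors this says that a whole slice is zero.
\<close>

lemma border_common_kernel:
  fixes X0 X1 X2 :: "'k::{alg_closed_field, field_char_0} ^ 3 ^ 3"
  assumes "w \<noteq> 0" "X0 *v w = 0" "X1 *v w = 0" "X2 *v w = 0"
  shows "border X0 X1 X2"
proof -
  obtain P where P: "P *v v3 1 0 0 = w" "det P \<noteq> 0" by (rule basis_with_first[OF assms(1)])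
  obtain Q where Q: "P ** Q = mat 1" "Q ** P = mat 1" by (rule invertible_m33[OF P(2)])
  have col: "(X ** P) $ j $ 0 = 0" if "X *v w = 0" for X j
  proof -
    have "(X ** P) $ j $ 0 = ((X ** P) *v v3 1 0 0) $ j"
      by (simp add: matrix_vector_mult_def sum_UNIV_3)
    also have "\<dots> = (X *v w) $ j" by (simp add: P(1) flip: matrix_vector_mul_assoc)
    finally show ?thesis using that by simp
  qed
  have "sec3 (cycle3 (cube3 (X0 ** P) (X1 ** P) (X2 ** P)))"
    by (rule sec3_two_slices) (use assms(2-4) in \<open>simp add: cycle3_def cube3_def col\<close>)
  then have "border (mat 1 ** X0 ** P) (mat 1 ** X1 ** P) (mat 1 ** X2 ** P)"
    by (simp add: border_def)
  then show ?thesis by (rule border_conj[OF _ _ Q(1)]) simp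
qed

lemma border_common_left_kernel:
  fixes X0 X1 X2 :: "'k::{alg_closed_field, field_char_0} ^ 3 ^ 3"
  assumes "w \<noteq> 0" "transpose X0 *v w = 0" "transpose X1 *v w = 0" "transpose X2 *v w = 0"
  shows "border X0 X1 X2"
proof -
  obtain P where P: "P *v v3 1 0 0 = w" "det P \<noteq> 0" by (rule basis_with_first[OF assms(1)])
  let ?P = "transpose P"
  have "det ?P \<noteq> 0" using P(2) by simp
  then obtain Q where Q: "?P ** Q = mat 1" "Q ** ?P = mat 1" by (rule invertible_m33)
  have row: "(?P ** X) $ 0 $ k = 0" if "transpose X *v w = 0" for X k
  proof -
    have "(?P ** X) $ 0 $ k = (transpose (?P ** X) *v v3 1 0 0) $ k"
      by (simp add: matrix_vector_mult_def sum_UNIV_3 transpose_def)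
    also have "\<dots> = (transpose X *v w) $ k"
      by (simp add: P(1) matrix_transpose_mul flip: matrix_vector_mul_assoc)
    finally show ?thesis using that by simp
  qed
  have "sec3 (cycle3 (cycle3 (cube3 (?P ** X0) (?P ** X1) (?P ** X2))))"
    by (rule sec3_two_slices) (use assms(2-4) in \<open>simp add: cycle3_def cube3_def row\<close>)
  then have "border (?P ** X0 ** mat 1) (?P ** X1 ** mat 1) (?P ** X2 ** mat 1)"
    by (simp add: border_def)
  then show ?thesis by (rule border_conj[OF _ Q(2)]) simp
qed

text \<open>
  The condition of Strassen on a net of matrices. It is the commutation of \<open>X\<close> and
  \<open>Z\<close> after \<open>Y\<close> has been made the identity, written without division
  so that it makes sense for singular \<open>Y\<close>.
\<close>

definition strassen :: "'k::comm_ring_1 ^ 3 ^ 3 \<Rightarrow> 'k ^ 3 ^ 3 \<Rightarrow> 'k ^ 3 ^ 3 \<Rightarrow> bool" where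
  "strassen X0 X1 X2 \<longleftrightarrow> (\<forall>a b c. lc3 X0 X1 X2 a ** adj3 (lc3 X0 X1 X2 b) ** lc3 X0 X1 X2 c
     = lc3 X0 X1 X2 c ** adj3 (lc3 X0 X1 X2 b) ** lc3 X0 X1 X2 a)"

definition singular :: "'k::comm_ring_1 ^ 3 ^ 3 \<Rightarrow> 'k ^ 3 ^ 3 \<Rightarrow> 'k ^ 3 ^ 3 \<Rightarrow> bool" where
  "singular X0 X1 X2 \<longleftrightarrow> (\<forall>a. det (lc3 X0 X1 X2 a) = 0)"

lemma smul_0_1 [simp]: "smul 0 X = 0" "smul 1 X = X"
  by (simp_all add: vec_eq_iff)

lemma smul_mult: "smul k A ** B = smul k (A ** B)" "A ** smul k B = smul k (A ** B)"
  "smul k (smul l A) = smul (k * l) A"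
  by (simp_all add: vec_eq_iff matrix_matrix_mult_def sum_distrib_left mult_ac)

lemma mat_mult_smul: "A ** mat k = smul k A" "mat k ** A = smul k A"
  for A :: "'k::comm_ring_1 ^ 3 ^ 3"
  by (rule m33_cases[of A], simp add: m33_simps mult.commute)+

lemma lc3_lc3: "lc3 (lc3 X0 X1 X2 a) (lc3 X0 X1 X2 b) (lc3 X0 X1 X2 c) d
   = lc3 X0 X1 X2 (d$0 *s a + d$1 *s b + d$2 *s c)"
  by (simp add: lc3_def vec_eq_iff algebra_simps)

lemma strassen_lc: "strassen X0 X1 X2 \<Longrightarrow> strassen (lc3 X0 X1 X2 a) (lc3 X0 X1 X2 b) (lc3 X0 X1 X2 c)"
  unfolding strassen_def lc3_lc3 by blast

lemma singular_lc: "singular X0 X1 X2 \<Longrightarrow> singular (lc3 X0 X1 X2 a) (lc3 X0 X1 X2 b) (lc3 X0 X1 X2 c)"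
  unfolding singular_def lc3_lc3 by blast

lemma strassen_swap01: "strassen X0 X1 X2 \<Longrightarrow> strassen X1 X0 X2"
  using strassen_lc[of X0 X1 X2 "v3 0 1 0" "v3 1 0 0" "v3 0 0 1"] by simp

lemma strassen_swap12: "strassen X0 X1 X2 \<Longrightarrow> strassen X0 X2 X1"
  using strassen_lc[of X0 X1 X2 "v3 1 0 0" "v3 0 0 1" "v3 0 1 0"] by simp

lemma singular_swap01: "singular X0 X1 X2 \<Longrightarrow> singular X1 X0 X2"
  using singular_lc[of X0 X1 X2 "v3 0 1 0" "v3 1 0 0" "v3 0 0 1"] by simp

lemma singular_swap12: "singular X0 X1 X2 \<Longrightarrow> singular X0 X2 X1"
  using singular_lc[of X0 X1 X2 "v3 1 0 0" "v3 0 0 1" "v3 0 1 0"] by simp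

lemma lc3_mult: "lc3 (P ** X0 ** Q) (P ** X1 ** Q) (P ** X2 ** Q) a = P ** lc3 X0 X1 X2 a ** Q"
proof -
  have smul: "smul c (P ** X ** Q) = P ** smul c X ** Q" for c X
    by (simp add: vec_eq_iff matrix_matrix_mult_def sum_distrib_left sum_distrib_right mult_ac)
  show ?thesis
    by (simp add: lc3_def smul matrix_add_ldistrib matrix_mult_add_left)
qed

lemma singular_mult: "singular X0 X1 X2 \<Longrightarrow> singular (P ** X0 ** Q) (P ** X1 ** Q) (P ** X2 ** Q)"
  by (simp add: singular_def lc3_mult det_mul)

text \<open>
  Both sides are multiplied by \<open>det P * det Q\<close>, since \<open>Q adj(Q)\<close> and
  \<open>adj(P) P\<close> are scalar.
\<close>

lemma strassen_mult:
  assumes "strassen X0 X1 X2"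
  shows "strassen (P ** X0 ** Q) (P ** X1 ** Q) (P ** X2 ** Q)"
proof -
  have "(P ** A ** Q) ** adj3 (P ** B ** Q) ** (P ** C ** Q)
      = smul (det P * det Q) (P ** (A ** adj3 B ** C) ** Q)" for A B C
  proof -
    have "(P ** A ** Q) ** adj3 (P ** B ** Q) ** (P ** C ** Q)
        = P ** A ** (Q ** adj3 Q) ** adj3 B ** (adj3 P ** P) ** C ** Q"
      by (simp add: adj3_mult matrix_mul_assoc)
    then show ?thesis
      by (simp add: adj3_left adj3_right mat_mult_smul smul_mult matrix_mul_assoc)
  qed
  then show ?thesis using assms unfolding strassen_def lc3_mult by simp
qed

lemma border_invertible:
  fixes X0 X1 X2 :: "'k::{alg_closed_field, field_char_0} ^ 3 ^ 3"
  assumes "strassen X0 X1 X2" "det X0 \<noteq> 0"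
  shows "border X0 X1 X2"
proof -
  obtain W where W: "X0 ** W = mat 1" "W ** X0 = mat 1" by (rule invertible_m33[OF assms(2)])
  have "strassen (W ** X0 ** mat 1) (W ** X1 ** mat 1) (W ** X2 ** mat 1)"
    by (rule strassen_mult[OF assms(1)])
  then have s: "strassen (mat 1) (W ** X1) (W ** X2)" by (simp add: W)
  have "(W ** X1) ** (W ** X2) = (W ** X2) ** (W ** X1)"
    using s[unfolded strassen_def, rule_format, of "v3 0 1 0" "v3 1 0 0" "v3 0 0 1"]
    by (simp add: adj3_mat)
  then have "border (W ** X0 ** mat 1) (W ** X1 ** mat 1) (W ** X2 ** mat 1)"
    using border_commuting by (simp add: W)
  then show ?thesis by (rule border_conj[OF _ W(1)]) simp
qed

lemma lc3_perm: "lc3 X0 X1 X2 (v3 a b c) = lc3 X1 X0 X2 (v3 b a c)"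
  "lc3 X0 X1 X2 (v3 a b c) = lc3 X0 X2 X1 (v3 a c b)"
  by (simp_all add: lc3_def)

text \<open>
  An invertible element of the net takes the place of a slice that occurs in it with nonzero
  coefficient.
\<close>

lemma border_nonsingular:
  fixes X0 X1 X2 :: "'k::{alg_closed_field, field_char_0} ^ 3 ^ 3"
  assumes "strassen X0 X1 X2" "\<not> singular X0 X1 X2"
  shows "border X0 X1 X2"
proof -
  obtain a where a: "det (lc3 X0 X1 X2 a) \<noteq> 0" using assms(2) unfolding singular_def by blast
  obtain a0 a1 a2 where av: "a = v3 a0 a1 a2" by (rule v3_cases)
  have main: "border Y0 Y1 Y2" if s: "strassen Y0 Y1 Y2" and d: "det (lc3 Y0 Y1 Y2 (v3 c0 c1 c2)) \<noteq> 0"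
    and c0: "c0 \<noteq> 0" for Y0 Y1 Y2 :: "'k ^ 3 ^ 3" and c0 c1 c2
  proof -
    let ?Z = "lc3 Y0 Y1 Y2 (v3 c0 c1 c2)"
    have "strassen ?Z Y1 Y2"
      using strassen_lc[OF s, of "v3 c0 c1 c2" "v3 0 1 0" "v3 0 0 1"] by simp
    (* The new first slice is an invertible combination, and the old one is recovered from it. *)
    then have "border ?Z Y1 Y2" using d by (rule border_invertible)
    from border_lc[OF this, of "v3 (1/c0) (-c1/c0) (-c2/c0)" "v3 0 1 0" "v3 0 0 1"]
    have "border (lc3 ?Z Y1 Y2 (v3 (1/c0) (-c1/c0) (-c2/c0))) Y1 Y2" by simp
    moreover have "lc3 ?Z Y1 Y2 (v3 (1/c0) (-c1/c0) (-c2/c0)) = Y0"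
      using c0 by (simp add: lc3_def vec_eq_iff field_simps)
    ultimately show ?thesis by simp
  qed
  have "a0 \<noteq> 0 \<or> a1 \<noteq> 0 \<or> a2 \<noteq> 0"
  proof (rule ccontr)
    assume "\<not> ?thesis"
    then have "lc3 X0 X1 X2 a = 0" by (simp add: av lc3_def vec_eq_iff)
    then show False using a by (simp add: m33_zero m33_det)
  qed
  then consider "a0 \<noteq> 0" | "a1 \<noteq> 0" | "a2 \<noteq> 0" by blast
  then show ?thesis
  proof cases
    case 1 then show ?thesis using main[OF assms(1)] a av by blast
  next
    case 2
    then have "border X1 X0 X2"
      using main[OF strassen_swap01[OF assms(1)], of a1 a0 a2] a av by (simp add: lc3_perm(1)[of X0])
    then show ?thesis by (rule border_swap01)
  next
    case 3
    have "border X2 X0 X1"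
      using main[OF strassen_swap01[OF strassen_swap12[OF assms(1)]], of a2 a0 a1] 3 a av
      by (simp add: lc3_perm(2)[of X0 X1 X2] lc3_perm(1)[of X0 X2 X1])
    then show ?thesis using border_swap01 border_swap12 by blast
  qed
qed

subsection \<open>Nets without an invertible element\<close>

text \<open>
  This is the limit of \<open>t^-1 a0 (b0 + t b1) (c1 + t c0) + t^-1 a1 (b0 + t b2) (c1 + t c2)
  + (b a2 - t^-1 (a0 + a1)) b0 c1\<close> for \<open>t\<close> going to zero: the poles of the
  three summands cancel.
\<close>

lemma border_double_tangent:
  fixes b :: "'k::field_char_0"
  shows "border (m33 1 0 0 0 1 0 0 0 0) (m33 0 0 1 0 0 0 0 1 0) (m33 0 b 0 0 0 0 0 0 0)"
proof -
  let ?X0 = "\<lambda>t::'k. m33 1 0 0 t 1 0 0 0 0" and ?X1 = "\<lambda>t::'k. m33 0 0 1 0 0 0 0 1 t"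
    and ?X2 = "\<lambda>t::'k. m33 0 b 0 0 0 0 0 0 0"
  have good: "border (?X0 t) (?X1 t) (?X2 t)" if "t \<noteq> 0" for t
  proof -
    (* The three summands of the curve in the description above. *)
    let ?x = "\<lambda>i::3. if i = 0 then v3 (1/t) 0 0 else if i = 1 then v3 0 (1/t) 0 else v3 (-1/t) (-1/t) b"
    let ?y = "\<lambda>i::3. if i = 0 then v3 1 t 0 else if i = 1 then v3 1 0 t else v3 1 0 0"
    let ?z = "\<lambda>i::3. if i = 0 then v3 t 1 0 else if i = 1 then v3 0 1 t else v3 0 1 0"
    have "cube3 (?X0 t) (?X1 t) (?X2 t) = (\<Sum>i\<in>UNIV. tensor3 (?x i) (?y i) (?z i))"
      using that by (simp add: vec_eq_iff all_3 sum_UNIV_3 tensor3_def)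
    then have "rank_le3 (cube3 (?X0 t) (?X1 t) (?X2 t))" unfolding rank_le3_def by (intro exI)
    then show ?thesis unfolding border_def by (rule rank_le3_imp_sec3)
  qed
  have "border (?X0 0) (?X1 0) (?X2 0)"
  proof (rule border_curve[where ?X0.0 = ?X0 and ?X1.0 = ?X1 and ?X2.0 = ?X2])
    show "finite {t. \<not> border (?X0 t) (?X1 t) (?X2 t)}"
      by (rule finite_subset[of _ "{0}"]) (use good in auto)
  qed (intro polyfun_m33 polyfun_const polyfun_id)+
  then show ?thesis .
qed

text \<open>
  Singularity forces the entries in the second row and first column to vanish, and the Strassen
  condition forces the diagonal entries of the third slice to agree. Subtracting multiples of
  the first slice and clearing the rest of the second one leads to the explicit limit.
\<close>

lemma border_zero_block:
  fixes r :: "'k::{alg_closed_field, field_char_0}"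
  assumes s: "strassen (m33 1 0 0 0 1 0 0 0 0) (m33 p00 p01 1 p10 p11 0 0 r 0) (m33 a b 0 c d 0 0 0 0)"
    and sing: "singular (m33 1 0 0 0 1 0 0 0 0) (m33 p00 p01 1 p10 p11 0 0 r 0) (m33 a b 0 c d 0 0 0 0)"
    and r: "r \<noteq> 0"
  shows "border (m33 1 0 0 0 1 0 0 0 0) (m33 p00 p01 1 p10 p11 0 0 r 0) (m33 a b 0 c d 0 0 0 0)"
      (is "border ?X0 ?X1 ?X2")
proof -
  have "det (lc3 ?X0 ?X1 ?X2 (v3 0 1 0)) = 0" "det (lc3 ?X0 ?X1 ?X2 (v3 0 1 1)) = 0"
    using sing unfolding singular_def by blast+
  then have "r * p10 = 0" "r * (p10 + c) = 0" by (simp_all add: lc3_v3 m33_simps algebra_simps)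
  then have p10: "p10 = 0" and c: "c = 0" using r by simp_all
  let ?Y1 = "m33 0 p01 1 0 (p11 - p00) 0 0 r 0" and ?Y2 = "m33 0 b 0 0 (d - a) 0 0 0 0"
  have l1: "lc3 ?X0 ?X1 ?X2 (v3 (- p00) 1 0) = ?Y1" and l2: "lc3 ?X0 ?X1 ?X2 (v3 (- a) 0 1) = ?Y2"
    by (simp_all add: lc3_v3 m33_simps p10 c)
  have "lc3 ?X0 ?X1 ?X2 (v3 1 0 0) ** adj3 (lc3 ?X0 ?X1 ?X2 (v3 (- p00) 1 0)) ** lc3 ?X0 ?X1 ?X2 (v3 (- a) 0 1)
     = lc3 ?X0 ?X1 ?X2 (v3 (- a) 0 1) ** adj3 (lc3 ?X0 ?X1 ?X2 (v3 (- p00) 1 0)) ** lc3 ?X0 ?X1 ?X2 (v3 1 0 0)"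
    using s unfolding strassen_def by blast
  then have "r * (d - a) = 0" unfolding l1 l2 lc3_units by (simp add: m33_simps)
  then have d: "d = a" using r by simp
  (* Row and column operations that leave the first and third slice alone and clear the second
     one up to its two units. *)
  define P where "P = m33 1 0 0 0 1 (- (p11 - p00) / r) 0 0 (1 / r)"
  define Q where "Q = m33 1 0 0 0 1 0 0 (- p01) 1"
  have "det P \<noteq> 0" "det Q \<noteq> 0" using r by (simp_all add: P_def Q_def m33_det)
  then obtain P' Q' where PQ: "P' ** P = mat 1" "Q ** Q' = mat 1" by (metis invertible_m33)
  have "P ** ?X0 ** Q = ?X0" "P ** ?Y1 ** Q = m33 0 0 1 0 0 0 0 1 0" "P ** ?Y2 ** Q = m33 0 b 0 0 0 0 0 0 0"
    using r by (simp_all add: P_def Q_def m33_simps d)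
  then have "border (P ** ?X0 ** Q) (P ** ?Y1 ** Q) (P ** ?Y2 ** Q)"
    using border_double_tangent[of b] by simp
  then have "border ?X0 ?Y1 ?Y2" by (rule border_conj[OF _ PQ])
  from border_lc[OF this, of "v3 1 0 0" "v3 p00 1 0" "v3 a 0 1"]
  have "border ?X0 (lc3 ?X0 ?Y1 ?Y2 (v3 p00 1 0)) (lc3 ?X0 ?Y1 ?Y2 (v3 a 0 1))" by simp
  moreover have "lc3 ?X0 ?Y1 ?Y2 (v3 p00 1 0) = ?X1" "lc3 ?X0 ?Y1 ?Y2 (v3 a 0 1) = ?X2"
    by (simp_all add: lc3_v3 m33_simps p10 c d)
  ultimately show ?thesis by simp
qed

text \<open>
  The last column of the second slice is moved to the first basis vector; the last row is
  orthogonal to it and so becomes a multiple of the second dual basis vector.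
\<close>

lemma border_two_vectors:
  fixes q0 :: "'k::{alg_closed_field, field_char_0}"
  assumes s: "strassen (m33 1 0 0 0 1 0 0 0 0) (m33 p00 p01 q0 p10 p11 q1 r0 r1 0) (m33 a b 0 c d 0 0 0 0)"
    and sing: "singular (m33 1 0 0 0 1 0 0 0 0) (m33 p00 p01 q0 p10 p11 q1 r0 r1 0) (m33 a b 0 c d 0 0 0 0)"
    and q: "q0 \<noteq> 0 \<or> q1 \<noteq> 0" and r: "r0 \<noteq> 0 \<or> r1 \<noteq> 0"
    and qr: "q0 * r0 + q1 * r1 = 0"
  shows "border (m33 1 0 0 0 1 0 0 0 0) (m33 p00 p01 q0 p10 p11 q1 r0 r1 0) (m33 a b 0 c d 0 0 0 0)"
      (is "border ?X0 ?X1 ?X2")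
proof -
  have conj: "border ?X0 ?X1 ?X2" if PQ: "P ** Q = mat 1" "Q ** P = mat 1" and X0: "P ** ?X0 ** Q = ?X0"
    and X1: "(P ** ?X1 ** Q) $ 0 $ 2 = 1" "(P ** ?X1 ** Q) $ 1 $ 2 = 0" "(P ** ?X1 ** Q) $ 2 $ 0 = 0"
      "(P ** ?X1 ** Q) $ 2 $ 2 = 0" "(P ** ?X1 ** Q) $ 2 $ 1 \<noteq> 0"
    and X2: "(P ** ?X2 ** Q) $ 0 $ 2 = 0" "(P ** ?X2 ** Q) $ 1 $ 2 = 0" "(P ** ?X2 ** Q) $ 2 $ 0 = 0"
      "(P ** ?X2 ** Q) $ 2 $ 1 = 0" "(P ** ?X2 ** Q) $ 2 $ 2 = 0"
    for P Q
  proof -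
    obtain p00' p01' e1 p10' p11' e2 e3 r' e4 where "P ** ?X1 ** Q = m33 p00' p01' e1 p10' p11' e2 e3 r' e4"
      by (rule m33_cases)
    then have Y1: "P ** ?X1 ** Q = m33 p00' p01' 1 p10' p11' 0 0 r' 0" and r': "r' \<noteq> 0" using X1 by simp_all
    obtain a' b' e1 c' d' e2 e3 e4 e5 where "P ** ?X2 ** Q = m33 a' b' e1 c' d' e2 e3 e4 e5" by (rule m33_cases)
    then have Y2: "P ** ?X2 ** Q = m33 a' b' 0 c' d' 0 0 0 0" using X2 by simp
    have "border ?X0 (m33 p00' p01' 1 p10' p11' 0 0 r' 0) (m33 a' b' 0 c' d' 0 0 0 0)"
      using strassen_mult[OF s, of P Q] singular_mult[OF sing, of P Q]
      unfolding X0 Y1 Y2 by (rule border_zero_block[OF _ _ r'])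
    then have "border (P ** ?X0 ** Q) (P ** ?X1 ** Q) (P ** ?X2 ** Q)" unfolding X0 Y1 Y2 .
    then show ?thesis by (rule border_conj[OF _ PQ(2) PQ(2)])
  qed
  show ?thesis
  proof (cases "q0 = 0")
    case False
    have r0: "r0 = - r1 * q1 / q0" using qr False by (simp add: field_simps eq_neg_iff_add_eq_0)
    then have r1: "r1 \<noteq> 0" using r by auto
    let ?P = "m33 (1/q0) 0 0 (-q1/q0) 1 0 0 0 1" and ?Q = "m33 q0 0 0 q1 1 0 0 0 1"
    show ?thesis
      by (rule conj[of ?P ?Q])
         (use False r0 r1 in \<open>simp_all add: m33_mult m33_mat m33_eq_iff field_simps\<close>)
  next
    case True
    then have q1: "q1 \<noteq> 0" and r1: "r1 = 0" and r0: "r0 \<noteq> 0" using q r qr by auto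
    let ?P = "m33 0 (1/q1) 0 1 0 0 0 0 1" and ?Q = "m33 0 1 0 q1 0 0 0 0 1"
    show ?thesis
      by (rule conj[of ?P ?Q])
         (use True q1 r0 r1 in \<open>simp_all add: m33_mult m33_mat m33_eq_iff field_simps\<close>)
  qed
qed

lemma v3_zero_iff: "v3 a b c = 0 \<longleftrightarrow> a = 0 \<and> b = 0 \<and> c = 0"
  by (simp add: vec_eq_iff all_3)

text \<open>
  With first slice \<open>diag(1, 1, 0)\<close>, write the last columns of the other slices as
  \<open>q\<close>, \<open>q'\<close> and their last rows as \<open>r\<close>,
  \<open>r'\<close>. Singularity makes the corner entries vanish, and also the pairings of
  \<open>q\<close> with \<open>r\<close> and of \<open>q'\<close> with \<open>r'\<close>. The
  Strassen condition with the first slice in the middle says that the outer products of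
  \<open>q\<close> with \<open>r'\<close> and of \<open>q'\<close> with \<open>r\<close> agree.
  So both columns vanish, or both rows vanish, or one pair \<open>(q, r)\<close> has both parts
  nonzero and the other pair is a multiple of it.
\<close>

lemma border_rank2_normal:
  fixes X1 X2 :: "'k::{alg_closed_field, field_char_0} ^ 3 ^ 3"
  assumes s: "strassen (m33 1 0 0 0 1 0 0 0 0) X1 X2" and sing: "singular (m33 1 0 0 0 1 0 0 0 0) X1 X2"
  shows "border (m33 1 0 0 0 1 0 0 0 0) X1 X2" (is "border ?X0 _ _")
proof -
  (* The coefficients of the determinant of s X0 + Y as a polynomial in s, from the values at s =
     0, 1, -1. *)
  have block: "Y $ 2 $ 2 = 0 \<and> Y $ 0 $ 2 * Y $ 2 $ 0 + Y $ 1 $ 2 * Y $ 2 $ 1 = 0"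
    if sing: "singular ?X0 Y Z" for Y Z
  proof -
    obtain a b c d e f g h i where Y: "Y = m33 a b c d e f g h i" by (rule m33_cases)
    have d: "det (lc3 ?X0 Y Z (v3 s t 0)) = 0" for s t using sing unfolding singular_def by blast
    have d0: "det Y = 0" using d[of 0 1] by (simp add: lc3_def) 
    have d1: "det (lc3 ?X0 Y Z (v3 1 1 0)) = 0" "det (lc3 ?X0 Y Z (v3 (-1) 1 0)) = 0" using d by blast+
    have e1: "i + ((a + e) * i - c * g - f * h) = 0"
      using d1(1) d0 unfolding Y lc3_v3 by (simp add: m33_smul m33_add m33_det algebra_simps)
    have e2: "i - ((a + e) * i - c * g - f * h) = 0"
      using d1(2) d0 unfolding Y lc3_v3 by (simp add: m33_smul m33_add m33_det algebra_simps)
    have "2 * i = (i + ((a + e) * i - c * g - f * h)) + (i - ((a + e) * i - c * g - f * h))"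
      by (simp only: mult_2 diff_add_eq add_diff_eq) simp
    then have "2 * i = 0" unfolding e1 e2 by simp
    then have "i = 0" by simp
    moreover from this have "f * h = - (c * g)" using e1 by (simp add: algebra_simps)
    ultimately show ?thesis by (simp add: Y)
  qed
  obtain p00 p01 q0 p10 p11 q1 r0 r1 s1 where X1: "X1 = m33 p00 p01 q0 p10 p11 q1 r0 r1 s1" by (rule m33_cases)
  obtain p00' p01' q0' p10' p11' q1' r0' r1' s2 where
    X2: "X2 = m33 p00' p01' q0' p10' p11' q1' r0' r1' s2" by (rule m33_cases)
  have b1: "s1 = 0" "q0 * r0 + q1 * r1 = 0" using block[OF sing] by (simp_all add: X1)
  have b2: "s2 = 0" "q0' * r0' + q1' * r1' = 0" using block[OF singular_swap12[OF sing]] by (simp_all add: X2)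
  have "lc3 ?X0 X1 X2 (v3 0 1 0) ** adj3 (lc3 ?X0 X1 X2 (v3 1 0 0)) ** lc3 ?X0 X1 X2 (v3 0 0 1)
     = lc3 ?X0 X1 X2 (v3 0 0 1) ** adj3 (lc3 ?X0 X1 X2 (v3 1 0 0)) ** lc3 ?X0 X1 X2 (v3 0 1 0)"
    using s unfolding strassen_def by blast
  then have rk: "q0 * r0' = q0' * r0" "q0 * r1' = q0' * r1" "q1 * r0' = q1' * r0" "q1 * r1' = q1' * r1"
    unfolding lc3_units X1 X2 by (simp_all add: m33_simps b1 b2)
  have two: "border ?X0 Y1 Y2"
    if Y1: "Y1 = m33 x00 x01 y0 x10 x11 y1 z0 z1 0" and Y2: "Y2 = m33 x00' x01' y0' x10' x11' y1' z0' z1' 0"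
      and y: "y0 \<noteq> 0 \<or> y1 \<noteq> 0" and z: "z0 \<noteq> 0 \<or> z1 \<noteq> 0" and yz: "y0 * z0 + y1 * z1 = 0"
      and l: "y0' = l * y0" "y1' = l * y1" "z0' = l * z0" "z1' = l * z1"
      and st: "strassen ?X0 Y1 Y2" and sing: "singular ?X0 Y1 Y2"
    for Y1 Y2 x00 x01 y0 x10 x11 y1 z0 z1 x00' x01' y0' x10' x11' y1' z0' z1' l
  proof -
    (* Subtracting l times the second slice removes the last row and column of the third one. *)
    let ?Z = "m33 (x00' - l * x00) (x01' - l * x01) 0 (x10' - l * x10) (x11' - l * x11) 0 0 0 0"
    have Z: "lc3 ?X0 Y1 Y2 (v3 0 (- l) 1) = ?Z" by (simp add: lc3_v3 m33_simps Y1 Y2 l)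
    have "strassen ?X0 Y1 ?Z" using strassen_lc[OF st, of "v3 1 0 0" "v3 0 1 0" "v3 0 (- l) 1"] by (simp add: Z)
    moreover have "singular ?X0 Y1 ?Z"
      using singular_lc[OF sing, of "v3 1 0 0" "v3 0 1 0" "v3 0 (- l) 1"] by (simp add: Z)
    ultimately have "border ?X0 Y1 ?Z"
      unfolding Y1 by (rule border_two_vectors[OF _ _ y z yz])
    from border_lc[OF this, of "v3 1 0 0" "v3 0 1 0" "v3 0 l 1"]
    have "border ?X0 Y1 (lc3 ?X0 Y1 ?Z (v3 0 l 1))" by simp
    moreover have "lc3 ?X0 Y1 ?Z (v3 0 l 1) = Y2" by (simp add: lc3_v3 m33_simps Y1 Y2 l)
    ultimately show ?thesis by simp
  qed
  consider (q) "q0 = 0" "q1 = 0" "q0' = 0" "q1' = 0" | (r) "r0 = 0" "r1 = 0" "r0' = 0" "r1' = 0"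
    | (1) "q0 \<noteq> 0 \<or> q1 \<noteq> 0" "r0 \<noteq> 0 \<or> r1 \<noteq> 0" | (2) "q0' \<noteq> 0 \<or> q1' \<noteq> 0" "r0' \<noteq> 0 \<or> r1' \<noteq> 0"
    using rk by (cases "q0 = 0 \<and> q1 = 0"; cases "r0 = 0 \<and> r1 = 0";
      cases "q0' = 0 \<and> q1' = 0"; cases "r0' = 0 \<and> r1' = 0"; auto)
  then show ?thesis
  proof cases
    case q
    show ?thesis
      by (rule border_common_kernel[of "v3 0 0 1"])
         (simp_all add: X1 X2 m33_vec_units v3_zero_iff q b1 b2)
  next
    case r
    show ?thesis
      by (rule border_common_left_kernel[of "v3 0 0 1"])
         (simp_all add: X1 X2 m33_transpose m33_vec_units v3_zero_iff r b1 b2)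
  next
    case 1
    define l where "l = (if r0 \<noteq> 0 then r0' / r0 else r1' / r1)"
    have lq: "q0' = l * q0" "q1' = l * q1" using 1(2) rk by (auto simp: l_def field_simps)
    have lr: "r0' = l * r0" "r1' = l * r1" using 1(1) rk unfolding lq by (auto simp: algebra_simps)
    show ?thesis
      by (rule two[OF X1[unfolded b1] X2[unfolded b2] 1 b1(2) lq lr s sing])
  next
    case 2
    define l where "l = (if r0' \<noteq> 0 then r0 / r0' else r1 / r1')"
    have lq: "q0 = l * q0'" "q1 = l * q1'" using 2(2) rk by (auto simp: l_def field_simps)
    have lr: "r0 = l * r0'" "r1 = l * r1'" using 2(1) rk unfolding lq by (auto simp: algebra_simps)
    show ?thesis
      by (rule border_swap12, rule two[OF X2[unfolded b2] X1[unfolded b1] 2 b2(2) lq lr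
            strassen_swap12[OF s] singular_swap12[OF sing]])
  qed
qed

text \<open>
  Row and column operations built from an invertible two by two minor. Cyclic shifts of rows and
  columns first move that minor to the upper left corner.
\<close>

lemma rank2_normal_form:
  fixes X :: "'k::field ^ 3 ^ 3"
  assumes "det X = 0" "adj3 X \<noteq> 0"
  obtains P Q where "det P \<noteq> 0" "det Q \<noteq> 0" "P ** X ** Q = m33 1 0 0 0 1 0 0 0 0"
proof -
  have topleft: "\<exists>P Q. det P \<noteq> 0 \<and> det Q \<noteq> 0 \<and> P ** Y ** Q = m33 1 0 0 0 1 0 0 0 0"
    if "det Y = 0" "adj3 Y $ 2 $ 2 \<noteq> 0" for Y :: "'k ^ 3 ^ 3"
  proof -
    obtain a b c d e f g h i where Y: "Y = m33 a b c d e f g h i" by (rule m33_cases)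
    define D where "D = a * e - b * d"
    have D: "D \<noteq> 0" using that(2) by (simp add: Y m33_adj3 D_def)
    have ae: "a * e = D + b * d" by (simp add: D_def)
    have i: "D * i = a*f*h - b*f*g + c*e*g - c*d*h"
      using that(1) by (simp add: Y m33_det D_def algebra_simps)
    let ?P = "m33 (e/D) (-b/D) 0 (-d/D) (a/D) 0 (d*h - e*g) (b*g - a*h) D"
    let ?Q = "m33 1 0 (b*f - c*e) 0 1 (c*d - a*f) 0 0 D"
    have "det ?P = (a * e - b * d) / D" using D by (simp add: m33_det field_simps)
    then have "det ?P = 1" using D by (simp flip: D_def)
    moreover have "det ?Q = D" by (simp add: m33_det)
    moreover have "?P ** Y ** ?Q = m33 1 0 0 0 1 0 0 0 0"
    proof -
      have "(d*h - e*g) * a + (b*g - a*h) * d + D * g = 0"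
        "(d*h - e*g) * b + (b*g - a*h) * e + D * h = 0"
        by (simp_all add: D_def algebra_simps)
      moreover have "(d*h - e*g) * c + (b*g - a*h) * f + D * i = 0"
        unfolding i by (simp add: algebra_simps)
      moreover have "e/D * a + -b/D * d = (a * e - b * d) / D" "-d/D * b + a/D * e = (a * e - b * d) / D"
        by (simp_all add: diff_divide_distrib mult.commute)
      then have "e/D * a + -b/D * d = 1" "-d/D * b + a/D * e = 1"
        using D by (simp_all flip: D_def)
      moreover have "e/D * b + -b/D * e = 0" "-d/D * a + a/D * d = 0" by (simp_all add: field_simps)
      ultimately have "?P ** Y = m33 1 0 ((e*c - b*f)/D) 0 1 ((a*f - d*c)/D) 0 0 0"
        unfolding Y m33_mult m33_eq_iff by (simp add: diff_divide_distrib)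
      then show ?thesis using D by (simp add: m33_mult m33_eq_iff field_simps)
    qed
    ultimately show ?thesis using D by (metis zero_neq_one)
  qed
  obtain s r where sr: "adj3 X $ s $ r \<noteq> 0" using assms(2) by (auto simp: vec_eq_iff)
  (* The cyclic shift by c. *)
  define S :: "3 \<Rightarrow> 'k ^ 3 ^ 3" where "S c = (\<chi> i j. if j = i + c then 1 else 0)" for c
  have S: "(S c ** Y) $ i $ j = Y $ (i + c) $ j" "(Y ** transpose (S c)) $ i $ j = Y $ i $ (j + c)" for c Y i j
  proof -
    have "(S c ** Y) $ i $ j = (\<Sum>k\<in>UNIV. if k = i + c then Y $ k $ j else 0)"
      unfolding matrix_matrix_mult_def S_def by (simp add: if_distrib[of "\<lambda>x. x * _"] cong: if_cong)
    then show "(S c ** Y) $ i $ j = Y $ (i + c) $ j" by simp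
    have "(Y ** transpose (S c)) $ i $ j = (\<Sum>k\<in>UNIV. if k = j + c then Y $ i $ k else 0)"
      unfolding matrix_matrix_mult_def S_def transpose_def
      by (simp add: if_distrib[of "\<lambda>x. _ * x"] cong: if_cong)
    then show "(Y ** transpose (S c)) $ i $ j = Y $ i $ (j + c)" by simp
  qed
  have "S c ** S (- c) = mat 1" for c by (simp add: vec_eq_iff S) (simp add: S_def mat_def eq_commute)
  then have dS: "det (S c) \<noteq> 0" for c by (rule det_nz_of_inverse)
  define Y where "Y = S (r + 1) ** X ** transpose (S (s + 1))"
  have "adj3 Y $ 2 $ 2 = adj3 X $ s $ r"
  proof -
    have n: "(2::3) + 1 = 0" "(2::3) + 2 = 1" "(1::3) + 1 = 2" by simp_all
    have a: "0 + (x + 1) = x + (1::3)" "1 + (x + 1) = x + (2::3)" for x by (simp_all add: add_ac)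
    show ?thesis by (simp only: adj3_def vec_lambda_beta Y_def S n a)
  qed
  moreover have "det Y = 0" using assms(1) by (simp add: Y_def det_mul)
  ultimately obtain P Q where PQ: "det P \<noteq> 0" "det Q \<noteq> 0" "P ** Y ** Q = m33 1 0 0 0 1 0 0 0 0"
    using topleft[of Y] sr by auto
  show ?thesis
  proof
    show "det (P ** S (r + 1)) \<noteq> 0" "det (transpose (S (s + 1)) ** Q) \<noteq> 0"
      using PQ dS by (simp_all add: det_mul)
    show "(P ** S (r + 1)) ** X ** (transpose (S (s + 1)) ** Q) = m33 1 0 0 0 1 0 0 0 0"
      using PQ(3) by (simp add: Y_def matrix_mul_assoc)
  qed
qed

lemma border_singular_rank2:
  fixes X0 X1 X2 :: "'k::{alg_closed_field, field_char_0} ^ 3 ^ 3"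
  assumes s: "strassen X0 X1 X2" and sing: "singular X0 X1 X2" and rk: "adj3 X0 \<noteq> 0"
  shows "border X0 X1 X2"
proof -
  have "det (lc3 X0 X1 X2 (v3 1 0 0)) = 0" using sing unfolding singular_def by blast
  then have "det X0 = 0" by simp
  then obtain P Q where PQ: "det P \<noteq> 0" "det Q \<noteq> 0" "P ** X0 ** Q = m33 1 0 0 0 1 0 0 0 0"
    by (rule rank2_normal_form[OF _ rk])
  obtain P' Q' where i: "P' ** P = mat 1" "Q ** Q' = mat 1" using PQ(1,2) by (metis invertible_m33)
  have "border (P ** X0 ** Q) (P ** X1 ** Q) (P ** X2 ** Q)"
    using strassen_mult[OF s, of P Q] singular_mult[OF sing, of P Q] border_rank2_normal
    unfolding PQ(3) by blast
  then show ?thesis by (rule border_conj[OF _ i])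
qed

lemma rank1_if_adj3_zero:
  fixes X :: "'k::field ^ 3 ^ 3"
  assumes "adj3 X = 0"
  obtains x y where "\<forall>i j. X $ i $ j = x $ i * y $ j"
proof -
  note outer = that
  obtain a b c d e f g h i where X: "X = m33 a b c d e f g h i" by (rule m33_cases)
  have m: "e*i = f*h" "c*h = b*i" "b*f = c*e" "f*g = d*i" "a*i = c*g" "c*d = a*f" "d*h = e*g" "b*g = a*h" "a*e = b*d"
    using assms by (simp_all add: X m33_adj3 m33_zero m33_eq_iff)
  have out: thesis if o: "X = (\<chi> i j. v3 x0 x1 x2 $ i * v3 y0 y1 y2 $ j)" for x0 x1 x2 y0 y1 y2
  proof (rule outer)
    show "\<forall>i j. X $ i $ j = v3 x0 x1 x2 $ i * v3 y0 y1 y2 $ j" by (simp add: o)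
  qed
  consider "a \<noteq> 0" | "b \<noteq> 0" | "c \<noteq> 0" | "a = 0" "b = 0" "c = 0" "d \<noteq> 0" | "a = 0" "b = 0" "c = 0" "e \<noteq> 0"
    | "a = 0" "b = 0" "c = 0" "f \<noteq> 0" | "a = 0" "b = 0" "c = 0" "d = 0" "e = 0" "f = 0" by blast
  then show thesis
  proof cases
    case 1 show thesis by (rule out[of 1 "d/a" "g/a" a b c]) (use 1 m in \<open>simp add: X vec_eq_iff all_3 field_simps\<close>)
  next
    case 2 show thesis by (rule out[of 1 "e/b" "h/b" a b c]) (use 2 m in \<open>simp add: X vec_eq_iff all_3 field_simps\<close>)
  next
    case 3 show thesis by (rule out[of 1 "f/c" "i/c" a b c]) (use 3 m in \<open>simp add: X vec_eq_iff all_3 field_simps\<close>)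
  next
    case 4 show thesis by (rule out[of 0 1 "g/d" d e f]) (use 4 m in \<open>simp add: X vec_eq_iff all_3 field_simps\<close>)
  next
    case 5 show thesis by (rule out[of 0 1 "h/e" d e f]) (use 5 m in \<open>simp add: X vec_eq_iff all_3 field_simps\<close>)
  next
    case 6 show thesis by (rule out[of 0 1 "i/f" d e f]) (use 6 m in \<open>simp add: X vec_eq_iff all_3 field_simps\<close>)
  next
    case 7 show thesis by (rule out[of 0 0 1 g h i]) (use 7 in \<open>simp add: X vec_eq_iff all_3\<close>)
  qed
qed

text \<open>
  Each slice contributes one decomposable tensor.
\<close>

lemma border_rank1_slices:
  fixes X0 X1 X2 :: "'k::field ^ 3 ^ 3"
  assumes "adj3 X0 = 0" "adj3 X1 = 0" "adj3 X2 = 0"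
  shows "border X0 X1 X2"
proof -
  obtain x0 y0 where 0: "\<forall>i j. X0 $ i $ j = x0 $ i * y0 $ j" by (rule rank1_if_adj3_zero[OF assms(1)])
  obtain x1 y1 where 1: "\<forall>i j. X1 $ i $ j = x1 $ i * y1 $ j" by (rule rank1_if_adj3_zero[OF assms(2)])
  obtain x2 y2 where 2: "\<forall>i j. X2 $ i $ j = x2 $ i * y2 $ j" by (rule rank1_if_adj3_zero[OF assms(3)])
  have "cube3 X0 X1 X2 = (\<Sum>i\<in>UNIV. tensor3 (axis i 1)
      ((\<lambda>i::3. if i = 0 then x0 else if i = 1 then x1 else x2) i)
      ((\<lambda>i::3. if i = 0 then y0 else if i = 1 then y1 else y2) i))"
    by (simp add: vec_eq_iff all_3 sum_UNIV_3 tensor3_def axis_def 0 1 2)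
  then have "rank_le3 (cube3 X0 X1 X2)" unfolding rank_le3_def by (intro exI)
  then show ?thesis unfolding border_def by (rule rank_le3_imp_sec3)
qed

text \<open>
  If the net has no invertible element, its slices have rank at most two. A slice of rank two is
  brought to normal form.
\<close>

theorem border_strassen:
  fixes X0 X1 X2 :: "'k::{alg_closed_field, field_char_0} ^ 3 ^ 3"
  assumes s: "strassen X0 X1 X2"
  shows "border X0 X1 X2"
proof (cases "singular X0 X1 X2")
  case False then show ?thesis by (rule border_nonsingular[OF s])
next
  case sing: True
  consider "adj3 X0 \<noteq> 0" | "adj3 X1 \<noteq> 0" | "adj3 X2 \<noteq> 0" | "adj3 X0 = 0" "adj3 X1 = 0" "adj3 X2 = 0" by blast
  then show ?thesis
  proof cases
    case 1 then show ?thesis by (rule border_singular_rank2[OF s sing])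
  next
    case 2 show ?thesis
      by (rule border_swap01, rule border_singular_rank2[OF strassen_swap01[OF s] singular_swap01[OF sing] 2])
  next
    case 3
    have "border X2 X0 X1"
      by (rule border_singular_rank2[OF strassen_swap01[OF strassen_swap12[OF s]]
            singular_swap01[OF singular_swap12[OF sing]] 3])
    then show ?thesis using border_swap01 border_swap12 by blast
  next
    case 4 then show ?thesis by (rule border_rank1_slices)
  qed
qed

section \<open>Tensors supported on three dimensional subspaces\<close>

lemma tensor_expansion:
  fixes T :: "'k::comm_ring_1 ^ ('a::finite \<times> 'b::finite \<times> 'c::finite)"
  shows "T = (\<Sum>i\<in>UNIV. \<Sum>j\<in>UNIV. \<Sum>k\<in>UNIV. tensor3 (T $ (i, j, k) *s axis i 1) (axis j 1) (axis k 1))"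
proof -
  have "(\<Sum>i\<in>UNIV. \<Sum>j\<in>UNIV. \<Sum>k\<in>UNIV. tensor3 (T $ (i, j, k) *s axis i 1) (axis j 1) (axis k 1)) $ (i', j', k')
     = T $ (i', j', k')" for i' j' k'
  proof -
    have "(\<Sum>i\<in>UNIV. \<Sum>j\<in>UNIV. \<Sum>k\<in>UNIV. tensor3 (T $ (i, j, k) *s axis i 1) (axis j 1) (axis k 1)) $ (i', j', k')
      = (\<Sum>i\<in>UNIV. \<Sum>j\<in>UNIV. \<Sum>k\<in>UNIV.
          if k = k' then (if j = j' then (if i = i' then T $ (i, j, k) else 0) else 0) else 0)"
      unfolding sum_component by (intro sum.cong refl) (auto simp: tensor3_def axis_def)
    also have "\<dots> = T $ (i', j', k')" by simp
    finally show ?thesis .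
  qed
  then show ?thesis by (auto simp: vec_eq_iff)
qed

lemma tmap_tmap: "tmap g h l (tmap g' h' l' T) = tmap (g ** g') (h ** h') (l ** l') T"
  by (subst (1 2) tensor_expansion[of T])
     (simp add: tmap_sum tmap_tensor3 matrix_vector_mul_assoc)

text \<open>
  Used with projections: a tensor in a product of subspaces is fixed by the projections onto
  them.
\<close>

lemma tmap_fixes_span:
  assumes "T \<in> vec.span X" "\<And>x. x \<in> X \<Longrightarrow> tmap g h l x = x"
  shows "tmap g h l T = T"
  using assms(1)
proof (induction rule: vec.span_induct_alt)
  case (step c x y)
  have "tmap g h l (c *s x) = c *s tmap g h l x"
    by (auto simp: tmap_def vec_eq_iff sum_distrib_left mult_ac)
  then show ?case using step assms(2) by (simp add: tmap_add)
qed (simp add: tmap_0)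

lemma independent_left_inverse:
  fixes a :: "'i::finite \<Rightarrow> 'k::field ^ 'n::finite"
  assumes a: "bij_betw a UNIV B" and indep: "vec.independent B"
  obtains A' :: "'k ^ 'n ^ 'i" where "A' ** (\<chi> i j. a j $ i) = mat 1"
proof -
  have inj: "inj a" and ran: "range a = B" using a by (auto simp: bij_betw_def)
  have fB: "finite B" using ran by (metis finite finite_imageI)
  let ?A = "\<chi> i j. a j $ i"
  have "\<forall>c. (\<Sum>i\<in>UNIV. c i *s column i ?A) = 0 \<longrightarrow> (\<forall>i. c i = 0)"
  proof (intro allI impI)
    fix c i assume "(\<Sum>i\<in>UNIV. c i *s column i ?A) = 0"
    then have "(\<Sum>i\<in>UNIV. c i *s a i) = 0" by (simp add: column_def)
    then have "(\<Sum>v\<in>B. c (inv a v) *s v) = 0"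
      using sum.reindex_bij_betw[OF a, of "\<lambda>v. c (inv a v) *s v"] inj by simp
    then have "c (inv a (a i)) = 0" by (rule vec.independentD[OF indep fB subset_refl]) (use ran in blast)
    then show "c i = 0" using inj by simp
  qed
  then have "\<exists>A' :: 'k ^ 'n ^ 'i. A' ** ?A = mat 1"
    by (rule iffD2[OF matrix_left_invertible_independent_columns])
  then show ?thesis using that by (elim exE)
qed

text \<open>
  A basis of the subspace and a left inverse of it give a projection onto the subspace that
  factors through \<open>'k ^ 3\<close>.
\<close>

lemma subspace_projection:
  fixes S :: "('k::field ^ 'a::finite) set"
  assumes "vec.subspace S" "vec.dim S = 3"
  obtains A :: "'k ^ 3 ^ 'a" and A' :: "'k ^ 'a ^ 3" where
    "\<forall>x\<in>S. A *v (A' *v x) = x" "\<forall>v. A *v v \<in> S"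
proof -
  obtain B where B: "B \<subseteq> S" "vec.independent B" "S \<subseteq> vec.span B" "card B = 3"
    using vec.basis_exists[of S] assms(2) by metis
  have fB: "finite B" using B(4) by (metis card.infinite zero_neq_numeral)
  have "card (UNIV :: 3 set) = card B" using B(4) by simp
  then obtain a :: "3 \<Rightarrow> 'k ^ 'a" where a: "bij_betw a UNIV B"
    using finite_same_card_bij[OF finite fB] by blast
  define A :: "'k ^ 3 ^ 'a" where "A = (\<chi> i j. a j $ i)"
  have Av: "A *v v = (\<Sum>j\<in>UNIV. v $ j *s a j)" for v
    by (simp add: A_def matrix_vector_mult_def vec_eq_iff mult.commute)
  have inj: "inj a" and ran: "range a = B" using a by (auto simp: bij_betw_def)
  obtain A' :: "'k ^ 'a ^ 3" where A': "A' ** A = mat 1"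
    unfolding A_def by (rule independent_left_inverse[OF a B(2)])
  have "A *v v \<in> S" for v
    unfolding Av using B(1) ran by (intro vec.subspace_sum vec.subspace_scale assms(1)) auto
  moreover have "A *v (A' *v x) = x" if "x \<in> S" for x
  proof -
    have "x \<in> vec.span (range a)" using that B(3) ran by blast
    then obtain v where "x = A *v v"
    proof (induction arbitrary: thesis rule: vec.span_induct_alt)
      case base then show ?case using matrix_vector_mult_0_right by metis
    next
      case (step c y z)
      obtain i where "y = a i" using step(1) by blast
      then have y: "y = A *v axis i 1"
        by (simp add: vec_eq_iff A_def matrix_vector_mult_def axis_def if_distrib[of "\<lambda>x. _ * x"] cong: if_cong)
      obtain v where z: "z = A *v v" using step(2) by blast
      have "c *s y + z = A *v (c *s axis i 1 + v)"
        by (simp add: y z matrix_vector_right_distrib vector_scalar_commute)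
      then show ?case by (rule step(3))
    qed
    then have "A *v (A' *v x) = A *v ((A' ** A) *v v)" by (simp add: matrix_vector_mul_assoc)
    also have "\<dots> = x" by (simp add: A' \<open>x = A *v v\<close>)
    finally show ?thesis .
  qed
  ultimately show ?thesis using that by blast
qed

text \<open>
  The definition of the subspace variety asks for dimension exactly three, so smaller subspaces
  have to be enlarged, which the lower bound on the dimensions of the factors allows.
\<close>

lemma subspace_of_dim_3:
  fixes R :: "('k::field ^ 'a::finite) set"
  assumes "vec.subspace R" "vec.dim R \<le> 3" "CARD('a) \<ge> 3"
  obtains S where "vec.subspace S" "R \<subseteq> S" "vec.dim S = 3"
proof -
  obtain B where B: "B \<subseteq> R" "vec.independent B" "R \<subseteq> vec.span B" "card B = vec.dim R"
    by (rule vec.basis_exists)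
  obtain C where C: "B \<subseteq> C" "vec.independent C" "UNIV \<subseteq> vec.span C"
    using vec.maximal_independent_subset_extend[of B UNIV] B(2) by auto
  have "card C = CARD('a)"
    using vec.dim_unique[of C UNIV "card C"] C vec.dim_UNIV by (simp add: card_cart_basis) 
  moreover have finC: "finite C" using C(2) by (rule vec.finiteI_independent)
  ultimately obtain D where D: "B \<subseteq> D" "D \<subseteq> C" "card D = 3"
    using exists_subset_between[of B 3 C] B(4) C(1) assms(2,3) by auto
  show ?thesis
  proof
    show "vec.subspace (vec.span D)" by simp
    show "R \<subseteq> vec.span D" using B(3) D(1) vec.span_mono by blast
    show "vec.dim (vec.span D) = 3"
      using C(2) D(2,3) vec.independent_mono vec.dim_eq_card_independent by (metis vec.dim_span)
  qed
qed

text \<open>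
  A tensor in the subspace variety can be compressed to a three by three by three tensor and
  recovered from it, so that the question reduces to that format.
\<close>

lemma SubD:
  fixes T :: "'k::field ^ ('a::finite \<times> 'b::finite \<times> 'c::finite)"
  assumes "pt T \<in> Sub 3 3 3" "T \<noteq> 0"
  obtains A :: "'k ^ 3 ^ 'a" and A' B C and B' :: "'k ^ 'b ^ 3" and C' :: "'k ^ 'c ^ 3"
  where "T = tmap A B C (tmap A' B' C' T)"
proof -
  obtain T' SA SB SC where T': "pt T = pt T'" "T' \<noteq> 0"
    and s: "vec.subspace SA" "vec.subspace SB" "vec.subspace SC"
      "vec.dim SA = 3" "vec.dim SB = 3" "vec.dim SC = 3"
    and sp: "T' \<in> vec.span {tensor3 x y z |x y z. x \<in> SA \<and> y \<in> SB \<and> z \<in> SC}"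
    using assms(1) unfolding Sub_def by blast
  obtain c where c: "T = c *s T'" using pt_eqD[OF T'(1) assms(2)] by blast
  obtain A :: "'k ^ 3 ^ 'a" and A' where A: "\<forall>x\<in>SA. A *v (A' *v x) = x"
    by (rule subspace_projection[OF s(1,4)])
  obtain B :: "'k ^ 3 ^ 'b" and B' where B: "\<forall>x\<in>SB. B *v (B' *v x) = x"
    by (rule subspace_projection[OF s(2,5)])
  obtain C :: "'k ^ 3 ^ 'c" and C' where C: "\<forall>x\<in>SC. C *v (C' *v x) = x"
    by (rule subspace_projection[OF s(3,6)])
  have "T \<in> vec.span {tensor3 x y z |x y z. x \<in> SA \<and> y \<in> SB \<and> z \<in> SC}"
    unfolding c using sp by (rule vec.span_scale)
  then have eq: "tmap (A ** A') (B ** B') (C ** C') T = T"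
    by (rule tmap_fixes_span) (use A B C in \<open>auto simp: tmap_tensor3 simp flip: matrix_vector_mul_assoc\<close>)
  show ?thesis by (rule that[of A B C A' B' C']) (simp add: tmap_tmap eq)
qed

text \<open>
  A matrix of rank four has four independent vectors in its image; preimages of these and a left
  inverse give a generalized minor equal to the determinant of the identity.
\<close>

lemma rank_le3_of_minors:
  fixes M :: "'k::field ^ 'm::finite ^ 'n::finite"
  assumes "\<And>(e :: 4 \<Rightarrow> 'k ^ 'n) (f :: 4 \<Rightarrow> 'k ^ 'm). det (\<chi> s t. \<Sum>i\<in>UNIV. \<Sum>j\<in>UNIV. e s $ i * f t $ j * M $ i $ j) = 0"
  shows "vec.dim (range ((*v) M)) \<le> 3"
proof (rule ccontr)
  assume "\<not> ?thesis"
  then have d: "4 \<le> vec.dim (range ((*v) M))" by simp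
  obtain B where B: "B \<subseteq> range ((*v) M)" "vec.independent B" "range ((*v) M) \<subseteq> vec.span B"
      "card B = vec.dim (range ((*v) M))" by (rule vec.basis_exists)
  obtain D where D: "D \<subseteq> B" "card D = 4" using d B(4) obtain_subset_with_card_n by metis
  have fD: "finite D" using D(2) by (metis card.infinite zero_neq_numeral)
  have indD: "vec.independent D" using B(2) D(1) vec.independent_mono by blast
  have "card (UNIV :: 4 set) = card D" using D(2) by simp
  then obtain a :: "4 \<Rightarrow> 'k ^ 'n" where a: "bij_betw a UNIV D"
    using finite_same_card_bij[OF finite fD] by blast
  have inj: "inj a" and ran: "range a = D" using a by (auto simp: bij_betw_def)
  have "\<exists>f. a t = M *v f" for t using ran D(1) B(1) by blast
  then obtain f where f: "\<And>t. a t = M *v f t" by metis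
  define A :: "'k ^ 4 ^ 'n" where "A = (\<chi> i j. a j $ i)"
  obtain A' :: "'k ^ 'n ^ 4" where A': "A' ** A = mat 1"
    unfolding A_def by (rule independent_left_inverse[OF a indD])
  have "(\<chi> s t. \<Sum>i\<in>UNIV. \<Sum>j\<in>UNIV. A' $ s $ i * f t $ j * M $ i $ j) = A' ** A"
    by (simp add: vec_eq_iff matrix_matrix_mult_def A_def f matrix_vector_mult_def sum_distrib_left mult_ac)
  then have "det (A' ** A) = 0" using assms[of "\<lambda>s. A' $ s" f] by simp
  then show False by (simp add: A')
qed

text \<open>
  The matrix of the four by four minor factors through \<open>'k ^ 3\<close>; the factors are
  padded to square matrices with a zero column.
\<close>

lemma minors_of_rank_le3:
  fixes u :: "3 \<Rightarrow> 'k::field ^ 'n::finite" and w :: "3 \<Rightarrow> 'k ^ 'm::finite" and e :: "4 \<Rightarrow> 'k ^ 'n"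
    and f :: "4 \<Rightarrow> 'k ^ 'm"
  assumes "\<And>i j. M i j = (\<Sum>r\<in>UNIV. u r $ i * w r $ j)"
  shows "det ((\<chi> s t. \<Sum>i\<in>UNIV. \<Sum>j\<in>UNIV. e s $ i * f t $ j * M i j) :: 'k ^ 4 ^ 4) = 0"
proof -
  define p where "p s r = (\<Sum>i\<in>UNIV. e s $ i * u r $ i)" for s r
  define q where "q t r = (\<Sum>j\<in>UNIV. f t $ j * w r $ j)" for t r
  define P :: "'k ^ 4 ^ 4" where
    "P = (\<chi> s r. if r = 0 then p s 0 else if r = 1 then p s 1 else if r = 2 then p s 2 else 0)"
  define Q :: "'k ^ 4 ^ 4" where
    "Q = (\<chi> r t. if r = 0 then q t 0 else if r = 1 then q t 1 else if r = 2 then q t 2 else 0)"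
  have "(\<Sum>i\<in>UNIV. \<Sum>j\<in>UNIV. e s $ i * f t $ j * M i j) = (\<Sum>r\<in>UNIV. p s r * q t r)" for s t
  proof -
    have "(\<Sum>i\<in>UNIV. \<Sum>j\<in>UNIV. e s $ i * f t $ j * M i j)
       = (\<Sum>i\<in>UNIV. \<Sum>j\<in>UNIV. \<Sum>r\<in>UNIV. (e s $ i * u r $ i) * (f t $ j * w r $ j))"
      by (simp add: assms sum_distrib_left mult_ac)
    also have "\<dots> = (\<Sum>i\<in>UNIV. \<Sum>r\<in>UNIV. \<Sum>j\<in>UNIV. (e s $ i * u r $ i) * (f t $ j * w r $ j))"
      by (intro sum.cong refl sum.swap)
    also have "\<dots> = (\<Sum>r\<in>UNIV. \<Sum>i\<in>UNIV. \<Sum>j\<in>UNIV. (e s $ i * u r $ i) * (f t $ j * w r $ j))"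
      by (rule sum.swap)
    also have "\<dots> = (\<Sum>r\<in>UNIV. p s r * q t r)" by (simp add: p_def q_def sum_product)
    finally show ?thesis .
  qed
  moreover have "(P ** Q) $ s $ t = (\<Sum>r\<in>UNIV. p s r * q t r)" for s t
    by (simp add: matrix_matrix_mult_def sum_4 sum_UNIV_3 P_def Q_def add_ac)
  ultimately have "(\<chi> s t. \<Sum>i\<in>UNIV. \<Sum>j\<in>UNIV. e s $ i * f t $ j * M i j) = P ** Q"
    by (simp add: vec_eq_iff)
  moreover have "det P = 0" by (rule det_zero_column(2)[of 3]) (simp add: column_def P_def vec_eq_iff)
  ultimately show ?thesis by (simp add: det_mul)
qed

text \<open>
  The flattening whose minors span the exterior power module.
\<close>

definition flat :: "('x \<Rightarrow> 'y \<Rightarrow> 'v) \<Rightarrow> 'k ^ 'v \<Rightarrow> 'k ^ 'y::finite ^ 'x::finite" where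
  "flat \<iota> T = (\<chi> i j. T $ \<iota> i j)"

lemma peval_det: "peval (det M) x = det (\<chi> s t. peval (M $ s $ t) x)"
  by (simp add: det_def)

lemma ext4_vanish_iff:
  fixes T :: "'k::field ^ 'v::finite" and \<iota> :: "'x::finite \<Rightarrow> 'y::finite \<Rightarrow> 'v"
  shows "(\<forall>p\<in>ext4_module \<iota>. peval p T = 0) \<longleftrightarrow>
   (\<forall>(e :: 4 \<Rightarrow> 'k ^ 'x) (f :: 4 \<Rightarrow> 'k ^ 'y).
      det ((\<chi> s t. \<Sum>i\<in>UNIV. \<Sum>j\<in>UNIV. e s $ i * f t $ j * T $ \<iota> i j) :: 'k ^ 4 ^ 4) = 0)"
proof -
  let ?g = "\<lambda>e f. det ((\<chi> s t. \<Sum>i\<in>UNIV. \<Sum>j\<in>UNIV. pscale ((e :: 4 \<Rightarrow> 'k ^ 'x) s $ i * (f :: 4 \<Rightarrow> 'k ^ 'y) t $ j)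
     (pvar (\<iota> i j))) :: ('v, 'k) mpoly ^ 4 ^ 4)"
  have g: "peval (?g e f) T = det ((\<chi> s t. \<Sum>i\<in>UNIV. \<Sum>j\<in>UNIV. e s $ i * f t $ j * T $ \<iota> i j) :: 'k ^ 4 ^ 4)" for e f
    by (simp add: peval_det)
  have "(\<forall>p\<in>ext4_module \<iota>. peval p T = 0) \<longleftrightarrow> (\<forall>e f. peval (?g e f) T = 0)"
  proof
    assume "\<forall>p\<in>ext4_module \<iota>. peval p T = 0"
    moreover have "?g e f \<in> ext4_module \<iota>" for e f
      unfolding ext4_module_def by (intro mpoly.span_base CollectI exI conjI) auto
    ultimately show "\<forall>e f. peval (?g e f) T = 0" by blast
  next
    assume a: "\<forall>e f. peval (?g e f) T = 0"
    have "peval p T = 0" if "p \<in> ext4_module \<iota>" for p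
      using that unfolding ext4_module_def
      by (induction rule: mpoly.span_induct_alt) (use a in \<open>auto\<close>)
    then show "\<forall>p\<in>ext4_module \<iota>. peval p T = 0" by blast
  qed
  then show ?thesis unfolding g .
qed

lemma homogeneous_uminus: "homogeneous d p \<Longrightarrow> homogeneous d (- p)"
  by (simp add: homogeneous_def)

lemma homogeneous_ext4:
  fixes \<iota> :: "'x::finite \<Rightarrow> 'y::finite \<Rightarrow> 'v::finite" and p :: "('v, 'k::field) mpoly"
  assumes "p \<in> ext4_module \<iota>"
  shows "homogeneous 4 p"
  using assms unfolding ext4_module_def
proof (induction rule: mpoly.span_induct_alt)
  case base show ?case by (rule homogeneous_0)
next
  case (step c p q)
  have det: "homogeneous 4 (det M)" if M: "\<And>s t. homogeneous 1 (M $ s $ t)" for M :: "('v, 'k) mpoly ^ 4 ^ 4"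
  proof -
    have 1: "homogeneous 4 (\<Prod>s\<in>UNIV. M $ s $ \<pi> s)" for \<pi>
      using homogeneous_prod[of "UNIV :: 4 set" "\<lambda>_. 1" "\<lambda>s. M $ s $ \<pi> s"] M by simp
    have "homogeneous 4 (of_int (sign \<pi>) * (\<Prod>s\<in>UNIV. M $ s $ \<pi> s))" for \<pi>
      using 1[of \<pi>] homogeneous_uminus[OF 1[of \<pi>]] by (cases rule: sign_cases[of \<pi>]) simp_all
    then show ?thesis unfolding det_def by (intro homogeneous_sum)
  qed
  have "homogeneous 4 p" using step(1)
    by (auto intro!: det homogeneous_sum homogeneous_pscale homogeneous_pvar[unfolded One_nat_def])
  then show ?case using step(2) by (intro homogeneous_add homogeneous_pscale)
qed

lemma tmap_slices2: "tmap (mat 1) h (mat 1) T $ (i, j, k) = (\<Sum>j'\<in>UNIV. h $ j $ j' * T $ (i, j', k))"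
proof -
  have "(\<Sum>i'\<in>UNIV. \<Sum>j'\<in>UNIV. \<Sum>k'\<in>UNIV. mat 1 $ i $ i' * h $ j $ j' * mat 1 $ k $ k' * T $ (i', j', k'))
      = (\<Sum>i'\<in>UNIV. mat 1 $ i $ i' * (\<Sum>j'\<in>UNIV. \<Sum>k'\<in>UNIV. mat 1 $ k $ k' * (h $ j $ j' * T $ (i', j', k'))))"
    by (simp add: sum_distrib_left mult_ac)
  then show ?thesis by (simp add: tmap_def sum_mat_1)
qed

lemma tmap_slices3: "tmap (mat 1) (mat 1) l T $ (i, j, k) = (\<Sum>k'\<in>UNIV. l $ k $ k' * T $ (i, j, k'))"
proof -
  have "(\<Sum>i'\<in>UNIV. \<Sum>j'\<in>UNIV. \<Sum>k'\<in>UNIV. mat 1 $ i $ i' * mat 1 $ j $ j' * l $ k $ k' * T $ (i', j', k'))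
      = (\<Sum>i'\<in>UNIV. mat 1 $ i $ i' * (\<Sum>j'\<in>UNIV. mat 1 $ j $ j' * (\<Sum>k'\<in>UNIV. l $ k $ k' * T $ (i', j', k'))))"
    by (simp add: sum_distrib_left mult_ac)
  then show ?thesis by (simp add: tmap_def sum_mat_1)
qed

lemma flat_column: "(\<chi> i. T $ \<iota> i j) \<in> range ((*v) (flat \<iota> T :: 'k::comm_ring_1 ^ 'y::finite ^ 'x::finite))"
proof
  show "(\<chi> i. T $ \<iota> i j) = flat \<iota> T *v axis j 1"
    by (simp add: vec_eq_iff flat_def matrix_vector_mult_def axis_def if_distrib[of "\<lambda>x. _ * x"] cong: if_cong)
qed simp

text \<open>
  The columns of a flattening with vanishing minors lie in a three dimensional subspace.
\<close>

lemma ext4_support: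
  fixes T :: "'k::field ^ 'v::finite" and \<iota> :: "'x::finite \<Rightarrow> 'y::finite \<Rightarrow> 'v"
  assumes "\<forall>p\<in>ext4_module \<iota>. peval p T = 0" "CARD('x) \<ge> 3"
  obtains S A A' where "vec.subspace S" "vec.dim S = 3" "\<forall>v. (A :: 'k ^ 3 ^ 'x) *v v \<in> S"
    "\<forall>j. (A ** A') *v (\<chi> i. T $ \<iota> i j) = (\<chi> i. T $ \<iota> i j)"
proof -
  have "vec.dim (range ((*v) (flat \<iota> T))) \<le> 3"
    using assms(1) unfolding ext4_vanish_iff by (intro rank_le3_of_minors) (simp add: flat_def)
  moreover have "vec.subspace (range ((*v) (flat \<iota> T)))"
    by (rule vec.subspace_image[OF vec.subspace_UNIV])
  ultimately obtain S where S: "vec.subspace S" "range ((*v) (flat \<iota> T)) \<subseteq> S" "vec.dim S = 3"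
    using subspace_of_dim_3 assms(2) by metis
  obtain A :: "'k ^ 3 ^ 'x" and A' where A: "\<forall>x\<in>S. A *v (A' *v x) = x" "\<forall>v. A *v v \<in> S"
    by (rule subspace_projection[OF S(1,3)])
  have "(A ** A') *v (\<chi> i. T $ \<iota> i j) = (\<chi> i. T $ \<iota> i j)" for j
    using A(1) subsetD[OF S(2) flat_column] by (simp flip: matrix_vector_mul_assoc)
  then show ?thesis using that S(1,3) A(2) by blast
qed

text \<open>
  The projections onto the supports in the three factors each fix the tensor, hence so does
  their product.
\<close>

lemma Sub_if_ext4_vanish:
  fixes T :: "'k::field ^ ('a::finite \<times> 'b::finite \<times> 'c::finite)"
  assumes "CARD('a) \<ge> 3" "CARD('b) \<ge> 3" "CARD('c) \<ge> 3" "T \<noteq> 0"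
    and v: "\<forall>p\<in>ext4_A. peval p T = 0" "\<forall>p\<in>ext4_B. peval p T = 0" "\<forall>p\<in>ext4_C. peval p T = 0"
  shows "pt T \<in> Sub 3 3 3"
proof -
  obtain SA A A' where SA: "vec.subspace SA" "vec.dim SA = 3" "\<forall>v. (A :: 'k ^ 3 ^ 'a) *v v \<in> SA"
    and A: "\<forall>j. (A ** A') *v (\<chi> i. T $ (case j of (j, k) \<Rightarrow> (i, j, k))) = (\<chi> i. T $ (case j of (j, k) \<Rightarrow> (i, j, k)))"
    by (rule ext4_support[OF v(1)[unfolded ext4_A_def] assms(1)])
  obtain SB B B' where SB: "vec.subspace SB" "vec.dim SB = 3" "\<forall>v. (B :: 'k ^ 3 ^ 'b) *v v \<in> SB"
    and B: "\<forall>i. (B ** B') *v (\<chi> j. T $ (case i of (i, k) \<Rightarrow> (i, j, k))) = (\<chi> j. T $ (case i of (i, k) \<Rightarrow> (i, j, k)))"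
    by (rule ext4_support[OF v(2)[unfolded ext4_B_def] assms(2)])
  obtain SC C C' where SC: "vec.subspace SC" "vec.dim SC = 3" "\<forall>v. (C :: 'k ^ 3 ^ 'c) *v v \<in> SC"
    and C: "\<forall>i. (C ** C') *v (\<chi> k. T $ (case i of (i, j) \<Rightarrow> (i, j, k))) = (\<chi> k. T $ (case i of (i, j) \<Rightarrow> (i, j, k)))"
    by (rule ext4_support[OF v(3)[unfolded ext4_C_def] assms(3)])
  have "(\<Sum>i'\<in>UNIV. (A ** A') $ i $ i' * T $ (i', j, k)) = T $ (i, j, k)" for i j k
    using spec[OF A, of "(j, k)"] by (simp add: vec_eq_iff matrix_vector_mult_def)
  then have a: "tmap (A ** A') (mat 1) (mat 1) T = T" by (auto simp: vec_eq_iff tmap_slices)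
  have "(\<Sum>j'\<in>UNIV. (B ** B') $ j $ j' * T $ (i, j', k)) = T $ (i, j, k)" for i j k
    using spec[OF B, of "(i, k)"] by (simp add: vec_eq_iff matrix_vector_mult_def)
  then have b: "tmap (mat 1) (B ** B') (mat 1) T = T" by (auto simp: vec_eq_iff tmap_slices2)
  have "(\<Sum>k'\<in>UNIV. (C ** C') $ k $ k' * T $ (i, j, k')) = T $ (i, j, k)" for i j k
    using spec[OF C, of "(i, j)"] by (simp add: vec_eq_iff matrix_vector_mult_def)
  then have c: "tmap (mat 1) (mat 1) (C ** C') T = T" by (auto simp: vec_eq_iff tmap_slices3)
  have "tmap (A ** A') (B ** B') (C ** C') T
     = tmap (A ** A') (mat 1) (mat 1) (tmap (mat 1) (B ** B') (mat 1) (tmap (mat 1) (mat 1) (C ** C') T))"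
    by (simp add: tmap_tmap)
  then have T: "T = tmap A B C (tmap A' B' C' T)" by (simp add: a b c tmap_tmap)
  let ?X = "{tensor3 x y z |x y z. x \<in> SA \<and> y \<in> SB \<and> z \<in> SC}"
  have "tmap A B C t \<in> vec.span ?X" for t
    by (subst tensor_expansion[of t], unfold tmap_sum tmap_tensor3)
       (intro vec.span_sum vec.span_base CollectI exI conjI refl; use SA SB SC in blast)
  then have "T \<in> vec.span ?X" by (subst T)
  then show ?thesis unfolding Sub_def using SA SB SC assms(4) by blast
qed

lemma sec3_ext4:
  fixes T :: "'k::field ^ ('a::finite \<times> 'b::finite \<times> 'c::finite)"
  assumes "sec3 T"
  shows "\<forall>p\<in>ext4_A \<union> ext4_B \<union> ext4_C. peval p T = 0"
proof
  fix p :: "('a \<times> 'b \<times> 'c, 'k) mpoly" assume p: "p \<in> ext4_A \<union> ext4_B \<union> ext4_C"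
  have "homogeneous 4 p" using p unfolding ext4_A_def ext4_B_def ext4_C_def
    by (elim UnE) (rule homogeneous_ext4, assumption)+
  then have "hpf 4 (peval p)" by (rule hpf_peval)
  moreover have "peval p X = 0" if "rank_le3 X" for X
  proof -
    obtain x y z where X: "X = (\<Sum>i\<in>(UNIV :: 3 set). tensor3 (x i) (y i) (z i))"
      using \<open>rank_le3 X\<close> unfolding rank_le3_def by blast
    have 1: "\<forall>q\<in>ext4_A. peval q X = 0"
      unfolding ext4_A_def ext4_vanish_iff
      by (intro allI minors_of_rank_le3[where u = x and w = "\<lambda>r. \<chi> p. y r $ fst p * z r $ snd p"])
         (auto simp: X tensor3_def mult_ac)
    have 2: "\<forall>q\<in>ext4_B. peval q X = 0"
      unfolding ext4_B_def ext4_vanish_iff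
      by (intro allI minors_of_rank_le3[where u = y and w = "\<lambda>r. \<chi> p. x r $ fst p * z r $ snd p"])
         (auto simp: X tensor3_def mult_ac)
    have 3: "\<forall>q\<in>ext4_C. peval q X = 0"
      unfolding ext4_C_def ext4_vanish_iff
      by (intro allI minors_of_rank_le3[where u = z and w = "\<lambda>r. \<chi> p. x r $ fst p * y r $ snd p"])
         (auto simp: X tensor3_def mult_ac)
    show ?thesis using 1 2 3 p by blast
  qed
  ultimately show "peval p T = 0" by (rule sec3_hpf[OF assms])
qed

section \<open>The commutation conditions\<close>

lemma ext_power_2:
  fixes M :: "'k::field_char_0 ^ ('b::finite \<times> 'c::finite)"
  shows "ext_power 2 M J L = M $ (J 0, L 0) * M $ (J 1, L 1) - M $ (J 0, L 1) * M $ (J 1, L 0)"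
proof -
  have "{..<2::nat} = {0, 1}" by auto
  then have P: "{\<rho>. \<rho> permutes {..<2::nat}} = {id, Transposition.transpose 0 1}"
    by (auto simp: permutes_doubleton_iff)
  have "id \<noteq> (Transposition.transpose 0 1 :: nat \<Rightarrow> nat)"
    by (metis id_apply transpose_apply_first zero_neq_one)
  then show ?thesis unfolding ext_power_minor P
    by (simp add: sign_swap_id lessThan_Suc numeral_2_eq_2)
qed

text \<open>
  The arguments \<open>f\<close>, \<open>g\<close>, \<open>h\<close> stand for the contractions
  with \<open>\<alpha>\<close>, \<open>\<alpha>1\<close>, \<open>\<alpha>2\<close>. Its upper
  left entry is the coordinate of \<open>psi\<close> with indices \<open>b0, b1, b2\<close>,
  \<open>b\<close>, \<open>c\<close>, \<open>c0, c1, c2\<close>; the outer matrices only select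
  a row and a column, so that \<open>psi\<close> turns into an entry of a product with an
  adjugate.
\<close>

definition psi_matrix :: "('b \<Rightarrow> 'c \<Rightarrow> 'k::comm_ring_1) \<Rightarrow> ('b \<Rightarrow> 'c \<Rightarrow> 'k) \<Rightarrow> ('b \<Rightarrow> 'c \<Rightarrow> 'k)
    \<Rightarrow> 'b \<Rightarrow> 'b \<Rightarrow> 'b \<Rightarrow> 'b \<Rightarrow> 'c \<Rightarrow> 'c \<Rightarrow> 'c \<Rightarrow> 'c \<Rightarrow> 'k ^ 3 ^ 3" where
  "psi_matrix f g h b0 b1 b2 b c c0 c1 c2 =
     m33 (h b c0) (h b c1) (h b c2) 0 0 0 0 0 0 **
     adj3 (m33 (f b0 c0) (f b0 c1) (f b0 c2) (f b1 c0) (f b1 c1) (f b1 c2) (f b2 c0) (f b2 c1) (f b2 c2)) **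
     m33 (g b0 c) 0 0 (g b1 c) 0 0 (g b2 c) 0 0"

lemma psi_3:
  fixes T :: "'k::field_char_0 ^ ('a::finite \<times> 'b::finite \<times> 'c::finite)"
  shows "psi 3 \<alpha> \<alpha>1 \<alpha>2 T J j k L = psi_matrix (\<lambda>b c. contract T \<alpha> $ (b, c)) (\<lambda>b c. contract T \<alpha>1 $ (b, c))
    (\<lambda>b c. contract T \<alpha>2 $ (b, c)) (J 0) (J 1) (J 2) j k (L 0) (L 1) (L 2) $ 0 $ 0"
proof -
  have 2: "(3::nat) - 1 = 2" by simp
  have s: "{..2::nat} = {0, 1, 2}" by auto
  show ?thesis
    unfolding psi_def wedge_left_def wedge_right_def 2 ext_power_2 s psi_matrix_def m33_adj3 m33_mult m33_nth
    by (simp add: omit_def algebra_simps numeral_2_eq_2)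
qed

text \<open>
  On a sum of three decomposable tensors all contractions are \<open>B D C\<close> with
  \<open>D\<close> diagonal, and the adjugate cancels the inner factors up to the scalar
  \<open>det B * det C\<close>.
\<close>

lemma rank_le3_commuting:
  fixes T :: "'k::field_char_0 ^ ('a::finite \<times> 'b::finite \<times> 'c::finite)"
  assumes "rank_le3 T"
  shows "commuting 3 T"
  unfolding commuting_def
proof (intro allI ext)
  fix \<alpha> \<alpha>1 \<alpha>2 :: "'k ^ 'a" and J :: "nat \<Rightarrow> 'b" and j k and L :: "nat \<Rightarrow> 'c"
  obtain x y z where T: "T = (\<Sum>i\<in>(UNIV :: 3 set). tensor3 (x i) (y i) (z i))"
    using assms unfolding rank_le3_def by blast
  define d where "d \<alpha> i = (\<Sum>l\<in>UNIV. \<alpha> $ l * x i $ l)" for \<alpha> :: "'k ^ 'a" and i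
  define D where "D \<alpha> = m33 (d \<alpha> 0) 0 0 0 (d \<alpha> 1) 0 0 0 (d \<alpha> 2)" for \<alpha>
  have con: "contract T \<alpha> $ (b, c) = d \<alpha> 0 * y 0 $ b * z 0 $ c + d \<alpha> 1 * y 1 $ b * z 1 $ c + d \<alpha> 2 * y 2 $ b * z 2 $ c"
    for \<alpha> b c
    by (simp add: contract_def T sum_UNIV_3 tensor3_def d_def distrib_left sum.distrib sum_distrib_left
        sum_distrib_right mult_ac)
  define Bj where "Bj = m33 (y 0 $ j) (y 1 $ j) (y 2 $ j) 0 0 0 0 0 0"
  (* Rows and columns of the contractions that are named by the multi-indices. *)
  define B where "B = m33 (y 0 $ J 0) (y 1 $ J 0) (y 2 $ J 0) (y 0 $ J 1) (y 1 $ J 1) (y 2 $ J 1) (y 0 $ J 2) (y 1 $ J 2) (y 2 $ J 2)"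
  define Ck where "Ck = m33 (z 0 $ k) 0 0 (z 1 $ k) 0 0 (z 2 $ k) 0 0"
  define C where "C = m33 (z 0 $ L 0) (z 0 $ L 1) (z 0 $ L 2) (z 1 $ L 0) (z 1 $ L 1) (z 1 $ L 2) (z 2 $ L 0) (z 2 $ L 1) (z 2 $ L 2)"
  have psi: "psi 3 \<alpha> \<beta> \<gamma> T J j k L = (Bj ** D \<gamma> ** C ** adj3 (B ** D \<alpha> ** C) ** (B ** D \<beta> ** Ck)) $ 0 $ 0" for \<beta> \<gamma>
  proof -
    have 1: "m33 (contract T \<gamma> $ (j, L 0)) (contract T \<gamma> $ (j, L 1)) (contract T \<gamma> $ (j, L 2)) 0 0 0 0 0 0 = Bj ** D \<gamma> ** C"
      by (simp add: Bj_def D_def C_def m33_mult m33_eq_iff con mult_ac)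
    have 2: "m33 (contract T \<beta> $ (J 0, k)) 0 0 (contract T \<beta> $ (J 1, k)) 0 0 (contract T \<beta> $ (J 2, k)) 0 0 = B ** D \<beta> ** Ck"
      by (simp add: B_def D_def Ck_def m33_mult m33_eq_iff con mult_ac)
    have 3: "m33 (contract T \<alpha> $ (J 0, L 0)) (contract T \<alpha> $ (J 0, L 1)) (contract T \<alpha> $ (J 0, L 2))
       (contract T \<alpha> $ (J 1, L 0)) (contract T \<alpha> $ (J 1, L 1)) (contract T \<alpha> $ (J 1, L 2))
       (contract T \<alpha> $ (J 2, L 0)) (contract T \<alpha> $ (J 2, L 1)) (contract T \<alpha> $ (J 2, L 2)) = B ** D \<alpha> ** C"
      by (simp add: B_def D_def C_def m33_mult m33_eq_iff con mult_ac)
    show ?thesis unfolding psi_3 psi_matrix_def 1 2 3 ..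
  qed
  have "Bj ** D \<gamma> ** C ** adj3 (B ** D \<alpha> ** C) ** (B ** D \<beta> ** Ck)
     = smul (det B * det C) (Bj ** (D \<gamma> ** adj3 (D \<alpha>) ** D \<beta>) ** Ck)" for \<beta> \<gamma>
  proof -
    have "Bj ** D \<gamma> ** C ** adj3 (B ** D \<alpha> ** C) ** (B ** D \<beta> ** Ck)
       = Bj ** D \<gamma> ** (C ** adj3 C) ** adj3 (D \<alpha>) ** (adj3 B ** B) ** D \<beta> ** Ck"
      by (simp add: adj3_mult matrix_mul_assoc)
    then show ?thesis by (simp add: adj3_left adj3_right mat_mult_smul smul_mult matrix_mul_assoc)
  qed
  moreover have "D \<gamma> ** adj3 (D \<alpha>) ** D \<beta> = D \<beta> ** adj3 (D \<alpha>) ** D \<gamma>" for \<beta> \<gamma>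
    by (simp add: D_def m33_adj3 m33_mult m33_eq_iff)
  ultimately show "psi 3 \<alpha> \<alpha>1 \<alpha>2 T J j k L = psi 3 \<alpha> \<alpha>2 \<alpha>1 T J j k L" unfolding psi by metis
qed

text \<open>
  The coordinates of \<open>psi\<close> are quartic polynomials in the tensor, so the condition
  passes to the closure.
\<close>

lemma sec3_commuting:
  fixes T :: "'k::field_char_0 ^ ('a::finite \<times> 'b::finite \<times> 'c::finite)"
  assumes "sec3 T"
  shows "commuting 3 T"
  unfolding commuting_def
proof (intro allI ext)
  fix \<alpha> \<alpha>1 \<alpha>2 :: "'k ^ 'a" and J :: "nat \<Rightarrow> 'b" and j k and L :: "nat \<Rightarrow> 'c"
  let ?f = "\<lambda>T. psi 3 \<alpha> \<alpha>1 \<alpha>2 T J j k L - psi 3 \<alpha> \<alpha>2 \<alpha>1 T J j k L"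
  have con: "hpf 1 (\<lambda>T :: 'k ^ ('a \<times> 'b \<times> 'c). contract T \<alpha> $ p)" for \<alpha> p
    by (cases p) (auto simp: contract_def intro!: hpf_sum hpf_scale hpf_coord_Suc)
  have "hpf (1 + (1 + 1) + 1) (\<lambda>T :: 'k ^ ('a \<times> 'b \<times> 'c). psi 3 \<alpha> \<beta> \<gamma> T J j k L)" for \<beta> \<gamma>
    unfolding psi_3 psi_matrix_def m33_adj3 m33_mult m33_nth mult_zero_left mult_zero_right
      add_0_right add_0_left
    by (intro hpf_add hpf_diff hpf_mult con)
  then have "hpf (1 + (1 + 1) + 1) ?f" by (intro hpf_diff)
  moreover have "?f X = 0" if "rank_le3 X" for X
    using rank_le3_commuting[OF that] unfolding commuting_def by simp
  ultimately have "?f T = 0" by (rule sec3_hpf[OF assms])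
  then show "psi 3 \<alpha> \<alpha>1 \<alpha>2 T J j k L = psi 3 \<alpha> \<alpha>2 \<alpha>1 T J j k L" by simp
qed

definition tev :: "'k::comm_ring_1 ^ ('a::finite \<times> 'b::finite \<times> 'c::finite) \<Rightarrow> 'k ^ 'a \<Rightarrow> 'k ^ 'b \<Rightarrow> 'k ^ 'c \<Rightarrow> 'k" where
  "tev T \<alpha> \<beta> \<gamma> = (\<Sum>i\<in>UNIV. \<Sum>j\<in>UNIV. \<Sum>k\<in>UNIV. \<alpha> $ i * \<beta> $ j * \<gamma> $ k * T $ (i, j, k))"

text \<open>
  The contraction of \<open>T\<close> with \<open>\<alpha>\<close>, evaluated on three vectors
  of each of the other two factors. Ranging over all triples of vectors makes the conditions
  below independent of bases.
\<close>

definition slice :: "'k::comm_ring_1 ^ ('a::finite \<times> 'b::finite \<times> 'c::finite) \<Rightarrow> (3 \<Rightarrow> 'k ^ 'b) \<Rightarrow> (3 \<Rightarrow> 'k ^ 'c)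
    \<Rightarrow> 'k ^ 'a \<Rightarrow> 'k ^ 3 ^ 3" where
  "slice T \<beta> \<gamma> \<alpha> = (\<chi> s t. tev T \<alpha> (\<beta> s) (\<gamma> t))"

definition strassen_tensor :: "'k::comm_ring_1 ^ ('a::finite \<times> 'b::finite \<times> 'c::finite) \<Rightarrow> bool" where
  "strassen_tensor T \<longleftrightarrow> (\<forall>\<beta> \<gamma> \<alpha>1 \<alpha> \<alpha>2. slice T \<beta> \<gamma> \<alpha>1 ** adj3 (slice T \<beta> \<gamma> \<alpha>) ** slice T \<beta> \<gamma> \<alpha>2
     = slice T \<beta> \<gamma> \<alpha>2 ** adj3 (slice T \<beta> \<gamma> \<alpha>) ** slice T \<beta> \<gamma> \<alpha>1)"

lemma tev_linear:
  "tev T (\<alpha> + \<alpha>') \<beta> \<gamma> = tev T \<alpha> \<beta> \<gamma> + tev T \<alpha>' \<beta> \<gamma>"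
  "tev T \<alpha> (\<beta> + \<beta>') \<gamma> = tev T \<alpha> \<beta> \<gamma> + tev T \<alpha> \<beta>' \<gamma>"
  "tev T \<alpha> \<beta> (\<gamma> + \<gamma>') = tev T \<alpha> \<beta> \<gamma> + tev T \<alpha> \<beta> \<gamma>'"
  "tev T (c *s \<alpha>) \<beta> \<gamma> = c * tev T \<alpha> \<beta> \<gamma>" "tev T \<alpha> (c *s \<beta>) \<gamma> = c * tev T \<alpha> \<beta> \<gamma>"
  "tev T \<alpha> \<beta> (c *s \<gamma>) = c * tev T \<alpha> \<beta> \<gamma>"
  by (simp_all add: tev_def algebra_simps sum.distrib sum_distrib_left)

lemma contract_tev: "contract T \<alpha> $ (j, k) = tev T \<alpha> (axis j 1) (axis k 1)"
proof -
  have "tev T \<alpha> (axis j 1) (axis k 1) = (\<Sum>i\<in>UNIV. \<Sum>j'\<in>UNIV. \<Sum>k'\<in>UNIV.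
     if k' = k then (if j' = j then \<alpha> $ i * T $ (i, j', k') else 0) else 0)"
    unfolding tev_def by (intro sum.cong refl) (auto simp: axis_def)
  then show ?thesis by (simp add: contract_def)
qed

definition linear_form :: "('k::comm_ring_1 ^ 'n::finite \<Rightarrow> 'k) \<Rightarrow> bool" where
  "linear_form h \<longleftrightarrow> (\<forall>x y. h (x + y) = h x + h y) \<and> (\<forall>c x. h (c *s x) = c * h x)"

lemma linear_form_zero_on_axes:
  assumes "linear_form h" "\<And>i. h (axis i 1) = 0"
  shows "h x = 0"
proof -
  have lin: "h (x + y) = h x + h y" "h (c *s x) = c * h x" for x y c
    using assms(1) unfolding linear_form_def by blast+
  have 0: "h 0 = 0" using lin(2)[of 0 0] by simp
  have "h (\<Sum>i\<in>I. f i) = (\<Sum>i\<in>I. h (f i))" for f and I :: "'b set"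
    by (induction I rule: infinite_finite_induct) (simp_all add: lin(1) 0)
  then have "h (\<Sum>i\<in>UNIV. x $ i *s axis i 1) = 0" by (simp add: lin(2) assms(2))
  then show ?thesis by (simp add: basis_expansion)
qed

lemma linear_form_intros:
  "linear_form f \<Longrightarrow> linear_form g \<Longrightarrow> linear_form (\<lambda>x. f x + g x)"
  "linear_form f \<Longrightarrow> linear_form g \<Longrightarrow> linear_form (\<lambda>x. f x - g x)"
  "linear_form f \<Longrightarrow> linear_form (\<lambda>x. f x * a)" "linear_form f \<Longrightarrow> linear_form (\<lambda>x. a * f x)"
  "linear_form (\<lambda>\<alpha>. tev T \<alpha> \<beta> \<gamma>)" "linear_form (\<lambda>\<beta>. tev T \<alpha> \<beta> \<gamma>)" "linear_form (\<lambda>\<gamma>. tev T \<alpha> \<beta> \<gamma>)"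
  unfolding linear_form_def by (simp_all add: tev_linear algebra_simps)

text \<open>
  The difference of the two sides of the commutation condition, as a multilinear form in eight
  vectors. The condition is given for basis vectors only, and multilinearity extends it to all
  vectors.
\<close>

definition comm_form where
  "comm_form T \<alpha> \<alpha>1 \<alpha>2 b0 b1 b2 b c c0 c1 c2 =
     psi_matrix (tev T \<alpha>) (tev T \<alpha>1) (tev T \<alpha>2) b0 b1 b2 b c c0 c1 c2 $ 0 $ 0
     - psi_matrix (tev T \<alpha>) (tev T \<alpha>2) (tev T \<alpha>1) b0 b1 b2 b c c0 c1 c2 $ 0 $ 0"

lemma comm_form_linear:
  "linear_form (\<lambda>b0. comm_form T \<alpha> \<alpha>1 \<alpha>2 b0 b1 b2 b c c0 c1 c2)"
  "linear_form (\<lambda>b1. comm_form T \<alpha> \<alpha>1 \<alpha>2 b0 b1 b2 b c c0 c1 c2)"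
  "linear_form (\<lambda>b2. comm_form T \<alpha> \<alpha>1 \<alpha>2 b0 b1 b2 b c c0 c1 c2)"
  "linear_form (\<lambda>b. comm_form T \<alpha> \<alpha>1 \<alpha>2 b0 b1 b2 b c c0 c1 c2)"
  "linear_form (\<lambda>c. comm_form T \<alpha> \<alpha>1 \<alpha>2 b0 b1 b2 b c c0 c1 c2)"
  "linear_form (\<lambda>c0. comm_form T \<alpha> \<alpha>1 \<alpha>2 b0 b1 b2 b c c0 c1 c2)"
  "linear_form (\<lambda>c1. comm_form T \<alpha> \<alpha>1 \<alpha>2 b0 b1 b2 b c c0 c1 c2)"
  "linear_form (\<lambda>c2. comm_form T \<alpha> \<alpha>1 \<alpha>2 b0 b1 b2 b c c0 c1 c2)"
  unfolding comm_form_def psi_matrix_def m33_adj3 m33_mult m33_nth mult_zero_left mult_zero_right add_0_right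
  by (intro linear_form_intros)+

lemma commuting_imp_strassen:
  fixes T :: "'k::field_char_0 ^ ('a::finite \<times> 'b::finite \<times> 'c::finite)"
  assumes "commuting 3 T"
  shows "strassen_tensor T"
proof -
  have main: "comm_form T \<alpha> \<alpha>1 \<alpha>2 b0 b1 b2 b c c0 c1 c2 = 0" for \<alpha> \<alpha>1 \<alpha>2 b0 b1 b2 b c c0 c1 c2
  proof -
    let ?D = "comm_form T \<alpha> \<alpha>1 \<alpha>2"
    have 0: "?D (axis j0 1) (axis j1 1) (axis j2 1) (axis j 1) (axis k 1) (axis k0 1) (axis k1 1) (axis k2 1) = 0"
      for j0 j1 j2 j k k0 k1 k2
    proof -
      let ?J = "\<lambda>n::nat. if n = 0 then j0 else if n = 1 then j1 else j2"
      let ?L = "\<lambda>n::nat. if n = 0 then k0 else if n = 1 then k1 else k2"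
      have "psi 3 \<alpha> \<alpha>1 \<alpha>2 T ?J j k ?L = psi 3 \<alpha> \<alpha>2 \<alpha>1 T ?J j k ?L"
        using assms unfolding commuting_def by metis
      then show ?thesis unfolding psi_3 by (simp add: contract_tev psi_matrix_def comm_form_def)
    qed
    have 1: "?D (axis j0 1) (axis j1 1) (axis j2 1) (axis j 1) (axis k 1) (axis k0 1) (axis k1 1) c2 = 0" for j0 j1 j2 j k k0 k1 c2
      by (rule linear_form_zero_on_axes[OF comm_form_linear(8) 0])
    have 2: "?D (axis j0 1) (axis j1 1) (axis j2 1) (axis j 1) (axis k 1) (axis k0 1) c1 c2 = 0" for j0 j1 j2 j k k0 c1 c2
      by (rule linear_form_zero_on_axes[OF comm_form_linear(7) 1])
    have 3: "?D (axis j0 1) (axis j1 1) (axis j2 1) (axis j 1) (axis k 1) c0 c1 c2 = 0" for j0 j1 j2 j k c0 c1 c2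
      by (rule linear_form_zero_on_axes[OF comm_form_linear(6) 2])
    have 4: "?D (axis j0 1) (axis j1 1) (axis j2 1) (axis j 1) c c0 c1 c2 = 0" for j0 j1 j2 j c c0 c1 c2
      by (rule linear_form_zero_on_axes[OF comm_form_linear(5) 3])
    have 5: "?D (axis j0 1) (axis j1 1) (axis j2 1) b c c0 c1 c2 = 0" for j0 j1 j2 b c c0 c1 c2
      by (rule linear_form_zero_on_axes[OF comm_form_linear(4) 4])
    have 6: "?D (axis j0 1) (axis j1 1) b2 b c c0 c1 c2 = 0" for j0 j1 b2 b c c0 c1 c2
      by (rule linear_form_zero_on_axes[OF comm_form_linear(3) 5])
    have 7: "?D (axis j0 1) b1 b2 b c c0 c1 c2 = 0" for j0 b1 b2 b c c0 c1 c2
      by (rule linear_form_zero_on_axes[OF comm_form_linear(2) 6])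
    show ?thesis by (rule linear_form_zero_on_axes[OF comm_form_linear(1) 7])
  qed
  have sl: "slice T \<beta> \<gamma> \<alpha> = m33 (tev T \<alpha> (\<beta> 0) (\<gamma> 0)) (tev T \<alpha> (\<beta> 0) (\<gamma> 1)) (tev T \<alpha> (\<beta> 0) (\<gamma> 2))
     (tev T \<alpha> (\<beta> 1) (\<gamma> 0)) (tev T \<alpha> (\<beta> 1) (\<gamma> 1)) (tev T \<alpha> (\<beta> 1) (\<gamma> 2))
     (tev T \<alpha> (\<beta> 2) (\<gamma> 0)) (tev T \<alpha> (\<beta> 2) (\<gamma> 1)) (tev T \<alpha> (\<beta> 2) (\<gamma> 2))" for \<beta> \<gamma> \<alpha>
    by (simp add: slice_def vec_eq_iff all_3)
  have "(slice T \<beta> \<gamma> \<alpha>2 ** adj3 (slice T \<beta> \<gamma> \<alpha>) ** slice T \<beta> \<gamma> \<alpha>1) $ s $ t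
     = psi_matrix (tev T \<alpha>) (tev T \<alpha>1) (tev T \<alpha>2) (\<beta> 0) (\<beta> 1) (\<beta> 2) (\<beta> s) (\<gamma> t) (\<gamma> 0) (\<gamma> 1) (\<gamma> 2) $ 0 $ 0"
    for \<beta> \<gamma> \<alpha>1 \<alpha> \<alpha>2 s t
  proof -
    have "(R ** A ** S) $ s $ t = (m33 (R$s$0) (R$s$1) (R$s$2) 0 0 0 0 0 0 ** A ** m33 (S$0$t) 0 0 (S$1$t) 0 0 (S$2$t) 0 0) $ 0 $ 0"
      for R A S :: "'k ^ 3 ^ 3"
      by (simp add: matrix_matrix_mult_def sum_UNIV_3)
    then show ?thesis unfolding psi_matrix_def sl[symmetric] by (simp add: slice_def)
  qed
  then show ?thesis unfolding strassen_tensor_def vec_eq_iff using main[unfolded comm_form_def] by simp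
qed

lemma slice_linear: "slice T \<beta> \<gamma> (\<alpha> + \<alpha>') = slice T \<beta> \<gamma> \<alpha> + slice T \<beta> \<gamma> \<alpha>'"
  "slice T \<beta> \<gamma> (c *s \<alpha>) = smul c (slice T \<beta> \<gamma> \<alpha>)"
  by (simp_all add: slice_def vec_eq_iff tev_linear)

text \<open>
  Compression to three dimensional factors, the theorem on nets, and extension back to the given
  factors.
\<close>

theorem strassen_Sub_imp_sec3:
  fixes T :: "'k::{alg_closed_field, field_char_0} ^ ('a::finite \<times> 'b::finite \<times> 'c::finite)"
  assumes "strassen_tensor T" "pt T \<in> Sub 3 3 3" "T \<noteq> 0"
  shows "sec3 T"
proof -
  obtain A :: "'k ^ 3 ^ 'a" and A' B C and B' :: "'k ^ 'b ^ 3" and C' :: "'k ^ 'c ^ 3"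
    where T: "T = tmap A B C (tmap A' B' C' T)" by (rule SubD[OF assms(2,3)])
  let ?X = "\<lambda>i. slice T (($) B') (($) C') (A' $ i)"
  have "tmap A' B' C' T = cube3 (?X 0) (?X 1) (?X 2)"
    by (simp add: cube3_eq_iff tmap_def slice_def tev_def)
  moreover have "strassen (?X 0) (?X 1) (?X 2)"
  proof -
    have "lc3 (?X 0) (?X 1) (?X 2) a = slice T (($) B') (($) C') (a$0 *s A'$0 + a$1 *s A'$1 + a$2 *s A'$2)" for a
      by (simp add: lc3_def slice_linear)
    then show ?thesis using assms(1) unfolding strassen_def strassen_tensor_def by simp
  qed
  then have "sec3 (cube3 (?X 0) (?X 1) (?X 2))" using border_strassen unfolding border_def by blast
  ultimately have "sec3 (tmap A' B' C' T)" by simp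
  then show ?thesis using sec3_tmap[of "tmap A' B' C' T" A B C] T by simp
qed

section \<open>Quartic forms as symmetric tensors\<close>

text \<open>
  The quartic form of a tensor of degree four, not necessarily symmetric: the coefficient
  \<open>w P\<close> belongs to the monomial \<open>P 0 * P 1 * P 2 * P 3\<close>.
\<close>

definition quartic :: "((4 \<Rightarrow> 'v::finite) \<Rightarrow> 'k::field) \<Rightarrow> ('v, 'k) mpoly" where
  "quartic w = (\<Sum>P\<in>UNIV. pscale (w P) (\<Prod>s\<in>UNIV. pvar (P s)))"

text \<open>
  The exponents of the monomial of a word; they determine the word up to a permutation of its
  letters.
\<close>

definition exponents :: "(4 \<Rightarrow> 'v) \<Rightarrow> 'v \<Rightarrow>\<^sub>0 nat" where
  "exponents P = (\<Sum>s\<in>UNIV. Poly_Mapping.single (P s) 1)"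

lemma prod_pvar: "(\<Prod>s\<in>S. pvar (P s)) = Poly_Mapping.single (\<Sum>s\<in>S. Poly_Mapping.single (P s) 1) (1 :: 'k::comm_ring_1)"
proof (induction S rule: infinite_finite_induct)
  case (insert x F)
  then show ?case by (simp add: pvar_def mult_single)
qed simp_all

lemma pscale_single: "pscale c (Poly_Mapping.single m d) = Poly_Mapping.single m (c * d)"
  by (simp add: pscale_def pconst_def mult_single)

lemma quartic_singles: "quartic w = (\<Sum>P\<in>UNIV. Poly_Mapping.single (exponents P) (w P))"
  by (simp add: quartic_def prod_pvar pscale_single exponents_def)

lemma lookup_quartic: "Poly_Mapping.lookup (quartic w) m = (\<Sum>P | exponents P = m. w P)"
proof -
  have "Poly_Mapping.lookup (quartic w) m = (\<Sum>P\<in>UNIV. if exponents P = m then w P else 0)"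
    unfolding quartic_singles lookup_sum by (intro sum.cong refl) (simp add: lookup_single when_def)
  then show ?thesis by (simp add: sum.If_cases)
qed

lemma lookup_exponents: "Poly_Mapping.lookup (exponents P) v = card {s. P s = v}"
proof -
  have "Poly_Mapping.lookup (exponents P) v = (\<Sum>s\<in>UNIV. if P s = v then 1 else 0)"
    unfolding exponents_def lookup_sum by (intro sum.cong refl) (simp add: lookup_single when_def)
  then show ?thesis by (simp add: sum.If_cases)
qed

lemma exponents_permute:
  assumes "\<pi> permutes UNIV"
  shows "exponents (P \<circ> \<pi>) = exponents P"
  unfolding exponents_def using sum.permute[OF assms, of "\<lambda>s. Poly_Mapping.single (P s) 1", symmetric]
  by (simp only: o_def)

lemma exponents_eqD:
  fixes P P' :: "4 \<Rightarrow> 'v"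
  assumes "exponents P = exponents P'"
  shows "\<exists>\<pi>. \<pi> permutes UNIV \<and> P = P' \<circ> \<pi>"
proof -
  have "image_mset P (mset_set UNIV) = image_mset P' (mset_set UNIV)"
  proof (rule multiset_eqI)
    fix v
    have "count (image_mset Q (mset_set UNIV)) v = card {s. Q s = v}" for Q :: "4 \<Rightarrow> 'v"
      by (simp add: count_image_mset vimage_def)
    then show "count (image_mset P (mset_set UNIV)) v = count (image_mset P' (mset_set UNIV)) v"
      using assms by (simp flip: lookup_exponents)
  qed
  then obtain \<pi> where "\<pi> permutes UNIV" "\<forall>x\<in>UNIV. P x = P' (\<pi> x)"
    using image_mset_eq_implies_permutes[of "UNIV :: 4 set" P P'] by auto
  then show ?thesis by (auto simp: fun_eq_iff)
qed

lemma quartic_add: "quartic (\<lambda>P. w P + w' P) = quartic w + quartic w'"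
  by (simp add: quartic_singles single_add sum.distrib)

lemma quartic_scale: "quartic (\<lambda>P. c * w P) = pscale c (quartic w)"
  by (simp add: quartic_singles mpoly.scale_sum_right pscale_single)

definition symmetrize :: "((4 \<Rightarrow> 'v) \<Rightarrow> 'k::field) \<Rightarrow> (4 \<Rightarrow> 'v) \<Rightarrow> 'k" where
  "symmetrize w P = (\<Sum>\<pi> | \<pi> permutes UNIV. w (P \<circ> \<pi>))"

definition symmetric_fun :: "((4 \<Rightarrow> 'v) \<Rightarrow> 'k) \<Rightarrow> bool" where
  "symmetric_fun w \<longleftrightarrow> (\<forall>P \<pi>. \<pi> permutes UNIV \<longrightarrow> w (P \<circ> \<pi>) = w P)"

text \<open>
  In characteristic zero a symmetric tensor is determined by its form: the words with a given
  monomial all carry the same coefficient.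
\<close>

lemma symmetric_eq_0_if_quartic_eq_0:
  fixes w :: "(4 \<Rightarrow> 'v::finite) \<Rightarrow> 'k::field_char_0"
  assumes "symmetric_fun w" "quartic w = 0"
  shows "w P = 0"
proof -
  have "0 = Poly_Mapping.lookup (quartic w) (exponents P)" using assms(2) by simp
  also have "\<dots> = (\<Sum>P' | exponents P' = exponents P. w P)"
    unfolding lookup_quartic
    by (intro sum.cong refl) (use exponents_eqD assms(1) in \<open>fastforce simp: symmetric_fun_def\<close>)
  also have "\<dots> = of_nat (card {P'. exponents P' = exponents P}) * w P" by simp
  finally have "of_nat (card {P'. exponents P' = exponents P}) * w P = 0" by simp
  moreover have "card {P'. exponents P' = exponents P} \<noteq> 0" by auto
  ultimately show ?thesis by simp
qed

lemma permutes_UNIV_bij_compose: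
  "\<pi> permutes (UNIV :: 4 set) \<Longrightarrow> bij_betw (\<lambda>P. P \<circ> \<pi>) (UNIV :: (4 \<Rightarrow> 'v) set) UNIV"
  by (rule bij_betw_byWitness[where f' = "\<lambda>P. P \<circ> inv \<pi>"])
     (auto simp: o_assoc[symmetric] permutes_inv_o)

lemma quartic_compose_permutation:
  assumes "\<pi> permutes UNIV"
  shows "quartic (\<lambda>P. w (P \<circ> \<pi>)) = quartic w"
proof -
  have "quartic (\<lambda>P. w (P \<circ> \<pi>)) = (\<Sum>P\<in>UNIV. Poly_Mapping.single (exponents (P \<circ> \<pi>)) (w (P \<circ> \<pi>)))"
    by (simp add: quartic_singles exponents_permute[OF assms])
  also have "\<dots> = quartic w" unfolding quartic_singles
    by (rule sum.reindex_bij_betw[OF permutes_UNIV_bij_compose[OF assms], of "\<lambda>P. Poly_Mapping.single (exponents P) (w P)"])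
  finally show ?thesis .
qed

lemma quartic_0: "quartic (\<lambda>P. 0) = 0"
  by (simp add: quartic_singles)

lemma quartic_sum: "quartic (\<lambda>P. \<Sum>i\<in>I. w i P) = (\<Sum>i\<in>I. quartic (w i))"
  by (induction I rule: infinite_finite_induct) (simp_all add: quartic_0 quartic_add)

lemma quartic_symmetrize:
  "quartic (symmetrize w) = pscale (of_nat (card {\<pi>. \<pi> permutes (UNIV :: 4 set)})) (quartic w)"
proof -
  have "quartic (symmetrize w) = (\<Sum>\<pi> | \<pi> permutes (UNIV :: 4 set). quartic w)"
    unfolding symmetrize_def quartic_sum
    by (rule sum.cong[OF refl]) (simp add: quartic_compose_permutation)
  also have "\<dots> = pscale (of_nat (card {\<pi>. \<pi> permutes (UNIV :: 4 set)})) (quartic w)"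
    by (simp add: pscale_def pconst_def single_of_nat)
  finally show ?thesis .
qed

lemma permutes_compose_bij:
  "\<pi> permutes UNIV \<Longrightarrow> bij_betw (\<lambda>\<rho>. \<pi> \<circ> \<rho>) {\<rho>. \<rho> permutes (UNIV :: 'n::finite set)} {\<rho>. \<rho> permutes UNIV}"
  by (rule bij_betw_byWitness[where f' = "\<lambda>\<rho>. inv \<pi> \<circ> \<rho>"])
     (auto simp: o_assoc permutes_inv_o permutes_compose permutes_inv)

lemma symmetric_symmetrize: "symmetric_fun (symmetrize w)"
  unfolding symmetric_fun_def symmetrize_def
proof (intro allI impI)
  fix P :: "4 \<Rightarrow> 'a" and \<pi> :: "4 \<Rightarrow> 4" assume "\<pi> permutes UNIV"
  then show "(\<Sum>\<rho> | \<rho> permutes UNIV. w (P \<circ> \<pi> \<circ> \<rho>)) = (\<Sum>\<rho> | \<rho> permutes UNIV. w (P \<circ> \<rho>))"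
    using sum.reindex_bij_betw[OF permutes_compose_bij, of \<pi> "\<lambda>\<rho>. w (P \<circ> \<rho>)"] by (simp add: o_assoc)
qed

lemma symmetrize_eq_0:
  fixes w :: "(4 \<Rightarrow> 'v::finite) \<Rightarrow> 'k::field_char_0"
  assumes "quartic w = 0"
  shows "symmetrize w P = 0"
  by (rule symmetric_eq_0_if_quartic_eq_0[OF symmetric_symmetrize])
     (simp add: quartic_symmetrize assms)

lemma homogeneous_quartic: "homogeneous 4 (quartic w)"
proof -
  have "homogeneous (\<Sum>s\<in>(UNIV :: 4 set). 1) (\<Prod>s\<in>(UNIV :: 4 set). pvar (P s))" for P :: "4 \<Rightarrow> 'a"
    by (intro homogeneous_prod homogeneous_pvar) simp
  then show ?thesis unfolding quartic_def by (intro homogeneous_sum homogeneous_pscale) simp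
qed

lemma peval_quartic: "peval (quartic w) x = (\<Sum>P\<in>UNIV. w P * (\<Prod>s\<in>UNIV. x $ P s))"
  by (simp add: quartic_def)

lemma all_4: "(\<forall>i::4. P i) \<longleftrightarrow> P 0 \<and> P 1 \<and> P 2 \<and> P 3"
proof -
  have "(4 :: 4) = 0" by simp
  then show ?thesis by (metis forall_4)
qed

lemma sum_UNIV_4: "(\<Sum>i\<in>(UNIV :: 4 set). f i) = f 0 + f 1 + f 2 + f 3"
proof -
  have "(4 :: 4) = 0" by simp
  then show ?thesis by (simp only: sum_4 add_ac)
qed

lemma prod_UNIV_4: "(\<Prod>i\<in>(UNIV :: 4 set). f i) = f 0 * f 1 * f 2 * (f 3 :: 'a::comm_monoid_mult)"
proof -
  have "x \<in> {0, 1, 2, 3}" for x :: 4 using all_4[of "\<lambda>x. x \<in> {0, 1, 2, 3}"] by simp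
  then have U: "(UNIV :: 4 set) = {0, 1, 2, 3}" by (intro subset_antisym subsetI UNIV_I)
  show ?thesis unfolding U by (simp add: mult_ac)
qed

definition mk4 :: "'a \<Rightarrow> 'a \<Rightarrow> 'a \<Rightarrow> 'a \<Rightarrow> 4 \<Rightarrow> 'a" where
  "mk4 p q r s = (\<lambda>x. if x = 0 then p else if x = 1 then q else if x = 2 then r else s)"

lemma mk4_simps [simp]: "mk4 p q r s 0 = p" "mk4 p q r s 1 = q" "mk4 p q r s 2 = r" "mk4 p q r s 3 = s"
  by (simp_all add: mk4_def)

lemma fun4_eq_iff: "f = g \<longleftrightarrow> f 0 = g 0 \<and> f 1 = g 1 \<and> f 2 = g 2 \<and> f (3::4) = g 3"
  by (simp add: fun_eq_iff all_4)

lemma mk4_eta: "mk4 (f 0) (f 1) (f 2) (f 3) = f"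
  by (simp add: fun4_eq_iff)

text \<open>
  The coefficient of a monomial is distributed evenly among the words that give it.
\<close>

lemma homogeneous_4_quartic:
  fixes p :: "('v::finite, 'k::field_char_0) mpoly"
  assumes "homogeneous 4 p"
  obtains w where "symmetric_fun w" "p = quartic w"
proof -
  define w where "w P = Poly_Mapping.lookup p (exponents P) / of_nat (card {P'. exponents P' = exponents P})" for P
  have "symmetric_fun w" unfolding symmetric_fun_def w_def using exponents_permute by metis
  moreover have "p = quartic w"
  proof (rule poly_mapping_eqI)
    fix m
    show "Poly_Mapping.lookup p m = Poly_Mapping.lookup (quartic w) m"
    proof (cases "\<exists>P :: 4 \<Rightarrow> 'v. exponents P = m")
      case True
      then obtain P :: "4 \<Rightarrow> 'v" where P: "exponents P = m" by blast
      have "Poly_Mapping.lookup (quartic w) m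
          = of_nat (card {P'. exponents P' = m}) * (Poly_Mapping.lookup p m / of_nat (card {P'. exponents P' = m}))"
        unfolding lookup_quartic w_def by simp
      moreover have "card {P' :: 4 \<Rightarrow> 'v. exponents P' = m} \<noteq> 0" using P by auto
      ultimately show ?thesis by simp
    next
      case False
      have "Poly_Mapping.lookup p m = 0"
      proof (rule ccontr)
        assume "Poly_Mapping.lookup p m \<noteq> 0"
        then have deg: "(\<Sum>v\<in>UNIV. Poly_Mapping.lookup m v) = 4"
          using assms unfolding homogeneous_def by (simp add: in_keys_iff)
        define M where "M = (\<Sum>v\<in>UNIV. replicate_mset (Poly_Mapping.lookup m v) v)"
        have cM: "count M v = Poly_Mapping.lookup m v" for v
          unfolding M_def by (simp add: count_sum)
        have "size M = 4" unfolding M_def using deg by (simp add: size_multiset_sum)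
        obtain xs where xs: "mset xs = M" using ex_mset by blast
        then have "length xs = 4" using \<open>size M = 4\<close> by auto
        then obtain a b c d where abcd: "xs = [a, b, c, d]"
          by (auto simp: numeral_eq_Suc length_Suc_conv)
        have "exponents (mk4 a b c d) = m"
        proof (rule poly_mapping_eqI)
          fix v
          have "Poly_Mapping.lookup (exponents (mk4 a b c d)) v = count (mset xs) v"
            by (simp add: exponents_def sum_UNIV_4 lookup_add lookup_single when_def abcd)
          then show "Poly_Mapping.lookup (exponents (mk4 a b c d)) v = Poly_Mapping.lookup m v"
            by (simp add: xs cM)
        qed
        then show False using False by blast
      qed
      moreover have "{P :: 4 \<Rightarrow> 'v. exponents P = m} = {}" using False by blast
      ultimately show ?thesis unfolding lookup_quartic by simp
    qed
  qed
  ultimately show ?thesis using that by blast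
qed

lemma psubst_superset:
  assumes "finite A" "Poly_Mapping.keys p \<subseteq> A"
  shows "psubst M p = (\<Sum>m\<in>A. pconst (Poly_Mapping.lookup p m) *
     (\<Prod>v\<in>UNIV. (\<Sum>w\<in>UNIV. pscale (M $ w $ v) (pvar w)) ^ Poly_Mapping.lookup m v))"
  unfolding psubst_def
  by (rule sum.mono_neutral_left[OF assms]) (auto simp: in_keys_iff pconst_def)

lemma psubst_add: "psubst M (p + q) = psubst M p + psubst M q"
proof -
  let ?A = "Poly_Mapping.keys p \<union> Poly_Mapping.keys q"
  have "finite ?A" "Poly_Mapping.keys (p + q) \<subseteq> ?A" using Poly_Mapping.keys_add[of p q] by simp_all
  then show ?thesis
    by (simp add: psubst_superset[of ?A] lookup_add pconst_def single_add distrib_right sum.distrib)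
qed

lemma psubst_0: "psubst M 0 = 0"
  by (simp add: psubst_def)

lemma psubst_sum: "psubst M (\<Sum>i\<in>I. f i) = (\<Sum>i\<in>I. psubst M (f i))"
  by (induction I rule: infinite_finite_induct) (simp_all add: psubst_0 psubst_add)

lemma psubst_single: "psubst M (Poly_Mapping.single m c) =
  pscale c (\<Prod>v\<in>UNIV. (\<Sum>w\<in>UNIV. pscale (M $ w $ v) (pvar w)) ^ Poly_Mapping.lookup m v)"
  by (subst psubst_superset[of "{m}"]) (auto simp: pscale_def)

lemma prod_power_exponents:
  fixes L :: "'v::finite \<Rightarrow> 'r::comm_monoid_mult"
  shows "(\<Prod>v\<in>UNIV. L v ^ Poly_Mapping.lookup (exponents P) v) = (\<Prod>s\<in>UNIV. L (P s))"
proof -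
  have "L v ^ Poly_Mapping.lookup (exponents P) v = (\<Prod>s\<in>UNIV. if P s = v then L v else 1)" for v
    by (simp add: lookup_exponents prod.If_cases)
  then have "(\<Prod>v\<in>UNIV. L v ^ Poly_Mapping.lookup (exponents P) v) = (\<Prod>v\<in>UNIV. \<Prod>s\<in>UNIV. if P s = v then L v else 1)"
    by simp
  also have "\<dots> = (\<Prod>s\<in>UNIV. \<Prod>v\<in>UNIV. if P s = v then L v else 1)" by (rule prod.swap)
  also have "\<dots> = (\<Prod>s\<in>UNIV. L (P s))" by simp
  finally show ?thesis .
qed

lemma prod_sum_functions:
  fixes f :: "4 \<Rightarrow> 'v::finite \<Rightarrow> 'r::comm_semiring_1"
  shows "(\<Prod>s\<in>UNIV. \<Sum>v\<in>UNIV. f s v) = (\<Sum>P\<in>UNIV. \<Prod>s\<in>UNIV. f s (P s))"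
  using prod_sum_PiE[of UNIV "\<lambda>_. UNIV" f] by (simp add: PiE_UNIV_domain)

text \<open>
  A substitution acts on the tensor by the fourth tensor power.
\<close>

lemma psubst_quartic:
  fixes M :: "'k::field ^ 'v::finite ^ 'v"
  shows "psubst M (quartic w) = quartic (\<lambda>P. \<Sum>P'\<in>UNIV. (\<Prod>s\<in>UNIV. M $ P s $ P' s) * w P')"
proof -
  have prod_pscale: "(\<Prod>s\<in>S. pscale (c s) (p s)) = pscale (\<Prod>s\<in>S. c s) (\<Prod>s\<in>S. p s)"
    for S :: "4 set" and c and p :: "4 \<Rightarrow> ('v, 'k) mpoly"
    by (induction S rule: infinite_finite_induct)
       (simp_all add: pscale_def pconst_def mult_ac flip: mult_single[of 0 _ 0, simplified])
  have "psubst M (quartic w) = (\<Sum>P'\<in>UNIV. pscale (w P') (\<Prod>s\<in>UNIV. \<Sum>v\<in>UNIV. pscale (M $ v $ P' s) (pvar v)))"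
    unfolding quartic_singles psubst_sum psubst_single prod_power_exponents ..
  also have "\<dots> = (\<Sum>P'\<in>UNIV. \<Sum>P\<in>UNIV. pscale ((\<Prod>s\<in>UNIV. M $ P s $ P' s) * w P') (\<Prod>s\<in>UNIV. pvar (P s)))"
    unfolding prod_sum_functions prod_pscale mpoly.scale_sum_right
    by (simp add: mpoly.scale_scale mult.commute)
  also have "\<dots> = (\<Sum>P\<in>UNIV. \<Sum>P'\<in>UNIV. pscale ((\<Prod>s\<in>UNIV. M $ P s $ P' s) * w P') (\<Prod>s\<in>UNIV. pvar (P s)))"
    by (rule sum.swap)
  also have "\<dots> = quartic (\<lambda>P. \<Sum>P'\<in>UNIV. (\<Prod>s\<in>UNIV. M $ P s $ P' s) * w P')"
    unfolding quartic_def mpoly.scale_sum_left ..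
  finally show ?thesis .
qed

section \<open>The Schur module of the hook (2,1,1)\<close>

lemma mk4_eq_iff: "mk4 a b c d = mk4 a' b' c' d' \<longleftrightarrow> a = a' \<and> b = b' \<and> c = c' \<and> d = d'"
  by (simp add: fun4_eq_iff)

lemma permutes_UNIV_iff_inj: "\<pi> permutes (UNIV :: 'n::finite set) \<longleftrightarrow> inj \<pi>"
proof
  assume "inj \<pi>"
  then have "bij \<pi>" using finite_UNIV_inj_surj[OF finite] by (simp add: bij_def)
  then show "\<pi> permutes UNIV" by (rule bij_imp_permutes) simp
qed (rule permutes_inj)

lemma permutes_mk4: "mk4 a b c d permutes UNIV \<longleftrightarrow> distinct [a, b, c, d]"
  unfolding permutes_UNIV_iff_inj inj_def by (simp add: all_4) blast

lemma mk4_transpose: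
  "Transposition.transpose 0 1 = mk4 1 0 2 (3::4)" "Transposition.transpose 0 2 = mk4 2 1 0 (3::4)"
  "Transposition.transpose 0 3 = mk4 3 1 2 (0::4)" "Transposition.transpose 1 2 = mk4 0 2 1 (3::4)"
  "Transposition.transpose 1 3 = mk4 0 3 2 (1::4)" "Transposition.transpose 2 3 = mk4 0 1 3 (2::4)"
  "id = mk4 0 1 2 (3::4)"
  by (simp_all add: fun4_eq_iff Transposition.transpose_def)

lemma mk4_compose: "f \<circ> mk4 a b c d = mk4 (f a) (f b) (f c) (f d)"
  by (simp add: fun4_eq_iff)

lemma sign_mk4:
  "sign (mk4 0 1 2 (3::4)) = 1" "sign (mk4 1 0 2 (3::4)) = -1" "sign (mk4 2 1 0 (3::4)) = -1"
  "sign (mk4 3 1 2 (0::4)) = -1" "sign (mk4 0 1 3 (2::4)) = -1"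
  "sign (mk4 0 2 1 (3::4)) = -1" "sign (mk4 0 3 2 (1::4)) = -1"
  "sign (mk4 2 1 3 (0::4)) = 1" "sign (mk4 3 1 0 (2::4)) = 1"
proof -
  show "sign (mk4 1 0 2 (3::4)) = -1" "sign (mk4 2 1 0 (3::4)) = -1"
    "sign (mk4 3 1 2 (0::4)) = -1" "sign (mk4 0 1 3 (2::4)) = -1"
    "sign (mk4 0 2 1 (3::4)) = -1" "sign (mk4 0 3 2 (1::4)) = -1"
    unfolding mk4_transpose[symmetric] by (simp_all add: sign_swap_id)
  show "sign (mk4 0 1 2 (3::4)) = 1" unfolding mk4_transpose(7)[symmetric] by simp
  have "mk4 2 1 3 (0::4) = Transposition.transpose 0 2 \<circ> Transposition.transpose 2 3"
    "mk4 3 1 0 (2::4) = Transposition.transpose 0 3 \<circ> Transposition.transpose 2 3"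
    unfolding mk4_transpose by (simp_all add: fun4_eq_iff)
  then show "sign (mk4 2 1 3 (0::4)) = 1" "sign (mk4 3 1 0 (2::4)) = 1"
    by (simp_all add: sign_compose permutation_swap_id sign_swap_id)
qed

lemma tableau211_rows:
  "fst (tableau211 x) = 0 \<longleftrightarrow> x = 0 \<or> x = 1" "fst (tableau211 x) = 1 \<longleftrightarrow> x = 2" "fst (tableau211 x) = Suc 0 \<longleftrightarrow> x = 2"
  "fst (tableau211 x) = 2 \<longleftrightarrow> x = 3"
  "snd (tableau211 x) = 0 \<longleftrightarrow> x = 0 \<or> x = 2 \<or> x = 3" "snd (tableau211 x) = 1 \<longleftrightarrow> x = 1" "snd (tableau211 x) = Suc 0 \<longleftrightarrow> x = 1"
proof -
  have "\<forall>x. (fst (tableau211 x) = 0 \<longleftrightarrow> x = 0 \<or> x = 1) \<and> (fst (tableau211 x) = 1 \<longleftrightarrow> x = 2) \<and>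
    (fst (tableau211 x) = 2 \<longleftrightarrow> x = 3) \<and> (snd (tableau211 x) = 0 \<longleftrightarrow> x = 0 \<or> x = 2 \<or> x = 3) \<and>
    (snd (tableau211 x) = 1 \<longleftrightarrow> x = 1)"
    unfolding all_4 by (simp add: tableau211_def)
  then show "fst (tableau211 x) = 0 \<longleftrightarrow> x = 0 \<or> x = 1" "fst (tableau211 x) = 1 \<longleftrightarrow> x = 2" "fst (tableau211 x) = Suc 0 \<longleftrightarrow> x = 2"
  "fst (tableau211 x) = 2 \<longleftrightarrow> x = 3"
  "snd (tableau211 x) = 0 \<longleftrightarrow> x = 0 \<or> x = 2 \<or> x = 3" "snd (tableau211 x) = 1 \<longleftrightarrow> x = 1" "snd (tableau211 x) = Suc 0 \<longleftrightarrow> x = 1"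
    by simp_all
qed

lemma tableau211_values: "tableau211 0 = (0, 0)" "tableau211 1 = (0, 1)" "tableau211 2 = (1, 0)" "tableau211 3 = (2, 0)"
  by (simp_all add: tableau211_def)

lemma row_group_211: "row_group tableau211 = {mk4 0 1 2 3, mk4 1 0 2 3}"
proof -
  have "mk4 a b c d \<in> row_group tableau211 \<longleftrightarrow> mk4 a b c d \<in> {mk4 0 1 2 3, mk4 1 0 2 3}" for a b c d
    unfolding row_group_def mem_Collect_eq permutes_mk4 all_4 insert_iff mk4_eq_iff
    by (auto simp: tableau211_values tableau211_rows)
  then show ?thesis by (metis mk4_eta subset_antisym subsetI)
qed

lemma col_group_211: "col_group tableau211 =
  {mk4 0 1 2 3, mk4 2 1 0 3, mk4 3 1 2 0, mk4 0 1 3 2, mk4 2 1 3 0, mk4 3 1 0 2}"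
proof -
  have "mk4 a b c d \<in> col_group tableau211 \<longleftrightarrow> mk4 a b c d \<in>
    {mk4 0 1 2 3, mk4 2 1 0 3, mk4 3 1 2 0, mk4 0 1 3 2, mk4 2 1 3 0, mk4 3 1 0 2}" for a b c d
    unfolding col_group_def mem_Collect_eq permutes_mk4 all_4 insert_iff mk4_eq_iff
    by (auto simp: tableau211_values tableau211_rows)
  then show ?thesis by (metis mk4_eta subset_antisym subsetI)
qed

text \<open>
  The alternating sum over the three positions in the first column of the tableau; the position
  in the second column is the one with number 1.
\<close>

definition alt3 :: "('a \<Rightarrow> 'a \<Rightarrow> 'a \<Rightarrow> 'k::comm_ring_1) \<Rightarrow> 'a \<Rightarrow> 'a \<Rightarrow> 'a \<Rightarrow> 'k" where
  "alt3 h p r s = h p r s - h r p s - h s r p - h p s r + h r s p + h s p r"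

lemma young_explicit:
  "young_symmetrizer tableau211 f $ mk4 p q r s
    = alt3 (\<lambda>p r s. f $ mk4 p q r s + f $ mk4 q p r s) p r s"
  unfolding young_symmetrizer_def row_group_211 col_group_211
  by (simp add: mk4_eq_iff sign_mk4 mk4_compose alt3_def)

text \<open>
  The linear relations between the coordinates of an element of the Schur module: antisymmetry
  in the first column and the relation of Garnir, which exchanges the box in the second column
  with each box of the first one. The formulation with functions makes it applicable to each
  factor of a tensor product.
\<close>

definition hook_relations :: "((4 \<Rightarrow> 'a) \<Rightarrow> 'k::comm_ring_1) \<Rightarrow> bool" where
  "hook_relations f \<longleftrightarrow> (\<forall>p q r s. f (mk4 r q p s) = - f (mk4 p q r s) \<and> f (mk4 p q s r) = - f (mk4 p q r s) \<and>
     f (mk4 p q r s) = f (mk4 q p r s) + f (mk4 p r q s) + f (mk4 p s r q))"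

lemma hook_relations_schur: "f \<in> schur_module tableau211 \<Longrightarrow> hook_relations (($) f)"
proof -
  assume "f \<in> schur_module tableau211"
  then obtain g where g: "f = young_symmetrizer tableau211 g" unfolding schur_module_def by blast
  show ?thesis unfolding g hook_relations_def young_explicit alt3_def
    by (intro allI conjI) (simp_all add: algebra_simps)
qed

lemma hook_relations_add: "hook_relations f \<Longrightarrow> hook_relations g \<Longrightarrow> hook_relations (\<lambda>I. f I + g I)"
proof -
  assume f: "hook_relations f" and g: "hook_relations g"
  have 1: "f (mk4 r q p s) = - f (mk4 p q r s)" "f (mk4 p q s r) = - f (mk4 p q r s)"
    "g (mk4 r q p s) = - g (mk4 p q r s)" "g (mk4 p q s r) = - g (mk4 p q r s)" for p q r s
    using f g unfolding hook_relations_def by blast+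
  have 2: "f (mk4 p q r s) = f (mk4 q p r s) + f (mk4 p r q s) + f (mk4 p s r q)"
    "g (mk4 p q r s) = g (mk4 q p r s) + g (mk4 p r q s) + g (mk4 p s r q)" for p q r s
    using f g unfolding hook_relations_def by blast+
  show ?thesis unfolding hook_relations_def
  proof (intro allI conjI)
    fix p q r s
    show "f (mk4 r q p s) + g (mk4 r q p s) = - (f (mk4 p q r s) + g (mk4 p q r s))"
      using 1(1,3)[of p q r s] by simp
    show "f (mk4 p q s r) + g (mk4 p q s r) = - (f (mk4 p q r s) + g (mk4 p q r s))"
      using 1(2,4)[of p q r s] by simp
    show "f (mk4 p q r s) + g (mk4 p q r s) = f (mk4 q p r s) + g (mk4 q p r s) +
      (f (mk4 p r q s) + g (mk4 p r q s)) + (f (mk4 p s r q) + g (mk4 p s r q))"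
      by (simp only: 2[of p q r s] add_ac)
  qed
qed

lemma hook_relations_scale: "hook_relations f \<Longrightarrow> hook_relations (\<lambda>I. c * f I)"
proof -
  assume f: "hook_relations f"
  have 1: "f (mk4 r q p s) = - f (mk4 p q r s)" "f (mk4 p q s r) = - f (mk4 p q r s)" for p q r s
    using f unfolding hook_relations_def by blast+
  have 2: "f (mk4 p q r s) = f (mk4 q p r s) + f (mk4 p r q s) + f (mk4 p s r q)" for p q r s
    using f unfolding hook_relations_def by blast
  show ?thesis unfolding hook_relations_def
  proof (intro allI conjI)
    fix p q r s
    show "c * f (mk4 r q p s) = - (c * f (mk4 p q r s))" using 1(1)[of p q r s] by simp
    show "c * f (mk4 p q s r) = - (c * f (mk4 p q r s))" using 1(2)[of p q r s] by simp
    show "c * f (mk4 p q r s) = c * f (mk4 q p r s) + c * f (mk4 p r q s) + c * f (mk4 p s r q)"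
      by (simp only: 2[of p q r s] distrib_left)
  qed
qed

lemma hook_relations_0: "hook_relations (\<lambda>I. 0)"
  unfolding hook_relations_def by simp

lemma hook_column:
  assumes "hook_relations f" "\<pi> permutes UNIV" "\<pi> 1 = 1"
  shows "f (I \<circ> \<pi>) = of_int (sign \<pi>) * f I"
proof -
  have swap: "f (mk4 r q p s) = - f (mk4 p q r s)" "f (mk4 p q s r) = - f (mk4 p q r s)" for p q r s
    using assms(1) unfolding hook_relations_def by blast+
  have "\<pi> \<in> col_group tableau211"
  proof -
    have nz: "\<pi> x \<noteq> 1" if "x \<noteq> 1" for x using permutes_inj[OF assms(2)] assms(3) that by (metis injD)
    have col: "snd (tableau211 y) = 0" if "y \<noteq> 1" for y
      using that by (simp add: tableau211_def)
    have "snd (tableau211 (\<pi> s)) = snd (tableau211 s)" for s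
      by (cases "s = 1") (use nz col assms(3) in auto)
    then show ?thesis unfolding col_group_def using assms(2) by blast
  qed
  then have "\<pi> = mk4 0 1 2 3 \<or> \<pi> = mk4 2 1 0 3 \<or> \<pi> = mk4 3 1 2 0 \<or> \<pi> = mk4 0 1 3 2 \<or> \<pi> = mk4 2 1 3 0 \<or> \<pi> = mk4 3 1 0 2"
    unfolding col_group_211 by blast
  then show ?thesis
  proof (elim disjE)
    assume p: "\<pi> = mk4 0 1 2 3" show ?thesis by (simp add: p sign_mk4 mk4_compose mk4_eta)
  next
    assume p: "\<pi> = mk4 2 1 0 3" show ?thesis
      using swap(1)[of "I 0" "I 1" "I 2" "I 3"] by (simp add: p sign_mk4 mk4_compose mk4_eta)
  next
    assume p: "\<pi> = mk4 3 1 2 0" show ?thesis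
      using swap(1)[of "I 0" "I 1" "I 3" "I 2"] swap(2)[of "I 0" "I 1" "I 2" "I 3"] swap(2)[of "I 3" "I 1" "I 0" "I 2"]
      by (simp add: p sign_mk4 mk4_compose mk4_eta)
  next
    assume p: "\<pi> = mk4 0 1 3 2" show ?thesis
      using swap(2)[of "I 0" "I 1" "I 2" "I 3"] by (simp add: p sign_mk4 mk4_compose mk4_eta)
  next
    assume p: "\<pi> = mk4 2 1 3 0" show ?thesis
      using swap(1)[of "I 0" "I 1" "I 2" "I 3"] swap(2)[of "I 2" "I 1" "I 0" "I 3"] by (simp add: p sign_mk4 mk4_compose mk4_eta)
  next
    assume p: "\<pi> = mk4 3 1 0 2" show ?thesis
      using swap(1)[of "I 0" "I 1" "I 3" "I 2"] swap(2)[of "I 0" "I 1" "I 2" "I 3"] by (simp add: p sign_mk4 mk4_compose mk4_eta)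
  qed
qed

text \<open>
  This and the next permutation are the two rotations of the first column.
\<close>

definition rot :: "4 \<Rightarrow> 4" where "rot = mk4 2 1 3 0"
definition rot2 :: "4 \<Rightarrow> 4" where "rot2 = mk4 3 1 0 2"

lemma permutes_rot: "rot permutes UNIV" "rot2 permutes UNIV"
  by (simp_all add: rot_def rot2_def permutes_mk4)

abbreviation swap4 :: "4 \<Rightarrow> 4 \<Rightarrow> 4 \<Rightarrow> 4" where "swap4 \<equiv> Transposition.transpose"

lemma permutes_swap4: "swap4 a b permutes UNIV"
  by (simp add: permutes_swap_id)

lemma sign_compose_UNIV:
  "\<pi> permutes UNIV \<Longrightarrow> \<rho> permutes UNIV \<Longrightarrow> sign (\<pi> \<circ> \<rho>) = sign \<pi> * sign (\<rho> :: 'n::finite \<Rightarrow> 'n)"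
  using sign_compose permutation_permutes by (metis finite)

text \<open>
  A permutation that moves position 1 is a column permutation after a transposition of position
  1 with a first column position; rotating the column runs through all such transpositions, and
  their sum is known from the relation of Garnir.
\<close>

lemma hook_average:
  assumes f: "hook_relations f" and \<pi>: "\<pi> permutes UNIV"
  shows "f (I \<circ> \<pi>) + f (I \<circ> rot \<circ> \<pi>) + f (I \<circ> rot2 \<circ> \<pi>)
     = of_int (sign \<pi> * (if \<pi> 1 = 1 then 3 else -1)) * f I"
proof (cases "\<pi> 1 = 1")
  case True
  have r: "f (I \<circ> rot) = f I" "f (I \<circ> rot2) = f I"
    using hook_column[OF f permutes_rot(1)] hook_column[OF f permutes_rot(2)]
    by (simp_all add: rot_def rot2_def sign_mk4)
  then show ?thesis using True hook_column[OF f \<pi> True] by (simp add: r algebra_simps)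
next
  case False
  define x where "x = \<pi> 1"
  define \<rho> where "\<rho> = swap4 1 x \<circ> \<pi>"
  have \<rho>: "\<rho> permutes UNIV" "\<rho> 1 = 1" unfolding \<rho>_def x_def
    by (auto intro: permutes_compose[OF \<pi> permutes_swap4])
  have "sign \<rho> = - sign \<pi>"
    unfolding \<rho>_def using sign_compose_UNIV[OF permutes_swap4 \<pi>, of 1 x] False by (simp add: sign_swap_id x_def)
  have \<pi>\<rho>: "\<pi> = swap4 1 x \<circ> \<rho>" by (simp add: \<rho>_def o_assoc)
  have 1: "f (J \<circ> \<pi>) = - of_int (sign \<pi>) * f (J \<circ> swap4 1 x)" for J
    using hook_column[OF f \<rho>, of "J \<circ> swap4 1 x"] \<open>sign \<rho> = - sign \<pi>\<close>
    by (subst \<pi>\<rho>) (simp add: o_assoc)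
  have r: "f (J \<circ> rot) = f J" "f (J \<circ> rot2) = f J" for J
    using hook_column[OF f permutes_rot(1)] hook_column[OF f permutes_rot(2)]
    by (simp_all add: rot_def rot2_def sign_mk4)
  (* The sum over the three exchanges with position 1. *)
  have garnir: "f (J \<circ> swap4 1 0) + f (J \<circ> swap4 1 2) + f (J \<circ> swap4 1 3) = f J" for J
  proof -
    have "f (mk4 (J 0) (J 1) (J 2) (J 3)) = f (mk4 (J 1) (J 0) (J 2) (J 3)) + f (mk4 (J 0) (J 2) (J 1) (J 3))
       + f (mk4 (J 0) (J 3) (J 2) (J 1))" using f unfolding hook_relations_def by blast
    then show ?thesis unfolding mk4_transpose transpose_commute[of 1 0] mk4_compose mk4_eta by simp
  qed
  have conj: "I \<circ> \<kappa> \<circ> swap4 1 x = I \<circ> swap4 1 (\<kappa> x) \<circ> \<kappa>" if "\<kappa> permutes UNIV" "\<kappa> 1 = 1" for \<kappa>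
  proof -
    have "\<kappa> (swap4 1 x y) = swap4 1 (\<kappa> x) (\<kappa> y)" for y
      using that(2) inj_eq[OF permutes_inj[OF that(1)], of y 1] inj_eq[OF permutes_inj[OF that(1)], of y x]
      by (cases "y = 1"; cases "y = x") (simp_all add: Transposition.transpose_def)
    then show ?thesis by (simp add: fun_eq_iff)
  qed
  have "f (I \<circ> swap4 1 x) + f (I \<circ> rot \<circ> swap4 1 x) + f (I \<circ> rot2 \<circ> swap4 1 x)
     = f (I \<circ> swap4 1 x) + f (I \<circ> swap4 1 (rot x)) + f (I \<circ> swap4 1 (rot2 x))"
    using conj[OF permutes_rot(1)] conj[OF permutes_rot(2)] by (simp add: r) (simp add: rot_def rot2_def r[unfolded rot_def rot2_def])
  also have "\<dots> = f I"
  proof -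
    have "\<forall>y::4. y = 0 \<or> y = 1 \<or> y = 2 \<or> y = 3" unfolding all_4 by simp
    then have "x = 0 \<or> x = 2 \<or> x = 3" using False x_def by blast
    then show ?thesis using garnir[of I] by (auto simp: rot_def rot2_def algebra_simps)
  qed
  finally have sum: "f (I \<circ> swap4 1 x) + f (I \<circ> rot \<circ> swap4 1 x) + f (I \<circ> rot2 \<circ> swap4 1 x) = f I" .
  have "f (I \<circ> \<pi>) + f (I \<circ> rot \<circ> \<pi>) + f (I \<circ> rot2 \<circ> \<pi>)
     = - of_int (sign \<pi>) * (f (I \<circ> swap4 1 x) + f (I \<circ> rot \<circ> swap4 1 x) + f (I \<circ> rot2 \<circ> swap4 1 x))"
    unfolding 1 by (simp only: distrib_left)
  then show ?thesis using False unfolding sum by simp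
qed

section \<open>A copy of the Schur module tensor product in the quartics\<close>

text \<open>
  Pairing each permutation with its product with a transposition.
\<close>

lemma signed_sum_zero:
  fixes h :: "(4 \<Rightarrow> 4) \<Rightarrow> 'k::field_char_0"
  assumes "a \<noteq> b" "\<And>\<pi>. h (\<pi> \<circ> swap4 a b) = h \<pi>"
  shows "(\<Sum>\<pi> | \<pi> permutes UNIV. of_int (sign \<pi>) * h \<pi>) = 0"
proof -
  have "(\<Sum>\<pi> | \<pi> permutes UNIV. of_int (sign \<pi>) * h \<pi>)
     = (\<Sum>\<pi> | \<pi> permutes UNIV. of_int (sign (\<pi> \<circ> swap4 a b)) * h (\<pi> \<circ> swap4 a b))"
    by (rule sum_permutations_compose_right[OF permutes_swap4])
  also have "\<dots> = (\<Sum>\<pi> | \<pi> permutes UNIV. - (of_int (sign \<pi>) * h \<pi>))"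
    by (rule sum.cong[OF refl])
       (simp add: sign_compose_UNIV[OF _ permutes_swap4] sign_swap_id assms)
  finally show ?thesis by (simp add: sum_negf)
qed

text \<open>
  Write each factor as \<open>4 d - 1\<close> with \<open>d\<close> the indicator of a fixed
  point and expand. If a term leaves two positions free, the signs cancel; only the term with
  three fixed points, that is the identity, remains.
\<close>

lemma signed_sum_hooks:
  "(\<Sum>\<pi> | \<pi> permutes (UNIV :: 4 set). of_int (sign \<pi>) *
     (of_int (if \<pi> 1 = 1 then 3 else -1) * of_int (if \<pi> 2 = 2 then 3 else -1) * of_int (if \<pi> 3 = 3 then 3 else -1)))
   = (64 :: 'k::field_char_0)"
proof -
  define d :: "4 \<Rightarrow> (4 \<Rightarrow> 4) \<Rightarrow> 'k" where "d i \<pi> = (if \<pi> i = i then 1 else 0)" for i \<pi>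
  let ?S = "\<lambda>h. \<Sum>\<pi> | \<pi> permutes (UNIV :: 4 set). of_int (sign \<pi>) * (h \<pi> :: 'k)"
  have d: "of_int (if \<pi> i = i then 3 else -1) = 4 * d i \<pi> - 1" for i \<pi> by (simp add: d_def)
  have sw: "d i (\<pi> \<circ> swap4 a b) = d i \<pi>" if "i \<noteq> a" "i \<noteq> b" for i a b \<pi>
    using that by (simp add: d_def)
  have z: "?S (\<lambda>\<pi>. d 1 \<pi> * d 2 \<pi>) = 0" "?S (\<lambda>\<pi>. d 1 \<pi> * d 3 \<pi>) = 0" "?S (\<lambda>\<pi>. d 2 \<pi> * d 3 \<pi>) = 0"
    "?S (\<lambda>\<pi>. d 1 \<pi>) = 0" "?S (\<lambda>\<pi>. d 2 \<pi>) = 0" "?S (\<lambda>\<pi>. d 3 \<pi>) = 0" "?S (\<lambda>\<pi>. 1) = 0"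
    using signed_sum_zero[of 0 3 "\<lambda>\<pi>. d 1 \<pi> * d 2 \<pi>"] signed_sum_zero[of 0 2 "\<lambda>\<pi>. d 1 \<pi> * d 3 \<pi>"]
      signed_sum_zero[of 0 1 "\<lambda>\<pi>. d 2 \<pi> * d 3 \<pi>"] signed_sum_zero[of 0 3 "d 1"] signed_sum_zero[of 0 3 "d 2"]
      signed_sum_zero[of 0 1 "d 3"] signed_sum_zero[of 0 1 "\<lambda>\<pi>. 1"]
    by (simp_all add: sw)
  have "?S (\<lambda>\<pi>. d 1 \<pi> * d 2 \<pi> * d 3 \<pi>) = (\<Sum>\<pi> | \<pi> permutes (UNIV :: 4 set). if \<pi> = id then 1 else 0)"
  proof (rule sum.cong[OF refl])
    fix \<pi> :: "4 \<Rightarrow> 4" assume "\<pi> \<in> {\<pi>. \<pi> permutes UNIV}"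
    then have p: "\<pi> permutes UNIV" by simp
    have "\<pi> = id" if h: "\<pi> 1 = 1" "\<pi> 2 = 2" "\<pi> 3 = 3"
    proof -
      have "\<pi> 0 \<noteq> 1" "\<pi> 0 \<noteq> 2" "\<pi> 0 \<noteq> 3" 
        using h inj_eq[OF permutes_inj[OF p], of 0 1] inj_eq[OF permutes_inj[OF p], of 0 2]
          inj_eq[OF permutes_inj[OF p], of 0 3] by simp_all
      moreover have "\<forall>y::4. y = 0 \<or> y = 1 \<or> y = 2 \<or> y = 3" unfolding all_4 by simp
      ultimately have "\<pi> 0 = 0" by blast
      then show ?thesis using h by (simp add: fun4_eq_iff)
    qed
    then show "of_int (sign \<pi>) * (d 1 \<pi> * d 2 \<pi> * d 3 \<pi>) = (if \<pi> = id then 1 else 0)"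
      by (auto simp: d_def)
  qed
  also have "\<dots> = 1" by (simp add: permutes_id finite_permutations)
  finally have one: "?S (\<lambda>\<pi>. d 1 \<pi> * d 2 \<pi> * d 3 \<pi>) = 1" .
  have "?S (\<lambda>\<pi>. (4 * d 1 \<pi> - 1) * (4 * d 2 \<pi> - 1) * (4 * d 3 \<pi> - 1))
     = 64 * ?S (\<lambda>\<pi>. d 1 \<pi> * d 2 \<pi> * d 3 \<pi>) - 16 * ?S (\<lambda>\<pi>. d 1 \<pi> * d 2 \<pi>) - 16 * ?S (\<lambda>\<pi>. d 1 \<pi> * d 3 \<pi>)
       - 16 * ?S (\<lambda>\<pi>. d 2 \<pi> * d 3 \<pi>) + 4 * ?S (\<lambda>\<pi>. d 1 \<pi>) + 4 * ?S (\<lambda>\<pi>. d 2 \<pi>) + 4 * ?S (\<lambda>\<pi>. d 3 \<pi>) - ?S (\<lambda>\<pi>. 1)"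
    unfolding sum_distrib_left sum_subtractf[symmetric] sum.distrib[symmetric]
    by (rule sum.cong[OF refl]) (simp add: algebra_simps)
  then show ?thesis unfolding d z one by simp
qed

text \<open>
  Position 1 is distinguished in the Schur module. Its copies for the second and third factor
  are moved to positions 2 and 3. With the same position in all three factors, the tensor would
  be antisymmetric in the other three positions, as a product of three antisymmetric tensors,
  and its form would be zero.
\<close>

definition twist :: "(4 \<Rightarrow> 'a \<times> 'b \<times> 'c) \<Rightarrow> (4 \<Rightarrow> 'a) \<times> (4 \<Rightarrow> 'b) \<times> (4 \<Rightarrow> 'c)" where
  "twist P = (\<lambda>s. fst (P s), \<lambda>s. fst (snd (P (swap4 1 2 s))), \<lambda>s. snd (snd (P (swap4 1 3 s))))"

lemma bij_twist: "bij twist"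
proof (rule o_bij)
  let ?g = "\<lambda>(I, J, L) s. (I s, J (swap4 1 2 s), L (swap4 1 3 s))"
  show "?g \<circ> twist = id" "twist \<circ> ?g = id" by (auto simp: fun_eq_iff twist_def)
qed

definition hook_map :: "'k::field ^ ((4 \<Rightarrow> 'a) \<times> (4 \<Rightarrow> 'b) \<times> (4 \<Rightarrow> 'c))
    \<Rightarrow> ('a::finite \<times> 'b::finite \<times> 'c::finite, 'k) mpoly" where
  "hook_map u = quartic (\<lambda>P. u $ twist P)"

lemma hook_map_add: "hook_map (u + v) = hook_map u + hook_map v"
  by (simp add: hook_map_def quartic_add)

lemma hook_map_scale: "hook_map (c *s u) = pscale c (hook_map u)"
  by (simp add: hook_map_def quartic_scale)

lemma kron3_twist:
  "kron3 (tensor_power g) (tensor_power h) (tensor_power l) $ twist P $ twist P'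
    = (\<Prod>s\<in>UNIV. kron3 g h l $ P s $ P' s)"
proof -
  have "(\<Prod>s\<in>UNIV. f (swap4 a b s)) = (\<Prod>s\<in>UNIV. f s)" for f :: "4 \<Rightarrow> 'a" and a b
    using prod.permute[OF permutes_swap4, of f a b] by (simp add: o_def)
  from this[of "\<lambda>s. h $ fst (snd (P s)) $ fst (snd (P' s))"] this[of "\<lambda>s. l $ snd (snd (P s)) $ snd (snd (P' s))"]
  show ?thesis
    by (simp add: kron3_def tensor_power_def twist_def prod.distrib split_beta)
qed

lemma hook_map_equivariant:
  "hook_map (kron3 (tensor_power g) (tensor_power h) (tensor_power l) *v u) = psubst (kron3 g h l) (hook_map u)"
proof -
  let ?K = "kron3 (tensor_power g) (tensor_power h) (tensor_power l)"
  have "(\<Sum>P'\<in>UNIV. (\<Prod>s\<in>UNIV. kron3 g h l $ P s $ P' s) * u $ twist P') = (?K *v u) $ twist P" for P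
    using sum.reindex_bij_betw[OF bij_twist, of "\<lambda>q. ?K $ twist P $ q * u $ q"]
    by (simp add: matrix_vector_mult_def kron3_twist)
  then show ?thesis by (simp add: hook_map_def psubst_quartic)
qed

lemma schur211_slots:
  assumes "u \<in> schur211_tensor"
  shows "hook_relations (\<lambda>I. u $ (I, J, L))" "hook_relations (\<lambda>J. u $ (I, J, L))" "hook_relations (\<lambda>L. u $ (I, J, L))"
proof -
  have "(\<forall>J L. hook_relations (\<lambda>I. u $ (I, J, L))) \<and> (\<forall>I L. hook_relations (\<lambda>J. u $ (I, J, L)))
     \<and> (\<forall>I J. hook_relations (\<lambda>L. u $ (I, J, L)))"
    using assms unfolding schur211_tensor_def
  proof (induction rule: vec.span_induct_alt)
    case base then show ?case by (simp add: hook_relations_0)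
  next
    case (step c x y)
    then obtain f g h where x: "x = tensor3 f g h" and s: "f \<in> schur_module tableau211"
      "g \<in> schur_module tableau211" "h \<in> schur_module tableau211" by blast
    have 1: "hook_relations (\<lambda>I. (c * g $ J * h $ L) * f $ I)" "hook_relations (\<lambda>J. (c * f $ I * h $ L) * g $ J)"
      "hook_relations (\<lambda>L. (c * f $ I * g $ J) * h $ L)" for I J L
      using s by (simp_all add: hook_relations_scale hook_relations_schur)
    have 2: "hook_relations (\<lambda>I. (c *s x) $ (I, J, L))" "hook_relations (\<lambda>J. (c *s x) $ (I, J, L))"
      "hook_relations (\<lambda>L. (c *s x) $ (I, J, L))" for I J L
      using 1(1)[of J L] 1(2)[of I L] 1(3)[of I J] by (simp_all add: x tensor3_def mult_ac)
    have 3: "hook_relations (\<lambda>I. y $ (I, J, L))" "hook_relations (\<lambda>J. y $ (I, J, L))"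
      "hook_relations (\<lambda>L. y $ (I, J, L))" for I J L using step(2) by blast+
    show ?case unfolding vector_add_component
      using hook_relations_add[OF 2(1) 3(1)] hook_relations_add[OF 2(2) 3(2)] hook_relations_add[OF 2(3) 3(3)] by blast
  qed
  then show "hook_relations (\<lambda>I. u $ (I, J, L))" "hook_relations (\<lambda>J. u $ (I, J, L))" "hook_relations (\<lambda>L. u $ (I, J, L))"
    by blast+
qed

text \<open>
  The form vanishes, so the sum over all permutations of positions of the twisted tensor
  vanishes. Averaging this sum over the rotations of the columns in all three factors turns each
  summand into a scalar multiple of one and the same coordinate, by \<open>hook_average\<close>;
  the scalars add up to 64.
\<close>

lemma hook_map_eq_0:
  fixes u :: "'k::field_char_0 ^ ((4 \<Rightarrow> 'a::finite) \<times> (4 \<Rightarrow> 'b::finite) \<times> (4 \<Rightarrow> 'c::finite))"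
  assumes u: "u \<in> schur211_tensor" and z: "hook_map u = 0"
  shows "u = 0"
proof -
  have sym: "(\<Sum>\<pi> | \<pi> permutes UNIV. u $ (I \<circ> \<pi>, J \<circ> \<pi> \<circ> swap4 1 2, L \<circ> \<pi> \<circ> swap4 1 3)) = 0" for I J L
  proof -
    have "symmetrize (\<lambda>P. u $ twist P) (\<lambda>s. (I s, J s, L s)) = 0"
      by (rule symmetrize_eq_0) (use z in \<open>simp add: hook_map_def\<close>)
    then show ?thesis by (simp add: symmetrize_def twist_def o_def)
  qed
  have main: "64 * u $ (I, J, L) = 0" for I J L
  proof -
    (* In the second and third factor the permutation is conjugated by the twist, so that the
       condition of fixing position 1 becomes that of fixing position 2 or 3. *)
    define U where "U \<pi> \<kappa> \<nu> \<mu> = u $ (I \<circ> \<kappa> \<circ> \<pi>, J \<circ> \<nu> \<circ> (swap4 1 2 \<circ> \<pi> \<circ> swap4 1 2), L \<circ> \<mu> \<circ> (swap4 1 3 \<circ> \<pi> \<circ> swap4 1 3))"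
      for \<pi> \<kappa> \<nu> \<mu> :: "4 \<Rightarrow> 4"
    have zero: "(\<Sum>\<pi> | \<pi> permutes UNIV. U \<pi> \<kappa> \<nu> \<mu>) = 0" for \<kappa> \<nu> \<mu>
      using sym[of "I \<circ> \<kappa>" "J \<circ> \<nu> \<circ> swap4 1 2" "L \<circ> \<mu> \<circ> swap4 1 3"] by (simp add: U_def o_assoc)
    let ?R = "{id, rot, rot2}"
    have "id 0 \<noteq> rot 0" "id 0 \<noteq> rot2 0" "rot 0 \<noteq> rot2 0" by (simp_all add: rot_def rot2_def)
    then have ne: "id \<noteq> rot" "id \<noteq> rot2" "rot \<noteq> rot2" by metis+
    have R: "(\<Sum>\<kappa>\<in>?R. f \<kappa>) = f id + f rot + f rot2" for f :: "(4 \<Rightarrow> 4) \<Rightarrow> 'k" using ne by (simp add: add_ac)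
    have avg: "(\<Sum>\<kappa>\<in>?R. \<Sum>\<nu>\<in>?R. \<Sum>\<mu>\<in>?R. U \<pi> \<kappa> \<nu> \<mu>)
       = of_int (sign \<pi>) * (of_int (if \<pi> 1 = 1 then 3 else -1) * of_int (if \<pi> 2 = 2 then 3 else -1) *
         of_int (if \<pi> 3 = 3 then 3 else -1)) * u $ (I, J, L)" if \<pi>: "\<pi> permutes UNIV" for \<pi>
    proof -
      let ?c = "\<lambda>b. if b then 3 else (-1::int)"
      have conj: "(swap4 1 a \<circ> \<pi> \<circ> swap4 1 a) permutes UNIV" "sign (swap4 1 a \<circ> \<pi> \<circ> swap4 1 a) = sign \<pi>"
        "(swap4 1 a \<circ> \<pi> \<circ> swap4 1 a) 1 = 1 \<longleftrightarrow> \<pi> a = a" if "a \<noteq> 1" for a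
      proof -
        show "(swap4 1 a \<circ> \<pi> \<circ> swap4 1 a) permutes UNIV"
          by (intro permutes_compose permutes_swap4 \<pi>)
        show "sign (swap4 1 a \<circ> \<pi> \<circ> swap4 1 a) = sign \<pi>"
          using that by (simp add: sign_compose_UNIV permutes_compose permutes_swap4 \<pi> sign_swap_id)
        show "(swap4 1 a \<circ> \<pi> \<circ> swap4 1 a) 1 = 1 \<longleftrightarrow> \<pi> a = a"
          using that by (auto simp: Transposition.transpose_def)
      qed
      have A: "(\<Sum>\<kappa>\<in>?R. u $ (I \<circ> \<kappa> \<circ> \<pi>, J', L')) = of_int (sign \<pi> * ?c (\<pi> 1 = 1)) * u $ (I, J', L')" for J' L'
        unfolding R using hook_average[OF schur211_slots(1)[OF u, of J' L'] \<pi>, of I] by simp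
      have B: "(\<Sum>\<kappa>\<in>?R. u $ (I', J \<circ> \<kappa> \<circ> (swap4 1 2 \<circ> \<pi> \<circ> swap4 1 2), L')) = of_int (sign \<pi> * ?c (\<pi> 2 = 2)) * u $ (I', J, L')" for I' L'
        unfolding R using hook_average[OF schur211_slots(2)[OF u, of I' L'] conj(1)[of 2], of J] conj(2,3)[of 2] by (simp add: o_assoc)
      have C: "(\<Sum>\<kappa>\<in>?R. u $ (I', J', L \<circ> \<kappa> \<circ> (swap4 1 3 \<circ> \<pi> \<circ> swap4 1 3))) = of_int (sign \<pi> * ?c (\<pi> 3 = 3)) * u $ (I', J', L)" for I' J'
        unfolding R using hook_average[OF schur211_slots(3)[OF u, of I' J'] conj(1)[of 3], of L] conj(2,3)[of 3] by (simp add: o_assoc)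
      have "(\<Sum>\<kappa>\<in>?R. \<Sum>\<nu>\<in>?R. \<Sum>\<mu>\<in>?R. U \<pi> \<kappa> \<nu> \<mu>)
        = of_int (sign \<pi> * ?c (\<pi> 3 = 3)) * (of_int (sign \<pi> * ?c (\<pi> 2 = 2)) * (of_int (sign \<pi> * ?c (\<pi> 1 = 1)) * u $ (I, J, L)))"
        unfolding U_def C sum_distrib_left[symmetric] B A ..
      moreover have "sign \<pi> * sign \<pi> = 1" by (cases rule: sign_cases[of \<pi>]) simp_all
      then have "(of_int (sign \<pi>) * of_int (sign \<pi>) :: 'k) = 1" by (metis of_int_1 of_int_mult)
      ultimately show ?thesis by (simp add: mult_ac)
    qed
    have "0 = (\<Sum>\<kappa>\<in>?R. \<Sum>\<nu>\<in>?R. \<Sum>\<mu>\<in>?R. \<Sum>\<pi> | \<pi> permutes UNIV. U \<pi> \<kappa> \<nu> \<mu>)" by (simp only: zero sum.neutral_const)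
    also have "\<dots> = (\<Sum>\<pi> | \<pi> permutes UNIV. \<Sum>\<kappa>\<in>?R. \<Sum>\<nu>\<in>?R. \<Sum>\<mu>\<in>?R. U \<pi> \<kappa> \<nu> \<mu>)"
      unfolding R sum.distrib ..
    also have "\<dots> = (\<Sum>\<pi> | \<pi> permutes (UNIV :: 4 set). of_int (sign \<pi>) * (of_int (if \<pi> 1 = 1 then 3 else -1) *
       of_int (if \<pi> 2 = 2 then 3 else -1) * of_int (if \<pi> 3 = 3 then 3 else -1)) * u $ (I, J, L))"
      by (rule sum.cong[OF refl]) (simp only: avg mem_Collect_eq)
    also have "\<dots> = 64 * u $ (I, J, L)" unfolding sum_distrib_right[symmetric] signed_sum_hooks ..
    finally show ?thesis by simp
  qed
  then show ?thesis by (auto simp: vec_eq_iff)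
qed

text \<open>
  Young symmetrizers permute positions and therefore commute with tensor powers.
\<close>

lemma tensor_power_young:
  "tensor_power g *v young_symmetrizer t f = young_symmetrizer t (tensor_power g *v f)"
proof -
  have place: "(\<Sum>I'\<in>UNIV. tensor_power g $ I $ I' * f $ (I' \<circ> \<pi>)) = (tensor_power g *v f) $ (I \<circ> \<pi>)"
    if "\<pi> permutes UNIV" for I \<pi>
  proof -
    have 1: "tensor_power g $ (I \<circ> \<pi>) $ (I' \<circ> \<pi>) = tensor_power g $ I $ I'" for I'
      using prod.permute[OF that, of "\<lambda>s. g $ I s $ I' s"] by (simp add: tensor_power_def o_def)
    have "bij_betw (\<lambda>P. P \<circ> \<pi>) UNIV UNIV"
      by (rule bij_betw_byWitness[where f' = "\<lambda>P. P \<circ> inv \<pi>"])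
         (use that in \<open>auto simp: o_assoc[symmetric] permutes_inv_o\<close>)
    from sum.reindex_bij_betw[OF this, of "\<lambda>I'. tensor_power g $ (I \<circ> \<pi>) $ I' * f $ I'"]
    show ?thesis by (simp add: matrix_vector_mult_def 1)
  qed
  have "(tensor_power g *v young_symmetrizer t f) $ I = young_symmetrizer t (tensor_power g *v f) $ I" for I
  proof -
    have "(tensor_power g *v young_symmetrizer t f) $ I = (\<Sum>I'\<in>UNIV. \<Sum>\<sigma>\<in>row_group t. \<Sum>\<tau>\<in>col_group t.
        of_int (sign \<tau>) * (tensor_power g $ I $ I' * f $ (I' \<circ> \<tau> \<circ> \<sigma>)))"
      by (simp add: matrix_vector_mult_def young_symmetrizer_def sum_distrib_left mult_ac)
    also have "\<dots> = (\<Sum>\<sigma>\<in>row_group t. \<Sum>\<tau>\<in>col_group t. \<Sum>I'\<in>UNIV.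
        of_int (sign \<tau>) * (tensor_power g $ I $ I' * f $ (I' \<circ> \<tau> \<circ> \<sigma>)))"
      by (subst sum.swap, intro sum.cong refl, rule sum.swap)
    also have "\<dots> = (\<Sum>\<sigma>\<in>row_group t. \<Sum>\<tau>\<in>col_group t. of_int (sign \<tau>) * (tensor_power g *v f) $ (I \<circ> \<tau> \<circ> \<sigma>))"
    proof (intro sum.cong refl)
      fix \<sigma> \<tau> assume "\<sigma> \<in> row_group t" "\<tau> \<in> col_group t"
      then have "\<tau> \<circ> \<sigma> permutes UNIV" by (auto simp: row_group_def col_group_def intro: permutes_compose)
      from place[OF this, of I]
      show "(\<Sum>I'\<in>UNIV. of_int (sign \<tau>) * (tensor_power g $ I $ I' * f $ (I' \<circ> \<tau> \<circ> \<sigma>)))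
        = of_int (sign \<tau>) * (tensor_power g *v f) $ (I \<circ> \<tau> \<circ> \<sigma>)"
        by (simp add: o_assoc flip: sum_distrib_left)
    qed
    finally show ?thesis by (simp add: young_symmetrizer_def)
  qed
  then show ?thesis by (simp add: vec_eq_iff)
qed

lemma kron3_eq_tmap: "kron3 A B C *v T = tmap A B C T"
proof -
  have "(\<Sum>q\<in>UNIV. f q) = (\<Sum>i\<in>UNIV. \<Sum>j\<in>UNIV. \<Sum>k\<in>UNIV. f (i, j, k))" for f :: "'b \<times> 'c \<times> 'd \<Rightarrow> 'a"
    by (simp add: sum.cartesian_product flip: UNIV_Times_UNIV)
  then show ?thesis by (simp add: kron3_def tmap_def matrix_vector_mult_def vec_eq_iff split_beta)
qed

lemma schur211_invariant:
  assumes "u \<in> schur211_tensor"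
  shows "kron3 (tensor_power g) (tensor_power h) (tensor_power l) *v u \<in> schur211_tensor"
  using assms unfolding schur211_tensor_def
proof (induction rule: vec.span_induct_alt)
  case base then show ?case by (simp add: vec.span_zero)
next
  case (step c x y)
  let ?K = "kron3 (tensor_power g) (tensor_power h) (tensor_power l)"
  obtain f' g' h' where x: "x = tensor3 (young_symmetrizer tableau211 f') (young_symmetrizer tableau211 g')
     (young_symmetrizer tableau211 h')" using step(1) unfolding schur_module_def by blast
  have "?K *v x = tensor3 (young_symmetrizer tableau211 (tensor_power g *v f'))
     (young_symmetrizer tableau211 (tensor_power h *v g')) (young_symmetrizer tableau211 (tensor_power l *v h'))"
    unfolding x kron3_eq_tmap tmap_tensor3 tensor_power_young ..
  moreover have "\<dots> \<in> {tensor3 f g h |f g h. f \<in> schur_module tableau211 \<and>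
     g \<in> schur_module tableau211 \<and> h \<in> schur_module tableau211}" unfolding schur_module_def by blast
  ultimately have "?K *v x \<in> vec.span {tensor3 f g h |f g h. f \<in> schur_module tableau211 \<and>
     g \<in> schur_module tableau211 \<and> h \<in> schur_module tableau211}" by (simp add: vec.span_base)
  then show ?case using step(2)
    by (simp add: matrix_vector_right_distrib vector_scalar_commute vec.span_add vec.span_scale)
qed

lemma linear_hook_map: "Vector_Spaces.linear (*s) pscale hook_map"
  by unfold_locales (simp_all add: hook_map_add hook_map_scale)

text \<open>
  The existence of the module.
\<close>

theorem schur211_submodule_hook_map:
  "schur211_submodule (hook_map ` (schur211_tensor ::
     ('k::field_char_0 ^ ((4 \<Rightarrow> 'a::finite) \<times> (4 \<Rightarrow> 'b::finite) \<times> (4 \<Rightarrow> 'c::finite))) set))"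
proof -
  let ?U = "schur211_tensor :: ('k ^ ((4 \<Rightarrow> 'a) \<times> (4 \<Rightarrow> 'b) \<times> (4 \<Rightarrow> 'c))) set"
  have sub: "vec.subspace ?U" unfolding schur211_tensor_def by (rule vec.subspace_span)
  have m0: "hook_map (0 :: 'k ^ ((4 \<Rightarrow> 'a) \<times> (4 \<Rightarrow> 'b) \<times> (4 \<Rightarrow> 'c))) = 0" by (simp add: hook_map_def quartic_0)
  have "mpoly.subspace (hook_map ` ?U)"
    unfolding mpoly.subspace_def
  proof (intro conjI ballI allI)
    show "0 \<in> hook_map ` ?U" using m0 vec.subspace_0[OF sub] by (metis imageI)
    show "x + y \<in> hook_map ` ?U" if "x \<in> hook_map ` ?U" "y \<in> hook_map ` ?U" for x y
      using that vec.subspace_add[OF sub] by (auto simp flip: hook_map_add)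
    show "pscale c x \<in> hook_map ` ?U" if "x \<in> hook_map ` ?U" for c x
      using that vec.subspace_scale[OF sub] by (auto simp flip: hook_map_scale)
  qed
  moreover have "\<forall>f\<in>hook_map ` ?U. homogeneous 4 f" by (auto simp: hook_map_def homogeneous_quartic)
  moreover have "psubst (kron3 g h l) f \<in> hook_map ` ?U" if "f \<in> hook_map ` ?U" for f g h l
    using that schur211_invariant by (auto intro!: imageI simp flip: hook_map_equivariant)
  moreover have "inj_on hook_map ?U"
  proof (rule inj_onI)
    fix u v assume uv: "u \<in> ?U" "v \<in> ?U" "hook_map u = hook_map v"
    have "u = v + (u - v)" by simp
    then have "hook_map u = hook_map v + hook_map (u - v)" by (metis hook_map_add)
    then have "hook_map (u - v) = 0" using uv(3) by simp
    then have "u - v = 0" by (rule hook_map_eq_0[OF vec.subspace_diff[OF sub uv(1,2)]])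
    then show "u = v" by simp
  qed
  then have "bij_betw hook_map ?U (hook_map ` ?U)" by (rule inj_on_imp_bij_betw)
  ultimately show ?thesis unfolding schur211_submodule_def
    using linear_hook_map hook_map_equivariant by blast
qed

section \<open>Generators of the Schur module\<close>

definition hook :: "'k::comm_ring_1 ^ 'a \<Rightarrow> 'k ^ 'a \<Rightarrow> 'k ^ 'a \<Rightarrow> 'k ^ 'a \<Rightarrow> 'k ^ (4 \<Rightarrow> 'a::finite)" where
  "hook x0 x1 x2 x3 = young_symmetrizer tableau211 (\<chi> I. x0 $ I 0 * x1 $ I 1 * x2 $ I 2 * x3 $ I 3)"

lemma hook_coord: "hook x0 x1 x2 x3 $ mk4 p q r s
   = alt3 (\<lambda>p r s. x0 $ p * x1 $ q * x2 $ r * x3 $ s + x0 $ q * x1 $ p * x2 $ r * x3 $ s) p r s"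
  unfolding hook_def young_explicit by simp

lemma vec4_eqI: "(\<And>p q r s. x $ mk4 p q r s = y $ mk4 p q r s) \<Longrightarrow> x = y"
  by (metis mk4_eta vec_eq_iff)

lemma hook_in_schur: "hook x0 x1 x2 x3 \<in> schur_module tableau211"
  unfolding hook_def schur_module_def by blast

lemma tensor_power_hook:
  fixes x0 :: "'k::comm_ring_1 ^ 'a::finite"
  shows "tensor_power g *v hook x0 x1 x2 x3 = hook (g *v x0) (g *v x1) (g *v x2) (g *v x3)"
proof -
  have "tensor_power g *v (\<chi> I :: 4 \<Rightarrow> 'a. x0 $ I 0 * x1 $ I 1 * x2 $ I 2 * x3 $ I 3)
     = (\<chi> I :: 4 \<Rightarrow> 'a. (g *v x0) $ I 0 * (g *v x1) $ I 1 * (g *v x2) $ I 2 * (g *v x3) $ I 3)"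
  proof -
    have "(\<Sum>I'\<in>UNIV. tensor_power g $ I $ I' * (x0 $ I' 0 * x1 $ I' 1 * x2 $ I' 2 * x3 $ I' 3))
       = (\<Sum>I'\<in>UNIV. \<Prod>s\<in>UNIV. g $ I s $ I' s * mk4 x0 x1 x2 x3 s $ I' s)" for I
      by (simp add: tensor_power_def prod_UNIV_4 mult_ac)
    also have "\<dots> I = (\<Prod>s\<in>UNIV. \<Sum>v\<in>UNIV. g $ I s $ v * mk4 x0 x1 x2 x3 s $ v)" for I
      by (rule prod_sum_functions[symmetric])
    finally show ?thesis by (simp add: matrix_vector_mult_def prod_UNIV_4)
  qed
  then show ?thesis unfolding hook_def tensor_power_young by simp
qed

lemma hook_symmetric: "hook x0 x1 x2 x3 = hook x1 x0 x2 x3"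
  by (rule vec4_eqI) (simp add: hook_coord alt3_def algebra_simps)

lemma hook_antisymmetric: "hook x0 x1 x3 x2 = - hook x0 x1 x2 x3"
  by (rule vec4_eqI) (simp add: hook_coord alt3_def algebra_simps)

lemma hook_zero:
  "hook x x x y = 0" "hook x y x y = 0" "hook y x x y = 0" "hook y y x y = 0" "hook x0 x1 x x = 0"
  by (rule vec4_eqI, simp add: hook_coord alt3_def algebra_simps)+

lemma hook_add:
  "hook (x0 + y) x1 x2 x3 = hook x0 x1 x2 x3 + hook y x1 x2 x3"
  "hook x0 (x1 + y) x2 x3 = hook x0 x1 x2 x3 + hook x0 y x2 x3"
  "hook x0 x1 (x2 + y) x3 = hook x0 x1 x2 x3 + hook x0 x1 y x3"
  by (rule vec4_eqI, simp add: hook_coord alt3_def algebra_simps)+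

lemma hook_scale:
  "hook (c *s x0) x1 x2 x3 = c *s hook x0 x1 x2 x3" "hook x0 (c *s x1) x2 x3 = c *s hook x0 x1 x2 x3"
  "hook x0 x1 (c *s x2) x3 = c *s hook x0 x1 x2 x3" "hook x0 x1 x2 (c *s x3) = c *s hook x0 x1 x2 x3"
  by (rule vec4_eqI, simp add: hook_coord alt3_def algebra_simps)+

definition swap_mat :: "'a \<Rightarrow> 'a \<Rightarrow> 'k::comm_ring_1 ^ 'a ^ 'a::finite" where
  "swap_mat a b = (\<chi> r c. if r = Transposition.transpose a b c then 1 else 0)"

definition transvection :: "'a \<Rightarrow> 'a \<Rightarrow> 'k \<Rightarrow> 'k::comm_ring_1 ^ 'a ^ 'a::finite" where
  "transvection l m c = (\<chi> r s. (if r = s then 1 else 0) + (if r = l \<and> s = m then c else 0))"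

definition scale_mat :: "'a \<Rightarrow> 'k \<Rightarrow> 'k::comm_ring_1 ^ 'a ^ 'a::finite" where
  "scale_mat i c = (\<chi> r s. if r = s then (if r = i then c else 1) else 0)"

lemma matrix_axis: "(M *v axis i 1) $ r = M $ r $ i"
  by (simp add: matrix_vector_mult_def axis_def if_distrib[of "\<lambda>x. _ * x"] cong: if_cong)

lemma matrix_eqI_axis: "(\<And>i. A *v axis i 1 = B *v axis i 1) \<Longrightarrow> A = B"
  by (simp add: vec_eq_iff matrix_axis)

lemma swap_mat_axis: "swap_mat a b *v axis i 1 = axis (Transposition.transpose a b i) 1"
  unfolding vec_eq_iff matrix_axis by (auto simp: swap_mat_def axis_def)

lemma transvection_axis: "transvection l m c *v axis i 1 = (if i = m then axis m 1 + c *s axis l 1 else axis i 1)"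
  unfolding vec_eq_iff matrix_axis by (auto simp: transvection_def axis_def)

lemma scale_mat_axis: "scale_mat j c *v axis i 1 = (if i = j then c *s axis i 1 else axis i 1)"
  unfolding vec_eq_iff matrix_axis by (auto simp: scale_mat_def axis_def)

lemma invertible_swap_mat: "invertible (swap_mat a b)"
proof -
  have "swap_mat a b ** swap_mat a b = mat 1"
    by (rule matrix_eqI_axis) (simp add: swap_mat_axis flip: matrix_vector_mul_assoc)
  then show ?thesis unfolding invertible_def by blast
qed

lemma invertible_transvection:
  fixes c :: "'k::field"
  assumes "l \<noteq> m"
  shows "invertible (transvection l m c)"
proof -
  have "transvection l m c ** transvection l m (- c) = mat 1" for c :: 'k
    by (rule matrix_eqI_axis)
       (use assms in \<open>simp add: transvection_axis matrix_vector_right_distrib matrix_vector_mult_diff_distrib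
          vector_scalar_commute vec_eq_iff flip: matrix_vector_mul_assoc\<close>)
  from this[of c] this[of "- c"] show ?thesis unfolding invertible_def by auto
qed

lemma invertible_scale_mat:
  fixes c :: "'k::field"
  assumes "c \<noteq> 0"
  shows "invertible (scale_mat i c)"
proof -
  have "scale_mat i a ** scale_mat i b = mat 1" if "a * b = 1" for a b :: 'k
    by (rule matrix_eqI_axis)
       (use that in \<open>simp add: scale_mat_axis vector_scalar_commute vec_eq_iff mult.assoc[symmetric] mult.commute[of b a]
          flip: matrix_vector_mul_assoc\<close>)
  from this[of c "1/c"] this[of "1/c" c] show ?thesis using assms unfolding invertible_def by auto
qed

lemma young_linear:
  "young_symmetrizer t (f + g) = young_symmetrizer t f + young_symmetrizer t g"
  "young_symmetrizer t (c *s f) = c *s young_symmetrizer t f"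
  by (simp_all add: young_symmetrizer_def vec_eq_iff distrib_left sum.distrib sum_distrib_left mult_ac)

lemma young_sum: "young_symmetrizer t (\<Sum>i\<in>I. f i) = (\<Sum>i\<in>I. young_symmetrizer t (f i))"
proof (induction I rule: infinite_finite_induct)
  case empty
  show ?case using young_linear(2)[of t 0 0] by simp
next
  case (infinite I)
  then show ?case using young_linear(2)[of t 0 0] by simp
qed (simp add: young_linear)

lemma schur_module_hooks:
  assumes "vec.subspace D" "\<And>i j k l. hook (axis i 1) (axis j 1) (axis k 1) (axis l 1) \<in> D"
    "f \<in> schur_module tableau211"
  shows "f \<in> D"
proof -
  obtain g where g: "f = young_symmetrizer tableau211 g" using assms(3) unfolding schur_module_def by blast
  have "(axis I 1 :: 'a ^ (4 \<Rightarrow> 'b)) = (\<chi> I'. axis (I 0) 1 $ I' 0 * axis (I 1) 1 $ I' 1 * axis (I 2) 1 $ I' 2 * axis (I 3) 1 $ I' 3)"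
    for I :: "4 \<Rightarrow> 'b"
    by (auto simp: vec_eq_iff axis_def fun4_eq_iff)
  then have y: "young_symmetrizer tableau211 (axis I 1 :: 'a ^ (4 \<Rightarrow> 'b))
     = hook (axis (I 0) 1) (axis (I 1) 1) (axis (I 2) 1) (axis (I 3) 1)" for I by (simp add: hook_def)
  have "f = young_symmetrizer tableau211 (\<Sum>I\<in>UNIV. g $ I *s axis I 1)" unfolding g basis_expansion ..
  also have "\<dots> = (\<Sum>I\<in>UNIV. g $ I *s hook (axis (I 0) 1) (axis (I 1) 1) (axis (I 2) 1) (axis (I 3) 1))"
    by (simp add: young_sum young_linear y)
  also have "\<dots> \<in> D" by (intro vec.subspace_sum vec.subspace_scale assms(1,2))
  finally show ?thesis .
qed

text \<open>
  Swapping basis vectors reaches every hook with a repeated first vector. The difference of two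
  opposite transvections polarizes the repeated vector, and the symmetries of the hook give the
  remaining ones.
\<close>

lemma schur_module_generated:
  fixes D :: "('k::field_char_0 ^ (4 \<Rightarrow> 'a::finite)) set"
  assumes sub: "vec.subspace D" and inv: "\<And>g v. invertible g \<Longrightarrow> v \<in> D \<Longrightarrow> tensor_power g *v v \<in> D"
    and dist: "i0 \<noteq> i1" "i0 \<noteq> i2" "i1 \<noteq> i2"
    and start: "hook (axis i0 1) (axis i0 1) (axis i1 1) (axis i2 1) \<in> D"
    and f: "f \<in> schur_module tableau211"
  shows "f \<in> D"
proof -
  let ?h = "\<lambda>i j k l. hook (axis i 1) (axis j 1) (axis k 1) (axis l 1) :: 'k ^ (4 \<Rightarrow> 'a)"
  let ?t = "Transposition.transpose :: 'a \<Rightarrow> 'a \<Rightarrow> 'a \<Rightarrow> 'a"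
  have sw: "?h (?t a b i) (?t a b j) (?t a b k) (?t a b l) \<in> D" if "?h i j k l \<in> D" for a b i j k l
    using inv[OF invertible_swap_mat that, of a b] by (simp add: tensor_power_hook swap_mat_axis)
  have highest: "?h i i j k \<in> D" if d: "i \<noteq> j" "i \<noteq> k" "j \<noteq> k" for i j k
  proof -
    define j' where "j' = ?t i0 i i1"
    define k' where "k' = ?t i0 i i2"
    have 1: "?h i i j' k' \<in> D" using sw[OF start, of i0 i] by (simp add: j'_def k'_def)
    have d1: "i \<noteq> j'" "i \<noteq> k'" "j' \<noteq> k'"
      using dist unfolding j'_def k'_def by (auto simp: Transposition.transpose_def)
    define k'' where "k'' = ?t j' j k'"
    have 2: "?h i i j k'' \<in> D" using sw[OF 1, of j' j] d d1 by (simp add: k''_def Transposition.transpose_def)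
    have d2: "i \<noteq> k''" "j \<noteq> k''" using d d1 unfolding k''_def by (auto simp: Transposition.transpose_def)
    show ?thesis using sw[OF 2, of k'' k] d d2 by (simp add: Transposition.transpose_def)
  qed
  have mixed: "?h i l j k \<in> D" if d: "i \<noteq> j" "i \<noteq> k" "j \<noteq> k" for i j k l
  proof (cases "l = i")
    case True then show ?thesis using highest[OF d] by simp
  next
    case False
    (* The coefficient of c in this quadratic polynomial is isolated with c = 1 and c = -1. *)
    have tv: "?h i i j k + (c + c) *s ?h i l j k + (c * c) *s ?h l l j k \<in> D" for c
    proof -
      have "tensor_power (transvection l i c) *v ?h i i j k \<in> D"
        by (rule inv[OF invertible_transvection[OF False] highest[OF d]])
      moreover have "tensor_power (transvection l i c) *v ?h i i j k
         = ?h i i j k + (c + c) *s ?h i l j k + (c * c) *s ?h l l j k"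
        using d by (simp add: tensor_power_hook transvection_axis hook_add hook_scale hook_symmetric[of "axis l 1" "axis i 1"]
            vec_eq_iff algebra_simps)
      ultimately show ?thesis by simp
    qed
    have "(1/4) *s ((?h i i j k + (1 + 1) *s ?h i l j k + (1 * 1) *s ?h l l j k)
       - (?h i i j k + (-1 + -1) *s ?h i l j k + (-1 * -1) *s ?h l l j k)) \<in> D"
      by (intro vec.subspace_scale vec.subspace_diff sub tv)
    moreover have "(1/4) *s ((?h i i j k + (1 + 1) *s ?h i l j k + (1 * 1) *s ?h l l j k)
       - (?h i i j k + (-1 + -1) *s ?h i l j k + (-1 * -1) *s ?h l l j k)) = ?h i l j k"
      by (simp add: vec_eq_iff algebra_simps)
    ultimately show ?thesis by simp
  qed
  have zero: "0 \<in> D" by (rule vec.subspace_0[OF sub])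
  have "?h p q r s \<in> D" for p q r s
  proof -
    consider "r = s" | "r \<noteq> s" "p \<noteq> r" "p \<noteq> s" | "r \<noteq> s" "q \<noteq> r" "q \<noteq> s" | "p = r \<or> p = s" "q = r \<or> q = s" by blast
    then show ?thesis
    proof cases
      case 1 then show ?thesis by (simp add: hook_zero zero)
    next
      case 2 then show ?thesis by (intro mixed) auto
    next
      case 3
      then have "?h q p r s \<in> D" by (intro mixed) auto
      then show ?thesis by (subst hook_symmetric)
    next
      case 4 then show ?thesis by (auto simp: hook_zero zero)
    qed
  qed
  then show ?thesis by (rule schur_module_hooks[OF sub _ f])
qed

section \<open>The Kronecker coefficient is one\<close>

text \<open>
  A highest weight vector of weight (2,1,1) is described by a matrix \<open>n\<close>: the entry
  \<open>n q p\<close> is the coordinate with the second basis vector in position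
  \<open>q\<close> and the third one in position \<open>p\<close>. These matrices form the
  second exterior power of the three dimensional standard representation of the permutations of
  positions.
\<close>

definition skew :: "(4 \<Rightarrow> 4 \<Rightarrow> 'k::comm_ring_1) \<Rightarrow> bool" where
  "skew n \<longleftrightarrow> (\<forall>q p. n p q = - n q p) \<and> (\<forall>p. (\<Sum>q\<in>UNIV. n q p) = 0)"

text \<open>
  Coordinates on the space of such matrices, indexed by the three partitions of the four
  positions into two pairs. The Klein four-group acts on them by its three nontrivial
  characters.
\<close>

definition xi :: "nat \<Rightarrow> (4 \<Rightarrow> 4 \<Rightarrow> 'k::comm_ring_1) \<Rightarrow> 'k" where
  "xi a n = (if a = 0 then n 0 1 + n 2 3 else if a = 1 then n 0 2 + n 3 1 else n 0 3 + n 1 2)"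

lemma skew_eqs:
  fixes n :: "4 \<Rightarrow> 4 \<Rightarrow> 'k::field_char_0"
  assumes "skew n"
  shows "n p q = - n q p" "n p p = 0" "n 0 1 = n 1 2 + n 1 3" "n 0 2 = n 2 3 - n 1 2" "n 0 3 = - n 1 3 - n 2 3"
proof -
  have sk: "n p q = - n q p" for p q using assms unfolding skew_def by blast
  then show "n p q = - n q p" .
  have d: "n p p = 0" for p
  proof -
    have "n p p + n p p = 0" using sk[of p p] by (simp add: eq_neg_iff_add_eq_0)
    then show ?thesis by (simp flip: mult_2)
  qed
  then show "n p p = 0" .
  have s: "n 0 p + n 1 p + n 2 p + n 3 p = 0" for p
  proof -
    have "(\<Sum>q\<in>UNIV. n q p) = 0" using assms unfolding skew_def by blast
    then show ?thesis by (simp only: sum_UNIV_4)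
  qed
  have "n 0 1 - (n 1 2 + n 1 3) = n 0 1 + 0 + - n 1 2 + - n 1 3" by simp
  also have "\<dots> = 0" using s[of 1] unfolding sk[of 2 1] sk[of 3 1] d .
  finally show "n 0 1 = n 1 2 + n 1 3" by simp
  have "n 0 2 - (n 2 3 - n 1 2) = n 0 2 + n 1 2 + 0 + - n 2 3" by simp
  also have "\<dots> = 0" using s[of 2] unfolding sk[of 3 2] d .
  finally show "n 0 2 = n 2 3 - n 1 2" by simp
  have "n 0 3 - (- n 1 3 - n 2 3) = n 0 3 + n 1 3 + n 2 3 + 0" by simp
  also have "\<dots> = 0" using s[of 3] unfolding d .
  finally show "n 0 3 = - n 1 3 - n 2 3" by simp
qed

text \<open>
  The relations leave the three entries with indices in \<open>{1, 2, 3}\<close> free, and the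
  three coordinates determine them.
\<close>

lemma skew_eq_0:
  fixes n :: "4 \<Rightarrow> 4 \<Rightarrow> 'k::field_char_0"
  assumes n: "skew n" and xi: "xi 0 n = 0" "xi 1 n = 0" "xi 2 n = 0"
  shows "n q p = 0"
proof -
  note e = skew_eqs[OF n]
  have 1: "n 1 2 + n 1 3 + n 2 3 = 0" using xi(1) by (simp add: xi_def e(3))
  have 2: "n 2 3 - n 1 2 - n 1 3 = 0" using xi(2) e(1)[of 3 1] by (simp add: xi_def e(4))
  have "n 1 2 - n 1 3 - n 2 3 = - n 1 3 - n 2 3 + n 1 2" by simp
  also have "\<dots> = 0" using xi(3) by (simp add: xi_def e(5))
  finally have 3: "n 1 2 - n 1 3 - n 2 3 = 0" .
  have "2 * n 2 3 = (n 1 2 + n 1 3 + n 2 3) + (n 2 3 - n 1 2 - n 1 3)" by (simp add: algebra_simps)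
  then have a: "n 2 3 = 0" unfolding 1 2 by simp
  have "2 * n 1 2 = (n 1 2 + n 1 3 + n 2 3) + (n 1 2 - n 1 3 - n 2 3)" by (simp add: algebra_simps)
  then have b: "n 1 2 = 0" unfolding 1 3 by simp
  have c: "n 1 3 = 0" using 1 a b by simp
  have "\<forall>q p. n q p = 0"
    unfolding all_4 using a b c e(1)[of 1 0] e(1)[of 2 0] e(1)[of 3 0] e(1)[of 2 1] e(1)[of 3 1] e(1)[of 3 2]
    by (simp add: e(2) e(3,4,5))
  then show ?thesis by blast
qed

text \<open>
  The first six equations are the characters of the Klein four-group; the remaining ones show
  that a cycle of length three permutes the coordinates and that a transposition permutes them
  with a common sign.
\<close>

lemma xi_permuted:
  fixes n :: "4 \<Rightarrow> 4 \<Rightarrow> 'k::field_char_0"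
  assumes n: "skew n"
  shows "xi 0 (\<lambda>q p. n (mk4 1 0 3 2 q) (mk4 1 0 3 2 p)) = - xi 0 n"
    "xi 1 (\<lambda>q p. n (mk4 1 0 3 2 q) (mk4 1 0 3 2 p)) = - xi 1 n"
    "xi 2 (\<lambda>q p. n (mk4 1 0 3 2 q) (mk4 1 0 3 2 p)) = xi 2 n"
    "xi 0 (\<lambda>q p. n (mk4 2 3 0 1 q) (mk4 2 3 0 1 p)) = xi 0 n"
    "xi 1 (\<lambda>q p. n (mk4 2 3 0 1 q) (mk4 2 3 0 1 p)) = - xi 1 n"
    "xi 2 (\<lambda>q p. n (mk4 2 3 0 1 q) (mk4 2 3 0 1 p)) = - xi 2 n"
    "xi 0 (\<lambda>q p. n (mk4 0 2 3 1 q) (mk4 0 2 3 1 p)) = xi 1 n"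
    "xi 1 (\<lambda>q p. n (mk4 0 2 3 1 q) (mk4 0 2 3 1 p)) = xi 2 n"
    "xi 2 (\<lambda>q p. n (mk4 0 2 3 1 q) (mk4 0 2 3 1 p)) = xi 0 n"
    "xi 0 (\<lambda>q p. n (mk4 0 2 1 3 q) (mk4 0 2 1 3 p)) = - xi 2 n"
    "xi 1 (\<lambda>q p. n (mk4 0 2 1 3 q) (mk4 0 2 1 3 p)) = - xi 1 n"
    "xi 2 (\<lambda>q p. n (mk4 0 2 1 3 q) (mk4 0 2 1 3 p)) = - xi 0 n"
  using skew_eqs(1)[OF n, of 1 0] skew_eqs(1)[OF n, of 2 0] skew_eqs(1)[OF n, of 3 0]
    skew_eqs(1)[OF n, of 2 1] skew_eqs(1)[OF n, of 3 1] skew_eqs(1)[OF n, of 3 2]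
  by (simp_all add: xi_def skew_eqs(3,4,5)[OF n])

lemma xi_linear:
  "xi a (\<lambda>q p. c * n q p) = c * xi a n" "xi a (\<lambda>q p. n q p + n' q p) = xi a n + xi a n'"
  "xi a (\<lambda>q p. - n q p) = - xi a n" "xi a (\<lambda>q p. n q p - n' q p) = xi a n - xi a n'"
  by (simp_all add: xi_def algebra_simps)

text \<open>
  A coordinate in one factor can be taken without losing the relations in another one.
\<close>

lemma skew_xi:
  assumes "\<And>q p. skew (\<lambda>q' p'. G q p q' p')"
  shows "skew (\<lambda>q' p'. xi a (\<lambda>q p. G q p q' p'))"
proof -
  have 1: "G q p p' q' = - G q p q' p'" "(\<Sum>q'\<in>UNIV. G q p q' p') = 0" for q p q' p'
    using assms unfolding skew_def by blast+
  show ?thesis unfolding skew_def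
  proof (intro conjI allI)
    show "xi a (\<lambda>q p. G q p p' q') = - xi a (\<lambda>q p. G q p q' p')" for p' q'
      by (simp add: 1(1)[of _ _ p' q'] xi_linear)
    show "(\<Sum>q'\<in>UNIV. xi a (\<lambda>q p. G q p q' p')) = 0" for p'
      using 1(2)[of 0 1 p'] 1(2)[of 2 3 p'] 1(2)[of 0 2 p'] 1(2)[of 3 1 p'] 1(2)[of 0 3 p'] 1(2)[of 1 2 p']
      by (cases "a = 0"; cases "a = 1") (simp_all add: xi_def sum.distrib)
  qed
qed

definition xi3 :: "nat \<Rightarrow> nat \<Rightarrow> nat \<Rightarrow> (4 \<Rightarrow> 4 \<Rightarrow> 4 \<Rightarrow> 4 \<Rightarrow> 4 \<Rightarrow> 4 \<Rightarrow> 'k::comm_ring_1) \<Rightarrow> 'k" where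
  "xi3 a b c G = xi a (\<lambda>q p. xi b (\<lambda>q' p'. xi c (\<lambda>q'' p''. G q p q' p' q'' p'')))"

lemma skew_xi_slots:
  assumes sk: "\<And>q' p' q'' p''. skew (\<lambda>q p. G q p q' p' q'' p'')" "\<And>q p q'' p''. skew (\<lambda>q' p'. G q p q' p' q'' p'')"
      "\<And>q p q' p'. skew (\<lambda>q'' p''. G q p q' p' q'' p'')"
  shows "skew (\<lambda>q' p'. xi c (\<lambda>q'' p''. G q p q' p' q'' p''))"
    "skew (\<lambda>q p. xi b (\<lambda>q' p'. xi c (\<lambda>q'' p''. G q p q' p' q'' p'')))"
proof -
  show "skew (\<lambda>q' p'. xi c (\<lambda>q'' p''. G q p q' p' q'' p''))" for q p
    by (rule skew_xi[where G = "\<lambda>q'' p'' q' p'. G q p q' p' q'' p''"]) (rule sk(2))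
  have "skew (\<lambda>q p. xi c (\<lambda>q'' p''. G q p q' p' q'' p''))" for q' p'
    by (rule skew_xi[where G = "\<lambda>q'' p'' q p. G q p q' p' q'' p''"]) (rule sk(1))
  then show "skew (\<lambda>q p. xi b (\<lambda>q' p'. xi c (\<lambda>q'' p''. G q p q' p' q'' p'')))"
    by (rule skew_xi[where G = "\<lambda>q' p' q p. xi c (\<lambda>q'' p''. G q p q' p' q'' p'')"])
qed

text \<open>
  A permutation acts on the triple coordinates by the product of its actions on the three
  factors.
\<close>

lemma xi3_permuted:
  fixes G :: "4 \<Rightarrow> 4 \<Rightarrow> 4 \<Rightarrow> 4 \<Rightarrow> 4 \<Rightarrow> 4 \<Rightarrow> 'k::comm_ring_1"
  assumes xi: "\<And>(n :: 4 \<Rightarrow> 4 \<Rightarrow> 'k) a. skew n \<Longrightarrow> a \<in> A \<Longrightarrow> xi a (\<lambda>q p. n (\<pi> q) (\<pi> p)) = \<sigma> a * xi (\<tau> a) n"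
    and sk: "\<And>q' p' q'' p''. skew (\<lambda>q p. G q p q' p' q'' p'')" "\<And>q p q'' p''. skew (\<lambda>q' p'. G q p q' p' q'' p'')"
      "\<And>q p q' p'. skew (\<lambda>q'' p''. G q p q' p' q'' p'')"
    and inv: "\<And>q p q' p' q'' p''. G (\<pi> q) (\<pi> p) (\<pi> q') (\<pi> p') (\<pi> q'') (\<pi> p'') = G q p q' p' q'' p''"
    and abc: "a \<in> A" "b \<in> A" "c \<in> A"
  shows "xi3 a b c G = \<sigma> a * \<sigma> b * \<sigma> c * xi3 (\<tau> a) (\<tau> b) (\<tau> c) G"
proof -
  have "xi3 a b c G = xi a (\<lambda>q p. xi b (\<lambda>q' p'. xi c (\<lambda>q'' p''. G (\<pi> q) (\<pi> p) (\<pi> q') (\<pi> p') (\<pi> q'') (\<pi> p''))))"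
    by (simp add: xi3_def inv)
  also have "\<dots> = xi a (\<lambda>q p. xi b (\<lambda>q' p'. \<sigma> c * xi (\<tau> c) (\<lambda>q'' p''. G (\<pi> q) (\<pi> p) (\<pi> q') (\<pi> p') q'' p'')))"
    by (simp only: xi[OF sk(3) abc(3)])
  also have "\<dots> = xi a (\<lambda>q p. \<sigma> c * (\<sigma> b * xi (\<tau> b) (\<lambda>q' p'. xi (\<tau> c) (\<lambda>q'' p''. G (\<pi> q) (\<pi> p) q' p' q'' p''))))"
    by (simp only: xi_linear xi[OF skew_xi_slots(1)[OF sk] abc(2)])
  also have "\<dots> = \<sigma> c * (\<sigma> b * (\<sigma> a * xi (\<tau> a) (\<lambda>q p. xi (\<tau> b) (\<lambda>q' p'. xi (\<tau> c) (\<lambda>q'' p''. G q p q' p' q'' p'')))))"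
    by (simp only: xi_linear xi[OF skew_xi_slots(2)[OF sk] abc(1)])
  finally show ?thesis by (simp add: xi3_def mult_ac)
qed

text \<open>
  Invariance under the Klein four-group kills the triple coordinates with a nontrivial product
  of characters, so the three indices must be distinct. The six remaining ones agree up to sign
  by invariance under the other permutations, so one of them decides.
\<close>

lemma invariant_eq_0:
  fixes G :: "4 \<Rightarrow> 4 \<Rightarrow> 4 \<Rightarrow> 4 \<Rightarrow> 4 \<Rightarrow> 4 \<Rightarrow> 'k::field_char_0"
  assumes sk: "\<And>q' p' q'' p''. skew (\<lambda>q p. G q p q' p' q'' p'')" "\<And>q p q'' p''. skew (\<lambda>q' p'. G q p q' p' q'' p'')"
      "\<And>q p q' p'. skew (\<lambda>q'' p''. G q p q' p' q'' p'')"
    and inv: "\<And>\<pi> q p q' p' q'' p''. \<pi> permutes UNIV \<Longrightarrow> G (\<pi> q) (\<pi> p) (\<pi> q') (\<pi> p') (\<pi> q'') (\<pi> p'') = G q p q' p' q'' p''"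
    and z: "xi3 0 1 2 G = 0"
  shows "G q p q' p' q'' p'' = 0"
proof -
  have perms: "mk4 1 0 3 (2::4) permutes UNIV" "mk4 2 3 0 (1::4) permutes UNIV" "mk4 0 2 3 (1::4) permutes UNIV"
    "mk4 0 2 1 (3::4) permutes UNIV" by (simp_all add: permutes_mk4)
  define s1 :: "nat \<Rightarrow> 'k" where "s1 a = (if a = 2 then 1 else -1)" for a
  define s2 :: "nat \<Rightarrow> 'k" where "s2 a = (if a = 0 then 1 else -1)" for a
  have x1: "xi a (\<lambda>q p. n (mk4 1 0 3 2 q) (mk4 1 0 3 2 p)) = s1 a * xi a n"
    if "skew n" "a \<in> {0, 1, 2}" for a and n :: "4 \<Rightarrow> 4 \<Rightarrow> 'k"
    using that xi_permuted(1,2,3)[OF that(1)] by (auto simp: s1_def)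
  have x2: "xi a (\<lambda>q p. n (mk4 2 3 0 1 q) (mk4 2 3 0 1 p)) = s2 a * xi a n"
    if "skew n" "a \<in> {0, 1, 2}" for a and n :: "4 \<Rightarrow> 4 \<Rightarrow> 'k"
    using that xi_permuted(4,5,6)[OF that(1)] by (auto simp: s2_def)
  have k1: "xi3 a b c G = s1 a * s1 b * s1 c * xi3 a b c G" if "a \<in> {0,1,2}" "b \<in> {0,1,2}" "c \<in> {0,1,2}" for a b c
    by (rule xi3_permuted[where \<pi> = "mk4 1 0 3 2" and \<sigma> = "s1" and \<tau> = "\<lambda>a. a" and A = "{0,1,2}"])
      (rule x1 sk inv[OF perms(1)] that; assumption?)+
  have k2: "xi3 a b c G = s2 a * s2 b * s2 c * xi3 a b c G" if "a \<in> {0,1,2}" "b \<in> {0,1,2}" "c \<in> {0,1,2}" for a b c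
    by (rule xi3_permuted[where \<pi> = "mk4 2 3 0 1" and \<sigma> = "s2" and \<tau> = "\<lambda>a. a" and A = "{0,1,2}"])
      (rule x2 sk inv[OF perms(2)] that; assumption?)+
  define nx :: "nat \<Rightarrow> nat" where "nx a = (if a = 0 then 1 else if a = 1 then 2 else 0)" for a
  have x3: "xi a (\<lambda>q p. n (mk4 0 2 3 1 q) (mk4 0 2 3 1 p)) = 1 * xi (nx a) n"
    if "skew n" "a \<in> {0, 1, 2}" for a and n :: "4 \<Rightarrow> 4 \<Rightarrow> 'k"
    using that xi_permuted(7,8,9)[OF that(1)] by (auto simp: nx_def)
  have k3: "xi3 a b c G = 1 * 1 * 1 * xi3 (nx a) (nx b) (nx c) G" if "a \<in> {0,1,2}" "b \<in> {0,1,2}" "c \<in> {0,1,2}" for a b c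
    by (rule xi3_permuted[where \<pi> = "mk4 0 2 3 1" and \<sigma> = "\<lambda>a. 1" and \<tau> = "nx" and A = "{0,1,2}"])
      (rule x3 sk inv[OF perms(3)] that; assumption?)+
  have x4: "xi a (\<lambda>q p. n (mk4 0 2 1 3 q) (mk4 0 2 1 3 p)) = -1 * xi (2 - a) n"
    if "skew n" "a \<in> {0, 1, 2}" for a and n :: "4 \<Rightarrow> 4 \<Rightarrow> 'k"
    using that xi_permuted(10,11,12)[OF that(1)] by auto
  have k4: "xi3 a b c G = -1 * -1 * -1 * xi3 (2 - a) (2 - b) (2 - c) G" if "a \<in> {0,1,2}" "b \<in> {0,1,2}" "c \<in> {0,1,2}" for a b c
    by (rule xi3_permuted[where \<pi> = "mk4 0 2 1 3" and \<sigma> = "\<lambda>a. -1" and \<tau> = "\<lambda>a. 2 - a" and A = "{0,1,2}"])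
      (rule x4 sk inv[OF perms(4)] that; assumption?)+
  have c: "xi3 0 1 2 G = 0" "xi3 1 2 0 G = 0" "xi3 2 0 1 G = 0" "xi3 2 1 0 G = 0" "xi3 0 2 1 G = 0" "xi3 1 0 2 G = 0"
    using z k3[of 0 1 2] k3[of 1 2 0] k4[of 2 1 0] k3[of 2 1 0] k3[of 0 2 1] by (simp_all add: nx_def)
  have neg: "x = 0" if "x = - x" for x :: 'k
  proof -
    have "2 * x = 0" using that by (simp only: mult_2) (metis add.right_inverse)
    then show ?thesis by simp
  qed
  have all: "xi3 a b c G = 0" if "a \<in> {0,1,2}" "b \<in> {0,1,2}" "c \<in> {0,1,2}" for a b c
  proof (cases "s1 a * s1 b * s1 c = -1 \<or> s2 a * s2 b * s2 c = -1")
    case True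
    then have "xi3 a b c G = - xi3 a b c G" using k1[OF that] k2[OF that] by auto
    then show ?thesis by (rule neg)
  next
    case False
    then show ?thesis using that c by (auto simp: s1_def s2_def)
  qed
  have 1: "xi b (\<lambda>q' p'. xi c (\<lambda>q'' p''. G q p q' p' q'' p'')) = 0" if bc: "b \<in> {0,1,2}" "c \<in> {0,1,2}" for b c q p
    using all[of 0 b c] all[of 1 b c] all[of 2 b c] bc unfolding xi3_def
    by (intro skew_eq_0[OF skew_xi_slots(2)[OF sk, of b c]]) simp_all
  have 2: "xi c (\<lambda>q'' p''. G q p q' p' q'' p'') = 0" if c: "c \<in> {0,1,2}" for c q p q' p'
    by (rule skew_eq_0[OF skew_xi_slots(1)[OF sk, of c q p] 1[of 0 c] 1[of 1 c] 1[of 2 c]]) (use c in simp_all)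
  show ?thesis
    by (rule skew_eq_0[OF sk(3) 2[of 0] 2[of 1] 2[of 2]]) simp_all
qed

section \<open>Uniqueness of the module\<close>

text \<open>
  The properties of a highest weight vector of weight (2,1,1) that are used: its behaviour under
  finitely many group elements. The scaling by 2 detects the multiplicity of each basis vector,
  because the powers of 2 are distinct in characteristic zero.
\<close>

definition highest_weight :: "'a \<Rightarrow> 'a \<Rightarrow> 'a \<Rightarrow> 'k::field_char_0 ^ (4 \<Rightarrow> 'a::finite) \<Rightarrow> bool" where
  "highest_weight i0 i1 i2 x \<longleftrightarrow>
     (\<forall>i. tensor_power (scale_mat i 2) *v x = (if i = i0 then 4 else if i = i1 \<or> i = i2 then 2 else 1) *s x) \<and>
     tensor_power (swap_mat i1 i2) *v x = - x \<and> tensor_power (transvection i0 i1 1) *v x = x"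

text \<open>
  The words of weight (2,1,1): the second basis vector is in position \<open>q\<close>, the
  third in position \<open>p\<close>, and the first one elsewhere.
\<close>

definition arrangement :: "'a \<Rightarrow> 'a \<Rightarrow> 'a \<Rightarrow> 4 \<Rightarrow> 4 \<Rightarrow> 4 \<Rightarrow> 'a" where
  "arrangement i0 i1 i2 q p = (\<lambda>s. if s = q then i1 else if s = p then i2 else i0)"

definition pairs :: "'a \<Rightarrow> 'a \<Rightarrow> 'a \<Rightarrow> 'k::zero ^ (4 \<Rightarrow> 'a::finite) \<Rightarrow> 4 \<Rightarrow> 4 \<Rightarrow> 'k" where
  "pairs i0 i1 i2 x q p = (if q = p then 0 else x $ arrangement i0 i1 i2 q p)"

lemma highest_weight_hook:
  assumes "i0 \<noteq> i1" "i0 \<noteq> i2" "i1 \<noteq> i2"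
  shows "highest_weight i0 i1 i2 (hook (axis i0 1) (axis i0 1) (axis i1 1) (axis i2 1))" (is "highest_weight _ _ _ ?H")
proof -
  have "tensor_power (swap_mat i1 i2) *v ?H = hook (axis i0 1) (axis i0 1) (axis i2 1) (axis i1 1)"
    using assms by (simp add: tensor_power_hook swap_mat_axis)
  also have "\<dots> = - ?H" by (rule hook_antisymmetric)
  finally have "tensor_power (swap_mat i1 i2) *v ?H = - ?H" .
  moreover have "tensor_power (transvection i0 i1 1) *v ?H = ?H"
    using assms by (simp add: tensor_power_hook transvection_axis hook_add hook_zero)
  moreover have "tensor_power (scale_mat i 2) *v ?H = (if i = i0 then 4 else if i = i1 \<or> i = i2 then 2 else 1) *s ?H" for i
    using assms by (auto simp: tensor_power_hook scale_mat_axis hook_scale vec_eq_iff)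
  ultimately show ?thesis unfolding highest_weight_def by blast
qed

lemma tensor_power_scale_mat:
  fixes x :: "'k::comm_ring_1 ^ (4 \<Rightarrow> 'a::finite)"
  shows "(tensor_power (scale_mat i c) *v x) $ I = c ^ card {s. I s = i} * x $ I"
proof -
  have "tensor_power (scale_mat i c) $ I $ I' = (if I' = I then c ^ card {s. I s = i} else 0)" for I'
  proof (cases "I' = I")
    case True
    have "(\<Prod>s\<in>UNIV. scale_mat i c $ I s $ I s) = (\<Prod>s\<in>UNIV. if I s = i then c else 1)"
      by (simp add: scale_mat_def)
    then show ?thesis using True by (simp add: tensor_power_def prod.If_cases)
  next
    case False
    then obtain s where "I' s \<noteq> I s" by blast
    then have "scale_mat i c $ I s $ I' s = 0" by (simp add: scale_mat_def)
    then have "(\<Prod>s\<in>UNIV. scale_mat i c $ I s $ I' s) = 0" by (intro prod_zero) auto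
    then show ?thesis using False by (simp add: tensor_power_def)
  qed
  then show ?thesis by (simp add: matrix_vector_mult_def if_distrib[of "\<lambda>x. x * _"] cong: if_cong)
qed

lemma tensor_power_swap_mat:
  fixes x :: "'k::comm_ring_1 ^ (4 \<Rightarrow> 'a::finite)"
  shows "(tensor_power (swap_mat a b) *v x) $ I = x $ (Transposition.transpose a b \<circ> I)"
proof -
  have "tensor_power (swap_mat a b) $ I $ I' = (if I' = Transposition.transpose a b \<circ> I then 1 else (0::'k))" for I'
  proof (cases "I' = Transposition.transpose a b \<circ> I")
    case True
    then show ?thesis by (simp add: tensor_power_def swap_mat_def)
  next
    case False
    then obtain s where s: "I' s \<noteq> Transposition.transpose a b (I s)" by (auto simp: fun_eq_iff)
    then have "I s \<noteq> Transposition.transpose a b (I' s)" by (metis transpose_involutory)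
    then have "swap_mat a b $ I s $ I' s = (0::'k)" by (simp add: swap_mat_def)
    then have "(\<Prod>s\<in>UNIV. swap_mat a b $ I s $ I' s) = (0::'k)" by (intro prod_zero) auto
    then show ?thesis using False by (simp add: tensor_power_def)
  qed
  then show ?thesis by (simp add: matrix_vector_mult_def if_distrib[of "\<lambda>x. x * _"] cong: if_cong)
qed

lemma power_2_eq:
  "(2::'k::field_char_0) ^ n = 2 \<Longrightarrow> n = 1" "(2::'k) ^ n = 1 \<Longrightarrow> n = 0"
proof -
  have "of_nat (2 ^ n) = (of_nat (2 ^ m) :: 'k) \<Longrightarrow> n = m" for m
    unfolding of_nat_eq_iff by simp
  from this[of 1] this[of 0] show "(2::'k) ^ n = 2 \<Longrightarrow> n = 1" "(2::'k) ^ n = 1 \<Longrightarrow> n = 0" by simp_all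
qed

lemma highest_weight_support:
  fixes x :: "'k::field_char_0 ^ (4 \<Rightarrow> 'a::finite)"
  assumes highest_weight: "highest_weight i0 i1 i2 x" and d: "i0 \<noteq> i1" "i0 \<noteq> i2" "i1 \<noteq> i2" and nz: "x $ I \<noteq> 0"
  shows "\<exists>q p. q \<noteq> p \<and> I = arrangement i0 i1 i2 q p"
proof -
  have "2 ^ card {s. I s = i} * x $ I = (if i = i0 then 4 else if i = i1 \<or> i = i2 then 2 else 1) * x $ I" for i
    using highest_weight unfolding highest_weight_def by (metis tensor_power_scale_mat vector_smult_component)
  then have c: "2 ^ card {s. I s = i} = (if i = i0 then 4 else if i = i1 \<or> i = i2 then 2 else (1 :: 'k))" for i
    using nz by simp
  have "card {s. I s = i1} = 1" "card {s. I s = i2} = 1"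
    by (rule power_2_eq(1)[where 'k = 'k], use c[of i1] c[of i2] d in simp)+
  then obtain q p where q: "{s. I s = i1} = {q}" and p: "{s. I s = i2} = {p}"
    by (meson card_1_singletonE)
  have "I s = i0" if "s \<noteq> q" "s \<noteq> p" for s
  proof (rule ccontr)
    assume ne: "I s \<noteq> i0"
    have "I s \<noteq> i1" "I s \<noteq> i2" using that q p by auto
    then have "card {s'. I s' = I s} = 0" using c[of "I s"] ne power_2_eq(2)[where 'k = 'k] by auto
    then show False by auto
  qed
  then have "I = arrangement i0 i1 i2 q p" using q p d unfolding arrangement_def by (auto simp: fun_eq_iff)
  moreover have "q \<noteq> p" using q p d by auto
  ultimately show ?thesis by blast
qed

lemma highest_weight_eq_0:
  assumes "highest_weight i0 i1 i2 x" "i0 \<noteq> i1" "i0 \<noteq> i2" "i1 \<noteq> i2" "\<And>q p. pairs i0 i1 i2 x q p = 0"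
  shows "x $ I = 0"
  using highest_weight_support[OF assms(1-4), of I] assms(5) unfolding pairs_def by metis

lemma arrangement_inj:
  assumes "i0 \<noteq> i1" "i0 \<noteq> i2" "i1 \<noteq> i2" "q \<noteq> p" "q' \<noteq> p'" "arrangement i0 i1 i2 q p = arrangement i0 i1 i2 q' p'"
  shows "q = q'" "p = p'"
proof -
  have "arrangement i0 i1 i2 q p q = arrangement i0 i1 i2 q' p' q" "arrangement i0 i1 i2 q p p = arrangement i0 i1 i2 q' p' p"
    using assms(6) by simp_all
  then show "q = q'" "p = p'" using assms(1-5) by (auto simp: arrangement_def split: if_splits)
qed

text \<open>
  The sign under the swap of the last two basis vectors gives antisymmetry. The invariance under
  the transvection, read off at a word without the second basis vector, gives the vanishing of
  the sums.
\<close>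

lemma skew_pairs:
  fixes x :: "'k::field_char_0 ^ (4 \<Rightarrow> 'a::finite)"
  assumes highest_weight: "highest_weight i0 i1 i2 x" and d: "i0 \<noteq> i1" "i0 \<noteq> i2" "i1 \<noteq> i2"
  shows "skew (pairs i0 i1 i2 x)"
  unfolding skew_def
proof (intro conjI allI)
  fix q p :: 4
  have "Transposition.transpose i1 i2 \<circ> arrangement i0 i1 i2 q p = arrangement i0 i1 i2 p q" if "q \<noteq> p"
    using that d by (auto simp: arrangement_def fun_eq_iff Transposition.transpose_def)
  moreover have "x $ (Transposition.transpose i1 i2 \<circ> I) = - x $ I" for I
    using highest_weight unfolding highest_weight_def by (metis tensor_power_swap_mat vector_uminus_component)
  ultimately show "pairs i0 i1 i2 x p q = - pairs i0 i1 i2 x q p" unfolding pairs_def by (metis minus_zero)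
next
  fix p :: 4
  define I where "I = (\<lambda>s. if s = p then i2 else i0)"
  let ?T = "transvection i0 i1 1 :: 'k ^ 'a ^ 'a"
  let ?S = "{q. q \<noteq> p}"
  have "x $ I = 0"
  proof (rule ccontr)
    assume "x $ I \<noteq> 0"
    then obtain q p' where "I = arrangement i0 i1 i2 q p'" using highest_weight_support[OF highest_weight d] by blast
    then have "I q = i1" by (simp add: arrangement_def)
    then show False using d by (auto simp: I_def split: if_splits)
  qed
  then have "0 = (tensor_power ?T *v x) $ I" using highest_weight unfolding highest_weight_def by simp
  also have "\<dots> = (\<Sum>I'\<in>UNIV. tensor_power ?T $ I $ I' * x $ I')" by (simp add: matrix_vector_mult_def)
  also have "\<dots> = (\<Sum>I'\<in>(\<lambda>q. arrangement i0 i1 i2 q p) ` ?S. tensor_power ?T $ I $ I' * x $ I')"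
  proof (rule sum.mono_neutral_right)
    show "\<forall>I'\<in>UNIV - (\<lambda>q. arrangement i0 i1 i2 q p) ` ?S. tensor_power ?T $ I $ I' * x $ I' = 0"
    proof
      fix I' assume I': "I' \<in> UNIV - (\<lambda>q. arrangement i0 i1 i2 q p) ` ?S"
      show "tensor_power ?T $ I $ I' * x $ I' = 0"
      proof (rule ccontr)
        assume "tensor_power ?T $ I $ I' * x $ I' \<noteq> 0"
        then have t: "tensor_power ?T $ I $ I' \<noteq> 0" and xn: "x $ I' \<noteq> 0" by auto
        obtain q p' where qp: "q \<noteq> p'" "I' = arrangement i0 i1 i2 q p'" using highest_weight_support[OF highest_weight d xn] by blast
        have "?T $ I p $ I' p \<noteq> 0" using t by (auto simp: tensor_power_def)
        then have "p' = p" using d qp by (auto simp: transvection_def I_def arrangement_def split: if_splits)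
        then show False using I' qp by auto
      qed
    qed
  qed auto
  also have "\<dots> = (\<Sum>q\<in>?S. tensor_power ?T $ I $ arrangement i0 i1 i2 q p * x $ arrangement i0 i1 i2 q p)"
    by (rule sum.reindex[unfolded o_def]) (rule inj_onI, use arrangement_inj[OF d] in blast)
  also have "\<dots> = (\<Sum>q\<in>?S. pairs i0 i1 i2 x q p)"
  proof (rule sum.cong[OF refl])
    fix q assume q: "q \<in> ?S"
    have "?T $ I s $ arrangement i0 i1 i2 q p s = 1" for s
      using q d by (auto simp: transvection_def I_def arrangement_def)
    then show "tensor_power ?T $ I $ arrangement i0 i1 i2 q p * x $ arrangement i0 i1 i2 q p = pairs i0 i1 i2 x q p"
      using q by (simp add: tensor_power_def pairs_def)
  qed
  also have "\<dots> = (\<Sum>q\<in>UNIV. pairs i0 i1 i2 x q p)"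
    by (rule sum.mono_neutral_left) (auto simp: pairs_def)
  finally show "(\<Sum>q\<in>UNIV. pairs i0 i1 i2 x q p) = 0" by simp
qed

text \<open>
  In contrast to the twisted arrangement, the positions in the three factors are kept aligned,
  so that a permutation of positions acts on all three words alike.
\<close>

definition unzip3 :: "(4 \<Rightarrow> 'a \<times> 'b \<times> 'c) \<Rightarrow> (4 \<Rightarrow> 'a) \<times> (4 \<Rightarrow> 'b) \<times> (4 \<Rightarrow> 'c)" where
  "unzip3 P = (\<lambda>s. fst (P s), \<lambda>s. fst (snd (P s)), \<lambda>s. snd (snd (P s)))"

lemma bij_unzip3: "bij unzip3"
proof (rule o_bij)
  let ?g = "\<lambda>(I, J, L) s. (I s, J s, L s)"
  show "?g \<circ> unzip3 = id" "unzip3 \<circ> ?g = id" by (auto simp: fun_eq_iff unzip3_def)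
qed

lemma kron3_unzip3:
  "kron3 (tensor_power g) (tensor_power h) (tensor_power l) $ unzip3 P $ unzip3 P'
    = (\<Prod>s\<in>UNIV. kron3 g h l $ P s $ P' s)"
  by (simp add: kron3_def tensor_power_def unzip3_def prod.distrib split_beta)

text \<open>
  A form that is an eigenvector of a substitution comes from a symmetric tensor that is an
  eigenvector of the tensor power, as symmetric tensors are determined by their forms.
\<close>

lemma quartic_eigen:
  fixes w :: "(4 \<Rightarrow> 'v::finite) \<Rightarrow> 'k::field_char_0"
  assumes w: "symmetric_fun w" and e: "psubst M (quartic w) = pscale c (quartic w)"
  shows "(\<Sum>P'\<in>UNIV. (\<Prod>s\<in>UNIV. M $ P s $ P' s) * w P') = c * w P"
proof -
  let ?K = "\<lambda>P. \<Sum>P'\<in>UNIV. (\<Prod>s\<in>UNIV. M $ P s $ P' s) * w P'"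
  have "?K (P \<circ> \<pi>) = ?K P" if "\<pi> permutes UNIV" for P \<pi>
  proof -
    have "?K (P \<circ> \<pi>) = (\<Sum>P'\<in>UNIV. (\<Prod>s\<in>UNIV. M $ P (\<pi> s) $ P' (\<pi> s)) * w (P' \<circ> \<pi>))"
      using sum.reindex_bij_betw[OF permutes_UNIV_bij_compose[OF that],
          of "\<lambda>P'. (\<Prod>s\<in>UNIV. M $ P (\<pi> s) $ P' s) * w P'"] by simp
    also have "\<dots> = ?K P"
    proof (rule sum.cong[OF refl])
      fix P'
      have "w (P' \<circ> \<pi>) = w P'" using w that unfolding symmetric_fun_def by blast
      then show "(\<Prod>s\<in>UNIV. M $ P (\<pi> s) $ P' (\<pi> s)) * w (P' \<circ> \<pi>) = (\<Prod>s\<in>UNIV. M $ P s $ P' s) * w P'"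
        using prod.permute[OF that, of "\<lambda>s. M $ P s $ P' s"] by (simp add: o_def)
    qed
    finally show ?thesis .
  qed
  then have "symmetric_fun (\<lambda>P. ?K P + - c * w P)" using w unfolding symmetric_fun_def by simp
  moreover have "quartic (\<lambda>P. ?K P + - c * w P) = 0"
    unfolding quartic_add quartic_scale using e[unfolded psubst_quartic] by simp
  ultimately have "?K P + - c * w P = 0" by (rule symmetric_eq_0_if_quartic_eq_0)
  then show ?thesis by simp
qed

lemma tensor_power_mat_1:
  "tensor_power (mat 1 :: 'k::comm_ring_1 ^ 'n::finite ^ 'n) = (mat 1 :: 'k ^ ('d::finite \<Rightarrow> 'n) ^ ('d \<Rightarrow> 'n))"
proof -
  have "(\<Prod>s\<in>UNIV. (mat 1 :: 'k ^ 'n ^ 'n) $ I s $ I' s) = (mat 1 :: 'k ^ ('d \<Rightarrow> 'n) ^ ('d \<Rightarrow> 'n)) $ I $ I'" for I I'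
  proof (cases "I = I'")
    case True then show ?thesis by (simp add: mat_def)
  next
    case False
    then obtain s where "I s \<noteq> I' s" by blast
    then have "(mat 1 :: 'k ^ 'n ^ 'n) $ I s $ I' s = 0" by (simp add: mat_def)
    then have "(\<Prod>s\<in>UNIV. (mat 1 :: 'k ^ 'n ^ 'n) $ I s $ I' s) = 0" by (intro prod_zero) auto
    then show ?thesis using False by (simp add: mat_def)
  qed
  then show ?thesis unfolding tensor_power_def vec_eq_iff by simp
qed

locale three_weights =
  fixes i0 i1 i2 :: "'a::finite" and j0 j1 j2 :: "'b::finite" and k0 k1 k2 :: "'c::finite"
  assumes i: "i0 \<noteq> i1" "i0 \<noteq> i2" "i1 \<noteq> i2" and j: "j0 \<noteq> j1" "j0 \<noteq> j2" "j1 \<noteq> j2"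
    and k: "k0 \<noteq> k1" "k0 \<noteq> k2" "k1 \<noteq> k2"
begin

text \<open>
  Highest weight in each factor and invariant under permutations of positions: what remains of
  the image of a highest weight vector under an equivariant map into the quartic forms.
\<close>

definition highest_weight_tensor :: "'k::field_char_0 ^ ((4 \<Rightarrow> 'a) \<times> (4 \<Rightarrow> 'b) \<times> (4 \<Rightarrow> 'c)) \<Rightarrow> bool" where
  "highest_weight_tensor F \<longleftrightarrow> (\<forall>J L. highest_weight i0 i1 i2 (\<chi> I. F $ (I, J, L))) \<and> (\<forall>I L. highest_weight j0 j1 j2 (\<chi> J. F $ (I, J, L))) \<and>
     (\<forall>I J. highest_weight k0 k1 k2 (\<chi> L. F $ (I, J, L))) \<and>
     (\<forall>\<pi> I J L. \<pi> permutes UNIV \<longrightarrow> F $ (I \<circ> \<pi>, J \<circ> \<pi>, L \<circ> \<pi>) = F $ (I, J, L))"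

definition tensor_pairs :: "'k::field_char_0 ^ ((4 \<Rightarrow> 'a) \<times> (4 \<Rightarrow> 'b) \<times> (4 \<Rightarrow> 'c)) \<Rightarrow> 4 \<Rightarrow> 4 \<Rightarrow> 4 \<Rightarrow> 4 \<Rightarrow> 4 \<Rightarrow> 4 \<Rightarrow> 'k" where
  "tensor_pairs F q p q' p' q'' p'' = (if q = p \<or> q' = p' \<or> q'' = p'' then 0
     else F $ (arrangement i0 i1 i2 q p, arrangement j0 j1 j2 q' p', arrangement k0 k1 k2 q'' p''))"

text \<open>
  The coordinates at words of the right weight are an invariant tensor in the sense of
  \<open>invariant_eq_0\<close>; the other coordinates vanish one factor after the other.
\<close>

lemma highest_weight_tensor_eq_0:
  assumes F: "highest_weight_tensor F" and z: "xi3 0 1 2 (tensor_pairs F) = 0"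
  shows "F = 0"
proof -
  have highest_weight: "highest_weight i0 i1 i2 (\<chi> I. F $ (I, J, L))" "highest_weight j0 j1 j2 (\<chi> J. F $ (I, J, L))" "highest_weight k0 k1 k2 (\<chi> L. F $ (I, J, L))"
    for I J L using F unfolding highest_weight_tensor_def by blast+
  have s0: "skew (\<lambda>q p :: 4. 0 :: 'd)" by (simp add: skew_def)
  have G1: "(\<lambda>q p. tensor_pairs F q p q' p' q'' p'') = (if q' = p' \<or> q'' = p'' then (\<lambda>q p. 0)
     else pairs i0 i1 i2 (\<chi> I. F $ (I, arrangement j0 j1 j2 q' p', arrangement k0 k1 k2 q'' p'')))" for q' p' q'' p''
    by (auto simp: fun_eq_iff tensor_pairs_def pairs_def)
  have G2: "(\<lambda>q' p'. tensor_pairs F q p q' p' q'' p'') = (if q = p \<or> q'' = p'' then (\<lambda>q p. 0)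
     else pairs j0 j1 j2 (\<chi> J. F $ (arrangement i0 i1 i2 q p, J, arrangement k0 k1 k2 q'' p'')))" for q p q'' p''
    by (auto simp: fun_eq_iff tensor_pairs_def pairs_def)
  have G3: "(\<lambda>q'' p''. tensor_pairs F q p q' p' q'' p'') = (if q = p \<or> q' = p' then (\<lambda>q p. 0)
     else pairs k0 k1 k2 (\<chi> L. F $ (arrangement i0 i1 i2 q p, arrangement j0 j1 j2 q' p', L)))" for q p q' p'
    by (auto simp: fun_eq_iff tensor_pairs_def pairs_def)
  have G: "tensor_pairs F q p q' p' q'' p'' = 0" for q p q' p' q'' p''
  proof (rule invariant_eq_0[OF _ _ _ _ z])
    show "skew (\<lambda>q p. tensor_pairs F q p q' p' q'' p'')" for q' p' q'' p''
      unfolding G1 using s0 skew_pairs[OF highest_weight(1) i] by simp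
    show "skew (\<lambda>q' p'. tensor_pairs F q p q' p' q'' p'')" for q p q'' p''
      unfolding G2 using s0 skew_pairs[OF highest_weight(2) j] by simp
    show "skew (\<lambda>q'' p''. tensor_pairs F q p q' p' q'' p'')" for q p q' p'
      unfolding G3 using s0 skew_pairs[OF highest_weight(3) k] by simp
    show "tensor_pairs F (\<pi> q) (\<pi> p) (\<pi> q') (\<pi> p') (\<pi> q'') (\<pi> p'') = tensor_pairs F q p q' p' q'' p''"
      if \<pi>: "\<pi> permutes UNIV" for \<pi> q p q' p' q'' p''
    proof -
      have a: "arrangement a b c (\<pi> q) (\<pi> p) \<circ> \<pi> = arrangement a b c q p" for a b c :: 'x and q p
        using inj_eq[OF permutes_inj[OF \<pi>]] by (simp add: arrangement_def fun_eq_iff)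
      have "F $ (I, J, L) = F $ (I \<circ> \<pi>, J \<circ> \<pi>, L \<circ> \<pi>)" for I J L
        using F \<pi> unfolding highest_weight_tensor_def by metis
      then show ?thesis unfolding tensor_pairs_def
        using inj_eq[OF permutes_inj[OF \<pi>]] by (metis a)
    qed
  qed
  have 1: "F $ (arrangement i0 i1 i2 q p, arrangement j0 j1 j2 q' p', L) = 0" if "q \<noteq> p" "q' \<noteq> p'" for q p q' p' L
  proof -
    have "pairs k0 k1 k2 (\<chi> L. F $ (arrangement i0 i1 i2 q p, arrangement j0 j1 j2 q' p', L)) q'' p'' = tensor_pairs F q p q' p' q'' p''" for q'' p''
      using that by (simp add: pairs_def tensor_pairs_def)
    then have "(\<chi> L. F $ (arrangement i0 i1 i2 q p, arrangement j0 j1 j2 q' p', L)) $ L = 0"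
      by (intro highest_weight_eq_0[OF highest_weight(3) k]) (simp only: G)
    then show ?thesis by simp
  qed
  have 2: "F $ (arrangement i0 i1 i2 q p, J, L) = 0" if "q \<noteq> p" for q p J L
  proof -
    have "(\<chi> J. F $ (arrangement i0 i1 i2 q p, J, L)) $ J = 0"
      by (rule highest_weight_eq_0[OF highest_weight(2) j]) (simp add: pairs_def 1[OF that])
    then show ?thesis by simp
  qed
  have "F $ (I, J, L) = 0" for I J L
  proof -
    have "(\<chi> I. F $ (I, J, L)) $ I = 0" by (rule highest_weight_eq_0[OF highest_weight(1) i]) (simp add: pairs_def 2)
    then show ?thesis by simp
  qed
  then show ?thesis by (auto simp: vec_eq_iff)
qed

lemma highest_weight_diff:
  fixes r s :: "'k::field_char_0"
  assumes "highest_weight a b c x" "highest_weight a b c y"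
  shows "highest_weight a b c (\<chi> I. r * x $ I - s * y $ I)"
proof -
  have eq: "(\<chi> I. r * x $ I - s * y $ I) = r *s x - s *s y" by (simp add: vec_eq_iff)
  have lin: "M *v (r *s x - s *s y) = r *s (M *v x) - s *s (M *v y)" for M
    by (simp add: matrix_vector_mult_diff_distrib vector_scalar_commute)
  show ?thesis using assms unfolding eq highest_weight_def lin by (auto simp: vec_eq_iff algebra_simps)
qed

text \<open>
  The combination of the two tensors whose distinguished coordinate cancels is zero.
\<close>

lemma highest_weight_tensor_proportional:
  assumes F: "highest_weight_tensor F1" "highest_weight_tensor F2"
  shows "xi3 0 1 2 (tensor_pairs F1) *s F2 = xi3 0 1 2 (tensor_pairs F2) *s F1"
proof -
  let ?r = "xi3 0 1 2 (tensor_pairs F1)" and ?s = "xi3 0 1 2 (tensor_pairs F2)"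
  let ?F = "?r *s F2 - ?s *s F1"
  have "highest_weight_tensor ?F" unfolding highest_weight_tensor_def
  proof (intro conjI allI impI)
    show "highest_weight i0 i1 i2 (\<chi> I. ?F $ (I, J, L))" for J L
      using highest_weight_diff[of i0 i1 i2 "\<chi> I. F2 $ (I, J, L)" "\<chi> I. F1 $ (I, J, L)" ?r ?s] F unfolding highest_weight_tensor_def by simp
    show "highest_weight j0 j1 j2 (\<chi> J. ?F $ (I, J, L))" for I L
      using highest_weight_diff[of j0 j1 j2 "\<chi> J. F2 $ (I, J, L)" "\<chi> J. F1 $ (I, J, L)" ?r ?s] F unfolding highest_weight_tensor_def by simp
    show "highest_weight k0 k1 k2 (\<chi> L. ?F $ (I, J, L))" for I J
      using highest_weight_diff[of k0 k1 k2 "\<chi> L. F2 $ (I, J, L)" "\<chi> L. F1 $ (I, J, L)" ?r ?s] F unfolding highest_weight_tensor_def by simp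
    show "?F $ (I \<circ> \<pi>, J \<circ> \<pi>, L \<circ> \<pi>) = ?F $ (I, J, L)" if "\<pi> permutes UNIV" for \<pi> I J L
      using F that unfolding highest_weight_tensor_def by simp
  qed
  moreover have "xi3 0 1 2 (tensor_pairs ?F) = 0"
  proof -
    have "tensor_pairs ?F = (\<lambda>q p q' p' q'' p''. ?r * tensor_pairs F2 q p q' p' q'' p'' - ?s * tensor_pairs F1 q p q' p' q'' p'')"
      by (auto simp: fun_eq_iff tensor_pairs_def)
    then have "xi3 0 1 2 (tensor_pairs ?F) = ?r * ?s - ?s * ?r"
      by (simp only: xi3_def xi_linear)
    then show ?thesis by simp
  qed
  ultimately have "?F = 0" by (rule highest_weight_tensor_eq_0)
  then show ?thesis by simp
qed

text \<open>
  The highest weight vector of \<open>schur211_tensor\<close>.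
\<close>

definition u0 :: "'k::field_char_0 ^ ((4 \<Rightarrow> 'a) \<times> (4 \<Rightarrow> 'b) \<times> (4 \<Rightarrow> 'c))" where
  "u0 = tensor3 (hook (axis i0 1) (axis i0 1) (axis i1 1) (axis i2 1))
     (hook (axis j0 1) (axis j0 1) (axis j1 1) (axis j2 1)) (hook (axis k0 1) (axis k0 1) (axis k1 1) (axis k2 1))"

end

lemma invertible_mat_1: "invertible (mat 1 :: 'k::comm_ring_1 ^ 'n::finite ^ 'n)"
  unfolding invertible_def by (intro exI[of _ "mat 1"]) simp

lemma tensor3_scale:
  "tensor3 (c *s x) y z = c *s tensor3 x y z" "tensor3 x (c *s y) z = c *s tensor3 x y z"
  "tensor3 x y (c *s z) = c *s tensor3 x y z" for c :: "'k::comm_ring_1"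
  by (simp_all add: tensor3_def vec_eq_iff mult_ac)

text \<open>
  The data of the isomorphism, in a form that can be used without reference to linear maps
  between vector spaces.
\<close>

lemma schur211_submoduleE:
  assumes "schur211_submodule M"
  obtains \<phi> where "\<And>u v. \<phi> (u + v) = \<phi> u + \<phi> v" "\<And>c u. \<phi> (c *s u) = pscale c (\<phi> u)" "\<phi> 0 = 0"
    "inj_on \<phi> schur211_tensor" "M = \<phi> ` schur211_tensor" "\<And>u. u \<in> schur211_tensor \<Longrightarrow> homogeneous 4 (\<phi> u)"
    "\<And>g h l u. invertible g \<Longrightarrow> invertible h \<Longrightarrow> invertible l \<Longrightarrow> u \<in> schur211_tensor \<Longrightarrow>
       \<phi> (kron3 (tensor_power g) (tensor_power h) (tensor_power l) *v u) = psubst (kron3 g h l) (\<phi> u)"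
    "mpoly.subspace M"
proof -
  obtain \<phi> where lin: "Vector_Spaces.linear (*s) pscale \<phi>" and bij: "bij_betw \<phi> schur211_tensor M"
    and eq: "\<forall>g h l. invertible g \<longrightarrow> invertible h \<longrightarrow> invertible l \<longrightarrow> (\<forall>u \<in> schur211_tensor.
              \<phi> (kron3 (tensor_power g) (tensor_power h) (tensor_power l) *v u) = psubst (kron3 g h l) (\<phi> u))"
    using assms unfolding schur211_submodule_def by blast
  have hom: "\<forall>f\<in>M. homogeneous 4 f" and sub: "mpoly.subspace M" using assms unfolding schur211_submodule_def by blast+
  interpret L: Vector_Spaces.linear "(*s)" pscale \<phi> by (rule lin)
  show ?thesis
  proof (rule that[of \<phi>])
    show "inj_on \<phi> schur211_tensor" "M = \<phi> ` schur211_tensor" using bij by (auto simp: bij_betw_def)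
    show "homogeneous 4 (\<phi> u)" if "u \<in> schur211_tensor" for u using hom bij that by (auto simp: bij_betw_def)
  qed (use eq sub L.add L.scale L.zero in blast)+
qed

context three_weights
begin

lemma u0_in: "u0 \<in> schur211_tensor"
  unfolding u0_def schur211_tensor_def
  by (rule vec.span_base, rule CollectI, intro exI conjI, rule refl) (rule hook_in_schur)+

lemma u0_nonzero: "u0 \<noteq> 0"
proof
  assume z: "u0 = (0 :: 'd ^ ((4 \<Rightarrow> 'a) \<times> (4 \<Rightarrow> 'b) \<times> (4 \<Rightarrow> 'c)))"
  have "u0 $ (mk4 i0 i0 i1 i2, mk4 j0 j0 j1 j2, mk4 k0 k0 k1 k2) = (8 :: 'd)"
    using i j k by (simp add: u0_def tensor3_def hook_coord alt3_def axis_def)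
  then show False unfolding z by simp
qed

text \<open>
  Equivariance carries the eigenvector equations of the highest weight vector over to the
  symmetric tensor of its image.
\<close>

lemma image_of_u0:
  fixes \<phi> :: "'k::field_char_0 ^ ((4 \<Rightarrow> 'a) \<times> (4 \<Rightarrow> 'b) \<times> (4 \<Rightarrow> 'c)) \<Rightarrow> ('a \<times> 'b \<times> 'c, 'k) mpoly"
  assumes scale: "\<And>c u. \<phi> (c *s u) = pscale c (\<phi> u)"
    and hom: "\<And>u. u \<in> schur211_tensor \<Longrightarrow> homogeneous 4 (\<phi> u)"
    and eq: "\<And>g h l u. invertible g \<Longrightarrow> invertible h \<Longrightarrow> invertible l \<Longrightarrow> u \<in> schur211_tensor \<Longrightarrow>
       \<phi> (kron3 (tensor_power g) (tensor_power h) (tensor_power l) *v u) = psubst (kron3 g h l) (\<phi> u)"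
  obtains F where "highest_weight_tensor F" "\<phi> u0 = quartic (\<lambda>P. F $ unzip3 P)"
proof -
  obtain w where w: "symmetric_fun w" "\<phi> u0 = quartic w" by (rule homogeneous_4_quartic[OF hom[OF u0_in]])
  define F :: "'k ^ ((4 \<Rightarrow> 'a) \<times> (4 \<Rightarrow> 'b) \<times> (4 \<Rightarrow> 'c))" where "F = (\<chi> (q). w (inv unzip3 q))"
  have wF: "w P = F $ unzip3 P" for P by (simp add: F_def inv_f_f[OF bij_is_inj[OF bij_unzip3]])
  have eigen: "tmap (tensor_power g) (tensor_power h) (tensor_power l) F = c *s F"
    if inv: "invertible g" "invertible h" "invertible l"
      and u: "tmap (tensor_power g) (tensor_power h) (tensor_power l) u0 = c *s u0" for g h l c
  proof -
    have "psubst (kron3 g h l) (quartic w) = pscale c (quartic w)"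
      using eq[OF inv u0_in] u by (simp add: kron3_eq_tmap scale w(2))
    then have e: "(\<Sum>P'\<in>UNIV. (\<Prod>s\<in>UNIV. kron3 g h l $ P s $ P' s) * w P') = c * w P" for P
      by (rule quartic_eigen[OF w(1)])
    let ?K = "kron3 (tensor_power g) (tensor_power h) (tensor_power l)"
    have "(?K *v F) $ unzip3 P = c * F $ unzip3 P" for P
      using sum.reindex_bij_betw[OF bij_unzip3, of "\<lambda>q. ?K $ unzip3 P $ q * F $ q"] e[of P]
      by (simp add: matrix_vector_mult_def kron3_unzip3 wF)
    then have "(?K *v F) $ q = (c *s F) $ q" for q using bij_unzip3 by (metis bij_pointE vector_smult_component)
    then show ?thesis by (simp add: vec_eq_iff kron3_eq_tmap)
  qed
  let ?H1 = "hook (axis i0 1) (axis i0 1) (axis i1 1) (axis i2 1) :: 'k ^ (4 \<Rightarrow> 'a)"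
  let ?H2 = "hook (axis j0 1) (axis j0 1) (axis j1 1) (axis j2 1) :: 'k ^ (4 \<Rightarrow> 'b)"
  let ?H3 = "hook (axis k0 1) (axis k0 1) (axis k1 1) (axis k2 1) :: 'k ^ (4 \<Rightarrow> 'c)"
  have s1: "tensor_power g *v (\<chi> I. F $ (I, J, L)) = c *s (\<chi> I. F $ (I, J, L))"
    if "invertible g" "tensor_power g *v ?H1 = c *s ?H1" for g c J L
  proof -
    have "tmap (tensor_power g) (tensor_power (mat 1)) (tensor_power (mat 1)) F = c *s F"
      by (rule eigen[OF that(1) invertible_mat_1 invertible_mat_1]) (simp add: u0_def tmap_tensor3 tensor_power_mat_1 that(2) tensor3_scale)
    then have "tmap (tensor_power g) (tensor_power (mat 1)) (tensor_power (mat 1)) F $ (I, J, L) = (c *s F) $ (I, J, L)" for I by simp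
    then have "(\<Sum>I'\<in>UNIV. tensor_power g $ I $ I' * F $ (I', J, L)) = c * F $ (I, J, L)" for I
      by (simp only: tensor_power_mat_1 tmap_slices vector_smult_component)
    then show ?thesis by (simp add: vec_eq_iff matrix_vector_mult_def)
  qed
  have s2: "tensor_power g *v (\<chi> J. F $ (I, J, L)) = c *s (\<chi> J. F $ (I, J, L))"
    if "invertible g" "tensor_power g *v ?H2 = c *s ?H2" for g c I L
  proof -
    have "tmap (tensor_power (mat 1)) (tensor_power g) (tensor_power (mat 1)) F = c *s F"
      by (rule eigen[OF invertible_mat_1 that(1) invertible_mat_1]) (simp add: u0_def tmap_tensor3 tensor_power_mat_1 that(2) tensor3_scale)
    then have "tmap (tensor_power (mat 1)) (tensor_power g) (tensor_power (mat 1)) F $ (I, J, L) = (c *s F) $ (I, J, L)" for J by simp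
    then have "(\<Sum>J'\<in>UNIV. tensor_power g $ J $ J' * F $ (I, J', L)) = c * F $ (I, J, L)" for J
      by (simp only: tensor_power_mat_1 tmap_slices2 vector_smult_component)
    then show ?thesis by (simp add: vec_eq_iff matrix_vector_mult_def)
  qed
  have s3: "tensor_power g *v (\<chi> L. F $ (I, J, L)) = c *s (\<chi> L. F $ (I, J, L))"
    if "invertible g" "tensor_power g *v ?H3 = c *s ?H3" for g c I J
  proof -
    have "tmap (tensor_power (mat 1)) (tensor_power (mat 1)) (tensor_power g) F = c *s F"
      by (rule eigen[OF invertible_mat_1 invertible_mat_1 that(1)]) (simp add: u0_def tmap_tensor3 tensor_power_mat_1 that(2) tensor3_scale)
    then have "tmap (tensor_power (mat 1)) (tensor_power (mat 1)) (tensor_power g) F $ (I, J, L) = (c *s F) $ (I, J, L)" for L by simp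
    then have "(\<Sum>L'\<in>UNIV. tensor_power g $ L $ L' * F $ (I, J, L')) = c * F $ (I, J, L)" for L
      by (simp only: tensor_power_mat_1 tmap_slices3 vector_smult_component)
    then show ?thesis by (simp add: vec_eq_iff matrix_vector_mult_def)
  qed
  have neg: "- x = (-1) *s x" for x :: "'k ^ (4 \<Rightarrow> 'x::finite)" by (simp_all add: vec_eq_iff)
  have hwI: "highest_weight a b c x" if d: "a \<noteq> b"
    and H: "highest_weight a b c H" and st: "\<And>g r. invertible g \<Longrightarrow> tensor_power g *v H = r *s H \<Longrightarrow> tensor_power g *v x = r *s x"
    for a b c :: "'x::finite" and x H :: "'k ^ (4 \<Rightarrow> 'x)"
    unfolding highest_weight_def
  proof (intro conjI allI)
    show "tensor_power (scale_mat i 2) *v x = (if i = a then 4 else if i = b \<or> i = c then 2 else 1) *s x" for i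
      by (rule st[OF invertible_scale_mat]) (use H in \<open>simp_all add: highest_weight_def\<close>)
    show "tensor_power (swap_mat b c) *v x = - x"
      unfolding neg[of x] by (rule st[OF invertible_swap_mat], use H in \<open>unfold highest_weight_def neg\<close>, elim conjE)
    have "tensor_power (transvection a b 1) *v x = 1 *s x"
      by (rule st[OF invertible_transvection[OF d]]) (use H in \<open>simp add: highest_weight_def\<close>)
    then show "tensor_power (transvection a b 1) *v x = x" by simp
  qed
  have "highest_weight_tensor F" unfolding highest_weight_tensor_def
  proof (intro conjI allI impI)
    show "highest_weight i0 i1 i2 (\<chi> I. F $ (I, J, L))" for J L by (rule hwI[OF i(1) highest_weight_hook[OF i] s1])
    show "highest_weight j0 j1 j2 (\<chi> J. F $ (I, J, L))" for I L by (rule hwI[OF j(1) highest_weight_hook[OF j] s2])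
    show "highest_weight k0 k1 k2 (\<chi> L. F $ (I, J, L))" for I J by (rule hwI[OF k(1) highest_weight_hook[OF k] s3])
    fix \<pi> :: "4 \<Rightarrow> 4" and I J L assume "\<pi> permutes UNIV"
    then have "w ((\<lambda>s. (I s, J s, L s)) \<circ> \<pi>) = w (\<lambda>s. (I s, J s, L s))" using w(1) unfolding symmetric_fun_def by blast
    then show "F $ (I \<circ> \<pi>, J \<circ> \<pi>, L \<circ> \<pi>) = F $ (I, J, L)" unfolding wF by (simp add: unzip3_def o_def)
  qed
  moreover have "\<phi> u0 = quartic (\<lambda>P. F $ unzip3 P)" unfolding w(2) wF ..
  ultimately show ?thesis by (rule that)
qed

text \<open>
  The elements on which the two maps are proportional form an invariant subspace. It contains
  the highest weight vector, and the Schur module is generated by that vector in each factor in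
  turn.
\<close>

lemma proportional_on_tensors:
  fixes \<phi> \<psi> :: "'k::field_char_0 ^ ((4 \<Rightarrow> 'a) \<times> (4 \<Rightarrow> 'b) \<times> (4 \<Rightarrow> 'c)) \<Rightarrow> ('a \<times> 'b \<times> 'c, 'k) mpoly"
  assumes \<phi>: "\<And>u v. \<phi> (u + v) = \<phi> u + \<phi> v" "\<And>c u. \<phi> (c *s u) = pscale c (\<phi> u)" "\<phi> 0 = 0"
      "\<And>g h l u. invertible g \<Longrightarrow> invertible h \<Longrightarrow> invertible l \<Longrightarrow> u \<in> schur211_tensor \<Longrightarrow>
       \<phi> (kron3 (tensor_power g) (tensor_power h) (tensor_power l) *v u) = psubst (kron3 g h l) (\<phi> u)"
    and \<psi>: "\<And>u v. \<psi> (u + v) = \<psi> u + \<psi> v" "\<And>c u. \<psi> (c *s u) = pscale c (\<psi> u)" "\<psi> 0 = 0"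
      "\<And>g h l u. invertible g \<Longrightarrow> invertible h \<Longrightarrow> invertible l \<Longrightarrow> u \<in> schur211_tensor \<Longrightarrow>
       \<psi> (kron3 (tensor_power g) (tensor_power h) (tensor_power l) *v u) = psubst (kron3 g h l) (\<psi> u)"
    and hom: "\<And>u. u \<in> schur211_tensor \<Longrightarrow> homogeneous 4 (\<phi> u)"
    and start: "\<psi> u0 = pscale r (\<phi> u0)" and u: "u \<in> schur211_tensor"
  shows "\<psi> u = pscale r (\<phi> u)"
proof -
  define Q where "Q = {v \<in> schur211_tensor. \<psi> v = pscale r (\<phi> v)}"
  have subU: "vec.subspace (schur211_tensor :: ('k ^ ((4 \<Rightarrow> 'a) \<times> (4 \<Rightarrow> 'b) \<times> (4 \<Rightarrow> 'c))) set)"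
    unfolding schur211_tensor_def by (rule vec.subspace_span)
  have sub: "vec.subspace Q" unfolding vec.subspace_def
  proof (intro conjI ballI allI)
    show "0 \<in> Q" using vec.subspace_0[OF subU] by (simp add: Q_def \<phi>(3) \<psi>(3))
    show "x + y \<in> Q" if "x \<in> Q" "y \<in> Q" for x y
      using that vec.subspace_add[OF subU] by (simp add: Q_def \<phi>(1) \<psi>(1) mpoly.scale_right_distrib)
    show "c *s x \<in> Q" if "x \<in> Q" for c x
      using that vec.subspace_scale[OF subU] by (simp add: Q_def \<phi>(2) \<psi>(2) mult.commute)
  qed
  have psubst_pscale: "psubst M (pscale c p) = pscale c (psubst M p)" if hp: "homogeneous 4 p"
    for M :: "'k ^ ('a \<times> 'b \<times> 'c) ^ ('a \<times> 'b \<times> 'c)" and c p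
  proof -
    obtain w where "symmetric_fun w" and w: "p = quartic w" by (rule homogeneous_4_quartic[OF hp])
    show ?thesis unfolding w quartic_scale[symmetric] psubst_quartic
      by (simp add: sum_distrib_left mult_ac)
  qed
  have inv: "tmap (tensor_power g) (tensor_power h) (tensor_power l) v \<in> Q"
    if "invertible g" "invertible h" "invertible l" "v \<in> Q" for g h l v
    using that schur211_invariant[of v g h l] \<phi>(4)[of g h l v] \<psi>(4)[of g h l v] psubst_pscale[OF hom[of v]]
    by (simp add: Q_def flip: kron3_eq_tmap)
  have tadd: "tensor3 (x + x') y z = tensor3 x y z + tensor3 x' y z" "tensor3 x (y + y') z = tensor3 x y z + tensor3 x y' z"
    "tensor3 x y (z + z') = tensor3 x y z + tensor3 x y z'" "tensor3 (c *s x) y z = c *s tensor3 x y z"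
    "tensor3 x (c *s y) z = c *s tensor3 x y z" "tensor3 x y (c *s z) = c *s tensor3 x y z"
    "tensor3 0 y z = 0" "tensor3 x 0 z = 0" "tensor3 x y 0 = 0"
    for x x' :: "'k ^ (4 \<Rightarrow> 'a)" and y y' :: "'k ^ (4 \<Rightarrow> 'b)" and z z' :: "'k ^ (4 \<Rightarrow> 'c)" and c
    by (simp_all add: tensor3_def vec_eq_iff algebra_simps)
  let ?H1 = "hook (axis i0 1) (axis i0 1) (axis i1 1) (axis i2 1) :: 'k ^ (4 \<Rightarrow> 'a)"
  let ?H2 = "hook (axis j0 1) (axis j0 1) (axis j1 1) (axis j2 1) :: 'k ^ (4 \<Rightarrow> 'b)"
  let ?H3 = "hook (axis k0 1) (axis k0 1) (axis k1 1) (axis k2 1) :: 'k ^ (4 \<Rightarrow> 'c)"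
  have 1: "tensor3 x ?H2 ?H3 \<in> Q" if x: "x \<in> schur_module tableau211" for x
  proof -
    have "x \<in> {x. tensor3 x ?H2 ?H3 \<in> Q}"
    proof (rule schur_module_generated[OF _ _ i _ x])
      show "vec.subspace {x. tensor3 x ?H2 ?H3 \<in> Q}"
        using vec.subspace_0[OF sub] vec.subspace_add[OF sub] vec.subspace_scale[OF sub]
        by (simp add: vec.subspace_def tadd)
      show "tensor_power g *v v \<in> {x. tensor3 x ?H2 ?H3 \<in> Q}"
        if "invertible g" "v \<in> {x. tensor3 x ?H2 ?H3 \<in> Q}" for g v
        using inv[OF that(1) invertible_mat_1 invertible_mat_1, of "tensor3 v ?H2 ?H3"] that(2)
        by (simp add: tmap_tensor3 tensor_power_mat_1)
      show "?H1 \<in> {x. tensor3 x ?H2 ?H3 \<in> Q}" using u0_in start by (simp add: Q_def u0_def)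
    qed
    then show ?thesis by simp
  qed
  have 2: "tensor3 x y ?H3 \<in> Q" if x: "x \<in> schur_module tableau211" and y: "y \<in> schur_module tableau211" for x y
  proof -
    have "y \<in> {y. tensor3 x y ?H3 \<in> Q}"
    proof (rule schur_module_generated[OF _ _ j _ y])
      show "vec.subspace {y. tensor3 x y ?H3 \<in> Q}"
        using vec.subspace_0[OF sub] vec.subspace_add[OF sub] vec.subspace_scale[OF sub]
        by (simp add: vec.subspace_def tadd)
      show "tensor_power g *v v \<in> {y. tensor3 x y ?H3 \<in> Q}"
        if "invertible g" "v \<in> {y. tensor3 x y ?H3 \<in> Q}" for g v
        using inv[OF invertible_mat_1 that(1) invertible_mat_1, of "tensor3 x v ?H3"] that(2)
        by (simp add: tmap_tensor3 tensor_power_mat_1)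
      show "?H2 \<in> {y. tensor3 x y ?H3 \<in> Q}" using 1[OF x] by simp
    qed
    then show ?thesis by simp
  qed
  have 3: "tensor3 x y z \<in> Q"
    if x: "x \<in> schur_module tableau211" and y: "y \<in> schur_module tableau211" and z: "z \<in> schur_module tableau211" for x y z
  proof -
    have "z \<in> {z. tensor3 x y z \<in> Q}"
    proof (rule schur_module_generated[OF _ _ k _ z])
      show "vec.subspace {z. tensor3 x y z \<in> Q}"
        using vec.subspace_0[OF sub] vec.subspace_add[OF sub] vec.subspace_scale[OF sub]
        by (simp add: vec.subspace_def tadd)
      show "tensor_power g *v v \<in> {z. tensor3 x y z \<in> Q}"
        if "invertible g" "v \<in> {z. tensor3 x y z \<in> Q}" for g v
        using inv[OF invertible_mat_1 invertible_mat_1 that(1), of "tensor3 x y v"] that(2)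
        by (simp add: tmap_tensor3 tensor_power_mat_1)
      show "?H3 \<in> {z. tensor3 x y z \<in> Q}" using 2[OF x y] by simp
    qed
    then show ?thesis by simp
  qed
  have "schur211_tensor \<subseteq> Q" unfolding schur211_tensor_def
    by (rule vec.span_minimal[OF _ sub]) (use 3 in blast)
  then show ?thesis using u unfolding Q_def by blast
qed

text \<open>
  The images of the highest weight vector in two such submodules are proportional, so the
  isomorphisms onto them are proportional.
\<close>

lemma schur211_submodule_unique:
  fixes M1 M2 :: "('a \<times> 'b \<times> 'c, 'k::field_char_0) mpoly set"
  assumes M1: "schur211_submodule M1" and M2: "schur211_submodule M2"
  shows "M1 \<subseteq> M2"
proof -
  obtain \<phi> :: "'k ^ ((4 \<Rightarrow> 'a) \<times> (4 \<Rightarrow> 'b) \<times> (4 \<Rightarrow> 'c)) \<Rightarrow> ('a \<times> 'b \<times> 'c, 'k) mpoly" where \<phi>: "\<And>u v. \<phi> (u + v) = \<phi> u + \<phi> v" "\<And>c u. \<phi> (c *s u) = pscale c (\<phi> u)" "\<phi> 0 = 0"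
    "inj_on \<phi> schur211_tensor" "M1 = \<phi> ` schur211_tensor" "\<And>u. u \<in> schur211_tensor \<Longrightarrow> homogeneous 4 (\<phi> u)"
    "\<And>g h l u. invertible g \<Longrightarrow> invertible h \<Longrightarrow> invertible l \<Longrightarrow> u \<in> schur211_tensor \<Longrightarrow>
       \<phi> (kron3 (tensor_power g) (tensor_power h) (tensor_power l) *v u) = psubst (kron3 g h l) (\<phi> u)"
    "mpoly.subspace M1"
    by (rule schur211_submoduleE[OF M1], rule that)
  obtain \<psi> :: "'k ^ ((4 \<Rightarrow> 'a) \<times> (4 \<Rightarrow> 'b) \<times> (4 \<Rightarrow> 'c)) \<Rightarrow> ('a \<times> 'b \<times> 'c, 'k) mpoly" where \<psi>: "\<And>u v. \<psi> (u + v) = \<psi> u + \<psi> v" "\<And>c u. \<psi> (c *s u) = pscale c (\<psi> u)" "\<psi> 0 = 0"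
    "inj_on \<psi> schur211_tensor" "M2 = \<psi> ` schur211_tensor" "\<And>u. u \<in> schur211_tensor \<Longrightarrow> homogeneous 4 (\<psi> u)"
    "\<And>g h l u. invertible g \<Longrightarrow> invertible h \<Longrightarrow> invertible l \<Longrightarrow> u \<in> schur211_tensor \<Longrightarrow>
       \<psi> (kron3 (tensor_power g) (tensor_power h) (tensor_power l) *v u) = psubst (kron3 g h l) (\<psi> u)"
    "mpoly.subspace M2"
    by (rule schur211_submoduleE[OF M2], rule that)
  obtain F where F: "highest_weight_tensor F" "\<phi> u0 = quartic (\<lambda>P. F $ unzip3 P)" by (rule image_of_u0[OF \<phi>(2,6,7)])
  obtain G where G: "highest_weight_tensor G" "\<psi> u0 = quartic (\<lambda>P. G $ unzip3 P)" by (rule image_of_u0[OF \<psi>(2,6,7)])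
  let ?t = "\<lambda>F. xi3 0 1 2 (tensor_pairs F)"
  have z: "(0 :: 'k ^ ((4 \<Rightarrow> 'a) \<times> (4 \<Rightarrow> 'b) \<times> (4 \<Rightarrow> 'c))) \<in> schur211_tensor"
    unfolding schur211_tensor_def by (rule vec.span_zero)
  have nz: "?t F \<noteq> 0"
  proof
    assume "?t F = 0"
    then have "F = 0" by (rule highest_weight_tensor_eq_0[OF F(1)])
    then have "\<phi> u0 = \<phi> 0" by (simp add: F(2) quartic_0 \<phi>(3))
    then show False using inj_onD[OF \<phi>(4) _ u0_in z] u0_nonzero by blast
  qed
  have nz': "?t G \<noteq> 0"
  proof
    assume "?t G = 0"
    then have "G = 0" by (rule highest_weight_tensor_eq_0[OF G(1)])
    then have "\<psi> u0 = \<psi> 0" by (simp add: G(2) quartic_0 \<psi>(3))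
    then show False using inj_onD[OF \<psi>(4) _ u0_in z] u0_nonzero by blast
  qed
  (* Both distinguished coordinates are nonzero, as the two maps are injective. *)
  have "?t F *s G = ?t G *s F" by (rule highest_weight_tensor_proportional[OF F(1) G(1)])
  then have "?t F * G $ q = ?t G * F $ q" for q by (metis vector_smult_component)
  then have "F $ q = ?t F / ?t G * G $ q" for q using nz' by (simp add: field_simps)
  then have start: "\<phi> u0 = pscale (?t F / ?t G) (\<psi> u0)" unfolding F(2) G(2) quartic_scale[symmetric] by simp
  have "\<phi> u = pscale (?t F / ?t G) (\<psi> u)" if "u \<in> schur211_tensor" for u
    by (rule proportional_on_tensors[where \<phi> = \<psi> and \<psi> = \<phi>, OF _ _ _ _ _ _ _ _ _ start that])
       (fact \<phi> \<psi>)+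
  then have "\<phi> u \<in> M2" if "u \<in> schur211_tensor" for u
    using that mpoly.subspace_scale[OF \<psi>(8)] \<psi>(5) by simp
  then show ?thesis unfolding \<phi>(5) by blast
qed

end

section \<open>The zero locus of the module\<close>

text \<open>
  Antisymmetry in the first column kills the evaluation at equal vectors in two positions of
  this column.
\<close>

lemma slot_zero:
  fixes y :: "4 \<Rightarrow> 'k::field_char_0 ^ 'b::finite"
  assumes f: "hook_relations f" and st: "s \<noteq> t" "s \<noteq> 1" "t \<noteq> 1" "y s = y t"
  shows "(\<Sum>I\<in>UNIV. f I * (\<Prod>r\<in>UNIV. y r $ I r)) = 0" (is "?S = 0")
proof -
  let ?\<pi> = "swap4 s t"
  have y: "y (?\<pi> r) = y r" for r using st(4) by (simp add: Transposition.transpose_def)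
  have f\<pi>: "f (I \<circ> ?\<pi>) = - f I" for I
    using hook_column[OF f permutes_swap4, of s t I] st by (simp add: sign_swap_id)
  have p: "(\<Prod>r\<in>UNIV. y r $ I (?\<pi> r)) = (\<Prod>r\<in>UNIV. y r $ I r)" for I
    using prod.permute[OF permutes_swap4, of "\<lambda>r. y r $ I r" s t] by (simp add: o_def y)
  have "?S = (\<Sum>I\<in>UNIV. f (I \<circ> ?\<pi>) * (\<Prod>r\<in>UNIV. y r $ (I \<circ> ?\<pi>) r))"
    by (rule sum.reindex_bij_betw[OF permutes_UNIV_bij_compose[OF permutes_swap4], symmetric])
  also have "\<dots> = - ?S" by (simp only: f\<pi>) (simp add: o_def p sum_negf)
  finally show ?thesis by simp
qed

text \<open>
  The evaluation at four decomposable tensors separates into the three factors.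
\<close>

lemma sum_twist:
  fixes u :: "'k::field ^ ((4 \<Rightarrow> 'a::finite) \<times> (4 \<Rightarrow> 'b::finite) \<times> (4 \<Rightarrow> 'c::finite))"
  shows "(\<Sum>P\<in>UNIV. u $ twist P * (\<Prod>s\<in>UNIV. tensor3 (x s) (y s) (z s) $ P s))
    = (\<Sum>I\<in>UNIV. \<Sum>J\<in>UNIV. \<Sum>L\<in>UNIV. u $ (I, J, L) * ((\<Prod>s\<in>UNIV. x s $ I s) *
        (\<Prod>s\<in>UNIV. y (swap4 1 2 s) $ J s) * (\<Prod>s\<in>UNIV. z (swap4 1 3 s) $ L s)))"
proof -
  let ?G = "\<lambda>(I, J, L). (\<Prod>s\<in>UNIV. x s $ I s) *
        (\<Prod>s\<in>UNIV. y (swap4 1 2 s) $ J s) * (\<Prod>s\<in>UNIV. z (swap4 1 3 s) $ L s)"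
  have swap: "(\<Prod>s\<in>UNIV. h (swap4 a b s)) = (\<Prod>s\<in>UNIV. h s)" for h :: "4 \<Rightarrow> 'k" and a b
    using prod.permute[OF permutes_swap4, of h a b] by (simp add: o_def)
  have G: "(\<Prod>s\<in>UNIV. tensor3 (x s) (y s) (z s) $ P s) = ?G (twist P)" for P
    using swap[of "\<lambda>s. y s $ fst (snd (P s))" 1 2] swap[of "\<lambda>s. z s $ snd (snd (P s))" 1 3]
    by (simp add: tensor3_def twist_def split_beta prod.distrib)
  have "(\<Sum>P\<in>UNIV. u $ twist P * ?G (twist P)) = (\<Sum>q\<in>UNIV. u $ q * ?G q)"
    by (rule sum.reindex_bij_betw[OF bij_twist])
  then show ?thesis by (simp add: G sum.cartesian_product split_beta flip: UNIV_Times_UNIV)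
qed

text \<open>
  Expand the product of four copies of a sum of three terms: two of the four positions
  \<open>s\<close>, \<open>t\<close> carry the same term. One of the positions 1, 2, 3 is
  neither \<open>s\<close> nor \<open>t\<close>, and in the factor where this is the
  distinguished position, \<open>s\<close> and \<open>t\<close> belong to the first column.
\<close>

lemma hook_map_rank_le3:
  fixes u :: "'k::field_char_0 ^ ((4 \<Rightarrow> 'a::finite) \<times> (4 \<Rightarrow> 'b::finite) \<times> (4 \<Rightarrow> 'c::finite))"
  assumes u: "u \<in> schur211_tensor" and "rank_le3 X"
  shows "peval (hook_map u) X = 0"
proof -
  obtain x y z where X: "X = (\<Sum>i\<in>(UNIV :: 3 set). tensor3 (x i) (y i) (z i))"
    using assms(2) unfolding rank_le3_def by blast
  have zero: "(\<Sum>P\<in>UNIV. u $ twist P * (\<Prod>s\<in>UNIV. tensor3 (x (\<rho> s)) (y (\<rho> s)) (z (\<rho> s)) $ P s)) = 0"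
    for \<rho> :: "4 \<Rightarrow> 3"
  proof -
    (* Four positions, three summands. *)
    have "\<not> inj \<rho>"
    proof
      assume "inj \<rho>"
      then have "CARD(4) \<le> CARD(3)" by (intro card_inj_on_le[of \<rho>]) simp_all
      then show False by simp
    qed
    then obtain s t where st: "s \<noteq> t" "\<rho> s = \<rho> t" unfolding inj_def by blast
    have "(s \<noteq> 1 \<and> t \<noteq> 1) \<or> (s \<noteq> 2 \<and> t \<noteq> 2) \<or> (s \<noteq> 3 \<and> t \<noteq> 3)"
      using st(1) by auto
    then consider "s \<noteq> 1" "t \<noteq> 1" | "s \<noteq> 2" "t \<noteq> 2" | "s \<noteq> 3" "t \<noteq> 3" by blast
    then show ?thesis
    proof cases
      case 1
      have "(\<Sum>I\<in>UNIV. u $ (I, J, L) * (\<Prod>s\<in>UNIV. x (\<rho> s) $ I s)) = 0" for J L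
        by (rule slot_zero[OF schur211_slots(1)[OF u] st(1) 1]) (simp add: st)
      then have "(\<Sum>I\<in>UNIV. u $ (I, J, L) * ((\<Prod>s\<in>UNIV. x (\<rho> s) $ I s) * (\<Prod>s\<in>UNIV. y (\<rho> (swap4 1 2 s)) $ J s) *
         (\<Prod>s\<in>UNIV. z (\<rho> (swap4 1 3 s)) $ L s))) = 0" for J L
        using sum_distrib_right[of "\<lambda>I. u $ (I, J, L) * (\<Prod>s\<in>UNIV. x (\<rho> s) $ I s)" UNIV
          "(\<Prod>s\<in>UNIV. y (\<rho> (swap4 1 2 s)) $ J s) * (\<Prod>s\<in>UNIV. z (\<rho> (swap4 1 3 s)) $ L s)"]
        by (simp add: mult_ac)
      then show ?thesis unfolding sum_twist by (subst (2) sum.swap, subst sum.swap) simp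
    next
      case 2
      let ?p = "swap4 1 2"
      have ne: "?p s \<noteq> ?p t" "?p s \<noteq> 1" "?p t \<noteq> 1" using st(1) 2 by (auto simp: Transposition.transpose_def split: if_splits)
      have "(\<Sum>J\<in>UNIV. u $ (I, J, L) * (\<Prod>s\<in>UNIV. y (\<rho> (?p s)) $ J s)) = 0" for I L
        by (rule slot_zero[OF schur211_slots(2)[OF u] ne]) (simp add: st)
      then have "(\<Sum>J\<in>UNIV. u $ (I, J, L) * ((\<Prod>s\<in>UNIV. x (\<rho> s) $ I s) * (\<Prod>s\<in>UNIV. y (\<rho> (?p s)) $ J s) *
         (\<Prod>s\<in>UNIV. z (\<rho> (swap4 1 3 s)) $ L s))) = 0" for I L
        using sum_distrib_right[of "\<lambda>J. u $ (I, J, L) * (\<Prod>s\<in>UNIV. y (\<rho> (?p s)) $ J s)" UNIV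
          "(\<Prod>s\<in>UNIV. x (\<rho> s) $ I s) * (\<Prod>s\<in>UNIV. z (\<rho> (swap4 1 3 s)) $ L s)"]
        by (simp add: mult_ac)
      then show ?thesis unfolding sum_twist by (subst sum.swap) simp
    next
      case 3
      let ?p = "swap4 1 3"
      have ne: "?p s \<noteq> ?p t" "?p s \<noteq> 1" "?p t \<noteq> 1" using st(1) 3 by (auto simp: Transposition.transpose_def split: if_splits)
      have "(\<Sum>L\<in>UNIV. u $ (I, J, L) * (\<Prod>s\<in>UNIV. z (\<rho> (?p s)) $ L s)) = 0" for I J
        by (rule slot_zero[OF schur211_slots(3)[OF u] ne]) (simp add: st)
      then have "(\<Sum>L\<in>UNIV. u $ (I, J, L) * ((\<Prod>s\<in>UNIV. x (\<rho> s) $ I s) * (\<Prod>s\<in>UNIV. y (\<rho> (swap4 1 2 s)) $ J s) *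
         (\<Prod>s\<in>UNIV. z (\<rho> (?p s)) $ L s))) = 0" for I J
        using sum_distrib_right[of "\<lambda>L. u $ (I, J, L) * (\<Prod>s\<in>UNIV. z (\<rho> (?p s)) $ L s)" UNIV
          "(\<Prod>s\<in>UNIV. x (\<rho> s) $ I s) * (\<Prod>s\<in>UNIV. y (\<rho> (swap4 1 2 s)) $ J s)"]
        by (simp add: mult_ac)
      then show ?thesis unfolding sum_twist by simp
    qed
  qed
  have "(\<Prod>s\<in>UNIV. X $ P s) = (\<Sum>\<rho>\<in>UNIV. \<Prod>s\<in>UNIV. tensor3 (x (\<rho> s)) (y (\<rho> s)) (z (\<rho> s)) $ P s)"
    for P :: "4 \<Rightarrow> 'a \<times> 'b \<times> 'c"
    unfolding X sum_component by (rule prod_sum_functions)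
  then have "peval (hook_map u) X
     = (\<Sum>\<rho>\<in>UNIV. \<Sum>P\<in>UNIV. u $ twist P * (\<Prod>s\<in>UNIV. tensor3 (x (\<rho> s)) (y (\<rho> s)) (z (\<rho> s)) $ P s))"
    unfolding hook_map_def peval_quartic by (subst sum.swap) (simp add: sum_distrib_left)
  then show ?thesis by (simp only: zero sum.neutral_const)
qed

lemma sec3_hook_map:
  fixes T :: "'k::field_char_0 ^ ('a::finite \<times> 'b::finite \<times> 'c::finite)"
  assumes "sec3 T" "u \<in> schur211_tensor"
  shows "peval (hook_map u) T = 0"
  by (rule sec3_hpf[OF assms(1) hpf_peval]) (use hook_map_rank_le3[OF assms(2)] homogeneous_quartic in \<open>auto simp: hook_map_def\<close>)

definition pure4 :: "'k::comm_ring_1 ^ 'a \<Rightarrow> 'k ^ 'a \<Rightarrow> 'k ^ 'a \<Rightarrow> 'k ^ 'a \<Rightarrow> 'k ^ (4 \<Rightarrow> 'a::finite)" where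
  "pure4 x0 x1 x2 x3 = (\<chi> I. x0 $ I 0 * x1 $ I 1 * x2 $ I 2 * x3 $ I 3)"

text \<open>
  The symmetrized tensor with a repeated first vector has only six terms, since the row
  symmetrizer doubles each of them.
\<close>

lemma hook_pure4: "hook a a b c = 2 *s (pure4 a a b c - pure4 b a a c - pure4 c a b a
    - pure4 a a c b + pure4 b a c a + pure4 c a a b)"
  by (rule vec4_eqI) (simp add: hook_coord alt3_def pure4_def algebra_simps)

definition hook_form :: "'k::field ^ ('a::finite \<times> 'b::finite \<times> 'c::finite) \<Rightarrow> 'k ^ (4 \<Rightarrow> 'a)
    \<Rightarrow> 'k ^ (4 \<Rightarrow> 'b) \<Rightarrow> 'k ^ (4 \<Rightarrow> 'c) \<Rightarrow> 'k" where
  "hook_form T f g h = peval (hook_map (tensor3 f g h)) T"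

lemma hook_form_linear:
  "hook_form T (f + f') g h = hook_form T f g h + hook_form T f' g h"
  "hook_form T f (g + g') h = hook_form T f g h + hook_form T f g' h"
  "hook_form T f g (h + h') = hook_form T f g h + hook_form T f g h'"
  "hook_form T (f - f') g h = hook_form T f g h - hook_form T f' g h"
  "hook_form T f (g - g') h = hook_form T f g h - hook_form T f g' h"
  "hook_form T f g (h - h') = hook_form T f g h - hook_form T f g h'"
  "hook_form T (c *s f) g h = c * hook_form T f g h"
  "hook_form T f (c *s g) h = c * hook_form T f g h"
  "hook_form T f g (c *s h) = c * hook_form T f g h"
  unfolding hook_form_def hook_map_def peval_quartic
  by (simp_all add: tensor3_def twist_def algebra_simps sum_distrib_left flip: sum.distrib sum_subtractf)

lemma hook_form_pure4:
  "hook_form T (pure4 x0 x1 x2 x3) (pure4 y0 y1 y2 y3) (pure4 z0 z1 z2 z3)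
    = tev T x0 y0 z0 * tev T x1 y2 z3 * tev T x2 y1 z2 * tev T x3 y3 z1"
proof -
  let ?x = "mk4 x0 x1 x2 x3" and ?y = "mk4 y0 y2 y1 y3" and ?z = "mk4 z0 z3 z2 z1"
  let ?f = "\<lambda>s p. tensor3 (?x s) (?y s) (?z s) $ p * T $ p"
  have tev: "tev T x y z = (\<Sum>p\<in>UNIV. tensor3 x y z $ p * T $ p)" for x y z
    by (simp add: tev_def tensor3_def sum.cartesian_product split_beta flip: UNIV_Times_UNIV)
  have "tensor3 (pure4 x0 x1 x2 x3) (pure4 y0 y1 y2 y3) (pure4 z0 z1 z2 z3) $ twist P * (\<Prod>s\<in>UNIV. T $ P s)
     = (\<Prod>s\<in>UNIV. ?f s (P s))" for P
    by (simp add: prod_UNIV_4 tensor3_def pure4_def twist_def split_beta Transposition.transpose_def)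
  then have "hook_form T (pure4 x0 x1 x2 x3) (pure4 y0 y1 y2 y3) (pure4 z0 z1 z2 z3)
     = (\<Sum>P\<in>UNIV. \<Prod>s\<in>UNIV. ?f s (P s))"
    by (simp only: hook_form_def hook_map_def peval_quartic)
  also have "\<dots> = (\<Prod>s\<in>UNIV. \<Sum>p\<in>UNIV. ?f s p)" by (rule prod_sum_functions[symmetric])
  also have "\<dots> = tev T x0 y0 z0 * tev T x1 y2 z3 * tev T x2 y1 z2 * tev T x3 y3 z1"
    by (simp add: prod_UNIV_4 tev)
  finally show ?thesis .
qed

text \<open>
  The polarization of the adjugate, a quadratic map.
\<close>

definition polar3 :: "'k::comm_ring_1 ^ 3 ^ 3 \<Rightarrow> 'k ^ 3 ^ 3 \<Rightarrow> 'k ^ 3 ^ 3" where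
  "polar3 X Y = adj3 (X + Y) - adj3 X - adj3 Y"

lemma m33_diff: "m33 a b c d e f g h i - m33 a' b' c' d' e' f' g' h' i' =
  m33 (a-a') (b-b') (c-c') (d-d') (e-e') (f-f') (g-g') (h-h') (i-i' :: 'k::comm_ring_1)"
  by (simp add: vec_eq_iff all_3)

lemma polar3_same: "polar3 Y Y = adj3 Y + adj3 Y"
  by (rule m33_cases[of Y]) (simp add: polar3_def m33_adj3 m33_add m33_diff m33_eq_iff algebra_simps)

text \<open>
  The polarizations of \<open>Y adj(Y) = det Y\<close> and \<open>adj(Y) Y = det Y\<close>.
\<close>

lemma adj3_polarized:
  obtains d where "Y ** polar3 X Y = mat d - X ** adj3 Y" "polar3 X Y ** Y = mat d - adj3 Y ** X"
proof -
  let ?d = "(X ** adj3 Y) $ 0 $ 0 + (X ** adj3 Y) $ 1 $ 1 + (X ** adj3 Y) $ 2 $ 2"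
  have "Y ** polar3 X Y = mat ?d - X ** adj3 Y \<and> polar3 X Y ** Y = mat ?d - adj3 Y ** X"
    by (rule m33_cases[of X], rule m33_cases[of Y])
       (simp add: polar3_def m33_adj3 m33_add m33_diff m33_mult m33_mat m33_eq_iff algebra_simps)
  then show ?thesis using that by blast
qed

text \<open>
  The six terms come from the six terms of the symmetrized tensor in the first factor. The
  scalars from the polarized adjugate identities cancel.
\<close>

lemma polar3_commutator:
  "X ** polar3 Y Y ** Z - Y ** polar3 X Y ** Z - X ** polar3 Z Y ** Y - Z ** polar3 Y Y ** X
     + Z ** polar3 X Y ** Y + Y ** polar3 Z Y ** X
   = smul 4 (X ** adj3 Y ** Z - Z ** adj3 Y ** X)"
proof -
  obtain d where d: "Y ** polar3 X Y = mat d - X ** adj3 Y" "polar3 X Y ** Y = mat d - adj3 Y ** X"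
    by (rule adj3_polarized)
  obtain e where e: "Y ** polar3 Z Y = mat e - Z ** adj3 Y" "polar3 Z Y ** Y = mat e - adj3 Y ** Z"
    by (rule adj3_polarized)
  have D: "(A - B) ** C = A ** C - B ** C" "C ** (A - B) = C ** A - C ** B"
    "(A + B) ** C = A ** C + B ** C" "C ** (A + B) = C ** A + C ** B" for A B C :: "'a ^ 3 ^ 3"
    by (simp_all add: vec_eq_iff matrix_matrix_mult_def sum_subtractf algebra_simps sum.distrib)
  have r: "Z ** polar3 X Y ** Y = smul d Z - Z ** adj3 Y ** X" "X ** polar3 Z Y ** Y = smul e X - X ** adj3 Y ** Z"
    by (simp_all add: d(2) e(2) D mat_mult_smul matrix_mul_assoc flip: matrix_mul_assoc[of _ "polar3 _ _"])
  have s: "smul 4 A = A + A + A + A" for A :: "'a ^ 3 ^ 3" by (simp add: vec_eq_iff)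
  show ?thesis
    unfolding r d(1) e(1) polar3_same D s by (simp add: mat_mult_smul)
qed

text \<open>
  The 36 terms from the second and third factor combine to an entry of a matrix product: the
  repeated vectors select the first row and column, and the alternating sums give the minors.
\<close>

lemma hook_form_slices:
  "hook_form T (pure4 x0 x1 x2 x3) (hook (b 0) (b 0) (b 1) (b 2)) (hook (c 0) (c 0) (c 1) (c 2))
    = - 4 * (slice T b c x2 ** polar3 (slice T b c x0) (slice T b c x1) ** slice T b c x3) $ 0 $ 0"
proof -
  have s: "slice T b c x = m33 (tev T x (b 0) (c 0)) (tev T x (b 0) (c 1)) (tev T x (b 0) (c 2))
      (tev T x (b 1) (c 0)) (tev T x (b 1) (c 1)) (tev T x (b 1) (c 2))
      (tev T x (b 2) (c 0)) (tev T x (b 2) (c 1)) (tev T x (b 2) (c 2))" for x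
    by (simp add: slice_def vec_eq_iff all_3)
  show ?thesis
    unfolding hook_pure4 hook_form_linear hook_form_pure4 s polar3_def m33_add m33_adj3 m33_diff m33_mult m33_nth
    by (simp add: algebra_simps)
qed

text \<open>
  The factor -32 is nonzero in characteristic zero, so the commutator entry vanishes together
  with the form.
\<close>

lemma hook_form_commutator:
  "hook_form T (hook \<alpha> \<alpha> \<alpha>1 \<alpha>2) (hook (b 0) (b 0) (b 1) (b 2)) (hook (c 0) (c 0) (c 1) (c 2))
    = - 32 * (slice T b c \<alpha>1 ** adj3 (slice T b c \<alpha>) ** slice T b c \<alpha>2
             - slice T b c \<alpha>2 ** adj3 (slice T b c \<alpha>) ** slice T b c \<alpha>1) $ 0 $ 0"
proof -
  note p = polar3_commutator[of "slice T b c \<alpha>1" "slice T b c \<alpha>" "slice T b c \<alpha>2"]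
  have "hook_form T (hook \<alpha> \<alpha> \<alpha>1 \<alpha>2) (hook (b 0) (b 0) (b 1) (b 2)) (hook (c 0) (c 0) (c 1) (c 2))
    = - 8 * (smul 4 (slice T b c \<alpha>1 ** adj3 (slice T b c \<alpha>) ** slice T b c \<alpha>2
             - slice T b c \<alpha>2 ** adj3 (slice T b c \<alpha>) ** slice T b c \<alpha>1)) $ 0 $ 0"
    unfolding hook_pure4[of \<alpha>] hook_form_linear hook_form_slices p[symmetric] by (simp add: algebra_simps)
  then show ?thesis by simp
qed

text \<open>
  Cyclic shifts of rows and columns are compatible with the adjugate, as its definition is
  cyclic. They move every entry of the commutator to the corner.
\<close>

lemma commutator_shift:
  fixes X Y Z :: "'k::comm_ring_1 ^ 3 ^ 3"
  defines "sh \<equiv> \<lambda>j k (M :: 'k ^ 3 ^ 3). (\<chi> s t. M $ (s + j) $ (t + k))"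
  shows "(sh j k X ** adj3 (sh j k Y) ** sh j k Z) $ 0 $ 0 = (X ** adj3 Y ** Z) $ j $ k"
proof -
  have a: "adj3 (sh j k Y) = sh k j (adj3 Y)" by (simp add: sh_def adj3_def vec_eq_iff add_ac)
  have bij: "bij (\<lambda>t :: 3. t + i)" for i
    by (rule bij_betw_byWitness[where f' = "\<lambda>t. t - i"]) auto
  have shift: "(\<Sum>t\<in>UNIV. f (t + i)) = (\<Sum>t\<in>UNIV. f t)" for f :: "3 \<Rightarrow> 'k" and i
    by (rule sum.reindex_bij_betw[OF bij])
  have m: "sh p q A ** sh q r B = sh p r (A ** B)" for p q r A B
    unfolding sh_def matrix_matrix_mult_def
    using shift[of "\<lambda>t. A $ (i + p) $ t * B $ t $ (j + r)" q for i j] by (simp add: vec_eq_iff)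
  show ?thesis unfolding a m by (simp add: sh_def)
qed

text \<open>
  Shifting the vectors of the second and third factor cyclically gives all entries of the
  commutator from the corner entry.
\<close>

theorem hook_map_vanish_imp_strassen:
  fixes T :: "'k::field_char_0 ^ ('a::finite \<times> 'b::finite \<times> 'c::finite)"
  assumes v: "\<And>u. u \<in> schur211_tensor \<Longrightarrow> peval (hook_map u) T = 0"
  shows "strassen_tensor T"
  unfolding strassen_tensor_def
proof (intro allI)
  fix \<beta> :: "3 \<Rightarrow> 'k ^ 'b" and \<gamma> :: "3 \<Rightarrow> 'k ^ 'c" and \<alpha>1 \<alpha> \<alpha>2
  have "(slice T b c \<alpha>1 ** adj3 (slice T b c \<alpha>) ** slice T b c \<alpha>2
             - slice T b c \<alpha>2 ** adj3 (slice T b c \<alpha>) ** slice T b c \<alpha>1) $ 0 $ 0 = 0" for b c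
  proof -
    have "hook_form T (hook \<alpha> \<alpha> \<alpha>1 \<alpha>2) (hook (b 0) (b 0) (b 1) (b 2)) (hook (c 0) (c 0) (c 1) (c 2)) = 0"
      unfolding hook_form_def schur211_tensor_def
      by (rule v[unfolded schur211_tensor_def], rule vec.span_base, rule CollectI, intro exI conjI, rule refl)
         (rule hook_in_schur)+
    then show ?thesis unfolding hook_form_commutator by simp
  qed
  note z = this
  have sl: "slice T (\<lambda>s. \<beta> (s + j)) (\<lambda>t. \<gamma> (t + k)) x = (\<chi> s t. slice T \<beta> \<gamma> x $ (s + j) $ (t + k))" for j k x
    by (simp add: slice_def)
  show "slice T \<beta> \<gamma> \<alpha>1 ** adj3 (slice T \<beta> \<gamma> \<alpha>) ** slice T \<beta> \<gamma> \<alpha>2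
      = slice T \<beta> \<gamma> \<alpha>2 ** adj3 (slice T \<beta> \<gamma> \<alpha>) ** slice T \<beta> \<gamma> \<alpha>1"
    unfolding vec_eq_iff
  proof (intro allI)
    fix j k
    show "(slice T \<beta> \<gamma> \<alpha>1 ** adj3 (slice T \<beta> \<gamma> \<alpha>) ** slice T \<beta> \<gamma> \<alpha>2) $ j $ k
      = (slice T \<beta> \<gamma> \<alpha>2 ** adj3 (slice T \<beta> \<gamma> \<alpha>) ** slice T \<beta> \<gamma> \<alpha>1) $ j $ k"
      using z[of "\<lambda>s. \<beta> (s + j)" "\<lambda>t. \<gamma> (t + k)"] unfolding sl by (simp add: commutator_shift)
  qed
qed

section \<open>The four descriptions of the secant variety\<close>

lemma swap12_eq_0 [simp]: "swap12 T = 0 \<longleftrightarrow> T = 0" and cycle3_eq_0 [simp]: "cycle3 T = 0 \<longleftrightarrow> T = 0"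
  by (auto simp: swap12_def cycle3_def vec_eq_iff)

lemma span_tensor3_permute:
  fixes T :: "'k::field ^ ('a::finite \<times> 'b::finite \<times> 'c::finite)"
  assumes "T \<in> vec.span {tensor3 x y z |x y z. x \<in> A \<and> y \<in> B \<and> z \<in> C}"
  shows "swap12 T \<in> vec.span {tensor3 y x z |y x z. y \<in> B \<and> x \<in> A \<and> z \<in> C}"
    and "cycle3 T \<in> vec.span {tensor3 z x y |z x y. z \<in> C \<and> x \<in> A \<and> y \<in> B}"
  using assms
proof (induction rule: vec.span_induct_alt)
  case base
  have "swap12 (0 :: 'k ^ ('a \<times> 'b \<times> 'c)) = 0" "cycle3 (0 :: 'k ^ ('a \<times> 'b \<times> 'c)) = 0" by simp_all
  then show "swap12 (0 :: 'k ^ ('a \<times> 'b \<times> 'c)) \<in> vec.span {tensor3 y x z |y x z. y \<in> B \<and> x \<in> A \<and> z \<in> C}"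
    "cycle3 (0 :: 'k ^ ('a \<times> 'b \<times> 'c)) \<in> vec.span {tensor3 z x y |z x y. z \<in> C \<and> x \<in> A \<and> y \<in> B}"
    by (simp_all only: vec.span_zero)
next
  case (step c w T)
  then obtain x y z where w: "w = tensor3 x y z" and m: "x \<in> A" "y \<in> B" "z \<in> C" by blast
  have "swap12 (c *s w + T) = c *s tensor3 y x z + swap12 T" "cycle3 (c *s w + T) = c *s tensor3 z x y + cycle3 T"
    by (auto simp: w swap12_def cycle3_def tensor3_def vec_eq_iff)
  moreover have "tensor3 y x z \<in> vec.span {tensor3 y x z |y x z. y \<in> B \<and> x \<in> A \<and> z \<in> C}"
    "tensor3 z x y \<in> vec.span {tensor3 z x y |z x y. z \<in> C \<and> x \<in> A \<and> y \<in> B}"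
    using m by (auto intro!: vec.span_base)
  ultimately show "swap12 (c *s w + T) \<in> vec.span {tensor3 y x z |y x z. y \<in> B \<and> x \<in> A \<and> z \<in> C}"
    "cycle3 (c *s w + T) \<in> vec.span {tensor3 z x y |z x y. z \<in> C \<and> x \<in> A \<and> y \<in> B}"
    using step by (auto intro!: vec.span_add vec.span_scale)
qed

text \<open>
  The subspaces do not depend on the representative of the point.
\<close>

lemma Sub_tensor:
  fixes T :: "'k::field ^ ('a::finite \<times> 'b::finite \<times> 'c::finite)"
  assumes "pt T \<in> Sub b1 b2 b3" "T \<noteq> 0"
  obtains A B C where "vec.subspace A" "vec.subspace B" "vec.subspace C"
    "vec.dim A = b1" "vec.dim B = b2" "vec.dim C = b3"
    "T \<in> vec.span {tensor3 x y z |x y z. x \<in> A \<and> y \<in> B \<and> z \<in> C}"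
proof -
  obtain T' A B C where *: "pt T = pt T'" "vec.subspace A" "vec.subspace B" "vec.subspace C"
    "vec.dim A = b1" "vec.dim B = b2" "vec.dim C = b3"
    and T': "T' \<in> vec.span {tensor3 x y z |x y z. x \<in> A \<and> y \<in> B \<and> z \<in> C}"
    using assms(1) unfolding Sub_def by blast
  obtain c where "T = c *s T'" using pt_eqD[OF *(1) assms(2)] by blast
  then show ?thesis using that[OF *(2-7)] vec.span_scale[OF T', of c] by simp
qed

lemma Sub_swap12:
  assumes "pt T \<in> Sub b1 b2 b3" "T \<noteq> 0"
  shows "pt (swap12 T) \<in> Sub b2 b1 b3"
proof -
  obtain A B C where *: "vec.subspace A" "vec.subspace B" "vec.subspace C"
    "vec.dim A = b1" "vec.dim B = b2" "vec.dim C = b3"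
    and T: "T \<in> vec.span {tensor3 x y z |x y z. x \<in> A \<and> y \<in> B \<and> z \<in> C}"
    by (rule Sub_tensor[OF assms])
  show ?thesis unfolding Sub_def
    by (rule CollectI, intro exI[of _ "swap12 T"] conjI exI[of _ B] exI[of _ A] exI[of _ C])
       (use * assms(2) span_tensor3_permute(1)[OF T] in simp_all)
qed

lemma Sub_cycle3:
  assumes "pt T \<in> Sub b1 b2 b3" "T \<noteq> 0"
  shows "pt (cycle3 T) \<in> Sub b3 b1 b2"
proof -
  obtain A B C where *: "vec.subspace A" "vec.subspace B" "vec.subspace C"
    "vec.dim A = b1" "vec.dim B = b2" "vec.dim C = b3"
    and T: "T \<in> vec.span {tensor3 x y z |x y z. x \<in> A \<and> y \<in> B \<and> z \<in> C}"
    by (rule Sub_tensor[OF assms])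
  show ?thesis unfolding Sub_def
    by (rule CollectI, intro exI[of _ "cycle3 T"] conjI exI[of _ C] exI[of _ A] exI[of _ B])
       (use * assms(2) span_tensor3_permute(2)[OF T] in simp_all)
qed

lemma sec3_imp_Sub:
  fixes T :: "'k::field ^ ('a::finite \<times> 'b::finite \<times> 'c::finite)"
  assumes "CARD('a) \<ge> 3" "CARD('b) \<ge> 3" "CARD('c) \<ge> 3" "T \<noteq> 0" "sec3 T"
  shows "pt T \<in> Sub 3 3 3"
  using sec3_ext4[OF assms(5)] by (intro Sub_if_ext4_vanish assms(1-4)) blast+

text \<open>
  The commutation conditions for the three factors differ by a permutation of the factors, so
  the argument is given once for a condition \<open>P\<close> that holds on the cone and implies
  membership in it.
\<close>

lemma secant_variety_eq_Comm_Sub: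
  fixes C :: "('k::{alg_closed_field, field_char_0} ^ ('a::finite \<times> 'b::finite \<times> 'c::finite)) set set"
  assumes card: "CARD('a) \<ge> 3" "CARD('b) \<ge> 3" "CARD('c) \<ge> 3"
    and C: "C = {pt T |T. T \<noteq> 0 \<and> P T}"
    and sec: "\<And>T. sec3 T \<Longrightarrow> P T" "\<And>T. P T \<Longrightarrow> pt T \<in> Sub 3 3 3 \<Longrightarrow> T \<noteq> 0 \<Longrightarrow> sec3 T"
  shows "secant_variety 3 segre = C \<inter> Sub 3 3 3"
  unfolding secant_variety_segre C
proof (intro subset_antisym subsetI)
  fix L :: "('k ^ ('a \<times> 'b \<times> 'c)) set" assume "L \<in> {pt T |T. T \<noteq> 0 \<and> sec3 T}"
  then obtain T where "L = pt T" "T \<noteq> 0" "sec3 T" by blast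
  then show "L \<in> {pt T |T. T \<noteq> 0 \<and> P T} \<inter> Sub 3 3 3" using sec(1) sec3_imp_Sub[OF card] by blast
next
  fix L :: "('k ^ ('a \<times> 'b \<times> 'c)) set" assume "L \<in> {pt T |T. T \<noteq> 0 \<and> P T} \<inter> Sub 3 3 3"
  then obtain T where "L = pt T" "T \<noteq> 0" "P T" "pt T \<in> Sub 3 3 3" by blast
  then show "L \<in> {pt T |T. T \<noteq> 0 \<and> sec3 T}" using sec(2) by blast
qed

lemma three_elements:
  assumes "CARD('x) \<ge> 3"
  obtains a b c :: "'x::finite" where "a \<noteq> b" "a \<noteq> c" "b \<noteq> c"
proof -
  obtain S :: "'x set" where "card S = 3" using obtain_subset_with_card_n[OF assms] by blast
  then show ?thesis using that by (auto simp: card_3_iff)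
qed

theorem corollary5p2:
  assumes "CARD('a::finite) \<ge> 3" and "CARD('b::finite) \<ge> 3" and "CARD('c::finite) \<ge> 3"
  defines "\<sigma>3 \<equiv> secant_variety 3
    (segre :: ('k::{alg_closed_field, field_char_0} ^ ('a \<times> 'b \<times> 'c)) set set)"
  shows "(\<sigma>3 = Comm_A 3 \<inter> Sub 3 3 3 \<and> \<sigma>3 = Comm_B 3 \<inter> Sub 3 3 3 \<and> \<sigma>3 = Comm_C 3 \<inter> Sub 3 3 3)
    \<and> (\<exists>!M :: ('a \<times> 'b \<times> 'c, 'k) mpoly set. schur211_submodule M)
    \<and> (\<forall>M :: ('a \<times> 'b \<times> 'c, 'k) mpoly set. schur211_submodule M \<longrightarrow>
         \<sigma>3 = zero_locus (M \<union> ext4_A \<union> ext4_B \<union> ext4_C))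
    \<and> (\<exists>F :: ('a \<times> 'b \<times> 'c, 'k) mpoly set. (\<forall>f \<in> F. homogeneous 4 f) \<and> \<sigma>3 = zero_locus F)"
proof -
  let ?M = "hook_map ` (schur211_tensor :: ('k ^ ((4 \<Rightarrow> 'a) \<times> (4 \<Rightarrow> 'b) \<times> (4 \<Rightarrow> 'c))) set)"
  let ?F = "?M \<union> ext4_A \<union> ext4_B \<union> ext4_C"
  note card = assms(1-3)
  have A: "\<sigma>3 = Comm_A 3 \<inter> Sub 3 3 3" unfolding \<sigma>3_def
    by (rule secant_variety_eq_Comm_Sub[OF card Comm_A_def])
       (auto intro: sec3_commuting commuting_imp_strassen strassen_Sub_imp_sec3)
  have B: "\<sigma>3 = Comm_B 3 \<inter> Sub 3 3 3" unfolding \<sigma>3_def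
  proof (rule secant_variety_eq_Comm_Sub[OF card Comm_B_def, folded swap12_def])
    show "commuting 3 (swap12 T)" if "sec3 T" for T :: "'k ^ ('a \<times> 'b \<times> 'c)"
      using that by (intro sec3_commuting) simp
    show "sec3 T" if "commuting 3 (swap12 T)" "pt T \<in> Sub 3 3 3" "T \<noteq> 0" for T :: "'k ^ ('a \<times> 'b \<times> 'c)"
      using strassen_Sub_imp_sec3[OF commuting_imp_strassen[OF that(1)] Sub_swap12[OF that(2,3)]] that(3) by simp
  qed
  have C: "\<sigma>3 = Comm_C 3 \<inter> Sub 3 3 3" unfolding \<sigma>3_def
  proof (rule secant_variety_eq_Comm_Sub[OF card Comm_C_def, folded cycle3_def])
    show "commuting 3 (cycle3 T)" if "sec3 T" for T :: "'k ^ ('a \<times> 'b \<times> 'c)"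
      using that by (intro sec3_commuting) simp
    show "sec3 T" if "commuting 3 (cycle3 T)" "pt T \<in> Sub 3 3 3" "T \<noteq> 0" for T :: "'k ^ ('a \<times> 'b \<times> 'c)"
      using strassen_Sub_imp_sec3[OF commuting_imp_strassen[OF that(1)] Sub_cycle3[OF that(2,3)]] that(3) by simp
  qed
  have hom: "homogeneous 4 f" if "f \<in> ?F" for f
    using that unfolding ext4_A_def ext4_B_def ext4_C_def hook_map_def
    by (elim UnE imageE) (simp_all add: homogeneous_quartic homogeneous_ext4)
  have zero: "sec3 T \<longleftrightarrow> (\<forall>f\<in>?F. peval f T = 0)" if T: "T \<noteq> 0" for T
  proof
    assume "sec3 T"
    then show "\<forall>f\<in>?F. peval f T = 0" using sec3_ext4 sec3_hook_map by blast
  next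
    assume v: "\<forall>f\<in>?F. peval f T = 0"
    then have "strassen_tensor T" by (intro hook_map_vanish_imp_strassen) blast
    moreover have "pt T \<in> Sub 3 3 3" by (rule Sub_if_ext4_vanish[OF card T]) (use v in blast)+
    ultimately show "sec3 T" using T by (rule strassen_Sub_imp_sec3)
  qed
  have locus: "\<sigma>3 = zero_locus ?F"
    unfolding \<sigma>3_def secant_variety_segre by (subst zero_locus_eq) (use hom zero in blast)+
  have unique: "M = ?M" if M: "schur211_submodule M" for M :: "('a \<times> 'b \<times> 'c, 'k) mpoly set"
  proof -
    obtain i0 i1 i2 :: 'a where i: "i0 \<noteq> i1" "i0 \<noteq> i2" "i1 \<noteq> i2" by (rule three_elements[OF card(1)])
    obtain j0 j1 j2 :: 'b where j: "j0 \<noteq> j1" "j0 \<noteq> j2" "j1 \<noteq> j2" by (rule three_elements[OF card(2)])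
    obtain k0 k1 k2 :: 'c where k: "k0 \<noteq> k1" "k0 \<noteq> k2" "k1 \<noteq> k2" by (rule three_elements[OF card(3)])
    interpret three_weights i0 i1 i2 j0 j1 j2 k0 k1 k2 by unfold_locales (fact i j k)+
    show ?thesis
      by (intro subset_antisym schur211_submodule_unique M schur211_submodule_hook_map)
  qed
  have ex1: "\<exists>!M :: ('a \<times> 'b \<times> 'c, 'k) mpoly set. schur211_submodule M"
    using schur211_submodule_hook_map unique by blast
  have all: "\<sigma>3 = zero_locus (M \<union> ext4_A \<union> ext4_B \<union> ext4_C)" if "schur211_submodule M" for M
    using locus unique[OF that] by simp
  show ?thesis
    by (intro conjI allI impI exI[of _ ?F] ballI A B C ex1) (erule all, erule hom, rule locus)
qed

end
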